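(* Fix a positive integer $n$, and let $\alpha$ be a composition of length $n$ with $\lambda=\mathrm{sort}(\alpha)$ and $n>\ell(\lambda)$. Then \[ f_{\alpha}(X;q,0)=\sum_{\beta}K_{\alpha,\beta}(q)\,\mathcal{A}_{\beta}(X), \] where the sum runs over compositions $\beta$ of length $n$ with $\mathrm{sort}(\beta)\le \mathrm{sort}(\alpha)$ in dominance order, and \[ K_{\alpha,\beta}(q)=\sum_{\substack{Q\in \mathrm{SSYT}(\mathrm{sort}(\beta)',\mathrm{sort}(\alpha)')\\ \mathrm{type}(\rho^{-1}(M_\beta,Q))=\alpha}} q^{\mathrm{charge}(Q)} . \]
   Context: Compositions: a (weak) composition is a finite sequence of nonnegative integers; $\mathrm{sort}(\alpha)$ is the partition obtained by sorting the positive parts of $\alpha$ in weakly decreasing order; $\lambda'$ is the conjugate of a partition $\lambda$; $\le$ on partitions is dominance order. $\mathrm{SSYT}(\mu,\nu)$ is the set of semistandard Young tableaux of shape $\mu$ and content $\nu$ (French convention: row 1 at the bottom, rows weakly increase left to right, columns strictly increase bottom to top). $\mathrm{charge}$ is the Lascoux–Schützenberger charge statistic on semistandard tableaux. Multiline queues (MLQs): fix $n$. For a partition $\lambda$ with $L=\lambda_1$ and $n>\ell(\lambda)$, an MLQ of shape $\lambda$ is a tuple $M=(B_1,\dots,B_L)$ of subsets of $[n]$ with $|B_r|=\lambda'_r$, pictured as an $L\times n$ array with rows $1,\dots,L$ from bottom to top and columns $1,\dots,n$ left to right (cyclically, column $n+1$ = column $1$), with a ball at site $(r,j)$ iff $j\in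 B_r$. $\mathrm{MLQ}_\lambda$ is the set of these; $x^M=\prod_r\prod_{b\in B_r}x_b$, in variables $X=(x_1,\dots,x_n)$. Ferrari–Martin (FM) labelling: for $r=L,L-1,\dots,2$: every unlabelled ball in row $r$ gets label $r$; then the balls of row $r$ are processed in order of decreasing label (left to right among equal labels), each paired to the first not-yet-paired ball in row $r-1$ weakly to its right, cyclically wrapping from column $n$ to column $1$ if necessary; that ball receives the same label. Finally unlabelled balls in row $1$ get label $1$. $L_M(r,j)$ is the label at site $(r,j)$ (0 if empty). $\mathrm{type}(M)=(L_M(1,1),\dots,L_M(1,n))$. A pairing wraps if the ball in row $r-1$ is in a column strictly smaller than the ball in row $r$; $\mathrm{maj}(M)=\sum(\ell-r+1)$ over all wrapping pairings from row $r$ to row $r-1$ of balls of label $\ell$. $M$ is nonwrapping if $\mathrm{maj}(M)=0$; $\mathrm{NMLQ}_\lambda$ is the set of nonwrapping MLQs. $\mathrm{MLQ}[\alpha]=\{M:\mathrm{type}(M)=\alpha\}$, $\mathrm{NMLQ}[\alpha]$ its nonwrapping elements. For a composition $\beta$ of length $n$, $M_\beta$ is the MLQ with $B_r=\{i:\beta_i\ge r\}$. Polynomials: $f_\alpha(X;q,0)=\sum_{M\in\mathrm{MLQ}[\alpha]}q^{\mathrm{maj}(M)}x^M$ (the ASEP polynomial at $t=0$), and $\mathcal{A}_\beta(X)=\sum_{M\in \mathrm{NMLQ}[\beta]}x^M$ (the Demazure atom). Collapsing map: for $j\ge1$ and a tuple $N=(B_1,\dots,B_L)$ of subsets of $[n]$,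 the column word $cw(N)$ lists the row indices of balls reading columns left to right, each column top to bottom. Bracketing w.r.t. $j$: replace each $j$ by ")" and each $j+1$ by "(" (ignore other letters), and iteratively match a "(" with a ")" to its right when no unmatched parenthesis lies between them. $e^{\downarrow}_j(N)$ moves the ball corresponding to the leftmost unmatched $j+1$ of $cw(N)$ from row $j+1$ to row $j$ in the same column (identity if none); $e^{\downarrow\star}_j$ applies $e^{\downarrow}_j$ until it acts trivially. For $M=(B_1,\dots,B_L)\in\mathrm{MLQ}_\lambda$: set $M_1=M$, $Q_1$ a single row of $|B_1|$ boxes filled with $1$; for $i=1,\dots,L-1$ let $M_{i+1}=e^{\downarrow\star}_1e^{\downarrow\star}_2\cdots e^{\downarrow\star}_i(M_i)$ ($e^{\downarrow\star}_i$ applied first), and obtain $Q_{i+1}$ from $Q_i$ by adding $|B^{(i+1)}_j|-|B^{(i)}_j|$ boxes to row $j$ for $j\le i$ and $|B^{(i+1)}_{i+1}|$ boxes in row $i+1$, all filled with $i+1$, where $M_i=(B^{(i)}_1,\dots,B^{(i)}_L)$. Put $\rho_N(M)=M_L$, $\rho_Q(M)=Q_L$, $\rho(M)=(\rho_N(M),\rho_Q(M))$. It is known that $\rho$ is a bijection $\mathrm{MLQ}_\lambda\to\bigcup_{\mu\le\lambda}\mathrm{NMLQ}_\mu\times\mathrm{SSYT}(\mu',\lambda')$; $\rho^{-1}(M_\beta,Q)$ denotes the preimage of the pair $(M_\beta,Q)$. *)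

theory Defs
  imports
    "HOL-Library.Poly_Mapping"
    "HOL-Computational_Algebra.Polynomial"
begin

section \<open>Compositions and partitions\<close>

text \<open>
  Compositions and partitions are lists of naturals; a partition has only positive parts,
  in weakly decreasing order.
\<close>

definition comp_sort :: "nat list \<Rightarrow> nat list" where
  "comp_sort \<alpha> = rev (sort (filter (\<lambda>a. 0 < a) \<alpha>))"

definition part :: "nat list \<Rightarrow> nat \<Rightarrow> nat" where
  "part lam i = (if 1 \<le> i \<and> i \<le> length lam then lam ! (i - 1) else 0)"

definition conjugate :: "nat list \<Rightarrow> nat list" where
  "conjugate lam = map (\<lambda>r. length (filter (\<lambda>a. r \<le> a) lam)) [1..<Suc (part lam 1)]"

definition dominated :: "nat list \<Rightarrow> nat list \<Rightarrow> bool" where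
  "dominated mu lam \<longleftrightarrow>
     sum_list mu = sum_list lam \<and> (\<forall>k. sum_list (take k mu) \<le> sum_list (take k lam))"


section \<open>Semistandard tableaux and charge\<close>

text \<open>A tableau is the list of its rows, bottom row first (French convention).\<close>

type_synonym tableau = "nat list list"

definition SSYT :: "nat list \<Rightarrow> nat list \<Rightarrow> tableau set" where
  "SSYT mu nu = {T.
     map length T = mu \<and>
     (\<forall>R \<in> set T. sorted R) \<and>
     (\<forall>i j. Suc i < length T \<longrightarrow> j < length (T ! Suc i) \<longrightarrow> T ! i ! j < T ! Suc i ! j) \<and>
     (\<forall>k. count_list (concat T) k = part nu k)}"

definition reading_word :: "tableau \<Rightarrow> nat list" where
  "reading_word T = concat (rev T)"

text \<open>
  Charge of a word \<open>w\<close> of partition content. A standard subword of the letters at the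
  positions in \<open>S\<close> is extracted by choosing the rightmost \<open>1\<close>, and then, given the chosen
  \<open>r\<close>, the first \<open>r + 1\<close> met when moving left from it, cyclically. The starting position
  \<open>length w\<close> lies to the right of every letter. The letter \<open>1\<close> has index \<open>0\<close>, and the index
  grows by one from \<open>r\<close> to \<open>r + 1\<close> exactly when \<open>r + 1\<close> lies to the right of \<open>r\<close>, i.e. when
  the search wraps around. The charge adds up all indices of all extracted subwords.
\<close>

definition next_left :: "nat set \<Rightarrow> nat \<Rightarrow> nat" where
  "next_left A p = (if \<exists>s \<in> A. s < p then Max {s \<in> A. s < p} else Max A)"

primrec sub_pos :: "nat list \<Rightarrow> nat set \<Rightarrow> nat \<Rightarrow> nat" where
  "sub_pos w S 0 = length w"
| "sub_pos w S (Suc r) = next_left {s \<in> S. w ! s = Suc r} (sub_pos w S r)"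

primrec sub_index :: "nat list \<Rightarrow> nat set \<Rightarrow> nat \<Rightarrow> nat" where
  "sub_index w S 0 = 0"
| "sub_index w S (Suc r) =
     sub_index w S r + (if sub_pos w S r < sub_pos w S (Suc r) then 1 else 0)"

definition sub_letters :: "nat list \<Rightarrow> nat set \<Rightarrow> nat set" where
  "sub_letters w S = {1..Max (insert 0 ((!) w ` S))}"

primrec remaining :: "nat list \<Rightarrow> nat \<Rightarrow> nat set" where
  "remaining w 0 = {..<length w}"
| "remaining w (Suc k) =
     remaining w k - sub_pos w (remaining w k) ` sub_letters w (remaining w k)"

definition word_charge :: "nat list \<Rightarrow> nat" where
  "word_charge w =
     (\<Sum>k < count_list w 1. \<Sum>r \<in> sub_letters w (remaining w k). sub_index w (remaining w k) r)"

definition charge :: "tableau \<Rightarrow> nat" where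
  "charge T = word_charge (reading_word T)"


section \<open>Multiline queues\<close>

text \<open>
  A tuple \<open>(B\<^sub>1, \<dots>, B\<^sub>L)\<close> is the function \<open>r \<mapsto> B\<^sub>r\<close>, extended by the empty set to the indices
  outside \<open>{1..L}\<close>. This identifies tuples that differ only by empty rows on top, as is
  needed to regard the result of collapsing as a multiline queue of the smaller shape.
  Columns are numbered \<open>1, \<dots>, n\<close>.
\<close>

type_synonym mlq = "nat \<Rightarrow> nat set"

definition height :: "mlq \<Rightarrow> nat" where
  "height M = (LEAST L. \<forall>r > L. M r = {})"

definition MLQ :: "nat \<Rightarrow> nat list \<Rightarrow> mlq set" where
  "MLQ n lam = {M. \<forall>r. M r \<subseteq> {1..n} \<and> card (M r) = part (conjugate lam) r}"

definition canonical_mlq :: "nat list \<Rightarrow> mlq" where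
  "canonical_mlq \<beta> = (\<lambda>r. if r = 0 then {} else {i \<in> {1..length \<beta>}. r \<le> \<beta> ! (i - 1)})"


subsection \<open>Ferrari--Martin labelling\<close>

definition first_right :: "nat set \<Rightarrow> nat \<Rightarrow> nat" where
  "first_right S c = (if \<exists>b \<in> S. c \<le> b then Min {b \<in> S. c \<le> b} else Min S)"

fun pair_balls :: "nat list \<Rightarrow> nat set \<Rightarrow> (nat \<times> nat) list" where
  "pair_balls [] S = []"
| "pair_balls (c # cs) S = (c, first_right S c) # pair_balls cs (S - {first_right S c})"

text \<open>
  The pairing from the upper row \<open>U\<close>, labelled by \<open>lab\<close>, to the lower row \<open>D\<close>. Since
  \<open>sort_key\<close> is stable, balls of equal label are processed from left to right.
\<close>

definition row_pairing :: "(nat \<Rightarrow> nat) \<Rightarrow> nat set \<Rightarrow> nat set \<Rightarrow> (nat \<times> nat) list" where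
  "row_pairing lab U D = pair_balls (sort_key (\<lambda>c. - int (lab c)) (sorted_list_of_set U)) D"

function fm_label :: "mlq \<Rightarrow> nat \<Rightarrow> nat \<Rightarrow> nat" where
  "fm_label M r =
     (if height M < r then (\<lambda>j. 0)
      else (\<lambda>j. if j \<notin> M r then 0
                else case map_of (map prod.swap
                       (row_pairing (fm_label M (Suc r)) (M (Suc r)) (M r))) j
                     of Some i \<Rightarrow> fm_label M (Suc r) i | None \<Rightarrow> r))"
  by pat_completeness auto
termination by (relation "measure (\<lambda>(M, r). Suc (height M) - r)") auto

declare fm_label.simps [simp del]

definition fm_pairs :: "mlq \<Rightarrow> nat \<Rightarrow> (nat \<times> nat) set" where
  "fm_pairs M r = set (row_pairing (fm_label M r) (M r) (M (r - 1)))"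

definition mlq_type :: "nat \<Rightarrow> mlq \<Rightarrow> nat list" where
  "mlq_type n M = map (fm_label M 1) [1..<Suc n]"

definition maj :: "mlq \<Rightarrow> nat" where
  "maj M = (\<Sum>r = 2..height M. \<Sum>(i, j) \<in> {(i, j) \<in> fm_pairs M r. j < i}. fm_label M r i - r + 1)"

definition MLQ_of_type :: "nat list \<Rightarrow> mlq set" where
  "MLQ_of_type \<alpha> = {M \<in> MLQ (length \<alpha>) (comp_sort \<alpha>). mlq_type (length \<alpha>) M = \<alpha>}"

definition NMLQ_of_type :: "nat list \<Rightarrow> mlq set" where
  "NMLQ_of_type \<alpha> = {M \<in> MLQ_of_type \<alpha>. maj M = 0}"


subsection \<open>Collapsing\<close>

text \<open>
  The column word, keeping for every letter the site \<open>(row, column)\<close> it comes from; the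
  column word proper is the list of first components.
\<close>

definition column_word :: "nat \<Rightarrow> mlq \<Rightarrow> (nat \<times> nat) list" where
  "column_word n N =
     concat (map (\<lambda>c. map (\<lambda>r. (r, c)) (filter (\<lambda>r. c \<in> N r) (rev [1..<Suc (height N)])))
       [1..<Suc n])"

text \<open>
  \<open>unmatched_open j st w\<close> lists, from left to right, the letters \<open>j + 1\<close> (opening
  parentheses) that remain unmatched after reading \<open>w\<close>, where the stack \<open>st\<close> holds the
  still unmatched opening parentheses read before, the most recent one first. A letter
  \<open>j\<close> (closing parenthesis) matches the top of the stack, if there is one.
\<close>

fun unmatched_open :: "nat \<Rightarrow> (nat \<times> nat) list \<Rightarrow> (nat \<times> nat) list \<Rightarrow> (nat \<times> nat) list" where
  "unmatched_open j st [] = rev st"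
| "unmatched_open j st ((r, c) # w) =
     (if r = Suc j then unmatched_open j ((r, c) # st) w
      else if r = j then unmatched_open j (tl st) w
      else unmatched_open j st w)"

definition e_down :: "nat \<Rightarrow> nat \<Rightarrow> mlq \<Rightarrow> mlq" where
  "e_down n j N =
     (case unmatched_open j [] (column_word n N) of
        [] \<Rightarrow> N
      | (r, c) # _ \<Rightarrow> N(Suc j := N (Suc j) - {c}, j := insert c (N j)))"

definition e_down_star :: "nat \<Rightarrow> nat \<Rightarrow> mlq \<Rightarrow> mlq" where
  "e_down_star n j N =
     (e_down n j ^^ (LEAST k. e_down n j ((e_down n j ^^ k) N) = (e_down n j ^^ k) N)) N"

text \<open>
  \<open>collapse n M i\<close> is \<open>M\<^sub>i\<close>. The recursion starts at \<open>i = 0\<close>: its first step applies an empty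
  composition of operators, so \<open>M\<^sub>1 = M\<^sub>0 = M\<close>.
\<close>

primrec collapse :: "nat \<Rightarrow> mlq \<Rightarrow> nat \<Rightarrow> mlq" where
  "collapse n M 0 = M"
| "collapse n M (Suc i) = foldr (e_down_star n) [1..<Suc i] (collapse n M i)"

text \<open>
  \<open>recording n M i j\<close> is row \<open>j\<close> of \<open>Q\<^sub>i\<close>. Starting from the empty \<open>Q\<^sub>0\<close>, the first step
  produces the single row \<open>Q\<^sub>1\<close> of \<open>card (M 1)\<close> boxes filled with \<open>1\<close>.
\<close>

primrec recording :: "nat \<Rightarrow> mlq \<Rightarrow> nat \<Rightarrow> nat \<Rightarrow> nat list" where
  "recording n M 0 = (\<lambda>j. [])"
| "recording n M (Suc i) = (\<lambda>j.
     if 1 \<le> j \<and> j \<le> i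
       then recording n M i j
              @ replicate (card (collapse n M (Suc i) j) - card (collapse n M i j)) (Suc i)
     else if j = Suc i then replicate (card (collapse n M (Suc i) (Suc i))) (Suc i)
     else [])"

definition rho_N :: "nat \<Rightarrow> mlq \<Rightarrow> mlq" where
  "rho_N n M = collapse n M (height M)"

text \<open>The empty rows on top are discarded, so that the list of row lengths is a partition.\<close>

definition rho_Q :: "nat \<Rightarrow> mlq \<Rightarrow> tableau" where
  "rho_Q n M = takeWhile (\<lambda>R. R \<noteq> []) (map (recording n M (height M)) [1..<Suc (height M)])"

definition rho :: "nat \<Rightarrow> mlq \<Rightarrow> mlq \<times> tableau" where
  "rho n M = (rho_N n M, rho_Q n M)"

definition rho_inv :: "nat \<Rightarrow> nat list \<Rightarrow> mlq \<times> tableau \<Rightarrow> mlq" where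
  "rho_inv n lam = the_inv_into (MLQ n lam) (rho n)"


section \<open>Polynomials\<close>

text \<open>Polynomials in \<open>x\<^sub>1, x\<^sub>2, \<dots>\<close> with coefficients in \<open>\<int>[q]\<close>; monomials are exponent vectors.\<close>

type_synonym xpoly = "(nat \<Rightarrow>\<^sub>0 nat) \<Rightarrow>\<^sub>0 int poly"

definition xvar :: "nat \<Rightarrow> xpoly" where
  "xvar j = Poly_Mapping.single (Poly_Mapping.single j 1) 1"

definition scalar :: "int poly \<Rightarrow> xpoly" where
  "scalar c = Poly_Mapping.single 0 c"

definition qvar :: "int poly" where
  "qvar = [:0, 1:]"

definition weight :: "mlq \<Rightarrow> xpoly" where
  "weight M = (\<Prod>r = 1..height M. \<Prod>b \<in> M r. xvar b)"

definition asep_poly :: "nat list \<Rightarrow> xpoly" where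
  "asep_poly \<alpha> = (\<Sum>M \<in> MLQ_of_type \<alpha>. scalar (qvar ^ maj M) * weight M)"

definition atom :: "nat list \<Rightarrow> xpoly" where
  "atom \<beta> = (\<Sum>M \<in> NMLQ_of_type \<beta>. weight M)"

definition K_coeff :: "nat list \<Rightarrow> nat list \<Rightarrow> int poly" where
  "K_coeff \<alpha> \<beta> =
     (\<Sum>Q \<in> {Q \<in> SSYT (conjugate (comp_sort \<beta>)) (conjugate (comp_sort \<alpha>)).
              mlq_type (length \<alpha>) (rho_inv (length \<alpha>) (comp_sort \<alpha>) (canonical_mlq \<beta>, Q)) = \<alpha>}.
       qvar ^ charge Q)"

end

theory Submission imports Defs begin

text \<open>
  Arrays of balls carry two commuting crystal structures: row operators move balls between adjacent
  rows as in collapsing, column operators move balls between adjacent columns. Two arrays in one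
  component of the column crystal are collapsed by the same word of row operators. Hence
  \<open>\<rho>\<^sub>Q\<close> is constant on these components; it separates them, because the array can be read off from
  \<open>\<rho>\<^sub>Q\<close> when it is column highest. \<open>\<rho>\<^sub>N(M)\<close> is the only row highest array that row operators
  reach from \<open>M\<close>, and nonwrapping means row highest. So \<open>\<rho>\<close> is bijective.

  The balls in row \<open>r\<close> with label at least \<open>k\<close> form row \<open>r\<close> of the array obtained from \<open>M\<close> by
  the Lascoux--Schuetzenberger involutions that bring the size of row \<open>k\<close> down to row \<open>r\<close>. These are
  words of row operators as well, so that maj is constant on the components of the column
  crystal. The component of \<open>M\<close> contains the array of the reading word of \<open>\<rho>\<^sub>Q(M)\<close>, whose maj is the
  charge: it counts the wraps of chains built greedily from the top, charge those of chains built
  greedily from the bottom, and both numbers are the least possible.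

  Finally, if two arrays \<open>M\<close>, \<open>M'\<close> in one component are such that \<open>\<rho>\<^sub>N(M)\<close>, \<open>\<rho>\<^sub>N(M')\<close> have the same
  type, then \<open>M\<close>, \<open>M'\<close> have the same type. So \<open>M\<close> is counted in \<open>K\<^sub>\<alpha>\<^sub>\<beta>\<close> with \<open>\<beta>\<close> the type of
  \<open>\<rho>\<^sub>N(M)\<close>.
\<close>

section \<open>Bracketing two rows\<close>

text \<open>Commutation is local: brackets between two rows are read off a path of heights, and a
  column move changes this path at one place only, where the extremal choice of the moved ball
  controls the neighbouring values. Facts about a component are then transported from its column
  highest member, whose collapse simply drops the balls of every column to the bottom. Arrays carry
  no fixed frame, since the reading word of a tableau may occupy more columns than the queue. The
  delicate point is the last one. A type is the family of first rows of \<open>M\<close> after the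
  words \<open>Tf k 1\<close>, and the hypothesis gives equality of such first rows only for the row
  highest arrays. So equality of first rows is proved after all words of row operators, by induction
  on the sum of the squared row sizes: inside a string of moves between rows 1 and 2 it is forced by
  the two ends, both of which have a larger sum. If no such string is available, all rows of the
  column highest member are initial segments, and adjacent swaps lead to a row highest array and
  back.\<close>

definition hgt :: "nat set \<Rightarrow> nat set \<Rightarrow> nat \<Rightarrow> int" where
  "hgt A B p = int (card (A \<inter> {1..p})) - int (card (B \<inter> {1..p}))"

text \<open>With \<open>A\<close> as opening and \<open>B\<close> as closing brackets, a column in both being a matched pair, \<open>uo\<close> and
  \<open>uc\<close> are the unmatched opening and closing brackets; \<open>dn\<close> and \<open>up\<close> single out the leftmost and the
  rightmost of them.\<close>

definition uo :: "nat set \<Rightarrow> nat set \<Rightarrow> nat set" where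
  "uo A B = {c. 1 \<le> c \<and> (\<forall>q\<ge>c. hgt A B (c - 1) < hgt A B q)}"

definition uc :: "nat set \<Rightarrow> nat set \<Rightarrow> nat set" where
  "uc A B = {c. 1 \<le> c \<and> (\<forall>q<c. hgt A B c < hgt A B q)}"

definition dn :: "nat set \<Rightarrow> nat set \<Rightarrow> nat \<Rightarrow> bool" where
  "dn A B c \<longleftrightarrow> 1 \<le> c \<and> (\<forall>q<c. hgt A B (c - 1) \<le> hgt A B q) \<and> (\<forall>q\<ge>c. hgt A B (c - 1) < hgt A B q)"

definition up :: "nat set \<Rightarrow> nat set \<Rightarrow> nat \<Rightarrow> bool" where
  "up A B c \<longleftrightarrow> 1 \<le> c \<and> (\<forall>q<c. hgt A B c < hgt A B q) \<and> (\<forall>q\<ge>c. hgt A B c \<le> hgt A B q)"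

definition fin1 :: "nat set \<Rightarrow> bool" where
  "fin1 A \<longleftrightarrow> finite A \<and> 0 \<notin> A"

section \<open>The lattice path of heights: balls of \<open>A\<close> are up steps, balls of
  \<open>B\<close> down steps\<close>

lemma hgt_0 [simp]: "hgt A B 0 = 0"
  by (simp add: hgt_def)

lemma hgt_Suc: "hgt A B (Suc p) = hgt A B p + of_bool (Suc p \<in> A) - of_bool (Suc p \<in> B)"
proof -
  have *: "{1..Suc p} = insert (Suc p) {1..p}" by auto
  have "card (S \<inter> {1..Suc p}) = card (S \<inter> {1..p}) + of_bool (Suc p \<in> S)" for S :: "nat set"
    unfolding * by (cases "Suc p \<in> S") (auto simp: Int_insert_right)
  then show ?thesis by (simp add: hgt_def)
qed

lemma hgt_step: "1 \<le> p \<Longrightarrow> hgt A B p = hgt A B (p - 1) + of_bool (p \<in> A) - of_bool (p \<in> B)"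
  using hgt_Suc[of A B "p - 1"] by simp

lemma fin1_bound: "fin1 A \<Longrightarrow> \<exists>P. A \<subseteq> {1..P}"
proof -
  assume "fin1 A"
  then have "finite A" "0 \<notin> A" by (auto simp: fin1_def)
  then have "A \<subseteq> {1..Max (insert 0 A)}"
    by (auto simp: Suc_le_eq intro: gr0I)
  then show ?thesis by blast
qed

lemma hgt_const: "A \<subseteq> {1..P} \<Longrightarrow> B \<subseteq> {1..P} \<Longrightarrow> P \<le> q \<Longrightarrow> hgt A B q = int (card A) - int (card B)"
proof -
  assume "A \<subseteq> {1..P}" "B \<subseteq> {1..P}" "P \<le> q"
  then have "A \<inter> {1..q} = A" "B \<inter> {1..q} = B" by auto
  then show ?thesis by (simp add: hgt_def)
qed

lemma hgt_limit:
  assumes "fin1 A" "fin1 B"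
  obtains P where "\<And>q. P \<le> q \<Longrightarrow> hgt A B q = int (card A) - int (card B)"
proof -
  obtain P1 where P1: "A \<subseteq> {1..P1}" using fin1_bound[OF assms(1)] by blast
  obtain P2 where P2: "B \<subseteq> {1..P2}" using fin1_bound[OF assms(2)] by blast
  have A: "A \<subseteq> {1..max P1 P2}" using P1 by (auto simp: subset_iff le_max_iff_disj)
  have B: "B \<subseteq> {1..max P1 P2}" using P2 by (auto simp: subset_iff le_max_iff_disj)
  show ?thesis by (rule that[of "max P1 P2"]) (rule hgt_const[OF A B])
qed

lemma uo_subset: "uo A B \<subseteq> A - B"
proof
  fix c assume "c \<in> uo A B"
  then have "1 \<le> c" "hgt A B (c - 1) < hgt A B c" by (auto simp: uo_def)
  with hgt_step[of c A B] show "c \<in> A - B" by (auto split: if_splits simp: of_bool_def)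
qed

lemma uc_subset: "uc A B \<subseteq> B - A"
proof
  fix c assume "c \<in> uc A B"
  then have "1 \<le> c" "hgt A B c < hgt A B (c - 1)" by (auto simp: uc_def)
  with hgt_step[of c A B] show "c \<in> B - A" by (auto split: if_splits simp: of_bool_def)
qed

lemma finite_uo: "fin1 A \<Longrightarrow> finite (uo A B)"
  using uo_subset[of A B] by (meson Diff_subset fin1_def finite_subset)

lemma finite_uc: "fin1 B \<Longrightarrow> finite (uc A B)"
  using uc_subset[of A B] by (meson Diff_subset fin1_def finite_subset)

text \<open>At an unmatched closing the path is lower than anywhere before, and just before an
  unmatched opening it is lower than anywhere after; the reverse order would contradict
  both.\<close>

lemma uc_less_uo: "c \<in> uc A B \<Longrightarrow> u \<in> uo A B \<Longrightarrow> c < u"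
proof (rule ccontr)
  assume *: "c \<in> uc A B" "u \<in> uo A B" "\<not> c < u"
  then have "1 \<le> u" "hgt A B (u - 1) < hgt A B c" by (auto simp: uo_def)
  moreover have "hgt A B c < hgt A B (u - 1)" using * \<open>1 \<le> u\<close> by (auto simp: uc_def)
  ultimately show False by simp
qed

lemma dn_unique: "dn A B c \<Longrightarrow> dn A B d \<Longrightarrow> c = d"
proof (induction c d rule: linorder_wlog)
  case (le a b)
  show ?case
  proof (rule ccontr)
    assume "a \<noteq> b"
    then have "a \<le> b - 1" "a - 1 < b" using le by auto
    then have "hgt A B (a - 1) < hgt A B (b - 1)" "hgt A B (b - 1) \<le> hgt A B (a - 1)"
      using le by (auto simp: dn_def)
    then show False by simp
  qed
qed auto

lemma up_unique: "up A B c \<Longrightarrow> up A B d \<Longrightarrow> c = d"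
proof (induction c d rule: linorder_wlog)
  case (le a b)
  then show ?case by (fastforce simp: up_def le_less)
qed auto

lemma dn_in_uo: "dn A B c \<Longrightarrow> c \<in> uo A B"
  by (auto simp: dn_def uo_def)

lemma up_in_uc: "up A B c \<Longrightarrow> c \<in> uc A B"
  by (auto simp: up_def uc_def)

text \<open>The column before the leftmost unmatched opening is the last place where the path
  attains its minimum. Any unmatched opening \<open>c0\<close> confines the minimum to the places up
  to \<open>c0 - 1\<close>, where a last one exists.\<close>

lemma dn_exists: "uo A B \<noteq> {} \<Longrightarrow> \<exists>c. dn A B c"
proof -
  assume "uo A B \<noteq> {}"
  then obtain c0 where c0: "1 \<le> c0" "\<And>q. q \<ge> c0 \<Longrightarrow> hgt A B (c0 - 1) < hgt A B q"
    by (auto simp: uo_def)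
  define m where "m = Min (hgt A B ` {..c0 - 1})"
  have m_le: "m \<le> hgt A B q" if "q \<le> c0 - 1" for q
    unfolding m_def using that by (intro Min_le) auto
  have "m \<in> hgt A B ` {..c0 - 1}" unfolding m_def by (intro Min_in) auto
  then have ne: "{q. q \<le> c0 - 1 \<and> hgt A B q = m} \<noteq> {}" by auto
  define P where "P = Max {q. q \<le> c0 - 1 \<and> hgt A B q = m}"
  have "P \<in> {q. q \<le> c0 - 1 \<and> hgt A B q = m}" unfolding P_def using ne by (intro Max_in) auto
  then have P: "P \<le> c0 - 1" "hgt A B P = m" by auto
  have Pmax: "q \<le> P" if "q \<le> c0 - 1" "hgt A B q = m" for q
    unfolding P_def using that by (intro Max_ge) auto
  have "dn A B (Suc P)" unfolding dn_def
  proof (intro conjI allI impI)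
    show "1 \<le> Suc P" by simp
    fix q assume "q < Suc P" then show "hgt A B (Suc P - 1) \<le> hgt A B q" using P m_le by auto
  next
    fix q assume q: "Suc P \<le> q"
    show "hgt A B (Suc P - 1) < hgt A B q"
    proof (cases "q \<le> c0 - 1")
      case True then show ?thesis using m_le[of q] Pmax[of q] P q by fastforce
    next
      case False then have "q \<ge> c0" by auto
      then show ?thesis using c0(2)[of q] m_le[of "c0 - 1"] P by auto
    qed
  qed
  then show ?thesis by blast
qed

text \<open>The first place where the path is as low as at \<open>q\<close> is a record low, hence
  an unmatched closing unless it is the start.\<close>

lemma low_point: "\<exists>x\<le>q. hgt A B x \<le> hgt A B q \<and> (x = 0 \<or> x \<in> uc A B)"
proof -
  define x where "x = (LEAST x. hgt A B x \<le> hgt A B q)"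
  have 1: "hgt A B x \<le> hgt A B q" unfolding x_def by (rule LeastI) auto
  have 2: "\<not> hgt A B y \<le> hgt A B q" if "y < x" for y
    using that not_less_Least unfolding x_def by blast
  have 3: "x \<le> q" unfolding x_def by (rule Least_le) auto
  have "x = 0 \<or> x \<in> uc A B" using 1 2 by (fastforce simp: uc_def)
  with 1 3 show ?thesis by blast
qed

lemma up_exists: "fin1 B \<Longrightarrow> uc A B \<noteq> {} \<Longrightarrow> up A B (Max (uc A B))"
proof -
  assume B: "fin1 B" and ne: "uc A B \<noteq> {}"
  define b where "b = Max (uc A B)"
  have bin: "b \<in> uc A B" unfolding b_def using finite_uc[OF B] ne by (rule Max_in)
  have bmax: "x \<le> b" if "x \<in> uc A B" for x
    unfolding b_def using finite_uc[OF B] that by (rule Max_ge)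
  have b1: "1 \<le> b" "\<And>q. q < b \<Longrightarrow> hgt A B b < hgt A B q" using bin by (auto simp: uc_def)
  have "hgt A B b \<le> hgt A B q" for q
  proof -
    obtain x where x: "hgt A B x \<le> hgt A B q" "x = 0 \<or> x \<in> uc A B"
      using low_point by blast
    then have "x < b \<or> x = b" using bmax[of x] b1 by auto
    then show ?thesis using x b1(2)[of x] by auto
  qed
  then have "up A B b" using b1 by (auto simp: up_def)
  then show ?thesis by (simp add: b_def)
qed

lemma dn_ex_iff: "(\<exists>c. dn A B c) \<longleftrightarrow> uo A B \<noteq> {}"
  using dn_exists dn_in_uo by blast

lemma up_ex_iff: "fin1 B \<Longrightarrow> (\<exists>c. up A B c) \<longleftrightarrow> uc A B \<noteq> {}"
  using up_exists up_in_uc by blast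

lemma up_Max: "fin1 B \<Longrightarrow> up A B c \<Longrightarrow> c = Max (uc A B)"
  using up_exists up_in_uc up_unique by blast

text \<open>Unmatched closings are the record lows, and a step of the path lowers it by at most one;
  so each of them lowers the running minimum by exactly one.\<close>

lemma hgt_low:
  "(\<forall>q\<le>p. - int (card (uc A B \<inter> {1..p})) \<le> hgt A B q) \<and>
   (\<exists>q\<le>p. hgt A B q = - int (card (uc A B \<inter> {1..p})))"
proof (induction p)
  case 0 then show ?case by auto
next
  case (Suc p)
  have *: "{1..Suc p} = insert (Suc p) {1..p}" by auto
  let ?k = "int (card (uc A B \<inter> {1..p}))"
  obtain q0 where q0: "q0 \<le> p" "hgt A B q0 = - ?k" using Suc by blast
  show ?case
  proof (cases "Suc p \<in> uc A B")
    case True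
    have c: "card (uc A B \<inter> {1..Suc p}) = Suc (card (uc A B \<inter> {1..p}))"
      unfolding * using True by (auto simp: Int_insert_right)
    have "\<forall>q<Suc p. hgt A B (Suc p) < hgt A B q" using True unfolding uc_def by blast
    then have "hgt A B (Suc p) < hgt A B q0" using q0(1) by simp
    moreover have "hgt A B (Suc p) \<ge> hgt A B p - 1" by (simp add: hgt_Suc)
    moreover have "hgt A B p \<ge> - ?k" using Suc by blast
    ultimately have e: "hgt A B (Suc p) = - ?k - 1" using q0 by linarith
    have "- int (card (uc A B \<inter> {1..Suc p})) \<le> hgt A B q" if "q \<le> Suc p" for q
      using that Suc e c by (cases "q = Suc p") (auto simp: le_Suc_eq intro: order_trans[of _ "-?k"])
    moreover have "hgt A B (Suc p) = - int (card (uc A B \<inter> {1..Suc p}))" using e c by simp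
    ultimately show ?thesis by blast
  next
    case False
    have c: "uc A B \<inter> {1..Suc p} = uc A B \<inter> {1..p}" unfolding * using False by auto
    obtain q where q: "q < Suc p" "hgt A B q \<le> hgt A B (Suc p)"
      using False by (auto simp: uc_def not_less)
    then have "- ?k \<le> hgt A B (Suc p)" using Suc by (meson less_Suc_eq_le order_trans)
    then show ?thesis unfolding c using Suc by (metis le_Suc_eq)
  qed
qed

lemma hgt_uc: "c \<in> uc A B \<Longrightarrow> hgt A B c = - int (card (uc A B \<inter> {1..c}))"
  using hgt_low[of c A B] by (metis (no_types, lifting) le_neq_implies_less linorder_not_less mem_Collect_eq order_refl uc_def)

lemma hgt_ge_card_uc: "fin1 B \<Longrightarrow> - int (card (uc A B)) \<le> hgt A B q"
proof -
  assume "fin1 B"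
  have "card (uc A B \<inter> {1..q}) \<le> card (uc A B)"
    using finite_uc[OF \<open>fin1 B\<close>] by (intro card_mono) auto
  then show ?thesis using hgt_low[of q A B] by (meson dual_order.trans le_refl neg_le_iff_le of_nat_le_iff)
qed

lemma hgt_eq_card_uc: "fin1 B \<Longrightarrow> \<exists>q. hgt A B q = - int (card (uc A B))"
proof -
  assume "fin1 B"
  then obtain P where "B \<subseteq> {1..P}" using fin1_bound by blast
  then have "uc A B \<inter> {1..P} = uc A B" using uc_subset[of A B] by auto
  then show ?thesis using hgt_low[of P A B] by metis
qed

text \<open>Lets bracket counts of two arrays be compared through all lower bounds \<open>v\<close>
  of the paths, without naming a place of the minimum.\<close>

lemma card_uc_min: "fin1 B \<Longrightarrow> v \<le> - int (card (uc A B)) \<longleftrightarrow> (\<forall>q. v \<le> hgt A B q)"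
  using hgt_ge_card_uc hgt_eq_card_uc by (metis order_trans)

lemma uo_nonempty:
  assumes "fin1 A" "fin1 B" "hgt A B q < int (card A) - int (card B)"
  shows "uo A B \<noteq> {}"
proof -
  obtain N where N: "\<And>x. N \<le> x \<Longrightarrow> hgt A B x = int (card A) - int (card B)"
    using hgt_limit assms by blast
  let ?S = "{x. hgt A B x \<le> hgt A B q}"
  have "x < N" if "x \<in> ?S" for x using that N[of x] assms(3) by (cases "x < N") auto
  then have fin: "finite ?S" by (meson finite_nat_set_iff_bounded)
  \<comment> \<open>The last visit at or below the height at \<open>q\<close>; from there on the
    path stays higher, so the next step is an unmatched opening.\<close>
  define P where "P = Max ?S"
  have "P \<in> ?S" unfolding P_def using fin by (intro Max_in) auto
  moreover have "x \<notin> ?S" if "P < x" for x using that fin Max_ge unfolding P_def by (meson linorder_not_less)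
  ultimately have "Suc P \<in> uo A B" unfolding uo_def
    by simp (metis Suc_le_lessD dual_order.strict_trans1 linorder_not_le)
  then show ?thesis by blast
qed

section \<open>How brackets change when one ball moves between the rows\<close>

lemma hgt_move:
  assumes "c \<in> A" "c \<notin> B" "1 \<le> c"
  shows "hgt (A - {c}) (insert c B) q = hgt A B q - (if c \<le> q then 2 else 0)"
proof (cases "c \<le> q")
  case True
  have 1: "(A - {c}) \<inter> {1..q} = (A \<inter> {1..q}) - {c}" by auto
  have 2: "insert c B \<inter> {1..q} = insert c (B \<inter> {1..q})" using True assms by auto
  have "card (A \<inter> {1..q}) \<ge> 1" using True assms by (metis (no_types, lifting) IntI One_nat_def Suc_leI atLeastAtMost_iff card_gt_0_iff empty_iff finite_Int finite_atLeastAtMost)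
  then show ?thesis unfolding hgt_def 1 2 using True assms by auto
next
  case False
  then have 1: "(A - {c}) \<inter> {1..q} = A \<inter> {1..q}" and 2: "insert c B \<inter> {1..q} = B \<inter> {1..q}"
    by auto
  show ?thesis unfolding hgt_def 1 2 using False by simp
qed

lemma dn_mem: "dn A B c \<Longrightarrow> c \<in> A \<and> c \<notin> B \<and> 1 \<le> c"
  using dn_in_uo[of A B c] uo_subset[of A B] by (auto simp only: dn_def)

lemma up_mem: "up A B c \<Longrightarrow> c \<in> B \<and> c \<notin> A \<and> 1 \<le> c"
  using up_in_uc[of A B c] uc_subset[of A B] by (auto simp only: up_def)

lemma dn_step: "dn A B c \<Longrightarrow> hgt A B c = hgt A B (c - 1) + 1"
  using dn_mem[of A B c] hgt_step[of c A B] by auto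

lemma up_step: "up A B c \<Longrightarrow> hgt A B c = hgt A B (c - 1) - 1"
  using up_mem[of A B c] hgt_step[of c A B] by auto

text \<open>The move lowers the path by 2 from \<open>c\<close> on. The last minimum at
  \<open>c - 1\<close> thus turns into a first minimum at \<open>c\<close>, one lower, which is what
  makes the two moves inverse to each other.\<close>

lemma dn_imp_up: assumes "dn A B c" shows "up (A - {c}) (insert c B) c"
proof -
  have m: "c \<in> A" "c \<notin> B" "1 \<le> c" using dn_mem[OF assms] by auto
  show ?thesis unfolding up_def hgt_move[OF m]
    using assms dn_step[OF assms] by (fastforce simp: dn_def)
qed

lemma up_imp_dn: assumes "up A B c" shows "dn (insert c A) (B - {c}) c"
proof -
  have m: "c \<in> B" "c \<notin> A" "1 \<le> c" using up_mem[OF assms] by auto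
  have h: "hgt (insert c A) (B - {c}) q = hgt A B q + (if c \<le> q then 2 else 0)" for q
    using hgt_move[of c "insert c A" "B - {c}" q] m
    by (smt (verit) DiffE Diff_insert_absorb insertI1 insert_Diff)
  show ?thesis unfolding dn_def h
    using assms up_step[OF assms] m by (fastforce simp: up_def)
qed

lemma uo_dn: assumes "dn A B c" shows "uo (A - {c}) (insert c B) = uo A B - {c}"
proof -
  have m: "c \<in> A" "c \<notin> B" "1 \<le> c" using dn_mem[OF assms] by auto
  note h = hgt_move[OF m]
  have l: "\<And>q. q < c \<Longrightarrow> hgt A B (c - 1) \<le> hgt A B q" and g: "\<And>q. q \<ge> c \<Longrightarrow> hgt A B (c - 1) < hgt A B q"
    using assms by (auto simp: dn_def)
  have "d \<in> uo (A - {c}) (insert c B) \<longleftrightarrow> d \<in> uo A B - {c}" for d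
  proof (cases "d \<le> c")
    case True
    have "d \<notin> uo (A - {c}) (insert c B)"
    proof
      assume "d \<in> uo (A - {c}) (insert c B)"
      then have "1 \<le> d" "hgt (A - {c}) (insert c B) (d - 1) < hgt (A - {c}) (insert c B) c" using True by (auto simp: uo_def)
      then have "hgt A B (d - 1) < hgt A B c - 2" unfolding h using True \<open>1 \<le> d\<close> by (auto split: if_splits)
      moreover have "d - 1 < c" using True \<open>1 \<le> d\<close> by linarith
      ultimately show False using l[of "d - 1"] dn_step[OF assms] by linarith
    qed
    moreover have "d \<notin> uo A B - {c}"
    proof
      assume d: "d \<in> uo A B - {c}"
      then have "1 \<le> d" "d < c" "hgt A B (d - 1) < hgt A B (c - 1)" using True by (auto simp: uo_def)
      then show False using l[of "d - 1"] by linarith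
    qed
    ultimately show ?thesis by blast
  next
    case False
    then show ?thesis by (auto simp: uo_def h)
  qed
  then show ?thesis by blast
qed

lemma uc_dn: assumes "dn A B c" shows "uc (A - {c}) (insert c B) = insert c (uc A B)"
proof -
  have m: "c \<in> A" "c \<notin> B" "1 \<le> c" using dn_mem[OF assms] by auto
  note h = hgt_move[OF m]
  have g: "\<And>q. q \<ge> c \<Longrightarrow> hgt A B (c - 1) < hgt A B q"
    using assms by (auto simp: dn_def)
  have "d \<in> uc (A - {c}) (insert c B) \<longleftrightarrow> d \<in> insert c (uc A B)" for d
  proof -
    consider "d < c" | "d = c" | "d > c" by linarith
    then show ?thesis
    proof cases
      case 1 then show ?thesis by (auto simp: uc_def h)
    next
      case 2
      then show ?thesis using dn_imp_up[OF assms] up_in_uc by blast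
    next
      case 3
      have "d \<notin> uc A B" 
      proof
        assume "d \<in> uc A B"
        then have "hgt A B d < hgt A B (c - 1)" using 3 by (auto simp: uc_def)
        then show False using g[of d] 3 by simp
      qed
      moreover have "d \<notin> uc (A - {c}) (insert c B)"
      proof
        assume "d \<in> uc (A - {c}) (insert c B)"
        then have "hgt A B d - 2 < hgt A B c - 2" using 3 by (auto simp: uc_def h)
        then show False using g[of d] 3 dn_step[OF assms] by auto
      qed
      ultimately show ?thesis using 3 by auto
    qed
  qed
  then show ?thesis by blast
qed

lemma uo_uc_up: assumes "up A B c"
  shows "uo (insert c A) (B - {c}) = insert c (uo A B)" "uc (insert c A) (B - {c}) = uc A B - {c}"
proof -
  have m: "c \<in> B" "c \<notin> A" "1 \<le> c" using up_mem[OF assms] by auto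
  note d = up_imp_dn[OF assms]
  have e: "insert c A - {c} = A" "insert c (B - {c}) = B" using m by auto
  have "uo A B = uo (insert c A) (B - {c}) - {c}" "uc A B = insert c (uc (insert c A) (B - {c}))"
    using uo_dn[OF d] uc_dn[OF d] unfolding e by auto
  moreover have "c \<in> uo (insert c A) (B - {c})" using d dn_in_uo by blast
  moreover have "c \<notin> uc (insert c A) (B - {c})" using uc_subset by blast
  ultimately show "uo (insert c A) (B - {c}) = insert c (uo A B)" "uc (insert c A) (B - {c}) = uc A B - {c}"
    by auto
qed

lemma fin1_insert [simp]: "fin1 (insert c A) \<longleftrightarrow> c \<noteq> 0 \<and> fin1 A"
  by (auto simp: fin1_def)
lemma fin1_Diff [simp]: "fin1 A \<Longrightarrow> fin1 (A - S)"
  by (auto simp: fin1_def)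

text \<open>Moving unmatched openings one at a time changes both sides by the same amount. Without
  unmatched openings the final height of the path is its minimum, which counts the unmatched
  closings.\<close>

lemma card_uo_uc:
  assumes "fin1 A" "fin1 B"
  shows "int (card (uo A B)) - int (card (uc A B)) = int (card A) - int (card B)"
  using assms
proof (induction "card (uo A B)" arbitrary: A B)
  case 0
  then have e: "uo A B = {}" using finite_uo by auto
  then have ge: "\<forall>q. int (card A) - int (card B) \<le> hgt A B q"
    using uo_nonempty[OF 0(2,3)] by (meson linorder_not_less)
  obtain P where "hgt A B P = int (card A) - int (card B)" using hgt_limit[OF 0(2,3)] by blast
  moreover have "int (card A) - int (card B) \<le> - int (card (uc A B))" using ge card_uc_min 0 by blast
  moreover have "- int (card (uc A B)) \<le> hgt A B P" using hgt_ge_card_uc 0 by blast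
  ultimately show ?case using e by simp
next
  case (Suc n)
  then have "uo A B \<noteq> {}" by auto
  then obtain c where c: "dn A B c" using dn_exists by blast
  have m: "c \<in> A" "c \<notin> B" "1 \<le> c" using dn_mem[OF c] by auto
  have cuo: "c \<in> uo A B" using c dn_in_uo by blast
  have cuc: "c \<notin> uc A B" using m uc_subset by blast
  have fA: "finite A" "finite B" using Suc by (auto simp: fin1_def)
  have "n = card (uo (A - {c}) (insert c B))"
    unfolding uo_dn[OF c] using cuo Suc(2) finite_uo[OF Suc(3)] by auto
  from Suc(1)[OF this] have "int (card (uo (A - {c}) (insert c B))) - int (card (uc (A - {c}) (insert c B)))
    = int (card (A - {c})) - int (card (insert c B))" using Suc m by auto
  moreover have "int (card (A - {c})) = int (card A) - 1" using m fA by (metis card_Suc_Diff1 of_nat_Suc add_diff_cancel_left')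
  moreover have "card (insert c B) = Suc (card B)" using m fA by simp
  moreover have "card (uc (A - {c}) (insert c B)) = Suc (card (uc A B))"
    unfolding uc_dn[OF c] using cuc finite_uc[OF Suc(4)] by simp
  ultimately show ?case using \<open>n = card (uo (A - {c}) (insert c B))\<close> Suc(2) by simp
qed

section \<open>Row and column operators\<close>

definition box :: "nat \<Rightarrow> nat \<Rightarrow> mlq \<Rightarrow> bool" where
  "box L n X \<longleftrightarrow> (\<forall>r c. c \<in> X r \<longrightarrow> 1 \<le> r \<and> r \<le> L \<and> 1 \<le> c \<and> c \<le> n)"

text \<open>Finite support without a prescribed frame: components must be able to compare a queue
  with the array of a word of another length.\<close>

definition mat :: "mlq \<Rightarrow> bool" where
  "mat X \<longleftrightarrow> (\<exists>L n. box L n X)"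

definition tr :: "mlq \<Rightarrow> mlq" where
  "tr X = (\<lambda>c. {r. c \<in> X r})"

definition mv :: "nat \<Rightarrow> nat \<Rightarrow> nat \<Rightarrow> mlq \<Rightarrow> mlq" where
  "mv a b c Z = Z(a := Z a - {c}, b := insert c (Z b))"

definition gdn :: "nat \<Rightarrow> nat \<Rightarrow> mlq \<Rightarrow> mlq" where
  "gdn a b Z = (if \<exists>c. dn (Z a) (Z b) c then mv a b (THE c. dn (Z a) (Z b) c) Z else Z)"

definition gup :: "nat \<Rightarrow> nat \<Rightarrow> mlq \<Rightarrow> mlq" where
  "gup a b Z = (if \<exists>c. up (Z a) (Z b) c then mv b a (THE c. up (Z a) (Z b) c) Z else Z)"

definition geps :: "nat \<Rightarrow> nat \<Rightarrow> mlq \<Rightarrow> nat" where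
  "geps a b Z = card (uo (Z a) (Z b))"

definition gphi :: "nat \<Rightarrow> nat \<Rightarrow> mlq \<Rightarrow> nat" where
  "gphi a b Z = card (uc (Z a) (Z b))"

lemma mem_tr [simp]: "r \<in> tr X c \<longleftrightarrow> c \<in> X r"
  by (simp add: tr_def)

lemma tr_tr [simp]: "tr (tr X) = X"
  by (simp add: tr_def)

lemma box_tr [simp]: "box n L (tr X) \<longleftrightarrow> box L n X"
  unfolding box_def mem_tr by blast

lemma mat_tr [simp]: "mat (tr X) \<longleftrightarrow> mat X"
  unfolding mat_def box_tr by blast

lemma box_mono: "box L n X \<Longrightarrow> L \<le> L' \<Longrightarrow> n \<le> n' \<Longrightarrow> box L' n' X"
  unfolding box_def by (meson order_trans)

lemma box_fin1: "box L n X \<Longrightarrow> fin1 (X r)"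
  unfolding box_def fin1_def by (metis finite_nat_set_iff_bounded_le not_one_le_zero)

lemma mat_fin1: "mat X \<Longrightarrow> fin1 (X r)"
  unfolding mat_def using box_fin1 by blast

lemma mat_finite: "mat X \<Longrightarrow> finite (X r)"
  using mat_fin1 fin1_def by blast

lemma mem_mv: "x \<in> mv a b c Z r \<longleftrightarrow> (if x = c \<and> r = b then True else if x = c \<and> r = a then False else x \<in> Z r)"
  by (auto simp: mv_def)

lemma box_mv: "box L n Z \<Longrightarrow> c \<in> Z a \<Longrightarrow> 1 \<le> b \<Longrightarrow> b \<le> L \<Longrightarrow> box L n (mv a b c Z)"
  unfolding box_def mem_mv by auto

lemma gdn_eq: "dn (Z a) (Z b) c \<Longrightarrow> gdn a b Z = mv a b c Z"
  unfolding gdn_def using dn_unique by (metis the_equality)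

lemma gup_eq: "up (Z a) (Z b) c \<Longrightarrow> gup a b Z = mv b a c Z"
  unfolding gup_def using up_unique by (metis the_equality)

lemma geps_pos: "mat Z \<Longrightarrow> 0 < geps a b Z \<longleftrightarrow> (\<exists>c. dn (Z a) (Z b) c)"
  unfolding geps_def dn_ex_iff using finite_uo[of "Z a" "Z b", OF mat_fin1[of Z a]] by (simp add: card_gt_0_iff)

lemma gphi_pos: "mat Z \<Longrightarrow> 0 < gphi a b Z \<longleftrightarrow> (\<exists>c. up (Z a) (Z b) c)"
  unfolding gphi_def using up_ex_iff[of "Z b" "Z a", OF mat_fin1[of Z b]] finite_uc[of "Z b" "Z a", OF mat_fin1[of Z b]]
  by (simp add: card_gt_0_iff)

lemma gdn_id: "mat Z \<Longrightarrow> geps a b Z = 0 \<Longrightarrow> gdn a b Z = Z"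
  unfolding gdn_def using geps_pos[of Z a b] by auto

lemma gup_id: "mat Z \<Longrightarrow> gphi a b Z = 0 \<Longrightarrow> gup a b Z = Z"
  unfolding gup_def using gphi_pos[of Z a b] by auto

lemma box_gdn: "box L n Z \<Longrightarrow> 1 \<le> b \<Longrightarrow> b \<le> L \<Longrightarrow> box L n (gdn a b Z)"
  using gdn_eq[of Z a b] box_mv[of L n Z _ a b] dn_mem[of "Z a" "Z b"] gdn_def by metis

lemma box_gup: "box L n Z \<Longrightarrow> 1 \<le> a \<Longrightarrow> a \<le> L \<Longrightarrow> box L n (gup a b Z)"
  using gup_eq[of Z a b] box_mv[of L n Z _ b a] up_mem[of "Z a" "Z b"] gup_def by metis

lemma mat_gdn: "mat Z \<Longrightarrow> 1 \<le> b \<Longrightarrow> mat (gdn a b Z)"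
proof -
  assume "mat Z" and b: "1 \<le> b"
  then obtain L n where "box L n Z" by (auto simp: mat_def)
  then have "box (max L b) n Z" by (rule box_mono) auto
  then show ?thesis using box_gdn[of "max L b" n Z b a] b by (auto simp: mat_def)
qed

lemma mat_gup: "mat Z \<Longrightarrow> 1 \<le> a \<Longrightarrow> mat (gup a b Z)"
proof -
  assume "mat Z" and b: "1 \<le> a"
  then obtain L n where "box L n Z" by (auto simp: mat_def)
  then have "box (max L a) n Z" by (rule box_mono) auto
  then show ?thesis using box_gup[of "max L a" n Z a b] b by (auto simp: mat_def)
qed

lemma gdn_rows:
  assumes "dn (Z a) (Z b) c" "a \<noteq> b"
  shows "gdn a b Z a = Z a - {c}" "gdn a b Z b = insert c (Z b)"
  unfolding gdn_eq[OF assms(1)] mv_def using assms(2) by auto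

lemma gup_rows:
  assumes "up (Z a) (Z b) c" "a \<noteq> b"
  shows "gup a b Z a = insert c (Z a)" "gup a b Z b = Z b - {c}"
  unfolding gup_eq[OF assms(1)] mv_def using assms(2) by auto

lemma gdn_other: "r \<noteq> a \<Longrightarrow> r \<noteq> b \<Longrightarrow> gdn a b Z r = Z r"
  by (auto simp: gdn_def mv_def)

lemma gup_other: "r \<noteq> a \<Longrightarrow> r \<noteq> b \<Longrightarrow> gup a b Z r = Z r"
  by (auto simp: gup_def mv_def)

lemma gup_gdn: assumes "mat Z" "a \<noteq> b" "0 < geps a b Z" shows "gup a b (gdn a b Z) = Z"
proof -
  obtain c where c: "dn (Z a) (Z b) c" using geps_pos assms by blast
  have "up (gdn a b Z a) (gdn a b Z b) c"
    unfolding gdn_rows[OF c assms(2)] by (rule dn_imp_up[OF c])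
  then show ?thesis unfolding gup_eq[OF \<open>up (gdn a b Z a) (gdn a b Z b) c\<close>]
    unfolding gdn_eq[OF c] using dn_mem[OF c] assms(2)
    by (intro ext set_eqI) (auto simp: mem_mv)
qed

lemma gdn_gup: assumes "mat Z" "a \<noteq> b" "0 < gphi a b Z" shows "gdn a b (gup a b Z) = Z"
proof -
  obtain c where c: "up (Z a) (Z b) c" using gphi_pos assms by blast
  have d: "dn (gup a b Z a) (gup a b Z b) c"
    unfolding gup_rows[OF c assms(2)] by (rule up_imp_dn[OF c])
  show ?thesis unfolding gdn_eq[OF d]
    unfolding gup_eq[OF c] using up_mem[OF c] assms(2)
    by (intro ext set_eqI) (auto simp: mem_mv)
qed

lemma gdn_counts: assumes "mat Z" "a \<noteq> b" "0 < geps a b Z"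
  shows "Suc (geps a b (gdn a b Z)) = geps a b Z" "gphi a b (gdn a b Z) = Suc (gphi a b Z)"
    "Suc (card (gdn a b Z a)) = card (Z a)" "card (gdn a b Z b) = Suc (card (Z b))"
proof -
  obtain c where c: "dn (Z a) (Z b) c" using geps_pos assms by blast
  have m: "c \<in> Z a" "c \<notin> Z b" using dn_mem[OF c] by auto
  have 1: "c \<in> uo (Z a) (Z b)" using dn_in_uo[OF c] .
  have 2: "c \<notin> uc (Z a) (Z b)" using m uc_subset[of "Z a" "Z b"] by auto
  note f = finite_uo[of "Z a" "Z b", OF mat_fin1[OF assms(1)]] finite_uc[of "Z b" "Z a", OF mat_fin1[OF assms(1)]]
    mat_finite[OF assms(1)]
  show "Suc (geps a b (gdn a b Z)) = geps a b Z" "gphi a b (gdn a b Z) = Suc (gphi a b Z)"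
    unfolding geps_def gphi_def gdn_rows[OF c assms(2)] uo_dn[OF c] uc_dn[OF c]
    using 1 2 f card.remove[OF f(1) 1] by auto
  show "Suc (card (gdn a b Z a)) = card (Z a)" "card (gdn a b Z b) = Suc (card (Z b))"
    unfolding gdn_rows[OF c assms(2)] using m f(3) card.remove[OF f(3) m(1)] by auto
qed

lemma gup_counts: assumes "mat Z" "a \<noteq> b" "1 \<le> a" "0 < gphi a b Z"
  shows "geps a b (gup a b Z) = Suc (geps a b Z)" "Suc (gphi a b (gup a b Z)) = gphi a b Z"
    "card (gup a b Z a) = Suc (card (Z a))" "Suc (card (gup a b Z b)) = card (Z b)"
proof -
  obtain c where c: "up (Z a) (Z b) c" using gphi_pos assms by blast
  have m: "c \<notin> Z a" "c \<in> Z b" using up_mem[OF c] by auto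
  have 1: "c \<in> uc (Z a) (Z b)" using up_in_uc[OF c] .
  have 2: "c \<notin> uo (Z a) (Z b)" using m uo_subset[of "Z a" "Z b"] by auto
  note f = finite_uo[of "Z a" "Z b", OF mat_fin1[OF assms(1)]] finite_uc[of "Z b" "Z a", OF mat_fin1[OF assms(1)]]
    mat_finite[OF assms(1)]
  show "geps a b (gup a b Z) = Suc (geps a b Z)" "Suc (gphi a b (gup a b Z)) = gphi a b Z"
    unfolding geps_def gphi_def gup_rows[OF c assms(2)] uo_uc_up[OF c]
    using 1 2 f card.remove[OF f(2) 1] by auto
  show "card (gup a b Z a) = Suc (card (Z a))" "Suc (card (gup a b Z b)) = card (Z b)"
    unfolding gup_rows[OF c assms(2)] using m f(3) card.remove[OF f(3) m(2)] by auto
qed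

lemma geps_gphi: "mat Z \<Longrightarrow> int (geps a b Z) - int (gphi a b Z) = int (card (Z a)) - int (card (Z b))"
  unfolding geps_def gphi_def by (rule card_uo_uc) (auto intro: mat_fin1)

section \<open>Row operators, and column operators as their transposes\<close>

definition rdn :: "nat \<Rightarrow> mlq \<Rightarrow> mlq" where "rdn j X = gdn (Suc j) j X"
definition rup :: "nat \<Rightarrow> mlq \<Rightarrow> mlq" where "rup j X = gup (Suc j) j X"
text \<open>In the transposed array column \<open>i\<close> opens and column \<open>i + 1\<close>
  closes, with rows read upwards. The ball that moves therefore goes one column to the left.\<close>

definition cup :: "nat \<Rightarrow> mlq \<Rightarrow> mlq" where "cup i X = tr (gup i (Suc i) (tr X))"
definition cdn :: "nat \<Rightarrow> mlq \<Rightarrow> mlq" where "cdn i X = tr (gdn i (Suc i) (tr X))"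
definition eps :: "nat \<Rightarrow> mlq \<Rightarrow> nat" where "eps j X = geps (Suc j) j X"
definition phi :: "nat \<Rightarrow> mlq \<Rightarrow> nat" where "phi j X = gphi (Suc j) j X"
definition ceps :: "nat \<Rightarrow> mlq \<Rightarrow> nat" where "ceps i X = geps i (Suc i) (tr X)"
definition cphi :: "nat \<Rightarrow> mlq \<Rightarrow> nat" where "cphi i X = gphi i (Suc i) (tr X)"

lemma mem_cmv: "x \<in> tr (mv a b R (tr X)) r \<longleftrightarrow>
    (if r = R \<and> x = b then True else if r = R \<and> x = a then False else x \<in> X r)"
  by (auto simp: mem_mv)

text \<open>This is why the two structures interact so little: a move to the adjacent column alters
  the prefix counts of its row at the single place \<open>i\<close>.\<close>

lemma card_shift:
  assumes "Suc i \<in> S" "i \<notin> S" "1 \<le> i"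
  shows "card (insert i (S - {Suc i}) \<inter> {1..q}) = card (S \<inter> {1..q}) + (if q = i then 1 else 0)"
proof -
  consider "q < i" | "q = i" | "q \<ge> Suc i" by linarith
  then show ?thesis
  proof cases
    case 1
    then have "insert i (S - {Suc i}) \<inter> {1..q} = S \<inter> {1..q}" by auto
    then show ?thesis using 1 by simp
  next
    case 2
    then have "insert i (S - {Suc i}) \<inter> {1..q} = insert i (S \<inter> {1..q})" using assms by auto
    then show ?thesis using 2 assms by simp
  next
    case 3
    have e: "insert i (S - {Suc i}) \<inter> {1..q} = insert i ((S \<inter> {1..q}) - {Suc i})" using 3 assms by auto
    have "Suc i \<in> S \<inter> {1..q}" using 3 assms by auto
    then have "card (S \<inter> {1..q}) = Suc (card ((S \<inter> {1..q}) - {Suc i}))"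
      by (intro card.remove) auto
    then show ?thesis unfolding e using 3 assms by simp
  qed
qed

lemma card_shift': "Suc i \<in> S \<Longrightarrow> i \<notin> S \<Longrightarrow> finite S \<Longrightarrow> card (insert i (S - {Suc i})) = card S"
  using card.remove[of S "Suc i"] by simp

lemma cmv_hgt:
  assumes "up (tr X i) (tr X (Suc i)) R" "1 \<le> i"
  shows "hgt (tr (mv (Suc i) i R (tr X)) (Suc j)) (tr (mv (Suc i) i R (tr X)) j) q =
    hgt (X (Suc j)) (X j) q + (if q = i then of_bool (R = Suc j) - of_bool (R = j) else 0)"
proof -
  have m: "Suc i \<in> X R" "i \<notin> X R" using up_mem[OF assms(1)] by auto
  have 1: "tr (mv (Suc i) i R (tr X)) r = (if r = R then insert i (X R - {Suc i}) else X r)" for r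
    using assms(2) by (rule_tac set_eqI, unfold mem_cmv) auto
  show ?thesis unfolding hgt_def 1 using card_shift[OF m assms(2), of q] by auto
qed

lemma rmv_hgt:
  assumes "dn (X (Suc j)) (X j) c" "1 \<le> j"
  shows "hgt (tr (mv (Suc j) j c X) i) (tr (mv (Suc j) j c X) (Suc i)) q =
    hgt (tr X i) (tr X (Suc i)) q + (if q = j then of_bool (c = i) - of_bool (c = Suc i) else 0)"
proof -
  have m: "Suc j \<in> tr X c" "j \<notin> tr X c" using dn_mem[OF assms(1)] by auto
  have 1: "tr (mv (Suc j) j c X) r = (if r = c then insert j (tr X c - {Suc j}) else tr X r)" for r
    using assms(2) by (intro set_eqI) (auto simp: mem_mv)
  show ?thesis unfolding hgt_def 1 using card_shift[OF m assms(2), of q] by auto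
qed

section \<open>Rows \<open>j\<close>, \<open>j + 1\<close> against columns \<open>i\<close>,
  \<open>i + 1\<close>: the 2 by 2 block where the moves can meet\<close>

context
  fixes X :: mlq and i j :: nat
  assumes i1: "1 \<le> i" and j1: "1 \<le> j"
begin

definition "blk r c = (of_bool (c \<in> X r) :: int)"

lemma block_hgt:
  "hgt (X (Suc j)) (X j) i = hgt (X (Suc j)) (X j) (i - 1) + blk (Suc j) i - blk j i"
  "hgt (X (Suc j)) (X j) (Suc i) = hgt (X (Suc j)) (X j) i + blk (Suc j) (Suc i) - blk j (Suc i)"
  "hgt (tr X i) (tr X (Suc i)) j = hgt (tr X i) (tr X (Suc i)) (j - 1) + blk j i - blk j (Suc i)"
  "hgt (tr X i) (tr X (Suc i)) (Suc j) = hgt (tr X i) (tr X (Suc i)) j + blk (Suc j) i - blk (Suc j) (Suc i)"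
  using hgt_step[OF i1, of "X (Suc j)" "X j"] hgt_step[OF j1, of "tr X i" "tr X (Suc i)"]
    hgt_Suc[of "X (Suc j)" "X j" i] hgt_Suc[of "tr X i" "tr X (Suc i)" j] by (auto simp: blk_def)

lemma blk01: "blk r c = 0 \<or> blk r c = 1" by (auto simp: blk_def)

text \<open>The row path changes at most at column \<open>i\<close>. If it drops there, its new
  value already occurs at a neighbouring column; if it grows, its old value still occurs at one. The
  inequality needed in the block comes from \<open>R\<close> being the first minimum of the column
  path.\<close>

lemma cmv_min:
  assumes R: "up (tr X i) (tr X (Suc i)) R"
  defines "X' \<equiv> tr (mv (Suc i) i R (tr X))"
  shows "(\<forall>q. v \<le> hgt (X' (Suc j)) (X' j) q) \<longleftrightarrow> (\<forall>q. v \<le> hgt (X (Suc j)) (X j) q)"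
proof -
  let ?h = "hgt (X (Suc j)) (X j)" and ?k = "hgt (tr X i) (tr X (Suc i))"
  let ?h' = "hgt (X' (Suc j)) (X' j)"
  have h': "?h' q = ?h q + (if q = i then of_bool (R = Suc j) - of_bool (R = j) else 0)" for q
    unfolding X'_def by (rule cmv_hgt[OF R i1])
  have m: "Suc i \<in> X R" "i \<notin> X R" using up_mem[OF R] by auto
  have lt: "\<And>q. q < R \<Longrightarrow> ?k R < ?k q" and ge: "\<And>q. q \<ge> R \<Longrightarrow> ?k R \<le> ?k q"
    using R by (auto simp: up_def)
  note bh = block_hgt
  consider "R = j" | "R = Suc j" | "R \<noteq> j" "R \<noteq> Suc j" by blast
  then show ?thesis
  proof cases
    case 1
    have b: "blk j (Suc i) = 1" "blk j i = 0" using m 1 by (auto simp: blk_def)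
    have "?k j \<le> ?k (Suc j)" using ge[of "Suc j"] 1 by auto
    then have dc: "blk (Suc j) (Suc i) \<le> blk (Suc j) i" using bh by linarith
    have eq: "?h' i = ?h i - 1" using h' 1 by auto
    have "?h' i = ?h (i - 1) \<or> ?h' i = ?h (Suc i)"
      using bh b dc blk01[of "Suc j" i] blk01[of "Suc j" "Suc i"] eq by linarith
    then show ?thesis using h' 1 i1
      by (smt (verit) Suc_n_not_le_n diff_less n_not_Suc_n zero_less_one of_bool_eq)
  next
    case 2
    have b: "blk (Suc j) (Suc i) = 1" "blk (Suc j) i = 0" using m 2 by (auto simp: blk_def)
    have "?k (Suc j) < ?k (j - 1)" using lt[of "j - 1"] 2 by auto
    then have dc: "blk j i \<le> blk j (Suc i)" using bh b by linarith
    have eq: "?h' i = ?h i + 1" using h' 2 by auto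
    have n: "?h' (i - 1) = ?h (i - 1)" "?h' (Suc i) = ?h (Suc i)" using h' i1 by auto
    have "?h i = ?h' (i - 1) \<or> ?h i = ?h' (Suc i)"
      using bh b dc blk01[of j i] blk01[of j "Suc i"] n by linarith
    then show ?thesis using h' eq by (smt (verit))
  next
    case 3
    then have "?h' q = ?h q" for q using h'[of q] by auto
    then show ?thesis by simp
  qed
qed

text \<open>The transposed situation: now the inequality in the block comes from
  \<open>c - 1\<close> being the last minimum of the row path.\<close>

lemma rmv_min:
  assumes c: "dn (X (Suc j)) (X j) c"
  defines "X' \<equiv> mv (Suc j) j c X"
  shows "(\<forall>q. v \<le> hgt (tr X' i) (tr X' (Suc i)) q) \<longleftrightarrow> (\<forall>q. v \<le> hgt (tr X i) (tr X (Suc i)) q)"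
proof -
  let ?h = "hgt (X (Suc j)) (X j)" and ?k = "hgt (tr X i) (tr X (Suc i))"
  let ?k' = "hgt (tr X' i) (tr X' (Suc i))"
  have k': "?k' q = ?k q + (if q = j then of_bool (c = i) - of_bool (c = Suc i) else 0)" for q
    unfolding X'_def by (rule rmv_hgt[OF c j1])
  have m: "c \<in> X (Suc j)" "c \<notin> X j" using dn_mem[OF c] by auto
  have lt: "\<And>q. q < c \<Longrightarrow> ?h (c - 1) \<le> ?h q" and ge: "\<And>q. q \<ge> c \<Longrightarrow> ?h (c - 1) < ?h q"
    using c by (auto simp: dn_def)
  note bh = block_hgt
  have n: "?k' (j - 1) = ?k (j - 1)" "?k' (Suc j) = ?k (Suc j)" using k' j1 by auto
  consider "c = i" | "c = Suc i" | "c \<noteq> i" "c \<noteq> Suc i" by blast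
  then show ?thesis
  proof cases
    case 1
    have b: "blk (Suc j) i = 1" "blk j i = 0" using m 1 by (auto simp: blk_def)
    have "?h (i - 1) < ?h (Suc i)" using ge[of "Suc i"] 1 by auto
    then have dc: "blk j (Suc i) \<le> blk (Suc j) (Suc i)" using bh b by linarith
    have eq: "?k' j = ?k j + 1" using k' 1 by auto
    have "?k j = ?k' (j - 1) \<or> ?k j = ?k' (Suc j)"
      using bh b dc blk01[of j "Suc i"] blk01[of "Suc j" "Suc i"] n by linarith
    then show ?thesis using k' eq by (smt (verit))
  next
    case 2
    have b: "blk (Suc j) (Suc i) = 1" "blk j (Suc i) = 0" using m 2 by (auto simp: blk_def)
    have "?h i \<le> ?h (i - 1)" using lt[of "i - 1"] 2 by auto
    then have dc: "blk (Suc j) i \<le> blk j i" using bh b by linarith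
    have eq: "?k' j = ?k j - 1" using k' 2 by auto
    have "?k' j = ?k (j - 1) \<or> ?k' j = ?k (Suc j)"
      using bh b dc blk01[of j i] blk01[of "Suc j" i] eq by linarith
    then show ?thesis using k' eq by (smt (verit))
  next
    case 3
    then have "?k' q = ?k q" for q using k'[of q] by auto
    then show ?thesis by simp
  qed
qed

text \<open>Unless both moves involve the common block, each keeps its place after the other. When
  they meet, the two extremal choices determine all four sites of the block, and the second move
  shifts to the parallel side of it.\<close>

lemma square:
  assumes c: "dn (X (Suc j)) (X j) c" and R: "up (tr X i) (tr X (Suc i)) R"
  shows "rdn j (cup i X) = cup i (rdn j X)"
proof -
  let ?h = "hgt (X (Suc j)) (X j)" and ?k = "hgt (tr X i) (tr X (Suc i))"
  define Xc where "Xc = tr (mv (Suc i) i R (tr X))"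
  define Xr where "Xr = mv (Suc j) j c X"
  let ?h' = "hgt (Xc (Suc j)) (Xc j)"
  let ?k' = "hgt (tr Xr i) (tr Xr (Suc i))"
  have h': "?h' q = ?h q + (if q = i then of_bool (R = Suc j) - of_bool (R = j) else 0)" for q
    unfolding Xc_def by (rule cmv_hgt[OF R i1])
  have k': "?k' q = ?k q + (if q = j then of_bool (c = i) - of_bool (c = Suc i) else 0)" for q
    unfolding Xr_def by (rule rmv_hgt[OF c j1])
  have mR: "Suc i \<in> X R" "i \<notin> X R" using up_mem[OF R] by auto
  have mc: "c \<in> X (Suc j)" "c \<notin> X j" "1 \<le> c" using dn_mem[OF c] by auto
  have R1: "1 \<le> R" using up_mem[OF R] by auto
  have klt: "\<And>q. q < R \<Longrightarrow> ?k R < ?k q" and kge: "\<And>q. q \<ge> R \<Longrightarrow> ?k R \<le> ?k q"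
    using R by (auto simp: up_def)
  have hlt: "\<And>q. q < c \<Longrightarrow> ?h (c - 1) \<le> ?h q" and hge: "\<And>q. q \<ge> c \<Longrightarrow> ?h (c - 1) < ?h q"
    using c by (auto simp: dn_def)
  note bh = block_hgt
  have key: ?thesis if c': "dn (Xc (Suc j)) (Xc j) c'" and R': "up (tr Xr i) (tr Xr (Suc i)) R'"
    and e: "mv (Suc j) j c' Xc = tr (mv (Suc i) i R' (tr Xr))" for c' R'
  proof -
    have "cup i X = Xc" unfolding cup_def gup_eq[OF R] Xc_def ..
    moreover have "rdn j X = Xr" unfolding rdn_def gdn_eq[OF c] Xr_def ..
    ultimately show ?thesis unfolding cup_def rdn_def
      by (metis e gdn_eq[of Xc, OF c'] gup_eq[of "tr Xr", OF R'])
  qed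
  have "\<not> (c = i \<and> R = Suc j)" "\<not> (c = Suc i \<and> R = j)" using mc(1,2) mR by auto
  then consider "c = i" "R = j" | "c = Suc i" "R = Suc j" | "c \<noteq> i" "c \<noteq> Suc i" | "R \<noteq> j" "R \<noteq> Suc j"
    by blast
  then show ?thesis
  proof cases
    case 1
    \<comment> \<open>Of the block only the site in row \<open>j\<close> and column \<open>i\<close>
      is empty. After either move the other operator acts on the ball in row \<open>j + 1\<close>
      and column \<open>i + 1\<close>.\<close>
    have b: "blk j (Suc i) = 1" "blk j i = 0" "blk (Suc j) i = 1" using mR mc 1 by (auto simp: blk_def)
    have "?h (i - 1) < ?h (Suc i)" using hge[of "Suc i"] 1 by auto
    then have d: "blk (Suc j) (Suc i) = 1" using bh b blk01[of "Suc j" "Suc i"] by linarith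
    then have dm: "Suc i \<in> X (Suc j)" by (auto simp: blk_def split: if_splits)
    show ?thesis
    proof (rule key)
      have hi: "?h' i = ?h (i - 1)" using h' 1 bh b d by auto
      show "dn (Xc (Suc j)) (Xc j) (Suc i)" unfolding dn_def
      proof (intro conjI allI impI)
        fix q assume "q < Suc i" then show "?h' (Suc i - 1) \<le> ?h' q"
          using hi hlt[of q] h'[of q] 1 by (cases "q = i") auto
      next
        fix q assume "q \<ge> Suc i" then show "?h' (Suc i - 1) < ?h' q"
          using hi hge[of q] h'[of q] 1 by auto
      qed simp
      have kj: "?k' (Suc j) = ?k j" "?k' j = ?k j + 1" using k' 1 bh b d by auto
      show "up (tr Xr i) (tr Xr (Suc i)) (Suc j)" unfolding up_def
      proof (intro conjI allI impI)
        fix q assume "q < Suc j" then show "?k' (Suc j) < ?k' q"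
          using kj klt[of q] k'[of q] 1 by (cases "q = j") auto
      next
        fix q assume "q \<ge> Suc j" then show "?k' (Suc j) \<le> ?k' q"
          using kj kge[of q] k'[of q] 1 by auto
      qed simp
      show "mv (Suc j) j (Suc i) Xc = tr (mv (Suc i) i (Suc j) (tr Xr))"
      proof (intro ext set_eqI)
        fix r x show "x \<in> mv (Suc j) j (Suc i) Xc r \<longleftrightarrow> x \<in> tr (mv (Suc i) i (Suc j) (tr Xr)) r"
          unfolding Xc_def Xr_def mem_cmv mem_mv using 1 mR mc dm
          by (cases "x = i"; cases "x = Suc i"; cases "r = j"; cases "r = Suc j"; simp)
      qed
    qed
  next
    case 2
    \<comment> \<open>The block holds one ball, in row \<open>j + 1\<close> and column
      \<open>i + 1\<close>; it travels to the opposite corner along either pair of sides.\<close>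
    have b: "blk (Suc j) (Suc i) = 1" "blk j (Suc i) = 0" "blk (Suc j) i = 0" using mR mc 2 by (auto simp: blk_def)
    have "?k (Suc j) < ?k (j - 1)" using klt[of "j - 1"] 2 by auto
    then have a: "blk j i = 0" using bh b blk01[of j i] by linarith
    then have am: "i \<notin> X j" by (auto simp: blk_def)
    show ?thesis
    proof (rule key)
      have hi: "?h' i = ?h i + 1" "?h' (i - 1) = ?h i" using h' 2 bh b a i1 by auto
      show "dn (Xc (Suc j)) (Xc j) i" unfolding dn_def
      proof (intro conjI allI impI)
        fix q assume "q < i" then show "?h' (i - 1) \<le> ?h' q"
          using hi hlt[of q] h'[of q] 2 by auto
      next
        fix q assume "q \<ge> i" then show "?h' (i - 1) < ?h' q"
          using hi hge[of q] h'[of q] 2 by (cases "q = i") auto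
      qed (rule i1)
      have kj: "?k' j = ?k (Suc j)" using k' 2 bh b a by auto
      show "up (tr Xr i) (tr Xr (Suc i)) j" unfolding up_def
      proof (intro conjI allI impI)
        fix q assume "q < j" then show "?k' j < ?k' q"
          using kj klt[of q] k'[of q] 2 by auto
      next
        fix q assume "q \<ge> j" then show "?k' j \<le> ?k' q"
          using kj kge[of q] k'[of q] 2 by (cases "q = j") auto
      qed (rule j1)
      show "mv (Suc j) j i Xc = tr (mv (Suc i) i j (tr Xr))"
      proof (intro ext set_eqI)
        fix r x show "x \<in> mv (Suc j) j i Xc r \<longleftrightarrow> x \<in> tr (mv (Suc i) i j (tr Xr)) r"
          unfolding Xc_def Xr_def mem_cmv mem_mv using 2 mR mc am
          by (cases "x = i"; cases "x = Suc i"; cases "r = j"; cases "r = Suc j"; simp)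
      qed
    qed
  next
    case 3
    \<comment> \<open>The only altered value of the row path either did not drop or equals an old
      value at a neighbour, so it cannot displace the last minimum at \<open>c - 1\<close>.\<close>
    have low: "?h' i = ?h (i - 1) \<or> ?h' i = ?h (Suc i) \<or> ?h' i \<ge> ?h i"
    proof (cases "R = j")
      case True
      have b: "blk j (Suc i) = 1" "blk j i = 0" using mR True by (auto simp: blk_def)
      have "?k j \<le> ?k (Suc j)" using kge[of "Suc j"] True by auto
      then have dc: "blk (Suc j) (Suc i) \<le> blk (Suc j) i" using bh by linarith
      have "?h' i = ?h i - 1" using h' True by auto
      then show ?thesis
        using bh b dc blk01[of "Suc j" i] blk01[of "Suc j" "Suc i"] by linarith
    next
      case False then show ?thesis using h'[of i] by auto
    qed
    have c1: "?h' (c - 1) = ?h (c - 1)" using h' 3 mc(3) by auto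
    show ?thesis
    proof (rule key)
      show "dn (Xc (Suc j)) (Xc j) c" unfolding dn_def c1
      proof (intro conjI allI impI)
        fix q assume q: "q < c"
        show "?h (c - 1) \<le> ?h' q"
        proof (cases "q = i")
          case True
          then have "Suc i < c" using q 3 by auto
          then show ?thesis using True low hlt[of "i - 1"] hlt[of "Suc i"] hlt[of i] by fastforce
        next
          case False then show ?thesis using h'[of q] hlt[of q] q by auto
        qed
      next
        fix q assume q: "q \<ge> c"
        show "?h (c - 1) < ?h' q"
        proof (cases "q = i")
          case True
          then have "c \<le> i - 1" using q 3 by auto
          then show ?thesis using True low hge[of "i - 1"] hge[of "Suc i"] hge[of i] by fastforce
        next
          case False then show ?thesis using h'[of q] hge[of q] q by auto
        qed
      qed (rule mc(3))
      have "?k' q = ?k q" for q using k'[of q] 3 by auto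
      then show "up (tr Xr i) (tr Xr (Suc i)) R" unfolding up_def using R by (simp add: up_def)
      show "mv (Suc j) j c Xc = tr (mv (Suc i) i R (tr Xr))"
      proof (intro ext set_eqI)
        fix r x show "x \<in> mv (Suc j) j c Xc r \<longleftrightarrow> x \<in> tr (mv (Suc i) i R (tr Xr)) r"
          unfolding Xc_def Xr_def mem_cmv mem_mv using 3
          by (cases "x = i"; cases "x = Suc i"; cases "r = j"; cases "r = Suc j"; simp)
      qed
    qed
  next
    case 4
    have low: "?k' j = ?k (j - 1) \<or> ?k' j = ?k (Suc j) \<or> ?k' j \<ge> ?k j"
    proof (cases "c = Suc i")
      case True
      have b: "blk (Suc j) (Suc i) = 1" "blk j (Suc i) = 0" using mc True by (auto simp: blk_def)
      have "?h i \<le> ?h (i - 1)" using hlt[of "i - 1"] True by auto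
      then have dc: "blk (Suc j) i \<le> blk j i" using bh b by linarith
      have "?k' j = ?k j - 1" using k' True by auto
      then show ?thesis
        using bh b dc blk01[of j i] blk01[of "Suc j" i] by linarith
    next
      case False then show ?thesis using k'[of j] by auto
    qed
    have R2: "?k' R = ?k R" using k' 4 by auto
    show ?thesis
    proof (rule key)
      show "up (tr Xr i) (tr Xr (Suc i)) R" unfolding up_def R2
      proof (intro conjI allI impI)
        fix q assume q: "q < R"
        show "?k R < ?k' q"
        proof (cases "q = j")
          case True
          then have "Suc j < R" using q 4 by auto
          then show ?thesis using True low klt[of "j - 1"] klt[of "Suc j"] klt[of j] by fastforce
        next
          case False then show ?thesis using k'[of q] klt[of q] q by auto
        qed
      next
        fix q assume q: "q \<ge> R"
        show "?k R \<le> ?k' q"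
        proof (cases "q = j")
          case True
          then have "R \<le> j - 1" using q 4 by auto
          then show ?thesis using True low kge[of "j - 1"] kge[of "Suc j"] kge[of j] by fastforce
        next
          case False then show ?thesis using k'[of q] kge[of q] q by auto
        qed
      qed (rule R1)
      have "?h' q = ?h q" for q using h'[of q] 4 by auto
      then show "dn (Xc (Suc j)) (Xc j) c" unfolding dn_def using c by (simp add: dn_def)
      show "mv (Suc j) j c Xc = tr (mv (Suc i) i R (tr Xr))"
      proof (intro ext set_eqI)
        fix r x show "x \<in> mv (Suc j) j c Xc r \<longleftrightarrow> x \<in> tr (mv (Suc i) i R (tr Xr)) r"
          unfolding Xc_def Xr_def mem_cmv mem_mv using 4
          by (cases "x = i"; cases "x = Suc i"; cases "r = j"; cases "r = Suc j"; simp)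
      qed
    qed
  qed
qed

end

section \<open>Components of the column crystal\<close>

lemma mat_cup: "mat X \<Longrightarrow> 1 \<le> i \<Longrightarrow> mat (cup i X)"
  unfolding cup_def by (simp add: mat_gup)
lemma mat_cdn: "mat X \<Longrightarrow> mat (cdn i X)"
  unfolding cdn_def by (simp add: mat_gdn)
lemma mat_rdn: "mat X \<Longrightarrow> 1 \<le> j \<Longrightarrow> mat (rdn j X)"
  unfolding rdn_def by (rule mat_gdn)
lemma mat_rup: "mat X \<Longrightarrow> mat (rup j X)"
  unfolding rup_def by (rule mat_gup) auto

lemma cup_id: "mat X \<Longrightarrow> cphi i X = 0 \<Longrightarrow> cup i X = X"
  unfolding cup_def cphi_def by (simp add: gup_id)
lemma cdn_id: "mat X \<Longrightarrow> ceps i X = 0 \<Longrightarrow> cdn i X = X"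
  unfolding cdn_def ceps_def by (simp add: gdn_id)
lemma rdn_id: "mat X \<Longrightarrow> eps j X = 0 \<Longrightarrow> rdn j X = X"
  unfolding rdn_def eps_def by (simp add: gdn_id)
lemma rup_id: "mat X \<Longrightarrow> phi j X = 0 \<Longrightarrow> rup j X = X"
  unfolding rup_def phi_def by (simp add: gup_id)

lemma rdn_counts:
  assumes "mat X" "0 < eps j X"
  shows "Suc (eps j (rdn j X)) = eps j X" "phi j (rdn j X) = Suc (phi j X)"
    "Suc (card (rdn j X (Suc j))) = card (X (Suc j))" "card (rdn j X j) = Suc (card (X j))"
    "rup j (rdn j X) = X"
  using gdn_counts[of X "Suc j" j] gup_gdn[of X "Suc j" j] assms
  unfolding rdn_def rup_def eps_def phi_def by auto

lemma rup_counts: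
  assumes "mat X" "0 < phi j X"
  shows "eps j (rup j X) = Suc (eps j X)" "Suc (phi j (rup j X)) = phi j X"
    "card (rup j X (Suc j)) = Suc (card (X (Suc j)))" "Suc (card (rup j X j)) = card (X j)"
    "rdn j (rup j X) = X"
  using gup_counts[of X "Suc j" j] gdn_gup[of X "Suc j" j] assms
  unfolding rdn_def rup_def eps_def phi_def by auto

lemma cup_counts:
  assumes "mat X" "1 \<le> i" "0 < cphi i X"
  shows "ceps i (cup i X) = Suc (ceps i X)" "Suc (cphi i (cup i X)) = cphi i X" "cdn i (cup i X) = X"
  using gup_counts[of "tr X" i "Suc i"] gdn_gup[of "tr X" i "Suc i"] assms
  unfolding cdn_def cup_def ceps_def cphi_def by auto

lemma cdn_counts:
  assumes "mat X" "0 < ceps i X"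
  shows "Suc (ceps i (cdn i X)) = ceps i X" "cphi i (cdn i X) = Suc (cphi i X)" "cup i (cdn i X) = X"
  using gdn_counts[of "tr X" i "Suc i"] gup_gdn[of "tr X" i "Suc i"] assms
  unfolding cdn_def cup_def ceps_def cphi_def by auto

lemma eps_phi: "mat X \<Longrightarrow> int (eps j X) - int (phi j X) = int (card (X (Suc j))) - int (card (X j))"
  unfolding eps_def phi_def by (rule geps_gphi)

lemma ceps_cphi: "mat X \<Longrightarrow> int (ceps i X) - int (cphi i X) = int (card (tr X i)) - int (card (tr X (Suc i)))"
  unfolding ceps_def cphi_def by (rule geps_gphi) simp

lemma rdn_other: "r \<noteq> j \<Longrightarrow> r \<noteq> Suc j \<Longrightarrow> rdn j X r = X r"
  unfolding rdn_def by (simp add: gdn_other)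
lemma rup_other: "r \<noteq> j \<Longrightarrow> r \<noteq> Suc j \<Longrightarrow> rup j X r = X r"
  unfolding rup_def by (simp add: gup_other)

lemma card_row_cup: assumes "mat X" "1 \<le> i" shows "card (cup i X r) = card (X r)"
proof (cases "0 < cphi i X")
  case True
  then obtain R where R: "up (tr X i) (tr X (Suc i)) R" unfolding cphi_def
    using gphi_pos[of "tr X"] assms by auto
  have m: "Suc i \<in> X R" "i \<notin> X R" using up_mem[OF R] by auto
  have 1: "cup i X r = (if r = R then insert i (X R - {Suc i}) else X r)" for r
    unfolding cup_def gup_eq[OF R] using assms(2) by (rule_tac set_eqI, unfold mem_cmv) auto
  show ?thesis unfolding 1 using card_shift'[OF m mat_finite[OF assms(1)]] by auto
next
  case False then show ?thesis using cup_id assms by simp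
qed

lemma card_col_rdn: assumes "mat X" "1 \<le> j" shows "card (tr (rdn j X) c) = card (tr X c)"
proof (cases "0 < eps j X")
  case True
  then obtain d where d: "dn (X (Suc j)) (X j) d" unfolding eps_def
    using geps_pos[of X] assms by auto
  have m: "Suc j \<in> tr X d" "j \<notin> tr X d" using dn_mem[OF d] by auto
  have 1: "tr (rdn j X) c = (if c = d then insert j (tr X d - {Suc j}) else tr X c)"
    unfolding rdn_def gdn_eq[OF d] using assms(2) by (intro set_eqI) (auto simp: mem_mv)
  have "finite (tr X d)" using mat_finite[of "tr X"] assms by simp
  then show ?thesis unfolding 1 using card_shift'[OF m] by auto
next
  case False then show ?thesis using rdn_id assms by simp
qed

lemma phi_eps_cup: assumes "mat X" "1 \<le> i" "1 \<le> j"
  shows "phi j (cup i X) = phi j X" "eps j (cup i X) = eps j X"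
proof -
  show 1: "phi j (cup i X) = phi j X"
  proof (cases "0 < cphi i X")
    case True
    then obtain R where R: "up (tr X i) (tr X (Suc i)) R" unfolding cphi_def
      using gphi_pos[of "tr X"] assms by auto
    have c: "cup i X = tr (mv (Suc i) i R (tr X))" unfolding cup_def gup_eq[OF R] ..
    have f: "fin1 (X j)" "fin1 (cup i X j)" using mat_fin1 mat_cup assms by auto
    have "v \<le> - int (phi j (cup i X)) \<longleftrightarrow> v \<le> - int (phi j X)" for v
      unfolding phi_def gphi_def card_uc_min[OF f(1)] card_uc_min[OF f(2)]
      unfolding c by (rule cmv_min[OF assms(2,3) R])
    from this[of "- int (phi j X)"] this[of "- int (phi j (cup i X))"] show ?thesis by simp
  next
    case False then show ?thesis using cup_id assms by simp
  qed
  show "eps j (cup i X) = eps j X"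
    using eps_phi[of X j] eps_phi[of "cup i X" j] 1 card_row_cup[OF assms(1,2)] mat_cup[OF assms(1,2)] assms(1)
    by simp
qed

lemma cphi_ceps_rdn: assumes "mat X" "1 \<le> i" "1 \<le> j"
  shows "cphi i (rdn j X) = cphi i X" "ceps i (rdn j X) = ceps i X"
proof -
  show 1: "cphi i (rdn j X) = cphi i X"
  proof (cases "0 < eps j X")
    case True
    then obtain d where d: "dn (X (Suc j)) (X j) d" unfolding eps_def
      using geps_pos[of X] assms by auto
    have c: "rdn j X = mv (Suc j) j d X" unfolding rdn_def gdn_eq[OF d] ..
    have f: "fin1 (tr X (Suc i))" "fin1 (tr (rdn j X) (Suc i))"
      using mat_fin1[of "tr X"] mat_fin1[of "tr (rdn j X)"] mat_rdn assms by auto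
    have "v \<le> - int (cphi i (rdn j X)) \<longleftrightarrow> v \<le> - int (cphi i X)" for v
      unfolding cphi_def gphi_def card_uc_min[OF f(1)] card_uc_min[OF f(2)]
      unfolding c by (rule rmv_min[OF assms(2,3) d])
    from this[of "- int (cphi i X)"] this[of "- int (cphi i (rdn j X))"] show ?thesis by simp
  next
    case False then show ?thesis using rdn_id assms by simp
  qed
  show "ceps i (rdn j X) = ceps i X"
    using ceps_cphi[of X i] ceps_cphi[of "rdn j X" i] 1 card_col_rdn[OF assms(1,3)] mat_rdn[OF assms(1,3)] assms(1)
    by simp
qed

lemma rdn_cup: assumes "mat X" "1 \<le> i" "1 \<le> j" shows "rdn j (cup i X) = cup i (rdn j X)"
proof -
  consider "eps j X = 0" | "cphi i X = 0" | "0 < eps j X" "0 < cphi i X" by blast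
  then show ?thesis
  proof cases
    case 1
    then show ?thesis using rdn_id[of X j] rdn_id[of "cup i X" j] phi_eps_cup[OF assms] mat_cup assms by simp
  next
    case 2
    then show ?thesis using cup_id[of X i] cup_id[of "rdn j X" i] cphi_ceps_rdn[OF assms] mat_rdn assms by simp
  next
    case 3
    then show ?thesis using square[OF assms(2,3)] geps_pos[of X "Suc j" j] gphi_pos[of "tr X" i "Suc i"] assms(1)
      unfolding eps_def cphi_def by auto
  qed
qed

lemma cphi_ceps_rup: assumes "mat X" "1 \<le> i" "1 \<le> j"
  shows "cphi i (rup j X) = cphi i X" "ceps i (rup j X) = ceps i X"
proof -
  have "cphi i (rup j X) = cphi i X \<and> ceps i (rup j X) = ceps i X"
  proof (cases "0 < phi j X")
    case True
    then show ?thesis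
      using cphi_ceps_rdn[OF mat_rup[OF assms(1), of j] assms(2,3)] rup_counts(5)[OF assms(1) True] by simp
  next
    case False then show ?thesis using rup_id assms by simp
  qed
  then show "cphi i (rup j X) = cphi i X" "ceps i (rup j X) = ceps i X" by auto
qed

text \<open>Write \<open>X\<close> as \<open>rdn j Y\<close> and cancel the inverse operators; the
  move at \<open>cup i Y\<close> is not trivial because \<open>eps\<close> is preserved.\<close>

lemma rup_cup: assumes "mat X" "1 \<le> i" "1 \<le> j" shows "rup j (cup i X) = cup i (rup j X)"
proof (cases "0 < phi j X")
  case True
  define Y where "Y = rup j X"
  have mY: "mat Y" unfolding Y_def using mat_rup assms by blast
  have XY: "X = rdn j Y" unfolding Y_def using rup_counts(5)[OF assms(1) True] by simp
  have "0 < eps j (cup i Y)"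
    using phi_eps_cup[OF mY assms(2,3)] rup_counts(1)[OF assms(1) True] unfolding Y_def by simp
  then have "rup j (rdn j (cup i Y)) = cup i Y" using rdn_counts(5) mat_cup mY assms by blast
  then show ?thesis unfolding Y_def[symmetric] unfolding XY rdn_cup[OF mY assms(2,3)] .
next
  case False
  then show ?thesis using rup_id[of X j] rup_id[of "cup i X" j] phi_eps_cup[OF assms] mat_cup assms by simp
qed

lemma phi_eps_cdn: assumes "mat X" "1 \<le> i" "1 \<le> j"
  shows "phi j (cdn i X) = phi j X" "eps j (cdn i X) = eps j X"
proof -
  have "phi j (cdn i X) = phi j X \<and> eps j (cdn i X) = eps j X"
  proof (cases "0 < ceps i X")
    case True
    then show ?thesis
      using phi_eps_cup[OF mat_cdn[OF assms(1), of i] assms(2,3)] cdn_counts(3)[OF assms(1) True] by simp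
  next
    case False then show ?thesis using cdn_id assms by simp
  qed
  then show "phi j (cdn i X) = phi j X" "eps j (cdn i X) = eps j X" by auto
qed

text \<open>Write \<open>X\<close> as \<open>cup i Z\<close>; preservation of both string lengths
  guarantees that the moves to be cancelled really act.\<close>

lemma cdn_commute:
  assumes "mat X" "1 \<le> i" "\<And>Y. mat Y \<Longrightarrow> mat (f Y)"
    and "\<And>Y. mat Y \<Longrightarrow> f (cup i Y) = cup i (f Y)"
    and "\<And>Y. mat Y \<Longrightarrow> ceps i (f Y) = ceps i Y" "\<And>Y. mat Y \<Longrightarrow> cphi i (f Y) = cphi i Y"
  shows "f (cdn i X) = cdn i (f X)"
proof (cases "0 < ceps i X")
  case True
  define Z where "Z = cdn i X"
  have mZ: "mat Z" and XZ: "X = cup i Z" "cphi i Z = Suc (cphi i X)"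
    using mat_cdn cdn_counts[OF assms(1) True] assms unfolding Z_def by auto
  have "0 < cphi i (f Z)" using assms(6)[OF mZ] XZ by simp
  then have "cdn i (cup i (f Z)) = f Z" using cup_counts(3) assms(2,3) mZ by blast
  then show ?thesis unfolding Z_def[symmetric] unfolding XZ assms(4)[OF mZ] by simp
next
  case False then show ?thesis using cdn_id assms(1,3,5) by simp
qed

lemma rdn_cdn: "mat X \<Longrightarrow> 1 \<le> i \<Longrightarrow> 1 \<le> j \<Longrightarrow> rdn j (cdn i X) = cdn i (rdn j X)"
  by (rule cdn_commute) (auto simp: mat_rdn rdn_cup cphi_ceps_rdn)

lemma rup_cdn: "mat X \<Longrightarrow> 1 \<le> i \<Longrightarrow> 1 \<le> j \<Longrightarrow> rup j (cdn i X) = cdn i (rup j X)"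
  by (rule cdn_commute) (auto simp: mat_rup rup_cup cphi_ceps_rup)

section \<open>Words of row operators\<close>

fun rops :: "(bool \<times> nat) list \<Rightarrow> mlq \<Rightarrow> mlq" where
  "rops [] X = X"
| "rops ((b, j) # w) X = rops w (if b then rup j X else rdn j X)"

definition rword :: "(bool \<times> nat) list \<Rightarrow> bool" where
  "rword w \<longleftrightarrow> (\<forall>(b, j) \<in> set w. 1 \<le> j)"

lemma rword_simps [simp]: "rword []" "rword ((b, j) # w) \<longleftrightarrow> 1 \<le> j \<and> rword w"
  "rword (u @ v) \<longleftrightarrow> rword u \<and> rword v"
  unfolding rword_def by auto

lemma rops_append: "rops (u @ v) X = rops v (rops u X)"
  by (induction u X rule: rops.induct) auto

lemma mat_rops: "rword w \<Longrightarrow> mat X \<Longrightarrow> mat (rops w X)"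
  by (induction w X rule: rops.induct) (auto simp: mat_rup mat_rdn)

lemma rops_cup:
  assumes "mat X" "rword w" "1 \<le> i"
  shows "rops w (cup i X) = cup i (rops w X)" "cphi i (rops w X) = cphi i X" "ceps i (rops w X) = ceps i X"
    "rops w (cdn i X) = cdn i (rops w X)"
proof -
  have "rops w (cup i X) = cup i (rops w X) \<and> cphi i (rops w X) = cphi i X \<and> ceps i (rops w X) = ceps i X
     \<and> rops w (cdn i X) = cdn i (rops w X)"
    using assms
  proof (induction w X rule: rops.induct)
    case (2 b j w X)
    then have m: "mat (if b then rup j X else rdn j X)" by (auto simp: mat_rup mat_rdn)
    show ?case using 2(1)[OF m] 2(2-)
      by (auto simp: rdn_cup rup_cup rdn_cdn rup_cdn cphi_ceps_rdn cphi_ceps_rup)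
  qed simp
  then show "rops w (cup i X) = cup i (rops w X)" "cphi i (rops w X) = cphi i X" "ceps i (rops w X) = ceps i X"
    "rops w (cdn i X) = cdn i (rops w X)" by auto
qed

lemma rops_inverse:
  assumes "mat X" "rword w" shows "\<exists>w'. rword w' \<and> rops w' (rops w X) = X"
  using assms
proof (induction w X rule: rops.induct)
  case (1 X) then show ?case by (intro exI[of _ "[]"]) auto
next
  case (2 b j w X)
  define Y where "Y = (if b then rup j X else rdn j X)"
  have m: "mat Y" unfolding Y_def using 2 by (auto simp: mat_rup mat_rdn)
  from 2(1)[folded Y_def, OF m] 2(3) obtain w' where w': "rword w'" "rops w' (rops w Y) = Y" by auto
  have "\<exists>v. rword v \<and> rops v Y = X"
  proof (cases b)
    case True
    show ?thesis
    proof (cases "0 < phi j X")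
      case T: True then show ?thesis using True rup_counts(5)[of X j] 2 unfolding Y_def
        by (intro exI[of _ "[(False, j)]"]) auto
    next
      case False then show ?thesis using True rup_id[of X j] 2 unfolding Y_def by (intro exI[of _ "[]"]) auto
    qed
  next
    case F: False
    show ?thesis
    proof (cases "0 < eps j X")
      case True then show ?thesis using F rdn_counts(5)[of X j] 2 unfolding Y_def
        by (intro exI[of _ "[(True, j)]"]) auto
    next
      case False then show ?thesis using F rdn_id[of X j] 2 unfolding Y_def by (intro exI[of _ "[]"]) auto
    qed
  qed
  then obtain v where "rword v" "rops v Y = X" by blast
  then show ?case using w' by (intro exI[of _ "w' @ v"]) (auto simp: rops_append Y_def)
qed

lemma card_col_rup: assumes "mat X" "1 \<le> j" shows "card (tr (rup j X) c) = card (tr X c)"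
proof (cases "0 < phi j X")
  case True
  then show ?thesis using card_col_rdn[OF mat_rup[OF assms(1)] assms(2), of j c]
    rup_counts(5)[OF assms(1) True] by simp
next
  case False then show ?thesis using rup_id assms by simp
qed

lemma card_col_rops: "mat X \<Longrightarrow> rword w \<Longrightarrow> card (tr (rops w X) c) = card (tr X c)"
proof (induction w X rule: rops.induct)
  case (2 b j w X)
  have m: "mat (if b then rup j X else rdn j X)" using 2 by (auto simp: mat_rup mat_rdn)
  show ?case using 2(1)[OF m] 2(2-) by (auto simp: card_col_rup card_col_rdn)
qed simp

section \<open>Components and their highest members\<close>

inductive conn :: "mlq \<Rightarrow> mlq \<Rightarrow> bool" for X where
  self: "conn X X"
| cup: "conn X Y \<Longrightarrow> 1 \<le> i \<Longrightarrow> 0 < cphi i Y \<Longrightarrow> conn X (cup i Y)"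
| cdn: "conn X Y \<Longrightarrow> 1 \<le> i \<Longrightarrow> 0 < ceps i Y \<Longrightarrow> conn X (cdn i Y)"

lemma conn_trans: assumes "conn X Y" "conn Y Z" shows "conn X Z"
  using assms(2,1) by induction (auto intro: conn.intros)

lemma conn_mat: "conn X Y \<Longrightarrow> mat X \<Longrightarrow> mat Y"
  by (induction rule: conn.induct) (auto simp: mat_cup mat_cdn)

lemma conn_sym: "conn X Y \<Longrightarrow> mat X \<Longrightarrow> conn Y X"
proof (induction rule: conn.induct)
  case self show ?case by (rule conn.self)
next
  case (cup Y i)
  have mY: "mat Y" using cup conn_mat by blast
  have "conn (cup i Y) (cdn i (cup i Y))"
    by (rule conn.cdn[OF conn.self]) (use cup mY cup_counts in auto)
  then show ?case using cup mY cup_counts(3) conn_trans by metis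
next
  case (cdn Y i)
  have mY: "mat Y" using cdn conn_mat by blast
  have "conn (cdn i Y) (cup i (cdn i Y))"
    by (rule conn.cup[OF conn.self]) (use cdn mY cdn_counts in auto)
  then show ?case using cdn mY cdn_counts(3) conn_trans by metis
qed

lemma conn_inv:
  assumes "conn X Y" "mat X"
  shows "\<And>r. card (Y r) = card (X r)" "\<And>j. 1 \<le> j \<Longrightarrow> eps j Y = eps j X" "\<And>j. 1 \<le> j \<Longrightarrow> phi j Y = phi j X"
proof -
  have c: "card (cdn i Y r) = card (Y r)" if "mat Y" "1 \<le> i" for i r Y
  proof (cases "0 < ceps i Y")
    case True
    then show ?thesis using card_row_cup[OF mat_cdn[OF that(1)] that(2)] cdn_counts(3)[OF that(1) True] by metis
  next
    case False then show ?thesis using cdn_id that by simp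
  qed
  have "mat Y \<and> (\<forall>r. card (Y r) = card (X r)) \<and> (\<forall>j\<ge>1. eps j Y = eps j X \<and> phi j Y = phi j X)"
    using assms
    by (induction rule: conn.induct) (auto simp: c card_row_cup phi_eps_cup phi_eps_cdn mat_cup mat_cdn)
  then show "\<And>r. card (Y r) = card (X r)" "\<And>j. 1 \<le> j \<Longrightarrow> eps j Y = eps j X" "\<And>j. 1 \<le> j \<Longrightarrow> phi j Y = phi j X"
    by auto
qed

text \<open>A row word commutes with every column move and keeps the lengths of column strings, so a
  path of acting moves is carried to a path of acting moves.\<close>

lemma conn_rops: "conn X Y \<Longrightarrow> mat X \<Longrightarrow> rword w \<Longrightarrow> conn (rops w X) (rops w Y)"
proof (induction rule: conn.induct)
  case self show ?case by (rule conn.self)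
next
  case (cup Y i)
  have "mat Y" using cup conn_mat by blast
  then show ?case using cup conn.cup[of "rops w X" "rops w Y" i] by (simp add: rops_cup)
next
  case (cdn Y i)
  have "mat Y" using cdn conn_mat by blast
  then show ?case using cdn conn.cdn[of "rops w X" "rops w Y" i] by (simp add: rops_cup)
qed

definition chigh :: "mlq \<Rightarrow> bool" where
  "chigh X \<longleftrightarrow> (\<forall>i\<ge>1. cphi i X = 0)"

definition rhigh :: "mlq \<Rightarrow> bool" where
  "rhigh X \<longleftrightarrow> (\<forall>j\<ge>1. eps j X = 0)"

lemma chigh_rops: "mat X \<Longrightarrow> rword w \<Longrightarrow> chigh (rops w X) \<longleftrightarrow> chigh X"
  unfolding chigh_def by (simp add: rops_cup)

lemma rhigh_conn: "conn X Y \<Longrightarrow> mat X \<Longrightarrow> rhigh Y \<longleftrightarrow> rhigh X"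
  unfolding rhigh_def using conn_inv by simp

lemma box_cup: assumes "box L n X" "1 \<le> i" shows "box L n (cup i X)"
proof (cases "\<exists>R. up (tr X i) (tr X (Suc i)) R")
  case True
  then obtain R where R: "up (tr X i) (tr X (Suc i)) R" by blast
  have "Suc i \<in> X R" using up_mem[OF R] by auto
  then have "i \<le> n" using assms(1) unfolding box_def by fastforce
  then show ?thesis using assms box_gup[of n L "tr X" i "Suc i"] unfolding cup_def by simp
next
  case False
  then show ?thesis using assms unfolding cup_def gup_def by auto
qed

lemma box_rdn: "box L n X \<Longrightarrow> 1 \<le> j \<Longrightarrow> box L n (rdn j X)"
proof (cases "\<exists>c. dn (X (Suc j)) (X j) c")
  case True
  assume b: "box L n X" "1 \<le> j"
  from True obtain c where c: "dn (X (Suc j)) (X j) c" by blast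
  have "c \<in> X (Suc j)" using dn_mem[OF c] by auto
  then have "j \<le> L" using b(1) unfolding box_def by fastforce
  then show ?thesis using b box_gdn[of L n X j "Suc j"] unfolding rdn_def by simp
next
  case False
  assume "box L n X"
  then show ?thesis using False unfolding rdn_def gdn_def by auto
qed

definition csum :: "mlq \<Rightarrow> nat" where
  "csum X = (\<Sum>(r, c) \<in> {(r, c). c \<in> X r}. c)"

lemma finite_sites: "mat X \<Longrightarrow> finite {(r, c). c \<in> X r}"
proof -
  assume "mat X"
  then obtain L n where "box L n X" by (auto simp: mat_def)
  then have "{(r, c). c \<in> X r} \<subseteq> {..L} \<times> {..n}" by (auto simp: box_def)
  then show ?thesis by (rule finite_subset) auto
qed

lemma csum_cup: assumes "mat X" "1 \<le> i" "0 < cphi i X" shows "csum (cup i X) < csum X"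
proof -
  obtain R where R: "up (tr X i) (tr X (Suc i)) R" using assms gphi_pos[of "tr X"] unfolding cphi_def by auto
  have m: "Suc i \<in> X R" "i \<notin> X R" using up_mem[OF R] by auto
  let ?S = "{(r, c). c \<in> X r}"
  have e: "{(r, c). c \<in> cup i X r} = insert (R, i) (?S - {(R, Suc i)})"
    unfolding cup_def gup_eq[OF R] mem_cmv using assms(2) by auto
  have "csum X = Suc i + (\<Sum>(r, c) \<in> ?S - {(R, Suc i)}. c)"
    unfolding csum_def using finite_sites[OF assms(1)] m by (subst sum.remove[of _ "(R, Suc i)"]) auto
  moreover have "csum (cup i X) = i + (\<Sum>(r, c) \<in> ?S - {(R, Suc i)}. c)"
    unfolding csum_def e using finite_sites[OF assms(1)] m by (subst sum.insert) auto
  ultimately show ?thesis by simp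
qed

text \<open>Every acting \<open>cup\<close> moves a ball to the left and lowers the sum of the
  column indices, so raising stops at a column highest array.\<close>

lemma raise_induct [consumes 1, case_names high step]:
  assumes "mat X"
    and "\<And>X. mat X \<Longrightarrow> chigh X \<Longrightarrow> P X"
    and "\<And>X i. mat X \<Longrightarrow> 1 \<le> i \<Longrightarrow> 0 < cphi i X \<Longrightarrow> P (cup i X) \<Longrightarrow> P X"
  shows "P X"
  using assms(1)
proof (induction "csum X" arbitrary: X rule: less_induct)
  case less
  show ?case
  proof (cases "chigh X")
    case True then show ?thesis using assms(2) less by blast
  next
    case False
    then obtain i where i: "1 \<le> i" "0 < cphi i X" unfolding chigh_def by auto
    then have "P (cup i X)" using less csum_cup mat_cup by blast
    then show ?thesis using assms(3) less i by blast
  qed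
qed

lemma ex_chigh: "mat X \<Longrightarrow> \<exists>Y. conn X Y \<and> chigh Y \<and> (\<forall>L n. box L n X \<longrightarrow> box L n Y)"
proof (induction rule: raise_induct)
  case (high X) then show ?case using conn.self by blast
next
  case (step X i)
  then obtain Y where Y: "conn (cup i X) Y" "chigh Y" "\<forall>L n. box L n (cup i X) \<longrightarrow> box L n Y" by blast
  have "conn X (cup i X)" using step by (intro conn.cup conn.self)
  then show ?case using Y conn_trans box_cup step by blast
qed

section \<open>Collapsing by row operators\<close>

lemma rdn_iter:
  assumes "mat X" "1 \<le> j" "k \<le> eps j X"
  shows "mat ((rdn j ^^ k) X)" "eps j ((rdn j ^^ k) X) = eps j X - k" "phi j ((rdn j ^^ k) X) = phi j X + k"
    "card ((rdn j ^^ k) X (Suc j)) = card (X (Suc j)) - k" "card ((rdn j ^^ k) X j) = card (X j) + k"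
    "k \<le> card (X (Suc j))"
proof -
  have "mat ((rdn j ^^ k) X) \<and> eps j ((rdn j ^^ k) X) = eps j X - k \<and> phi j ((rdn j ^^ k) X) = phi j X + k
    \<and> card ((rdn j ^^ k) X (Suc j)) + k = card (X (Suc j)) \<and> card ((rdn j ^^ k) X j) = card (X j) + k"
    using assms(3)
  proof (induction k)
    case 0 then show ?case using assms by simp
  next
    case (Suc k)
    then have "0 < eps j ((rdn j ^^ k) X)" by auto
    then show ?case using Suc mat_rdn[OF _ assms(2)] rdn_counts[of "(rdn j ^^ k) X" j] by auto
  qed
  then show "mat ((rdn j ^^ k) X)" "eps j ((rdn j ^^ k) X) = eps j X - k" "phi j ((rdn j ^^ k) X) = phi j X + k"
    "card ((rdn j ^^ k) X (Suc j)) = card (X (Suc j)) - k" "card ((rdn j ^^ k) X j) = card (X j) + k"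
    "k \<le> card (X (Suc j))" by auto
qed

lemma rup_iter:
  assumes "mat X" "k \<le> phi j X"
  shows "mat ((rup j ^^ k) X)" "eps j ((rup j ^^ k) X) = eps j X + k" "phi j ((rup j ^^ k) X) = phi j X - k"
    "card ((rup j ^^ k) X (Suc j)) = card (X (Suc j)) + k" "card ((rup j ^^ k) X j) = card (X j) - k"
    "k \<le> card (X j)"
proof -
  have "mat ((rup j ^^ k) X) \<and> eps j ((rup j ^^ k) X) = eps j X + k \<and> phi j ((rup j ^^ k) X) = phi j X - k
    \<and> card ((rup j ^^ k) X (Suc j)) = card (X (Suc j)) + k \<and> card ((rup j ^^ k) X j) + k = card (X j)"
    using assms(2)
  proof (induction k)
    case 0 then show ?case using assms by simp
  next
    case (Suc k)
    then have "0 < phi j ((rup j ^^ k) X)" by auto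
    then show ?case using Suc mat_rup rup_counts[of "(rup j ^^ k) X" j] by auto
  qed
  then show "mat ((rup j ^^ k) X)" "eps j ((rup j ^^ k) X) = eps j X + k" "phi j ((rup j ^^ k) X) = phi j X - k"
    "card ((rup j ^^ k) X (Suc j)) = card (X (Suc j)) + k" "card ((rup j ^^ k) X j) = card (X j) - k"
    "k \<le> card (X j)" by auto
qed

lemma rdn_iter_other: "r \<noteq> j \<Longrightarrow> r \<noteq> Suc j \<Longrightarrow> (rdn j ^^ k) X r = X r"
  by (induction k) (auto simp: rdn_other)
lemma rup_iter_other: "r \<noteq> j \<Longrightarrow> r \<noteq> Suc j \<Longrightarrow> (rup j ^^ k) X r = X r"
  by (induction k) (auto simp: rup_other)

lemma rdn_iter_rops: "(rdn j ^^ k) X = rops (replicate k (False, j)) X"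
  by (induction k arbitrary: X) (simp_all add: funpow_Suc_right del: funpow.simps(2))
lemma rup_iter_rops: "(rup j ^^ k) X = rops (replicate k (True, j)) X"
  by (induction k arbitrary: X) (simp_all add: funpow_Suc_right del: funpow.simps(2))

lemma rword_replicate [simp]: "1 \<le> j \<Longrightarrow> rword (replicate k (b, j))"
  by (auto simp: rword_def)

definition rmax :: "nat \<Rightarrow> mlq \<Rightarrow> mlq" where "rmax j X = (rdn j ^^ eps j X) X"

text \<open>By \<open>uo_dn\<close> a move removes just its own ball from the unmatched openings and
  creates no new one; so all original ones drop.\<close>

lemma rmax_rows:
  assumes "mat X" "1 \<le> j"
  shows "rmax j X (Suc j) = X (Suc j) - uo (X (Suc j)) (X j)" "rmax j X j = X j \<union> uo (X (Suc j)) (X j)"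
proof -
  have "(rdn j ^^ eps j X) X (Suc j) = X (Suc j) - uo (X (Suc j)) (X j) \<and>
    (rdn j ^^ eps j X) X j = X j \<union> uo (X (Suc j)) (X j)"
    using assms
  proof (induction "eps j X" arbitrary: X)
    case 0
    then have "uo (X (Suc j)) (X j) = {}"
      using finite_uo[of "X (Suc j)" "X j", OF mat_fin1[of X]] by (simp add: eps_def geps_def)
    then show ?case using 0 by simp
  next
    case (Suc k)
    then have p: "0 < eps j X" by simp
    then obtain c where c: "dn (X (Suc j)) (X j) c" using Suc geps_pos unfolding eps_def by blast
    define Y where "Y = rdn j X"
    have r: "Y (Suc j) = X (Suc j) - {c}" "Y j = insert c (X j)"
      unfolding Y_def rdn_def using gdn_rows[OF c] by auto
    have ey: "eps j Y = k" unfolding Y_def using rdn_counts(1)[OF Suc(3) p] Suc(2) by simp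
    have "(rdn j ^^ k) Y (Suc j) = Y (Suc j) - uo (Y (Suc j)) (Y j) \<and> (rdn j ^^ k) Y j = Y j \<union> uo (Y (Suc j)) (Y j)"
      using Suc(1)[of Y] ey Suc(3,4) mat_rdn unfolding Y_def by auto
    moreover have "(rdn j ^^ eps j X) X = (rdn j ^^ k) Y"
      unfolding Suc(2)[symmetric] Y_def by (simp add: funpow_swap1)
    ultimately show ?case unfolding r uo_dn[OF c] using dn_in_uo[OF c] by auto
  qed
  then show "rmax j X (Suc j) = X (Suc j) - uo (X (Suc j)) (X j)" "rmax j X j = X j \<union> uo (X (Suc j)) (X j)"
    unfolding rmax_def by auto
qed

lemma rmax_other: "r \<noteq> j \<Longrightarrow> r \<noteq> Suc j \<Longrightarrow> rmax j X r = X r"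
  unfolding rmax_def by (rule rdn_iter_other)

lemma mat_rmax: "mat X \<Longrightarrow> 1 \<le> j \<Longrightarrow> mat (rmax j X)"
  unfolding rmax_def by (rule rdn_iter) auto

lemma box_rmax: "box L n X \<Longrightarrow> 1 \<le> j \<Longrightarrow> box L n (rmax j X)"
  unfolding rmax_def
proof -
  assume b: "box L n X" "1 \<le> j"
  have "box L n ((rdn j ^^ k) X)" for k by (induction k) (use b box_rdn in auto)
  then show "box L n ((rdn j ^^ eps j X) X)" .
qed

section \<open>The column word compared with the path of heights\<close>

fun ucl :: "nat \<Rightarrow> (nat \<times> nat) list \<Rightarrow> nat" where
  "ucl j [] = 0"
| "ucl j ((r, c) # w) = (if r = Suc j then ucl j w - 1 else if r = j then Suc (ucl j w) else ucl j w)"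

text \<open>\<open>ucl\<close> counts the unmatched closings of a word; the truncated subtraction
  lets an opening cancel one if there is one. In front of \<open>w\<close> these closings consume
  that many entries from the top of the stack.\<close>

lemma unmatched_open_stack:
  "unmatched_open j st w = rev (drop (ucl j w) st) @ unmatched_open j [] w"
proof (induction w arbitrary: st)
  case (Cons x w)
  obtain r c where x: "x = (r, c)" by force
  have 1: "unmatched_open j (v # u) w = rev (drop (ucl j w) (v # u)) @ unmatched_open j [] w" for v u by (rule Cons)
  consider "r = Suc j" | "r = j" | "r \<noteq> Suc j" "r \<noteq> j" by blast
  then show ?case
  proof cases
    case c: 1 show ?thesis unfolding x by (cases "ucl j w") (simp_all add: c 1)
  next
    case 2 show ?thesis unfolding x using Cons[of "tl st"] by (simp add: 2 drop_Suc)
  next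
    case 3 then show ?thesis unfolding x using Cons[of st] by simp
  qed
qed simp

lemma unmatched_open_filter:
  "unmatched_open j st w = unmatched_open j st (filter (\<lambda>(r, c). r = j \<or> r = Suc j) w)"
  by (induction j st w rule: unmatched_open.induct) auto

definition colw :: "nat \<Rightarrow> mlq \<Rightarrow> nat \<Rightarrow> (nat \<times> nat) list" where
  "colw j X c = (if c \<in> X (Suc j) then [(Suc j, c)] else []) @ (if c \<in> X j then [(j, c)] else [])"

lemma box_height:
  assumes "box L n X" shows "\<And>r. height X < r \<Longrightarrow> X r = {}" "height X \<le> L"
proof -
  have L: "\<forall>r>L. X r = {}" using assms unfolding box_def by fastforce
  have "\<forall>r>height X. X r = {}" unfolding height_def by (rule LeastI[of _ L]) (rule L)
  then show "\<And>r. height X < r \<Longrightarrow> X r = {}" by blast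
  show "height X \<le> L" unfolding height_def by (rule Least_le) (rule L)
qed

lemma upt_split: "i \<le> j \<Longrightarrow> j \<le> k \<Longrightarrow> [i..<k] = [i..<j] @ [j..<k]"
  by (metis le_add_diff_inverse upt_add_eq_append)

lemma filter_two:
  assumes "1 \<le> j" "\<And>r. H < r \<Longrightarrow> \<not> P r"
  shows "filter (\<lambda>r. (r = j \<or> r = Suc j) \<and> P r) [1..<Suc H] =
    (if P j then [j] else []) @ (if P (Suc j) then [Suc j] else [])"
proof -
  let ?Q = "\<lambda>r. (r = j \<or> r = Suc j) \<and> P r"
  \<comment> \<open>The column word stops at the height of the array, which may lie below row
    \<open>j + 1\<close>; padding with empty rows makes both rows visible.\<close>
  define K where "K = max H (Suc j)"
  have 1: "filter ?Q [1..<Suc K] = filter ?Q [1..<Suc H]"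
  proof -
    have "[1..<Suc K] = [1..<Suc H] @ [Suc H..<Suc K]" unfolding K_def
      by (rule upt_split) auto
    moreover have "filter ?Q [Suc H..<Suc K] = []" using assms(2) by (auto simp: filter_empty_conv)
    ultimately show ?thesis by simp
  qed
  have "[1..<Suc K] = [1..<j] @ [j..<Suc K]"
    by (rule upt_split) (use assms(1) in \<open>auto simp: K_def\<close>)
  also have "[j..<Suc K] = j # Suc j # [Suc (Suc j)..<Suc K]"
    using upt_conv_Cons[of j "Suc K"] upt_conv_Cons[of "Suc j" "Suc K"] by (simp add: K_def del: upt_Suc)
  finally have "filter ?Q [1..<Suc K] = filter ?Q [1..<j] @ filter ?Q [j, Suc j] @ filter ?Q [Suc (Suc j)..<Suc K]"
    by simp
  moreover have "filter ?Q [1..<j] = []" "filter ?Q [Suc (Suc j)..<Suc K] = []" by (auto simp: filter_empty_conv)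
  moreover have "filter ?Q [j, Suc j] = (if P j then [j] else []) @ (if P (Suc j) then [Suc j] else [])" by simp
  ultimately have "filter ?Q [1..<Suc K] = (if P j then [j] else []) @ (if P (Suc j) then [Suc j] else [])"
    by (simp only: append_Nil append_Nil2)
  then show ?thesis by (simp only: 1)
qed

lemma column_word_filter:
  assumes "box L n X" "1 \<le> j"
  shows "filter (\<lambda>(r, c). r = j \<or> r = Suc j) (column_word m X) = concat (map (colw j X) [1..<Suc m])"
proof -
  have "filter (\<lambda>(r, c). r = j \<or> r = Suc j) (map (\<lambda>r. (r, c)) (filter (\<lambda>r. c \<in> X r) (rev [1..<Suc (height X)])))
    = colw j X c" for c
  proof -
    have "filter (\<lambda>(r, c). r = j \<or> r = Suc j) (map (\<lambda>r. (r, c)) (filter (\<lambda>r. c \<in> X r) (rev [1..<Suc (height X)])))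
      = map (\<lambda>r. (r, c)) (rev (filter (\<lambda>r. (r = j \<or> r = Suc j) \<and> c \<in> X r) [1..<Suc (height X)]))"
      by (simp add: filter_map rev_filter o_def conj_commute del: upt_Suc)
    also have "\<dots> = colw j X c"
      using box_height(1)[OF assms(1)] by (subst filter_two[OF assms(2)]) (auto simp: colw_def)
    finally show ?thesis .
  qed
  then show ?thesis unfolding column_word_def by (simp add: filter_concat o_def)
qed

lemma dn_Min: assumes "fin1 A" "uo A B \<noteq> {}" shows "dn A B (Min (uo A B))"
proof -
  obtain c where c: "dn A B c" using dn_exists assms by blast
  have "c \<le> u" if u: "u \<in> uo A B" for u
  proof (rule ccontr)
    assume n: "\<not> c \<le> u"
    then have "hgt A B (u - 1) < hgt A B (c - 1)" using u by (auto simp: uo_def)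
    moreover have "hgt A B (c - 1) \<le> hgt A B (u - 1)" using c n by (auto simp: dn_def)
    ultimately show False by simp
  qed
  then have "Min (uo A B) = c" using dn_in_uo[OF c] finite_uo[OF assms(1)] by (intro Min_eqI) auto
  then show ?thesis using c by simp
qed

text \<open>The scan is analysed from its right end. In the suffix after column \<open>p\<close> the
  unmatched closings measure how far the path falls below its value at \<open>p\<close>, and an
  opening in front survives exactly if there are none. The clauses support each other, hence one
  induction.\<close>

lemma unmatched_suffix:
  fixes X :: mlq and j :: nat
  defines "A \<equiv> X (Suc j)" and "B \<equiv> X j"
  assumes b: "box L n X" and p: "p \<le> n"
  shows "(\<forall>q\<ge>p. hgt A B p - int (ucl j (concat (map (colw j X) [Suc p..<Suc n]))) \<le> hgt A B q) \<and>
    (\<exists>q\<ge>p. hgt A B q = hgt A B p - int (ucl j (concat (map (colw j X) [Suc p..<Suc n])))) \<and>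
    (unmatched_open j [] (concat (map (colw j X) [Suc p..<Suc n])) = [] \<longleftrightarrow> uo A B \<inter> {p<..} = {}) \<and>
    (uo A B \<inter> {p<..} \<noteq> {} \<longrightarrow>
      hd (unmatched_open j [] (concat (map (colw j X) [Suc p..<Suc n]))) = (Suc j, Min (uo A B \<inter> {p<..})))"
  using p
proof (induction "n - p" arbitrary: p)
  case 0
  then have [simp]: "p = n" by simp
  have s: "A \<subseteq> {1..n}" "B \<subseteq> {1..n}" using b unfolding A_def B_def box_def by auto
  have "hgt A B n \<le> hgt A B q" if "q \<ge> n" for q using hgt_const[OF s] that by simp
  moreover have "uo A B \<inter> {n<..} = {}" using uo_subset[of A B] s by auto
  ultimately show ?case by auto
next
  case (Suc k)
  then have pn: "p < n" by simp
  define W where "W = concat (map (colw j X) [Suc (Suc p)..<Suc n])"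
  have Wp: "concat (map (colw j X) [Suc p..<Suc n]) = colw j X (Suc p) @ W"
    unfolding W_def using pn by (simp add: upt_conv_Cons del: upt_Suc)
  have IH: "\<forall>q\<ge>Suc p. hgt A B (Suc p) - int (ucl j W) \<le> hgt A B q"
    "\<exists>q\<ge>Suc p. hgt A B q = hgt A B (Suc p) - int (ucl j W)"
    "unmatched_open j [] W = [] \<longleftrightarrow> uo A B \<inter> {Suc p<..} = {}"
    "uo A B \<inter> {Suc p<..} \<noteq> {} \<longrightarrow> hd (unmatched_open j [] W) = (Suc j, Min (uo A B \<inter> {Suc p<..}))"
    using Suc(1)[of "Suc p"] Suc(2) pn unfolding W_def by auto
  have ge: "(\<forall>q\<ge>p. P q) \<longleftrightarrow> P p \<and> (\<forall>q\<ge>Suc p. P q)" for P :: "nat \<Rightarrow> bool"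
    by (metis Suc_leD Suc_leI le_eq_less_or_eq)
  have ex: "(\<exists>q\<ge>p. P q) \<longleftrightarrow> P p \<or> (\<exists>q\<ge>Suc p. P q)" for P :: "nat \<Rightarrow> bool"
    using ge[of "\<lambda>q. \<not> P q"] by blast
  have fu: "finite (uo A B)" unfolding A_def by (rule finite_uo[OF box_fin1[OF b]])
  have ins: "uo A B \<inter> {p<..} = (if Suc p \<in> uo A B then insert (Suc p) (uo A B \<inter> {Suc p<..}) else uo A B \<inter> {Suc p<..})"
    by (auto intro!: Suc_lessI)
  have hs: "hgt A B (Suc p) = hgt A B p + of_bool (Suc p \<in> A) - of_bool (Suc p \<in> B)" by (rule hgt_Suc)
  \<comment> \<open>Both directions compare the path before this column with its lowest value
    afterwards, which the induction hypothesis expresses by \<open>ucl\<close>.\<close>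
  have so: "Suc p \<in> uo A B \<longleftrightarrow> Suc p \<in> A \<and> Suc p \<notin> B \<and> ucl j W = 0"
  proof
    assume s: "Suc p \<in> uo A B"
    then have m: "Suc p \<in> A" "Suc p \<notin> B" using uo_subset[of A B] by auto
    from IH(2) obtain q where q: "q \<ge> Suc p" "hgt A B q = hgt A B (Suc p) - int (ucl j W)" by blast
    have "hgt A B p < hgt A B q" using s q by (auto simp: uo_def)
    then show "Suc p \<in> A \<and> Suc p \<notin> B \<and> ucl j W = 0" using m q hs by auto
  next
    assume "Suc p \<in> A \<and> Suc p \<notin> B \<and> ucl j W = 0"
    then show "Suc p \<in> uo A B" using IH(1) hs by (fastforce simp: uo_def)
  qed
  have Min1: "Min (insert (Suc p) (uo A B \<inter> {Suc p<..})) = Suc p"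
    using fu by (intro Min_eqI) auto
  have stack: "unmatched_open j [(Suc j, Suc p)] W = rev (drop (ucl j W) [(Suc j, Suc p)]) @ unmatched_open j [] W"
    by (rule unmatched_open_stack)
  consider "Suc p \<in> A" "Suc p \<in> B" | "Suc p \<in> A" "Suc p \<notin> B" | "Suc p \<notin> A" "Suc p \<in> B" | "Suc p \<notin> A" "Suc p \<notin> B"
    by blast
  then show ?case
  proof cases
    case 1
    have u: "ucl j (colw j X (Suc p) @ W) = ucl j W" "unmatched_open j [] (colw j X (Suc p) @ W) = unmatched_open j [] W"
      using 1 unfolding A_def B_def colw_def by auto
    show ?thesis unfolding Wp u ge ex ins using so 1 hs IH by auto
  next
    case 2
    have u: "ucl j (colw j X (Suc p) @ W) = ucl j W - 1"
      "unmatched_open j [] (colw j X (Suc p) @ W) = unmatched_open j [(Suc j, Suc p)] W"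
      using 2 unfolding A_def B_def colw_def by auto
    show ?thesis
    proof (cases "ucl j W = 0")
      case True
      have h: "hgt A B (Suc p) = hgt A B p + 1" using 2 hs by simp
      have s: "Suc p \<in> uo A B" using so True 2 by simp
      have "unmatched_open j [] (colw j X (Suc p) @ W) = (Suc j, Suc p) # unmatched_open j [] W"
        unfolding u stack using True by simp
      then show ?thesis unfolding Wp u(1) ge ex ins using s True h IH(1) Min1 by (auto simp: order_less_imp_le)
    next
      case False
      have h: "hgt A B (Suc p) = hgt A B p + 1" using 2 hs by simp
      have s: "Suc p \<notin> uo A B" using so False 2 by simp
      have e: "int (ucl j W - 1) = int (ucl j W) - 1" using False by simp
      have e2: "unmatched_open j [] (colw j X (Suc p) @ W) = unmatched_open j [] W"
        unfolding u stack using False by (cases "ucl j W") auto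
      have h2: "hgt A B p - (int (ucl j W) - 1) = hgt A B (Suc p) - int (ucl j W)" using h by simp
      show ?thesis unfolding Wp u(1) e2 e ge ex ins h2 using s h IH False by auto
    qed
  next
    case 3
    have u: "ucl j (colw j X (Suc p) @ W) = Suc (ucl j W)" "unmatched_open j [] (colw j X (Suc p) @ W) = unmatched_open j [] W"
      using 3 unfolding A_def B_def colw_def by auto
    have h: "hgt A B p - int (Suc (ucl j W)) = hgt A B (Suc p) - int (ucl j W)" using 3 hs by simp
    show ?thesis unfolding Wp u h ge ex ins using so 3 hs IH by auto
  next
    case 4
    have u: "ucl j (colw j X (Suc p) @ W) = ucl j W" "unmatched_open j [] (colw j X (Suc p) @ W) = unmatched_open j [] W"
      using 4 unfolding A_def B_def colw_def by auto
    show ?thesis unfolding Wp u ge ex ins using so 4 hs IH by auto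
  qed
qed

lemma e_down_eq: assumes "box L n X" "1 \<le> j" shows "e_down n j X = rdn j X"
proof -
  let ?W = "concat (map (colw j X) [Suc 0..<Suc n])"
  have w: "unmatched_open j [] (column_word n X) = unmatched_open j [] ?W"
    using unmatched_open_filter[of j "[]" "column_word n X"] column_word_filter[OF assms] by simp
  have pos: "uo (X (Suc j)) (X j) \<inter> {0<..} = uo (X (Suc j)) (X j)" by (auto simp: uo_def)
  note s = unmatched_suffix[OF assms(1), of 0 j, unfolded pos]
  show ?thesis
  proof (cases "uo (X (Suc j)) (X j) = {}")
    case True
    then have "unmatched_open j [] (column_word n X) = []" using s unfolding w by auto
    moreover have "rdn j X = X" using True dn_ex_iff unfolding rdn_def gdn_def by metis
    ultimately show ?thesis unfolding e_down_def by simp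
  next
    case False
    let ?c = "Min (uo (X (Suc j)) (X j))"
    have "unmatched_open j [] ?W \<noteq> []" "hd (unmatched_open j [] ?W) = (Suc j, ?c)"
      using False s by auto
    then obtain l where "unmatched_open j [] ?W = (Suc j, ?c) # l" by (metis list.collapse)
    then have "e_down n j X = X(Suc j := X (Suc j) - {?c}, j := insert ?c (X j))"
      unfolding e_down_def w by simp
    also have "\<dots> = rdn j X" unfolding rdn_def
      using gdn_eq[OF dn_Min[OF box_fin1[OF assms(1)] False]] by (simp add: mv_def)
    finally show ?thesis .
  qed
qed

text \<open>\<open>rdn\<close> acts trivially only when \<open>eps\<close> is 0, and each acting
  step lowers \<open>eps\<close> by one; so the least number of repetitions is
  \<open>eps j X\<close>.\<close>

lemma e_down_star_eq: assumes "box L n X" "1 \<le> j" shows "e_down_star n j X = rmax j X"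
proof -
  have m: "mat X" using assms by (auto simp: mat_def)
  have b: "box L n ((rdn j ^^ k) X)" for k by (induction k) (use assms box_rdn in auto)
  have it: "(e_down n j ^^ k) X = (rdn j ^^ k) X" for k
    by (induction k) (use e_down_eq[OF b assms(2)] in auto)
  have fx: "rdn j Y = Y \<longleftrightarrow> eps j Y = 0" if "mat Y" for Y
    using rdn_id[OF that] rdn_counts(1)[OF that] by (metis gr0I n_not_Suc_n)
  have "(LEAST k. e_down n j ((e_down n j ^^ k) X) = (e_down n j ^^ k) X) = eps j X"
    unfolding it e_down_eq[OF b assms(2)]
  proof (rule Least_equality)
    show "rdn j ((rdn j ^^ eps j X) X) = (rdn j ^^ eps j X) X"
      using fx rdn_iter[OF m assms(2), of "eps j X"] by simp
    fix k assume k: "rdn j ((rdn j ^^ k) X) = (rdn j ^^ k) X"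
    show "eps j X \<le> k"
    proof (rule ccontr)
      assume "\<not> eps j X \<le> k"
      then show False using k fx rdn_iter[OF m assms(2), of k] by simp
    qed
  qed
  then show ?thesis unfolding e_down_star_def rmax_def it by simp
qed

section \<open>Collapsing along a component\<close>

lemma foldr_rmax:
  assumes "box L n X" "\<And>j. j \<in> set js \<Longrightarrow> 1 \<le> j"
  shows "foldr (e_down_star n) js X = foldr rmax js X" "box L n (foldr rmax js X)"
proof -
  have "foldr (e_down_star n) js X = foldr rmax js X \<and> box L n (foldr rmax js X)"
    using assms(2)
  proof (induction js)
    case (Cons j js)
    then have "box L n (foldr rmax js X)" "1 \<le> j" by auto
    then show ?case using Cons e_down_star_eq box_rmax by simp
  qed (use assms in auto)
  then show "foldr (e_down_star n) js X = foldr rmax js X" "box L n (foldr rmax js X)" by auto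
qed

lemma box_collapse: "box L n X \<Longrightarrow> box L n (collapse n X k)"
proof (induction k)
  case (Suc k) then show ?case using foldr_rmax[of L n "collapse n X k" "[1..<Suc k]"] by (simp del: upt_Suc)
qed simp

lemma collapse_Suc: "box L n X \<Longrightarrow> collapse n X (Suc k) = foldr rmax [1..<Suc k] (collapse n X k)"
  using foldr_rmax[of L n "collapse n X k" "[1..<Suc k]"] box_collapse[of L n X k] by (simp del: upt_Suc)

lemma collapse_change_n: "box L n X \<Longrightarrow> box L m X \<Longrightarrow> collapse n X k = collapse m X k"
proof (induction k)
  case (Suc k) then show ?case using collapse_Suc[of L n X k] collapse_Suc[of L m X k] by simp
qed simp

text \<open>The number of repetitions is \<open>eps\<close>, which is constant on components; this
  is what makes collapsing a common word.\<close>

lemma rmax_conn: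
  assumes "conn X Y" "mat X" "1 \<le> j"
  shows "\<exists>w. rword w \<and> rmax j X = rops w X \<and> rmax j Y = rops w Y"
proof -
  have e: "eps j Y = eps j X" using conn_inv[OF assms(1,2)] assms(3) by simp
  show ?thesis unfolding rmax_def rdn_iter_rops e using assms(3)
    by (intro exI[of _ "replicate (eps j X) (False, j)"]) auto
qed

lemma foldr_rmax_conn:
  assumes "conn X Y" "mat X" "\<And>j. j \<in> set js \<Longrightarrow> 1 \<le> j"
  shows "\<exists>w. rword w \<and> foldr rmax js X = rops w X \<and> foldr rmax js Y = rops w Y"
  using assms(3)
proof (induction js)
  case Nil then show ?case by (intro exI[of _ "[]"]) auto
next
  case (Cons j js)
  then obtain w where w: "rword w" "foldr rmax js X = rops w X" "foldr rmax js Y = rops w Y" by auto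
  obtain v where "rword v" "rmax j (rops w X) = rops v (rops w X)" "rmax j (rops w Y) = rops v (rops w Y)"
    using rmax_conn[OF conn_rops[OF assms(1,2) w(1)] mat_rops[OF w(1) assms(2)]] Cons by auto
  then show ?case using w by (intro exI[of _ "w @ v"]) (auto simp: rops_append)
qed

lemma collapse_conn:
  assumes "conn X Y" "box L n X" "box L n Y"
  shows "\<exists>w. rword w \<and> collapse n X k = rops w X \<and> collapse n Y k = rops w Y"
proof (induction k)
  case 0 show ?case by (intro exI[of _ "[]"]) auto
next
  case (Suc k)
  have m: "mat X" using assms by (auto simp: mat_def)
  from Suc obtain w where w: "rword w" "collapse n X k = rops w X" "collapse n Y k = rops w Y" by blast
  have "\<exists>v. rword v \<and> foldr rmax [1..<Suc k] (rops w X) = rops v (rops w X) \<and> foldr rmax [1..<Suc k] (rops w Y) = rops v (rops w Y)"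
    by (rule foldr_rmax_conn[OF conn_rops[OF assms(1) m w(1)] mat_rops[OF w(1) m]]) auto
  then obtain v where v: "rword v" "foldr rmax [1..<Suc k] (rops w X) = rops v (rops w X)"
    "foldr rmax [1..<Suc k] (rops w Y) = rops v (rops w Y)" by blast
  show ?case unfolding collapse_Suc[OF assms(2)] collapse_Suc[OF assms(3)] w(2,3) v(2,3)
    using v(1) w(1) by (intro exI[of _ "w @ v"]) (auto simp: rops_append)
qed

lemma height_cong: "(\<And>r. X r = {} \<longleftrightarrow> Y r = {}) \<Longrightarrow> height X = height Y"
  unfolding height_def by simp

lemma conn_height: assumes "conn X Y" "mat X" shows "height X = height Y"
proof (rule height_cong)
  fix r show "X r = {} \<longleftrightarrow> Y r = {}"
    using conn_inv(1)[OF assms, of r] mat_finite[of X r] mat_finite[of Y r] conn_mat[OF assms] assms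
    by (metis card_0_eq)
qed

lemma recording_conn:
  assumes "conn X Y" "box L n X" "box L n Y"
  shows "recording n X k = recording n Y k"
proof (induction k)
  case (Suc k)
  have m: "mat X" using assms by (auto simp: mat_def)
  have c: "card (collapse n X k r) = card (collapse n Y k r)" for k r
    using collapse_conn[OF assms, of k] conn_rops[OF assms(1) m] conn_inv(1) mat_rops m by metis
  show ?case using Suc c by (auto simp del: collapse.simps)
qed simp

lemma rho_Q_conn: "conn X Y \<Longrightarrow> box L n X \<Longrightarrow> box L n Y \<Longrightarrow> rho_Q n X = rho_Q n Y"
  unfolding rho_Q_def using recording_conn conn_height mat_def by metis

lemma rho_N_conn: "conn X Y \<Longrightarrow> box L n X \<Longrightarrow> box L n Y \<Longrightarrow>
  \<exists>w. rword w \<and> rho_N n X = rops w X \<and> rho_N n Y = rops w Y"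
  unfolding rho_N_def using collapse_conn conn_height mat_def by metis

section \<open>Swapping the sizes of adjacent rows\<close>

text \<open>The balls of \<open>S\<close> that remain unpaired when the balls of \<open>A\<close> are paired cyclically into \<open>S\<close>.\<close>

definition vset :: "nat set \<Rightarrow> nat set \<Rightarrow> nat set" where
  "vset A S = {b \<in> uc A S. int (card (uo A S)) + hgt A S b < 0}"

lemma low_point':
  obtains x where "x \<le> q" "hgt A B x \<le> hgt A B q" "x = 0 \<or> x \<in> uc A B"
  using low_point[of q A B] by blast

lemma uc_mono: "b \<in> uc A S \<Longrightarrow> b' \<in> uc A S \<Longrightarrow> b < b' \<Longrightarrow> hgt A S b' < hgt A S b"
  by (auto simp: uc_def)

lemma uc_inj: "b \<in> uc A S \<Longrightarrow> b' \<in> uc A S \<Longrightarrow> hgt A S b = hgt A S b' \<Longrightarrow> b = b'"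
  using uc_mono[of b A S b'] uc_mono[of b' A S b] by (cases b b' rule: linorder_cases) auto

text \<open>By \<open>hgt_uc\<close> the unmatched closings have heights -1, -2, ... from left to
  right. So in \<open>vset\<close> the height condition says that a closing is not among the
  \<open>card (uo A S)\<close> leftmost ones, which go to the wrapped balls.\<close>

lemma uc_level:
  assumes "fin1 S" "1 \<le> k" "k \<le> card (uc A S)"
  shows "\<exists>b \<in> uc A S. hgt A S b = - int k"
proof -
  have f: "finite (uc A S)" using finite_uc[OF assms(1)] .
  let ?g = "\<lambda>b. card (uc A S \<inter> {1..b})"
  have h: "hgt A S b = - int (?g b)" if "b \<in> uc A S" for b using hgt_uc[OF that] .
  have inj: "inj_on ?g (uc A S)" using h uc_inj unfolding inj_on_def by metis
  have sub: "?g ` uc A S \<subseteq> {1..card (uc A S)}"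
  proof
    fix y assume "y \<in> ?g ` uc A S"
    then obtain b where b: "b \<in> uc A S" "y = ?g b" by blast
    have "b \<in> uc A S \<inter> {1..b}" using b by (auto simp: uc_def)
    then have "0 < ?g b" using f card_gt_0_iff by blast
    moreover have "?g b \<le> card (uc A S)" using f by (intro card_mono) auto
    ultimately show "y \<in> {1..card (uc A S)}" using b by simp
  qed
  have "?g ` uc A S = {1..card (uc A S)}"
    using sub inj f by (intro card_subset_eq) (auto simp: card_image)
  then have "k \<in> ?g ` uc A S" using assms by auto
  then show ?thesis using h by force
qed

text \<open>Each step takes the rightmost unmatched closing, the one of lowest height. The bound
  \<open>int t - int (phi j X)\<close> cuts off the \<open>t\<close> lowest heights of the original
  path.\<close>

lemma rup_iter_low:
  assumes "mat X" "t \<le> phi j X"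
  defines "h \<equiv> hgt (X (Suc j)) (X j)" and "U \<equiv> uc (X (Suc j)) (X j)"
  shows "(rup j ^^ t) X j = X j - {b \<in> U. h b < int t - int (phi j X)}"
    "(rup j ^^ t) X (Suc j) = X (Suc j) \<union> {b \<in> U. h b < int t - int (phi j X)}"
    "uc ((rup j ^^ t) X (Suc j)) ((rup j ^^ t) X j) = {b \<in> U. int t - int (phi j X) \<le> h b}"
proof -
  have f1: "fin1 (X j)" using mat_fin1 assms by blast
  have fU: "finite U" unfolding U_def using finite_uc[OF f1] .
  have "(rup j ^^ t) X j = X j - {b \<in> U. h b < int t - int (phi j X)} \<and>
    (rup j ^^ t) X (Suc j) = X (Suc j) \<union> {b \<in> U. h b < int t - int (phi j X)} \<and>
    uc ((rup j ^^ t) X (Suc j)) ((rup j ^^ t) X j) = {b \<in> U. int t - int (phi j X) \<le> h b}"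
    using assms(2)
  proof (induction t)
    case 0
    have "- int (phi j X) \<le> h b" for b
      using hgt_ge_card_uc[OF f1] unfolding h_def phi_def gphi_def .
    then have e: "{b \<in> U. h b < int 0 - int (phi j X)} = {}" "{b \<in> U. int 0 - int (phi j X) \<le> h b} = U"
      by (auto simp: not_less)
    show ?case unfolding e by (simp add: U_def)
  next
    case (Suc t)
    define Y where "Y = (rup j ^^ t) X"
    have IH: "Y j = X j - {b \<in> U. h b < int t - int (phi j X)}"
      "Y (Suc j) = X (Suc j) \<union> {b \<in> U. h b < int t - int (phi j X)}"
      "uc (Y (Suc j)) (Y j) = {b \<in> U. int t - int (phi j X) \<le> h b}"
      using Suc unfolding Y_def by auto
    have mY: "mat Y" "0 < phi j Y" unfolding Y_def using rup_iter[OF assms(1), of t j] Suc by auto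
    obtain c where c: "up (Y (Suc j)) (Y j) c" using gphi_pos mY unfolding phi_def by blast
    have cM: "c = Max (uc (Y (Suc j)) (Y j))" using up_Max[OF mat_fin1[OF mY(1)] c] .
    have "1 \<le> phi j X - t" "phi j X - t \<le> card (uc (X (Suc j)) (X j))"
      using Suc unfolding phi_def gphi_def by auto
    from uc_level[OF f1 this] obtain b where b: "b \<in> U" "h b = - int (phi j X - t)"
      unfolding U_def h_def by blast
    have hb: "h b = int t - int (phi j X)" using b Suc by simp
    have "b' \<le> b" if "b' \<in> {b \<in> U. int t - int (phi j X) \<le> h b}" for b'
    proof (rule ccontr)
      assume "\<not> b' \<le> b"
      then have "h b' < h b" using that b(1) uc_mono[of b "X (Suc j)" "X j" b'] by (auto simp: U_def h_def)
      then show False using that hb by auto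
    qed
    then have "Max (uc (Y (Suc j)) (Y j)) = b" unfolding IH(3) using b(1) hb fU by (intro Max_eqI) auto
    then have cb: "c = b" using cM by simp
    have e: "{b \<in> U. h b < int (Suc t) - int (phi j X)} = insert c {b \<in> U. h b < int t - int (phi j X)}"
    proof -
      have u: "b' = b" if "b' \<in> U" "h b' < int (Suc t) - int (phi j X)" "\<not> h b' < int t - int (phi j X)" for b'
      proof -
        have "h b' = h b" using that hb by auto
        then show ?thesis using uc_inj[of b' "X (Suc j)" "X j" b] that b unfolding U_def h_def by simp
      qed
      show ?thesis
      proof (rule set_eqI)
        fix d show "d \<in> {b \<in> U. h b < int (Suc t) - int (phi j X)} \<longleftrightarrow> d \<in> insert c {b \<in> U. h b < int t - int (phi j X)}"
          using u[of d] b(1) hb cb by auto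
      qed
    qed
    have e2: "{b \<in> U. int (Suc t) - int (phi j X) \<le> h b} = {b \<in> U. int t - int (phi j X) \<le> h b} - {c}"
      using e hb cb by (auto simp: not_less)
    have r: "(rup j ^^ Suc t) X = rup j Y" unfolding Y_def by simp
    have rows: "rup j Y (Suc j) = insert c (Y (Suc j))" "rup j Y j = Y j - {c}"
      unfolding rup_def using gup_rows[OF c] by auto
    show ?case unfolding r rows uo_uc_up[OF c] e e2 IH(3) unfolding IH(1,2) by auto
  qed
  then show "(rup j ^^ t) X j = X j - {b \<in> U. h b < int t - int (phi j X)}"
    "(rup j ^^ t) X (Suc j) = X (Suc j) \<union> {b \<in> U. h b < int t - int (phi j X)}"
    "uc ((rup j ^^ t) X (Suc j)) ((rup j ^^ t) X j) = {b \<in> U. int t - int (phi j X) \<le> h b}" by auto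
qed

text \<open>The Lascoux--Schuetzenberger involution, reflecting a string of row moves. By truncated
  subtraction at most one of the two exponents is nonzero.\<close>

definition sw :: "nat \<Rightarrow> mlq \<Rightarrow> mlq" where
  "sw j X = (rup j ^^ (card (X j) - card (X (Suc j)))) ((rdn j ^^ (card (X (Suc j)) - card (X j))) X)"

text \<open>The difference of the row sizes is \<open>phi - eps\<close>, so exactly the closings of
  height below \<open>- eps\<close> rise. These are the balls left over when the \<open>eps\<close>
  wrapped balls have taken the leftmost unmatched closings.\<close>

lemma sw_rows:
  assumes "mat X" "card (X (Suc j)) \<le> card (X j)"
  shows "sw j X j = X j - vset (X (Suc j)) (X j)" "sw j X (Suc j) = X (Suc j) \<union> vset (X (Suc j)) (X j)"
proof -
  let ?d = "card (X j) - card (X (Suc j))"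
  have e: "int (phi j X) - int (eps j X) = int ?d" using eps_phi[OF assms(1), of j] assms(2) by simp
  then have d: "?d \<le> phi j X" by simp
  have s: "sw j X = (rup j ^^ ?d) X" unfolding sw_def using assms by simp
  have i: "int ?d - int (phi j X) = - int (eps j X)" using e by simp
  have v: "{b \<in> uc (X (Suc j)) (X j). hgt (X (Suc j)) (X j) b < int ?d - int (phi j X)} = vset (X (Suc j)) (X j)"
    unfolding vset_def i eps_def geps_def by auto
  show "sw j X j = X j - vset (X (Suc j)) (X j)" "sw j X (Suc j) = X (Suc j) \<union> vset (X (Suc j)) (X j)"
    unfolding s rup_iter_low[OF assms(1) d] v by auto
qed

lemma sw_iter: assumes "mat X" "1 \<le> j"
  shows "\<exists>b k. sw j X = rops (replicate k (b, j)) X \<and> mat (sw j X)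
    \<and> card (sw j X j) = card (X (Suc j)) \<and> card (sw j X (Suc j)) = card (X j) \<and> sw j (sw j X) = X"
proof (cases "card (X (Suc j)) \<le> card (X j)")
  case True
  let ?d = "card (X j) - card (X (Suc j))"
  have d: "?d \<le> phi j X" using eps_phi[OF assms(1), of j] True by simp
  have s: "sw j X = (rup j ^^ ?d) X" unfolding sw_def using True by simp
  note it = rup_iter[OF assms(1) d, folded s]
  have inv: "(rdn j ^^ t) ((rup j ^^ t) X) = X" if "t \<le> phi j X" for t
    using that
  proof (induction t)
    case (Suc t)
    then have "rdn j (rup j ((rup j ^^ t) X)) = (rup j ^^ t) X"
      using rup_iter[OF assms(1), of t j] by (intro rup_counts(5)) auto
    then show ?case using Suc by (simp add: funpow_swap1)
  qed simp
  have c: "card (sw j X j) = card (X (Suc j))" "card (sw j X (Suc j)) = card (X j)"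
    using it True by auto
  have "sw j (sw j X) = (rdn j ^^ ?d) (sw j X)" unfolding sw_def[of j "sw j X"] c using True by simp
  also have "\<dots> = X" unfolding s using inv[OF d] .
  finally have "sw j (sw j X) = X" .
  moreover have "sw j X = rops (replicate ?d (True, j)) X" unfolding s rup_iter_rops ..
  ultimately show ?thesis using c it by blast
next
  case False
  let ?d = "card (X (Suc j)) - card (X j)"
  have d: "?d \<le> eps j X" using eps_phi[OF assms(1), of j] False by simp
  have s: "sw j X = (rdn j ^^ ?d) X" unfolding sw_def using False by simp
  note it = rdn_iter[OF assms d, folded s]
  have inv: "(rup j ^^ t) ((rdn j ^^ t) X) = X" if "t \<le> eps j X" for t
    using that
  proof (induction t)
    case (Suc t)
    then have "rup j (rdn j ((rdn j ^^ t) X)) = (rdn j ^^ t) X"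
      using rdn_iter[OF assms, of t] by (intro rdn_counts(5)) auto
    then show ?case using Suc by (simp add: funpow_swap1)
  qed simp
  have c: "card (sw j X j) = card (X (Suc j))" "card (sw j X (Suc j)) = card (X j)"
    using it False by auto
  have "sw j (sw j X) = (rup j ^^ ?d) (sw j X)" unfolding sw_def[of j "sw j X"] c using False by simp
  also have "\<dots> = X" unfolding s using inv[OF d] .
  finally have "sw j (sw j X) = X" .
  moreover have "sw j X = rops (replicate ?d (False, j)) X" unfolding s rdn_iter_rops ..
  ultimately show ?thesis using c it by blast
qed

lemma mat_sw: "mat X \<Longrightarrow> 1 \<le> j \<Longrightarrow> mat (sw j X)" using sw_iter by blast
lemma card_sw: "mat X \<Longrightarrow> 1 \<le> j \<Longrightarrow> card (sw j X j) = card (X (Suc j))"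
  "mat X \<Longrightarrow> 1 \<le> j \<Longrightarrow> card (sw j X (Suc j)) = card (X j)" using sw_iter by blast+
lemma sw_sw: "mat X \<Longrightarrow> 1 \<le> j \<Longrightarrow> sw j (sw j X) = X" using sw_iter by blast
lemma sw_other: "r \<noteq> j \<Longrightarrow> r \<noteq> Suc j \<Longrightarrow> sw j X r = X r"
  unfolding sw_def by (simp add: rup_iter_other rdn_iter_other)

lemma sw_conn:
  assumes "conn X Y" "mat X" "1 \<le> j"
  shows "\<exists>w. rword w \<and> sw j X = rops w X \<and> sw j Y = rops w Y"
proof -
  have c: "card (Y r) = card (X r)" for r using conn_inv[OF assms(1,2)] by simp
  show ?thesis unfolding sw_def c rdn_iter_rops rup_iter_rops rops_append[symmetric] using assms(3)
    by (intro exI[of _ "replicate (card (X (Suc j)) - card (X j)) (False, j) @ replicate (card (X j) - card (X (Suc j))) (True, j)"])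
      auto
qed

text \<open>A new ball at \<open>c\<close> cancels the next unmatched closing \<open>v1\<close> to
  its right, or, if there is none, becomes a wrapped ball. If \<open>v1\<close> was free it is the
  partner; otherwise one more wrapped ball's closing shifts on. In each case exactly the greedy
  partner leaves the free set, which is why the set of paired balls does not depend on the
  order.\<close>

lemma vset_insert:
  assumes A: "fin1 A" and S: "fin1 S" and c: "c \<notin> A" "1 \<le> c" and lt: "card A < card S"
  defines "x \<equiv> first_right (vset A S) c"
  shows "x \<in> vset A S" "vset (insert c A) S = vset A S - {x}"
    "card (uo (insert c A) S) = card (uo A S) + (if x < c then 1 else 0)"
proof -
  let ?h = "hgt A S" and ?h' = "hgt (insert c A) S"
  define ep where "ep = card (uo A S)"
  have h': "?h' q = ?h q + (if c \<le> q then 1 else 0)" for q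
  proof -
    have "insert c A \<inter> {1..q} = (if c \<le> q then insert c (A \<inter> {1..q}) else A \<inter> {1..q})" using c by auto
    then show ?thesis unfolding hgt_def using c by auto
  qed
  have cnt: "int ep - int (card (uc A S)) = int (card A) - int (card S)"
    unfolding ep_def using card_uo_uc[OF A S] .
  have cnt': "int (card (uo (insert c A) S)) - int (card (uc (insert c A) S)) = int (card A) + 1 - int (card S)"
    using card_uo_uc[of "insert c A" S] A S c by (simp add: fin1_def)
  have fU: "finite (uc A S)" using finite_uc[OF S] .
  have fV: "finite (vset A S)" unfolding vset_def using fU by simp
  have "1 \<le> Suc ep" "Suc ep \<le> card (uc A S)" using cnt lt by auto
  \<comment> \<open>\<open>y\<close> is the leftmost free ball: the first unmatched closing beyond
    those taken by the \<open>ep\<close> wrapped balls.\<close>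
  from uc_level[OF S this] obtain y where y: "y \<in> uc A S" "?h y = - int (Suc ep)" by blast
  have V: "vset A S = {b \<in> uc A S. ?h b < - int ep}" unfolding vset_def ep_def by auto
  have yV: "y \<in> vset A S" unfolding V using y by simp
  have ymin: "y \<le> b" if "b \<in> vset A S" for b
  proof (rule ccontr)
    assume "\<not> y \<le> b"
    moreover have "b \<in> uc A S" using that unfolding V by blast
    ultimately have "?h y < ?h b" using uc_mono[of b A S y] y(1) by simp
    then show False using that y unfolding V by auto
  qed
  have Vy: "vset A S - {y} = {b \<in> uc A S. ?h b < - int (Suc ep)}"
  proof (rule set_eqI)
    fix b show "b \<in> vset A S - {y} \<longleftrightarrow> b \<in> {b \<in> uc A S. ?h b < - int (Suc ep)}"
    proof (cases "b \<in> uc A S \<and> b \<noteq> y")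
      case True
      then have "?h b \<noteq> - int (Suc ep)" using uc_inj[of b A S y] y by auto
      then have "?h b < - int ep \<longleftrightarrow> ?h b < - int (Suc ep)" by linarith
      then show ?thesis using True unfolding V by auto
    next
      case False
      then show ?thesis using y unfolding V by auto
    qed
  qed
  have uclow: "b \<in> uc (insert c A) S \<longleftrightarrow> b \<in> uc A S" if "b < c" for b
  proof -
    have "?h' q = ?h q" if "q \<le> b" for q using h'[of q] that \<open>b < c\<close> by simp
    then show ?thesis by (simp add: uc_def)
  qed
  show "x \<in> vset A S" "vset (insert c A) S = vset A S - {x}"
    "card (uo (insert c A) S) = card (uo A S) + (if x < c then 1 else 0)"
  proof -
    have "x \<in> vset A S \<and> vset (insert c A) S = vset A S - {x} \<and>
      card (uo (insert c A) S) = card (uo A S) + (if x < c then 1 else 0)"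
    proof (cases "\<exists>b \<in> uc A S. c \<le> b")
      case False
      have uc': "uc (insert c A) S = uc A S"
      proof -
        have "b \<notin> uc (insert c A) S" if "c \<le> b" for b
        proof -
          obtain z where z: "z \<le> b" "?h z \<le> ?h b" "z = 0 \<or> z \<in> uc A S"
            using low_point'[of b A S] by metis
          have "z < c"
          proof (rule ccontr)
            assume "\<not> z < c"
            then have cz: "c \<le> z" by simp
            then have "z \<in> uc A S" using z(3) c(2) by (cases z) auto
            then show False using False cz by blast
          qed
          then have zb: "z < b" "?h' z < ?h' b" using that z by (auto simp: h')
          show ?thesis
          proof
            assume "b \<in> uc (insert c A) S"
            then have "?h' b < ?h' z" using zb(1) by (simp add: uc_def)
            then show False using zb(2) by simp
          qed
        qed
        then have "b \<in> uc (insert c A) S \<longleftrightarrow> b \<in> uc A S" for b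
          using uclow[of b] False by (cases "b < c") auto
        then show ?thesis by blast
      qed
      have e': "card (uo (insert c A) S) = Suc ep" using cnt cnt' unfolding uc' by linarith
      have lo: "b < c" if "b \<in> uc A S" for b using False that by auto
      have x: "x = y"
      proof -
        have "\<not> (\<exists>b \<in> vset A S. c \<le> b)" using False unfolding V by auto
        then have "x = Min (vset A S)" unfolding x_def first_right_def by simp
        also have "\<dots> = y" using fV yV ymin by (intro Min_eqI) auto
        finally show ?thesis .
      qed
      have "vset (insert c A) S = {b \<in> uc A S. ?h b < - int (Suc ep)}"
        unfolding vset_def e' uc' h' using lo by fastforce
      then show ?thesis unfolding x using Vy yV lo[OF y(1)] e' ep_def by simp
    next
      case True
      define v1 where "v1 = Min {b \<in> uc A S. c \<le> b}"
      have "v1 \<in> {b \<in> uc A S. c \<le> b}" unfolding v1_def using fU True by (intro Min_in) auto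
      then have v1: "v1 \<in> uc A S" "c \<le> v1" by auto
      have v1min: "v1 \<le> b" if "b \<in> uc A S" "c \<le> b" for b unfolding v1_def using fU that by (intro Min_le) auto
      \<comment> \<open>Left of \<open>c\<close> the path already comes within one of its height at
        \<open>v1\<close>; raising it by one from \<open>c\<close> on therefore spoils this record
        low and no later one.\<close>
      have v1lev: "\<exists>q<c. ?h q = ?h v1 + 1"
      proof -
        obtain q where q: "q \<le> c - 1" "?h q = - int (card (uc A S \<inter> {1..c - 1}))"
          using hgt_low[of "c - 1" A S] by blast
        have "uc A S \<inter> {1..v1} = insert v1 (uc A S \<inter> {1..c - 1})"
          using v1 v1min c by (auto simp: uc_def) (metis Suc_leI diff_Suc_1 le_antisym linorder_not_less not_less_eq_eq Suc_pred' One_nat_def Suc_le_eq)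
        moreover have "v1 \<notin> uc A S \<inter> {1..c - 1}" using v1 c by auto
        ultimately have "card (uc A S \<inter> {1..v1}) = Suc (card (uc A S \<inter> {1..c - 1}))" using fU by simp
        then have "?h v1 = ?h q - 1" using hgt_uc[OF v1(1)] q by simp
        then show ?thesis using q c by (intro exI[of _ q]) auto
      qed
      have uc': "uc (insert c A) S = uc A S - {v1}"
      proof (rule set_eqI)
        fix b
        consider "b < c" | "c \<le> b" "b \<in> uc A S" "b > v1" | "b = v1" | "c \<le> b" "b \<notin> uc A S"
          using v1min[of b] by fastforce
        then show "b \<in> uc (insert c A) S \<longleftrightarrow> b \<in> uc A S - {v1}"
        proof cases
          case 1 then show ?thesis using uclow[of b] v1 by auto
        next
          case 2
          have "?h' b < ?h' q" if "q < b" for q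
          proof (cases "q < c")
            case True
            have "?h b < ?h v1" "?h v1 < ?h q" using 2 v1 True by (auto simp: uc_def)
            then show ?thesis using True 2 by (simp add: h')
          next
            case False
            have "?h b < ?h q" using 2 that by (auto simp: uc_def)
            then show ?thesis using False 2 by (simp add: h')
          qed
          then show ?thesis using 2 c by (auto simp: uc_def)
        next
          case 3
          obtain q where "q < c" "?h q = ?h v1 + 1" using v1lev by blast
          then have "q < v1" "?h' q = ?h' v1" using v1 by (auto simp: h')
          then have "v1 \<notin> uc (insert c A) S" by (auto simp: uc_def)
          then show ?thesis using 3 by simp
        next
          case 4
          then obtain q where q: "q < b" "?h q \<le> ?h b" using c by (auto simp: uc_def not_less)
          then have "?h' q \<le> ?h' b" using 4 by (simp add: h')
          then have "b \<notin> uc (insert c A) S" using q by (auto simp: uc_def not_less)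
          then show ?thesis using 4 by simp
        qed
      qed
      have "card (uc A S) = Suc (card (uc A S - {v1}))" using card.remove[OF fU v1(1)] .
      then have e': "card (uo (insert c A) S) = ep" using cnt cnt' unfolding uc' by linarith
      have V': "vset (insert c A) S = {b \<in> uc A S. b \<noteq> v1 \<and> ?h' b < - int ep}"
        unfolding vset_def e' uc' by auto
      show ?thesis
      proof (cases "v1 \<in> vset A S")
        case T: True
        have x: "x = v1"
        proof -
          have "x = Min {b \<in> vset A S. c \<le> b}" unfolding x_def first_right_def using T v1 by auto
          also have "\<dots> = v1" using fU T v1 v1min unfolding V by (intro Min_eqI) auto
          finally show ?thesis .
        qed
        have "b \<in> vset (insert c A) S \<longleftrightarrow> b \<in> vset A S - {v1}" for b
        proof (cases "b < c")
          case True then show ?thesis unfolding V' V using v1 by (auto simp: h')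
        next
          case False
          have "?h b < ?h v1" if "b \<in> uc A S" "b \<noteq> v1"
            using uc_mono[OF v1(1) that(1)] v1min[OF that(1)] that False by auto
          then show ?thesis unfolding V' V using v1 T False unfolding V by (auto simp: h')
        qed
        then show ?thesis unfolding x using T v1 e' ep_def by auto
      next
        case F: False
        \<comment> \<open>Here \<open>v1\<close> already belongs to a wrapped ball, and all free
          balls lie to its right; \<open>c\<close> takes the leftmost of them without
          wrapping.\<close>
        then have hv1: "- int ep \<le> ?h v1" unfolding V using v1 by auto
        have gt: "v1 < b" if "b \<in> vset A S" for b
        proof (rule ccontr)
          assume "\<not> v1 < b"
          then have "?h v1 \<le> ?h b" using that v1(1) uc_mono[of b A S v1] unfolding V by (cases "b = v1") auto
          then show False using that hv1 unfolding V by auto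
        qed
        have all: "{b \<in> vset A S. c \<le> b} = vset A S" using gt v1 by fastforce
        have x: "x = y"
        proof -
          have "x = Min {b \<in> vset A S. c \<le> b}" unfolding x_def first_right_def using yV gt[OF yV] v1 by auto
          also have "\<dots> = y" unfolding all using fV yV ymin by (intro Min_eqI) auto
          finally show ?thesis .
        qed
        have "b \<in> vset (insert c A) S \<longleftrightarrow> b \<in> {b \<in> uc A S. ?h b < - int (Suc ep)}" for b
        proof (cases "b < c")
          case True
          have "?h v1 < ?h b" if "b \<in> uc A S" using uc_mono[OF that v1(1)] True v1 by auto
          then show ?thesis unfolding V' using True hv1 by (auto simp: h')
        next
          case False
          have "b \<noteq> v1" if "?h b < - int (Suc ep)" using that hv1 by auto
          then show ?thesis unfolding V' using False by (auto simp: h')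
        qed
        then show ?thesis unfolding x using Vy yV e' ep_def gt[OF yV] v1 by auto
      qed
    qed
    then show "x \<in> vset A S" "vset (insert c A) S = vset A S - {x}"
      "card (uo (insert c A) S) = card (uo A S) + (if x < c then 1 else 0)" by auto
  qed
qed

lemma pair_balls_append:
  "pair_balls (cs @ ds) S = pair_balls cs S @ pair_balls ds (S - snd ` set (pair_balls cs S))"
proof (induction cs arbitrary: S)
  case (Cons c cs)
  have "S - {first_right S c} - snd ` set (pair_balls cs (S - {first_right S c})) =
    S - snd ` set (pair_balls (c # cs) S)" by auto
  then show ?case using Cons by simp
qed simp

lemma map_fst_pair_balls [simp]: "map fst (pair_balls cs S) = cs"
  by (induction cs S rule: pair_balls.induct) auto

lemma vset_empty: "fin1 S \<Longrightarrow> vset {} S = S" and uo_empty: "uo {} S = {}"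
proof -
  show u: "uo {} S = {}" using uo_subset[of "{}" S] by simp
  assume S: "fin1 S"
  have neg: "hgt {} S b < hgt {} S q" if "b \<in> S" "q < b" for b q
  proof -
    have "b \<in> S \<inter> {1..b}" "b \<notin> S \<inter> {1..q}" using that S by (auto simp: fin1_def Suc_le_eq intro: gr0I)
    then have "S \<inter> {1..q} \<subset> S \<inter> {1..b}" using that by fastforce
    then have "card (S \<inter> {1..q}) < card (S \<inter> {1..b})" by (intro psubset_card_mono) auto
    then show ?thesis by (simp add: hgt_def)
  qed
  have b1: "1 \<le> b" if "b \<in> S" for b using that S by (cases b) (auto simp: fin1_def)
  have "uc {} S = S" using neg b1 uc_subset[of "{}" S] by (auto simp: uc_def)
  moreover have "hgt {} S b < 0" if "b \<in> S" for b using neg[OF that, of 0] b1[OF that] by auto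
  ultimately show "vset {} S = S" unfolding vset_def u by auto
qed

text \<open>Adds the processed balls one at a time by \<open>vset_insert\<close>. The right-hand
  sides depend only on \<open>set cs\<close>, so neither the order nor the treatment of ties affects
  them.\<close>

lemma pair_balls_vset:
  assumes "fin1 S" "distinct cs" "0 \<notin> set cs" "length cs \<le> card S"
  shows "S - snd ` set (pair_balls cs S) = vset (set cs) S \<and>
    length (filter (\<lambda>(i, j). j < i) (pair_balls cs S)) = card (uo (set cs) S) \<and>
    distinct (map snd (pair_balls cs S)) \<and> snd ` set (pair_balls cs S) \<subseteq> S"
  using assms(2-)
proof (induction cs rule: rev_induct)
  case Nil then show ?case using vset_empty[OF assms(1)] uo_empty by simp
next
  case (snoc c cs)
  then have IH: "S - snd ` set (pair_balls cs S) = vset (set cs) S"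
    "length (filter (\<lambda>(i, j). j < i) (pair_balls cs S)) = card (uo (set cs) S)"
    "distinct (map snd (pair_balls cs S))" "snd ` set (pair_balls cs S) \<subseteq> S" by auto
  define x where "x = first_right (vset (set cs) S) c"
  have lt: "card (set cs) < card S" using snoc distinct_card[of cs] by simp
  have fin: "fin1 (set cs)" "c \<notin> set cs" "1 \<le> c" using snoc by (auto simp: fin1_def Suc_le_eq intro: gr0I)
  note v = vset_insert[OF fin(1) assms(1) fin(2,3) lt, folded x_def]
  have p: "pair_balls (cs @ [c]) S = pair_balls cs S @ [(c, x)]"
    unfolding pair_balls_append IH(1) by (simp add: x_def)
  have xs: "x \<in> S" "x \<notin> snd ` set (pair_balls cs S)" using v(1) IH(1) by auto
  have "S - snd ` set (pair_balls (cs @ [c]) S) = vset (set cs) S - {x}"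
    unfolding p using IH(1) by auto
  then show ?case unfolding p using v IH xs by auto
qed

section \<open>Labels and major index\<close>

text \<open>\<open>foldr\<close> applies \<open>sw (k - 1)\<close> first and \<open>sw r\<close>
  last; rows below \<open>r\<close> are untouched.\<close>

definition Tf :: "nat \<Rightarrow> nat \<Rightarrow> mlq \<Rightarrow> mlq" where
  "Tf k r M = foldr sw [r..<k] M"

definition psz :: "mlq \<Rightarrow> bool" where
  "psz M \<longleftrightarrow> (\<forall>r\<ge>1. card (M (Suc r)) \<le> card (M r))"

lemma Tf_refl [simp]: "Tf k k M = M"
  by (simp add: Tf_def)

lemma Tf_Suc: "r < k \<Longrightarrow> Tf k r M = sw r (Tf k (Suc r) M)"
  by (simp add: Tf_def upt_conv_Cons del: upt_Suc)

lemma psz_mono: "psz M \<Longrightarrow> 1 \<le> r \<Longrightarrow> r \<le> k \<Longrightarrow> card (M k) \<le> card (M r)"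
proof (induction k)
  case (Suc k)
  show ?case
  proof (cases "r = Suc k")
    case False
    then have "r \<le> k" "1 \<le> k" using Suc by auto
    then show ?thesis using Suc unfolding psz_def by (meson order_trans)
  qed simp
qed simp

lemma Tf_rows:
  assumes "mat M" "1 \<le> r" "r \<le> k"
  shows "mat (Tf k r M)" "\<And>q. q < r \<Longrightarrow> Tf k r M q = M q" "card (Tf k r M r) = card (M k)"
proof -
  have "mat (Tf k r M) \<and> (\<forall>q<r. Tf k r M q = M q) \<and> card (Tf k r M r) = card (M k)"
    using assms(2,3)
  proof (induction "k - r" arbitrary: r)
    case 0 then show ?case using assms(1) by simp
  next
    case (Suc d)
    then have "mat (Tf k (Suc r) M) \<and> (\<forall>q<Suc r. Tf k (Suc r) M q = M q) \<and> card (Tf k (Suc r) M (Suc r)) = card (M k)"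
      by simp
    then show ?case using Suc by (auto simp: Tf_Suc mat_sw card_sw sw_other)
  qed
  then show "mat (Tf k r M)" "\<And>q. q < r \<Longrightarrow> Tf k r M q = M q" "card (Tf k r M r) = card (M k)" by auto
qed

lemma Tf_conn:
  assumes "conn X Y" "mat X" "1 \<le> r"
  shows "\<exists>w. rword w \<and> Tf k r X = rops w X \<and> Tf k r Y = rops w Y"
proof (cases "r \<le> k")
  case False
  then show ?thesis by (intro exI[of _ "[]"]) (simp add: Tf_def)
next
  case True
  then show ?thesis using assms(3)
  proof (induction "k - r" arbitrary: r)
    case 0 then show ?case by (intro exI[of _ "[]"]) simp
  next
    case (Suc d)
    have "d = k - Suc r" "Suc r \<le> k" using Suc(2) by auto
    from Suc(1)[OF this] obtain w where w: "rword w" "Tf k (Suc r) X = rops w X" "Tf k (Suc r) Y = rops w Y" by auto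
    obtain v where "rword v" "sw r (rops w X) = rops v (rops w X)" "sw r (rops w Y) = rops v (rops w Y)"
      using sw_conn[OF conn_rops[OF assms(1,2) w(1)] mat_rops[OF w(1) assms(2)] Suc(4)] by blast
    moreover have "r < k" using Suc(2) by simp
    ultimately show ?case using w by (intro exI[of _ "w @ v"]) (simp add: rops_append Tf_Suc)
  qed
qed

lemma sorted_split:
  fixes f :: "'a \<Rightarrow> 'b::linorder"
  shows "sorted (map f xs) \<Longrightarrow> xs = filter (\<lambda>x. f x \<le> t) xs @ filter (\<lambda>x. \<not> f x \<le> t) xs"
proof (induction xs)
  case (Cons a xs)
  show ?case
  proof (cases "f a \<le> t")
    case True then show ?thesis using Cons by simp
  next
    case False
    then have "filter (\<lambda>x. f x \<le> t) xs = []" "filter (\<lambda>x. \<not> f x \<le> t) xs = xs"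
      using Cons(2) by (fastforce simp: filter_empty_conv filter_id_conv)+
    then show ?thesis using False by simp
  qed
qed simp

text \<open>Balls are processed by decreasing label, so for every threshold \<open>k\<close> the
  balls of label at least \<open>k\<close> form a prefix of the run.\<close>

lemma row_pairing_split:
  assumes "finite U"
  obtains ls1 ls2 where
    "row_pairing lab U S = pair_balls ls1 S @ pair_balls ls2 (S - snd ` set (pair_balls ls1 S))"
    "row_pairing lab U S = pair_balls (ls1 @ ls2) S"
    "distinct (ls1 @ ls2)" "set ls1 = {i \<in> U. k \<le> lab i}" "set ls2 = {i \<in> U. \<not> k \<le> lab i}"
proof -
  define ls where "ls = sort_key (\<lambda>c. - int (lab c)) (sorted_list_of_set U)"
  define ls1 where "ls1 = filter (\<lambda>c. - int (lab c) \<le> - int k) ls"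
  define ls2 where "ls2 = filter (\<lambda>c. \<not> - int (lab c) \<le> - int k) ls"
  have ls: "ls = ls1 @ ls2" unfolding ls1_def ls2_def by (rule sorted_split) (simp add: ls_def)
  have d: "distinct ls" "set ls = U" using assms by (auto simp: ls_def)
  show ?thesis
  proof (rule that[of ls1 ls2])
    show p: "row_pairing lab U S = pair_balls (ls1 @ ls2) S"
      unfolding row_pairing_def ls_def[symmetric] using ls by simp
    show "row_pairing lab U S = pair_balls ls1 S @ pair_balls ls2 (S - snd ` set (pair_balls ls1 S))"
      unfolding p by (rule pair_balls_append)
    show "distinct (ls1 @ ls2)" using d ls by simp
    show "set ls1 = {i \<in> U. k \<le> lab i}" "set ls2 = {i \<in> U. \<not> k \<le> lab i}"
      unfolding ls1_def ls2_def using d by auto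
  qed
qed

lemma fst_pair_balls: assumes "p \<in> set (pair_balls cs S)" shows "fst p \<in> set cs"
proof -
  have "fst p \<in> fst ` set (pair_balls cs S)" using assms by (rule imageI)
  then show ?thesis unfolding set_map[symmetric] map_fst_pair_balls .
qed

lemma fm_label_rec:
  assumes "mat M" "psz M" "1 \<le> r" "r \<le> height M"
  shows "fm_label M r j = (if j \<notin> M r then 0
     else case map_of (map prod.swap (row_pairing (fm_label M (Suc r)) (M (Suc r)) (M r))) j
       of Some i \<Rightarrow> fm_label M (Suc r) i | None \<Rightarrow> r)"
  using assms(4) by (subst fm_label.simps) simp

text \<open>Downward induction on the row. The balls above with label at least \<open>k\<close> are
  paired first, and their partners form what \<open>sw r\<close> leaves in row \<open>r\<close>, by
  \<open>pair_balls_vset\<close> and \<open>sw_rows\<close>. The start is the empty row above the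
  height.\<close>

lemma fm_main:
  assumes M: "mat M" "psz M" and r: "1 \<le> r"
  shows "(\<forall>c. c \<notin> M r \<longrightarrow> fm_label M r c = 0) \<and> (\<forall>c \<in> M r. r \<le> fm_label M r c) \<and>
    (\<forall>k\<ge>r. {c \<in> M r. k \<le> fm_label M r c} = Tf k r M r)"
  using r
proof (induction "Suc (height M) - r" arbitrary: r)
  case 0
  then have h: "height M < r" by simp
  obtain L n where b: "box L n M" using M by (auto simp: mat_def)
  have e: "M q = {}" if "r \<le> q" for q using box_height(1)[OF b] that h by simp
  have "fm_label M r = (\<lambda>j. 0)" using h by (subst fm_label.simps) simp
  moreover have "Tf k r M r = {}" if "k \<ge> r" for k
  proof -
    have "card (Tf k r M r) = 0" using Tf_rows(3)[OF M(1) 0(2) that] e[OF that] by simp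
    then show ?thesis using mat_finite[OF Tf_rows(1)[OF M(1) 0(2) that], of r] by simp
  qed
  ultimately show ?case using e by auto
next
  case (Suc d)
  then have rh: "r \<le> height M" by simp
  define lab where "lab = fm_label M (Suc r)"
  have IH: "\<And>c. c \<in> M (Suc r) \<Longrightarrow> Suc r \<le> lab c" "\<And>k. k \<ge> Suc r \<Longrightarrow> {c \<in> M (Suc r). k \<le> lab c} = Tf k (Suc r) M (Suc r)"
    using Suc(1)[of "Suc r"] Suc(2) unfolding lab_def by auto
  define ps where "ps = row_pairing lab (M (Suc r)) (M r)"
  have rec: "fm_label M r j = (if j \<notin> M r then 0 else case map_of (map prod.swap ps) j of Some i \<Rightarrow> lab i | None \<Rightarrow> r)" for j
    using fm_label_rec[OF M Suc(3) rh] unfolding lab_def ps_def .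
  have fU: "finite (M (Suc r))" and fS: "fin1 (M r)" using mat_finite mat_fin1 M by auto
  have szU: "card (M (Suc r)) \<le> card (M r)" using M(2) Suc(3) by (auto simp: psz_def)
  have z: "0 \<notin> M (Suc r)" using mat_fin1[OF M(1)] by (auto simp: fin1_def)
  have split: "\<exists>ls1 ls2. ps = pair_balls ls1 (M r) @ pair_balls ls2 (M r - snd ` set (pair_balls ls1 (M r))) \<and>
     distinct (map snd ps) \<and> distinct (ls1 @ ls2) \<and> set ls1 = {i \<in> M (Suc r). k \<le> lab i} \<and>
     set ls2 = {i \<in> M (Suc r). \<not> k \<le> lab i} \<and> snd ` set (pair_balls ls1 (M r)) = M r - vset (set ls1) (M r)" for k
  proof -
    obtain ls1 ls2 where l: "ps = pair_balls ls1 (M r) @ pair_balls ls2 (M r - snd ` set (pair_balls ls1 (M r)))"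
      "ps = pair_balls (ls1 @ ls2) (M r)"
      "distinct (ls1 @ ls2)" "set ls1 = {i \<in> M (Suc r). k \<le> lab i}" "set ls2 = {i \<in> M (Suc r). \<not> k \<le> lab i}"
      by (rule row_pairing_split[OF fU, of lab "M r" k, folded ps_def])
    have "set (ls1 @ ls2) = M (Suc r)" using l(4,5) by auto
    then have len: "length (ls1 @ ls2) \<le> card (M r)" using distinct_card[OF l(3)] szU by simp
    have d: "distinct (map snd ps)" unfolding l(2)
      using pair_balls_vset[OF fS l(3) _ len] l(4,5) z by auto
    have "M r - snd ` set (pair_balls ls1 (M r)) = vset (set ls1) (M r)" "snd ` set (pair_balls ls1 (M r)) \<subseteq> M r"
      using pair_balls_vset[OF fS, of ls1] l(3,4) z len by auto
    then have e: "snd ` set (pair_balls ls1 (M r)) = M r - vset (set ls1) (M r)" by blast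
    show ?thesis by (intro exI[of _ ls1] exI[of _ ls2] conjI l(1) d l(3-5) e)
  qed
  have dsnd: "distinct (map snd ps)" using split by blast
  have mapof: "map_of (map prod.swap ps) j = Some i \<longleftrightarrow> (i, j) \<in> set ps" for i j
  proof -
    have "distinct (map fst (map prod.swap ps))" using dsnd by (simp add: comp_def)
    then have "map_of (map prod.swap ps) j = Some i \<longleftrightarrow> (j, i) \<in> set (map prod.swap ps)"
      by (rule map_of_eq_Some_iff)
    then show ?thesis by force
  qed
  have fstU: "i \<in> M (Suc r)" if "(i, j) \<in> set ps" for i j
    using split[of 0] that fst_pair_balls by fastforce
  have lower: "r \<le> fm_label M r c" if "c \<in> M r" for c
  proof (cases "map_of (map prod.swap ps) c")
    case None then show ?thesis unfolding rec using that by simp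
  next
    case (Some i)
    then have "Suc r \<le> lab i" using IH(1) fstU mapof by blast
    then show ?thesis unfolding rec using that Some by simp
  qed
  have "{c \<in> M r. k \<le> fm_label M r c} = Tf k r M r" if "k \<ge> r" for k
  proof (cases "k = r")
    case True then show ?thesis using lower by auto
  next
    case False
    then have k: "Suc r \<le> k" using that by simp
    \<comment> \<open>Above the threshold \<open>r\<close> a label is always inherited, because an
      unpaired ball gets label \<open>r\<close> itself; only the prefix \<open>ls1\<close>
      matters.\<close>
    obtain ls1 ls2 where l: "ps = pair_balls ls1 (M r) @ pair_balls ls2 (M r - snd ` set (pair_balls ls1 (M r)))"
      "set ls1 = {i \<in> M (Suc r). k \<le> lab i}" "set ls2 = {i \<in> M (Suc r). \<not> k \<le> lab i}"
      "snd ` set (pair_balls ls1 (M r)) = M r - vset (set ls1) (M r)" using split[of k] by blast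
    define Y where "Y = Tf k (Suc r) M"
    have Y: "mat Y" "Y r = M r" "Y (Suc r) = set ls1" "card (Y (Suc r)) \<le> card (Y r)"
      using Tf_rows[OF M(1) _ k] IH(2)[OF k] l(2) psz_mono[OF M(2) Suc(3) that] unfolding Y_def by auto
    have "Tf k r M r = snd ` set (pair_balls ls1 (M r))"
      unfolding l(4) using sw_rows(1)[OF Y(1,4)] Y(2,3) k unfolding Y_def by (simp add: Tf_Suc)
    moreover have "c \<in> M r \<and> k \<le> fm_label M r c \<longleftrightarrow> c \<in> snd ` set (pair_balls ls1 (M r))" for c
    proof
      assume c: "c \<in> M r \<and> k \<le> fm_label M r c"
      have "fm_label M r c = (case map_of (map prod.swap ps) c of Some i \<Rightarrow> lab i | None \<Rightarrow> r)"
        using c rec[of c] by presburger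
      then have "k \<le> (case map_of (map prod.swap ps) c of Some i \<Rightarrow> lab i | None \<Rightarrow> r)" using c by presburger
      then obtain i where i: "map_of (map prod.swap ps) c = Some i" "k \<le> lab i" using k by (auto split: option.splits)
      then have ic: "(i, c) \<in> set ps" using mapof by simp
      then have "(i, c) \<notin> set (pair_balls ls2 (M r - snd ` set (pair_balls ls1 (M r))))"
        using fst_pair_balls[of "(i, c)" ls2] l(3) i(2) by auto
      then have "(i, c) \<in> set (pair_balls ls1 (M r))" using ic unfolding l(1) by simp
      then show "c \<in> snd ` set (pair_balls ls1 (M r))" by force
    next
      assume c: "c \<in> snd ` set (pair_balls ls1 (M r))"
      then obtain i where i: "(i, c) \<in> set (pair_balls ls1 (M r))" by force
      then have "i \<in> set ls1" using fst_pair_balls by fastforce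
      then have "k \<le> lab i" using l(2) by simp
      moreover have "(i, c) \<in> set ps" unfolding l(1) using i by simp
      then have "map_of (map prod.swap ps) c = Some i" by (rule iffD2[OF mapof])
      moreover have "c \<in> M r" using c l(4) by auto
      ultimately show "c \<in> M r \<and> k \<le> fm_label M r c" using rec[of c] by simp
    qed
    ultimately show ?thesis by blast
  qed
  moreover have "fm_label M r c = 0" if "c \<notin> M r" for c using rec[of c] that by presburger
  ultimately show ?case using lower by blast
qed

lemma fm_label_ge: "mat M \<Longrightarrow> psz M \<Longrightarrow> 1 \<le> r \<Longrightarrow> r \<le> k \<Longrightarrow> 1 \<le> k \<Longrightarrow> k \<le> fm_label M r c \<longleftrightarrow> c \<in> Tf k r M r"
proof -
  assume a: "mat M" "psz M" "1 \<le> r" "r \<le> k" "1 \<le> k"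
  have m: "{c \<in> M r. k \<le> fm_label M r c} = Tf k r M r" "c \<notin> M r \<Longrightarrow> fm_label M r c = 0"
    using fm_main[OF a(1-3)] a(4) by auto
  have "c \<in> Tf k r M r \<longleftrightarrow> c \<in> M r \<and> k \<le> fm_label M r c" unfolding m(1)[symmetric] by simp
  then show ?thesis using m(2) a(5) by (cases "c \<in> M r") auto
qed

text \<open>The balls of a larger label would form a row of \<open>Tf (Suc (height M)) r M\<close>
  whose size is that of an empty row.\<close>

lemma fm_label_height:
  assumes "mat M" "psz M" "1 \<le> r" "r \<le> height M" shows "fm_label M r c \<le> height M"
proof (rule ccontr)
  assume "\<not> fm_label M r c \<le> height M"
  then have "c \<in> Tf (Suc (height M)) r M r" using fm_label_ge[OF assms(1-3), of "Suc (height M)" c] assms by simp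
  moreover have "M (Suc (height M)) = {}" using box_height(1) assms(1) mat_def by blast
  then have "card (Tf (Suc (height M)) r M r) = 0" using Tf_rows(3)[OF assms(1,3), of "Suc (height M)"] assms by simp
  then have "Tf (Suc (height M)) r M r = {}"
    using mat_finite[OF Tf_rows(1)[OF assms(1,3), of "Suc (height M)"], of r] assms by simp
  ultimately show False by simp
qed

text \<open>The pairs from balls of label at least \<open>k\<close> are a complete run of
  \<open>pair_balls\<close>, whose wraps are its unmatched openings.\<close>

lemma wraps_count:
  assumes M: "mat M" "psz M" and r: "1 \<le> r" "Suc r \<le> k"
  shows "card {(i, j) \<in> fm_pairs M (Suc r). j < i \<and> k \<le> fm_label M (Suc r) i} = eps r (Tf k (Suc r) M)"
proof -
  define lab where "lab = fm_label M (Suc r)"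
  have fU: "finite (M (Suc r))" and fS: "fin1 (M r)" using mat_finite mat_fin1 M by auto
  have szU: "card (M (Suc r)) \<le> card (M r)" using M(2) r by (auto simp: psz_def)
  have z: "0 \<notin> M (Suc r)" using mat_fin1[OF M(1)] by (auto simp: fin1_def)
  obtain ls1 ls2 where l: "row_pairing lab (M (Suc r)) (M r) = pair_balls ls1 (M r) @ pair_balls ls2 (M r - snd ` set (pair_balls ls1 (M r)))"
      "row_pairing lab (M (Suc r)) (M r) = pair_balls (ls1 @ ls2) (M r)"
      "distinct (ls1 @ ls2)" "set ls1 = {i \<in> M (Suc r). k \<le> lab i}" "set ls2 = {i \<in> M (Suc r). \<not> k \<le> lab i}"
    by (rule row_pairing_split[OF fU, of lab "M r" k])
  have s: "set ls1 = Tf k (Suc r) M (Suc r)" using fm_main[OF M, of "Suc r"] r l(4) unfolding lab_def by simp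
  have "set (ls1 @ ls2) = M (Suc r)" using l by auto
  then have len: "length (ls1 @ ls2) \<le> card (M r)" using distinct_card[OF l(3)] szU by simp
  have e: "{(i, j) \<in> fm_pairs M (Suc r). j < i \<and> k \<le> lab i} = set (filter (\<lambda>(i, j). j < i) (pair_balls ls1 (M r)))"
  proof (rule set_eqI)
    fix p :: "nat \<times> nat"
    obtain i j where p: "p = (i, j)" by force
    show "p \<in> {(i, j) \<in> fm_pairs M (Suc r). j < i \<and> k \<le> lab i} \<longleftrightarrow> p \<in> set (filter (\<lambda>(i, j). j < i) (pair_balls ls1 (M r)))"
      unfolding p fm_pairs_def lab_def[symmetric] diff_Suc_1 l(1)
      using fst_pair_balls[of "(i, j)" ls1 "M r"] l(4,5)
        fst_pair_balls[of "(i, j)" ls2 "M r - snd ` set (pair_balls ls1 (M r))"] by auto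
  qed
  have "distinct (map fst (pair_balls ls1 (M r)))" using l(3) by simp
  then have "distinct (pair_balls ls1 (M r))" by (rule distinct_map[THEN iffD1, THEN conjunct1])
  then have "card {(i, j) \<in> fm_pairs M (Suc r). j < i \<and> k \<le> lab i} = length (filter (\<lambda>(i, j). j < i) (pair_balls ls1 (M r)))"
    unfolding e by (intro distinct_card) simp
  also have "\<dots> = card (uo (set ls1) (M r))"
    using pair_balls_vset[OF fS, of ls1] l z len by auto
  finally show ?thesis unfolding s eps_def geps_def lab_def using Tf_rows(2)[OF M(1) _ r(2), of r] by simp
qed

text \<open>The weight of a wrapping ball of label \<open>l\<close> counts the thresholds
  \<open>k\<close> with \<open>r \<le> k \<le> l\<close>. Summing over thresholds removes the labels
  and leaves string lengths, which are constant on components.\<close>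

lemma maj_eq:
  assumes M: "mat M" "psz M"
  shows "maj M = (\<Sum>r = 2..height M. \<Sum>k = r..height M. eps (r - 1) (Tf k r M))"
  unfolding maj_def
proof (rule sum.cong[OF refl])
  fix r assume "r \<in> {2..height M}"
  then have r: "2 \<le> r" "r \<le> height M" by auto
  define W where "W = {(i, j) \<in> fm_pairs M r. j < i}"
  have fW: "finite W" unfolding W_def fm_pairs_def by (rule finite_subset[of _ "set (row_pairing (fm_label M r) (M r) (M (r - 1)))"]) auto
  have fstM: "fst p \<in> M r" if "p \<in> W" for p
  proof -
    have "p \<in> set (pair_balls (sort_key (\<lambda>c. - int (fm_label M r c)) (sorted_list_of_set (M r))) (M (r - 1)))"
      using that unfolding W_def fm_pairs_def row_pairing_def by auto
    from fst_pair_balls[OF this] show ?thesis using mat_finite[OF M(1), of r] by simp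
  qed
  have lab: "fm_label M r i - r + 1 = (\<Sum>k = r..height M. of_bool (k \<le> fm_label M r i))" if "i \<in> M r" for i
  proof -
    have "r \<le> fm_label M r i" "fm_label M r i \<le> height M"
      using fm_main[OF M, of r] fm_label_height[OF M, of r i] r that by auto
    then have "{r..height M} \<inter> {k. k \<le> fm_label M r i} = {r..fm_label M r i}" by auto
    then show ?thesis using \<open>r \<le> fm_label M r i\<close> by (simp add: sum.If_cases of_bool_def)
  qed
  have "(\<Sum>(i, j) \<in> W. fm_label M r i - r + 1) = (\<Sum>p \<in> W. \<Sum>k = r..height M. of_bool (k \<le> fm_label M r (fst p)))"
    using fstM lab by (intro sum.cong) auto
  also have "\<dots> = (\<Sum>k = r..height M. \<Sum>p \<in> W. of_bool (k \<le> fm_label M r (fst p)))" by (rule sum.swap)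
  also have "\<dots> = (\<Sum>k = r..height M. eps (r - 1) (Tf k r M))"
  proof (rule sum.cong[OF refl])
    fix k assume "k \<in> {r..height M}"
    then have k: "r \<le> k" by simp
    have "(\<Sum>p \<in> W. of_bool (k \<le> fm_label M r (fst p))) = card (W \<inter> {p. k \<le> fm_label M r (fst p)})"
      using fW by (simp add: sum.If_cases of_bool_def)
    also have "W \<inter> {p. k \<le> fm_label M r (fst p)} = {(i, j) \<in> fm_pairs M r. j < i \<and> k \<le> fm_label M r i}"
      unfolding W_def by auto
    also have "card \<dots> = eps (r - 1) (Tf k r M)"
      using wraps_count[OF M, of "r - 1" k] r k by simp
    finally show "(\<Sum>p \<in> W. of_bool (k \<le> fm_label M r (fst p))) = eps (r - 1) (Tf k r M)" .
  qed
  finally show "(\<Sum>(i, j) \<in> {(i, j) \<in> fm_pairs M r. j < i}. fm_label M r i - r + 1) = (\<Sum>k = r..height M. eps (r - 1) (Tf k r M))"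
    unfolding W_def .
qed

lemma psz_conn: "conn X Y \<Longrightarrow> mat X \<Longrightarrow> psz Y \<longleftrightarrow> psz X"
  unfolding psz_def using conn_inv(1) by simp

lemma maj_conn: assumes "conn X Y" "mat X" "psz X" shows "maj X = maj Y"
proof -
  have mY: "mat Y" "psz Y" using conn_mat psz_conn assms by blast+
  have "eps (r - 1) (Tf k r X) = eps (r - 1) (Tf k r Y)" if "2 \<le> r" for r k
  proof -
    have "1 \<le> r" using that by simp
    from Tf_conn[OF assms(1,2) this, of k] obtain w where w: "rword w" "Tf k r X = rops w X" "Tf k r Y = rops w Y"
      by blast
    show ?thesis unfolding w(2,3)
      using conn_inv(2)[OF conn_rops[OF assms(1,2) w(1)] mat_rops[OF w(1) assms(2)], of "r - 1"] that by simp
  qed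
  then show ?thesis unfolding maj_eq[OF assms(2,3)] maj_eq[OF mY] conn_height[OF assms(1,2)]
    by (intro sum.cong) auto
qed

section \<open>Column highest arrays\<close>

lemma hgt_diff: assumes "1 \<le> u" "u \<le> Suc q"
  shows "hgt A B q - hgt A B (u - 1) = int (card (A \<inter> {u..q})) - int (card (B \<inter> {u..q}))"
proof -
  have "card (S \<inter> {1..q}) = card (S \<inter> {1..u - 1}) + card (S \<inter> {u..q})" for S :: "nat set"
  proof -
    have "S \<inter> {1..q} = (S \<inter> {1..u - 1}) \<union> (S \<inter> {u..q})" using assms by auto
    moreover have "(S \<inter> {1..u - 1}) \<inter> (S \<inter> {u..q}) = {}" using assms by auto
    ultimately show ?thesis by (metis card_Un_disjoint finite_Int finite_atLeastAtMost)
  qed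
  then show ?thesis unfolding hgt_def by simp
qed

text \<open>From each place on, \<open>B\<close> has enough balls to close those of
  \<open>U1\<close>, while no closing follows a ball of \<open>U2\<close>. For a ball of
  \<open>U1\<close> the path is compared at the last closing.\<close>

lemma uo_split:
  assumes f: "fin1 U1" "fin1 U2" "fin1 B"
    and U2: "\<And>u b. u \<in> U2 \<Longrightarrow> b \<in> B \<union> U1 \<Longrightarrow> b < u"
    and U1: "\<And>p. card (U1 \<inter> {p..}) \<le> card (B \<inter> {p..})"
  shows "uo (U1 \<union> U2) B = U2"
proof
  show "uo (U1 \<union> U2) B \<subseteq> U2"
  proof
    fix u assume u: "u \<in> uo (U1 \<union> U2) B"
    show "u \<in> U2"
    proof (rule ccontr)
      assume "u \<notin> U2"
      then have u1: "u \<in> U1" using u uo_subset by blast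
      then have "u \<in> U1 \<inter> {u..}" by simp
      then have "0 < card (U1 \<inter> {u..})" using f by (auto simp: card_gt_0_iff fin1_def)
      then have "0 < card (B \<inter> {u..})" using U1[of u] by linarith
      then have ne: "B \<inter> {u..} \<noteq> {}" by auto
      define q where "q = Max B"
      have q: "q \<in> B" unfolding q_def using ne f by (intro Max_in) (auto simp: fin1_def)
      have qmax: "b \<le> q" if "b \<in> B" for b unfolding q_def using that f by (intro Max_ge) (auto simp: fin1_def)
      have uq: "u \<le> q" using ne qmax by fastforce
      have e1: "B \<inter> {u..q} = B \<inter> {u..}" using qmax by auto
      have "(U1 \<union> U2) \<inter> {u..q} \<subseteq> U1 \<inter> {u..}" using U2 q by fastforce
      then have "card ((U1 \<union> U2) \<inter> {u..q}) \<le> card (U1 \<inter> {u..})"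
        using f by (intro card_mono) (auto simp: fin1_def)
      then have "card ((U1 \<union> U2) \<inter> {u..q}) \<le> card (B \<inter> {u..q})" using U1[of u] e1 by simp
      moreover have "1 \<le> u" "hgt (U1 \<union> U2) B (u - 1) < hgt (U1 \<union> U2) B q" using u uq by (auto simp: uo_def)
      ultimately show False using hgt_diff[of u q "U1 \<union> U2" B] uq by simp
    qed
  qed
  show "U2 \<subseteq> uo (U1 \<union> U2) B"
  proof
    fix u assume u: "u \<in> U2"
    have u1: "1 \<le> u" using u f by (auto simp: fin1_def Suc_le_eq intro: gr0I)
    have "hgt (U1 \<union> U2) B (u - 1) < hgt (U1 \<union> U2) B q" if "u \<le> q" for q
    proof -
      have "B \<inter> {u..q} = {}" using U2[OF u] by fastforce
      moreover have "u \<in> (U1 \<union> U2) \<inter> {u..q}" using u that by simp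
      then have "0 < card ((U1 \<union> U2) \<inter> {u..q})" by (metis card_gt_0_iff empty_iff finite_Int finite_atLeastAtMost)
      ultimately show ?thesis using hgt_diff[of u q "U1 \<union> U2" B] u1 that by simp
    qed
    then show "u \<in> uo (U1 \<union> U2) B" using u1 by (simp add: uo_def)
  qed
qed

lemma rmax_split:
  assumes m: "mat X" "1 \<le> j" and X: "X (Suc j) = U1 \<union> U2"
    and U2: "\<And>u b. u \<in> U2 \<Longrightarrow> b \<in> X j \<union> U1 \<Longrightarrow> b < u"
    and U1: "\<And>p. card (U1 \<inter> {p..}) \<le> card (X j \<inter> {p..})"
  shows "rmax j X (Suc j) = U1" "rmax j X j = X j \<union> U2"
proof -
  have f: "fin1 U1" "fin1 U2" "fin1 (X j)"
    using mat_fin1[OF m(1), of "Suc j"] mat_fin1[OF m(1), of j] unfolding X by (auto simp: fin1_def)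
  have u: "uo (X (Suc j)) (X j) = U2" unfolding X by (rule uo_split[OF f U2 U1])
  have "U1 \<inter> U2 = {}" using U2 by fastforce
  then show "rmax j X (Suc j) = U1" "rmax j X j = X j \<union> U2"
    unfolding rmax_rows[OF m] u unfolding X by auto
qed

section \<open>Collapsing a column highest array\<close>

definition kap :: "mlq \<Rightarrow> nat \<Rightarrow> nat \<Rightarrow> nat" where
  "kap X r x = card (tr X x \<inter> {1..r})"

lemma kap_0 [simp]: "kap X 0 x = 0"
  by (simp add: kap_def)

lemma kap_Suc: "kap X (Suc r) x = kap X r x + of_bool (x \<in> X (Suc r))"
proof -
  have *: "{1..Suc r} = insert (Suc r) {1..r}" by auto
  show ?thesis unfolding kap_def * by (cases "x \<in> X (Suc r)") (auto simp: Int_insert_right)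
qed

lemma kap_le: "kap X r x \<le> r"
  by (induction r) (auto simp: kap_Suc)

lemma kap_mono: "r \<le> s \<Longrightarrow> kap X r x \<le> kap X s x"
  unfolding kap_def by (intro card_mono) auto

text \<open>The absence of unmatched closings between adjacent columns means that the column path
  never gets negative: a Yamanouchi condition on prefix counts.\<close>

lemma chigh_kap: assumes "mat X" shows "chigh X \<longleftrightarrow> (\<forall>r i. 1 \<le> i \<longrightarrow> kap X r (Suc i) \<le> kap X r i)"
proof -
  have "cphi i X = 0 \<longleftrightarrow> (\<forall>r. kap X r (Suc i) \<le> kap X r i)" for i
  proof -
    have f: "fin1 (tr X (Suc i))" using mat_fin1[of "tr X"] assms by simp
    have "cphi i X = 0 \<longleftrightarrow> 0 \<le> - int (cphi i X)" by simp
    also have "\<dots> \<longleftrightarrow> (\<forall>q. 0 \<le> hgt (tr X i) (tr X (Suc i)) q)"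
      unfolding cphi_def gphi_def by (rule card_uc_min[OF f])
    also have "\<dots> \<longleftrightarrow> (\<forall>r. kap X r (Suc i) \<le> kap X r i)" unfolding hgt_def kap_def by simp
    finally show ?thesis .
  qed
  then show ?thesis unfolding chigh_def by blast
qed

lemma chigh_antimono: assumes "mat X" "chigh X" "1 \<le> i" "i \<le> x" shows "kap X r x \<le> kap X r i"
  using assms(4)
proof (induction x)
  case 0 then show ?case using assms by simp
next
  case (Suc x)
  show ?case
  proof (cases "i = Suc x")
    case False
    then have "kap X r x \<le> kap X r i" "1 \<le> x" using Suc assms by auto
    then show ?thesis using chigh_kap assms by (meson order_trans)
  qed simp
qed

text \<open>An intermediate state while row \<open>i + 1\<close> is collapsed: below
  \<open>j\<close> the columns are stacked from rows \<open>1..i\<close> only, row \<open>j\<close>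
  also carries the newcomers that have not settled higher up, and rows above \<open>j\<close> up to
  \<open>i + 1\<close> are final.\<close>

definition Dn :: "mlq \<Rightarrow> nat \<Rightarrow> nat \<Rightarrow> mlq" where
  "Dn X i j = (\<lambda>r. if r = 0 then {}
     else if r < j then {x. 1 \<le> x \<and> r \<le> kap X i x}
     else if r = j then {x. 1 \<le> x \<and> (j \<le> kap X i x \<or> x \<in> X (Suc i))}
     else if r \<le> Suc i then {x. 1 \<le> x \<and> r \<le> kap X (Suc i) x} else X r)"

text \<open>In rows \<open>1..i\<close> every column has dropped to the bottom.\<close>

definition Cn :: "mlq \<Rightarrow> nat \<Rightarrow> mlq" where
  "Cn X i = (\<lambda>r. if r = 0 then {} else if r \<le> i then {x. 1 \<le> x \<and> r \<le> kap X i x} else X r)"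

lemma box_kap: "box L n X \<Longrightarrow> 0 < kap X r x \<Longrightarrow> x \<le> n"
  unfolding kap_def box_def by (fastforce simp: card_gt_0_iff)

lemma mat_Dn: assumes "mat X" shows "mat (Dn X i j)"
proof -
  obtain L n where b: "box L n X" using assms by (auto simp: mat_def)
  have "box (max L (max (Suc i) j)) n (Dn X i j)"
    unfolding box_def
  proof (intro allI impI)
    fix r c assume c: "c \<in> Dn X i j r"
    have r: "r \<noteq> 0" by (rule ccontr) (use c in \<open>simp add: Dn_def\<close>)
    consider "r < j" "1 \<le> c" "0 < kap X i c" | "r = j" "1 \<le> c" "0 < kap X i c \<or> c \<in> X (Suc i)"
      | "r \<le> Suc i" "1 \<le> c" "0 < kap X (Suc i) c" | "c \<in> X r"
      using c r by (fastforce simp: Dn_def split: if_splits)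
    then show "1 \<le> r \<and> r \<le> max L (max (Suc i) j) \<and> 1 \<le> c \<and> c \<le> n"
    proof cases
      case 4 then show ?thesis using b unfolding box_def by (meson le_max_iff_disj)
    next
      case 2 then show ?thesis using b r box_kap[OF b] unfolding box_def by auto
    qed (use r box_kap[OF b] in auto)
  qed
  then show ?thesis by (auto simp: mat_def)
qed

lemma mat_row0: "mat X \<Longrightarrow> X 0 = {}"
  unfolding mat_def box_def by fastforce

lemma mat_col0: "mat X \<Longrightarrow> c \<in> X r \<Longrightarrow> 1 \<le> c"
  unfolding mat_def box_def by blast

lemma Dn_start: "mat X \<Longrightarrow> Dn X i (Suc i) = Cn X i"
proof -
  assume m: "mat X"
  have "\<not> Suc i \<le> kap X i x" for x using kap_le[of X i x] by simp
  then show ?thesis using mat_row0[OF m] mat_col0[OF m] by (intro ext) (auto simp: Dn_def Cn_def)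
qed

lemma Dn_end: "mat X \<Longrightarrow> Dn X i 1 = Cn X (Suc i)"
  using mat_row0[of X] mat_col0[of X]
  by (intro ext) (auto simp: Dn_def Cn_def kap_Suc Suc_le_eq)

text \<open>A newcomer in row \<open>j + 1\<close> rests there if its column is filled up to row
  \<open>j\<close>, and falls otherwise. Column counts decrease to the right, so the falling balls
  lie to the right of all of row \<open>j\<close> and are exactly the unmatched ones.\<close>

lemma Dn_step:
  assumes X: "mat X" "chigh X" and j: "1 \<le> j" "j \<le> i"
  shows "rmax j (Dn X i (Suc j)) = Dn X i j"
proof -
  let ?D = "Dn X i (Suc j)"
  have m: "mat ?D" by (rule mat_Dn[OF X(1)])
  define U1 where "U1 = {x. 1 \<le> x \<and> Suc j \<le> kap X (Suc i) x}"
  define U2 where "U2 = {x \<in> X (Suc i). kap X i x < j}"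
  have low: "?D j = {x. 1 \<le> x \<and> j \<le> kap X i x}" using j by (simp add: Dn_def)
  have U1low: "U1 \<subseteq> ?D j" unfolding U1_def low by (auto simp: kap_Suc split: if_splits)
  have upp: "?D (Suc j) = U1 \<union> U2"
    unfolding U1_def U2_def Dn_def using mat_col0[OF X(1)] by (auto simp: kap_Suc)
  have b: "b < u" if "u \<in> U2" "b \<in> ?D j \<union> U1" for u b
  proof (rule ccontr)
    assume n: "\<not> b < u"
    have "j \<le> kap X i b" using that U1low low by auto
    moreover have "kap X i b \<le> kap X i u"
      using n that mat_col0[OF X(1)] unfolding U2_def by (intro chigh_antimono[OF X]) auto
    ultimately show False using that unfolding U2_def by auto
  qed
  have c: "card (U1 \<inter> {p..}) \<le> card (?D j \<inter> {p..})" for p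
    using U1low mat_finite[OF m, of j] by (intro card_mono) auto
  note r = rmax_split[OF m j(1) upp b c]
  show ?thesis
  proof
    fix r
    consider "r = j" | "r = Suc j" | "r \<noteq> j" "r \<noteq> Suc j" by blast
    then show "rmax j ?D r = Dn X i j r"
    proof cases
      case 1
      then show ?thesis using r(2) j mat_col0[OF X(1)] unfolding low U2_def by (auto simp: Dn_def)
    next
      case 2
      then show ?thesis using r(1) j unfolding U1_def by (simp add: Dn_def)
    next
      case 3
      then show ?thesis using rmax_other[of r j ?D] by (auto simp: Dn_def)
    qed
  qed
qed

lemma collapse_chigh:
  assumes b: "box L n X" and c: "chigh X"
  shows "collapse n X k = Cn X k"
proof (induction k)
  case 0
  have "mat X" using b by (auto simp: mat_def)
  then show ?case using mat_row0 by (intro ext) (auto simp: Cn_def)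
next
  case (Suc k)
  have m: "mat X" using b by (auto simp: mat_def)
  have "foldr rmax [j..<Suc k] (Cn X k) = Dn X k j" if "1 \<le> j" "j \<le> Suc k" for j
    using that
  proof (induction "Suc k - j" arbitrary: j)
    case 0
    then have "j = Suc k" by simp
    then show ?case using Dn_start[OF m, of k] by simp
  next
    case (Suc d)
    then have "foldr rmax [Suc j..<Suc k] (Cn X k) = Dn X k (Suc j)" by simp
    then show ?case using Dn_step[OF m c, of j k] Suc by (simp add: upt_conv_Cons del: upt_Suc)
  qed
  from this[of 1] show ?case using collapse_Suc[OF b, of k] Suc Dn_end[OF m] by simp
qed

section \<open>The recording tableau of a column highest array\<close>

definition seg :: "mlq \<Rightarrow> nat \<Rightarrow> nat \<Rightarrow> nat" where
  "seg X r j = card {x. 1 \<le> x \<and> j \<le> kap X r x}"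

text \<open>Turns known sizes \<open>s\<close> of collapsed rows into the entries of the recording
  tableau. Monotonicity of \<open>s\<close> ensures that the truncated differences lose nothing. It
  serves both column highest arrays and arrays of reading words.\<close>

lemma recording_generic:
  assumes s: "\<And>k j. 1 \<le> j \<Longrightarrow> j \<le> k \<Longrightarrow> card (collapse n X k j) = s k j"
    and s0: "\<And>k j. k < j \<Longrightarrow> s k j = 0" and mono: "\<And>k j. 1 \<le> j \<Longrightarrow> s k j \<le> s (Suc k) j" and j: "1 \<le> j"
  shows "sorted (recording n X k j) \<and> (\<forall>x \<in> set (recording n X k j). 1 \<le> x \<and> x \<le> k) \<and>
    (\<forall>r. length (filter (\<lambda>x. x \<le> r) (recording n X k j)) = s (min r k) j)"
proof (induction k)
  case 0 then show ?case using s0 j by simp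
next
  case (Suc k)
  have rec: "recording n X (Suc k) j = recording n X k j @ replicate (s (Suc k) j - s k j) (Suc k)"
  proof -
    consider "j \<le> k" | "j = Suc k" | "j > Suc k" by linarith
    then show ?thesis
    proof cases
      case 1 then show ?thesis using j s[of j "Suc k"] s[of j k] by (simp del: collapse.simps)
    next
      case 2
      have "recording n X k j = []" using 2 by (cases k) auto
      then show ?thesis using 2 s[of j "Suc k"] s0[of k j] by (simp del: collapse.simps)
    next
      case 3
      then have "recording n X k j = []" by (cases k) auto
      then show ?thesis using 3 s0[of "Suc k" j] by simp
    qed
  qed
  have "length (filter (\<lambda>x. x \<le> r) (recording n X (Suc k) j)) = s (min r (Suc k)) j" for r
  proof (cases "Suc k \<le> r")
    case True
    then have "length (filter (\<lambda>x. x \<le> r) (recording n X k j)) = s k j" using Suc by (simp add: min_def)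
    then show ?thesis unfolding rec using True mono[OF j, of k] by (simp add: min_def)
  next
    case False
    then show ?thesis unfolding rec using Suc by (simp add: min_def)
  qed
  then show ?case unfolding rec using Suc by (fastforce simp: sorted_append)
qed

lemma sorted_nth_le:
  fixes xs :: "nat list"
  shows "sorted xs \<Longrightarrow> p < length xs \<Longrightarrow> xs ! p \<le> r \<longleftrightarrow> p < length (filter (\<lambda>x. x \<le> r) xs)"
proof (induction xs arbitrary: p)
  case (Cons a xs)
  show ?case
  proof (cases "a \<le> r")
    case True
    then show ?thesis using Cons by (cases p) auto
  next
    case False
    then have "filter (\<lambda>x. x \<le> r) (a # xs) = []" using Cons(2) by (fastforce simp: filter_empty_conv)
    moreover have "a \<le> (a # xs) ! p" using Cons(2,3) by (cases p) auto
    ultimately show ?thesis using False by simp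
  qed
qed simp

lemma sorted_filter_unique:
  fixes xs ys :: "nat list"
  assumes "sorted xs" "sorted ys" "\<And>r. length (filter (\<lambda>x. x \<le> r) xs) = length (filter (\<lambda>x. x \<le> r) ys)"
  shows "xs = ys"
proof (rule nth_equalityI)
  define m where "m = Max (set xs \<union> set ys \<union> {0})"
  have "x \<le> m" if "x \<in> set xs \<union> set ys" for x unfolding m_def using that by (intro Max_ge) auto
  then have "filter (\<lambda>x. x \<le> m) xs = xs" "filter (\<lambda>x. x \<le> m) ys = ys" by (auto simp: filter_id_conv)
  then show l: "length xs = length ys" using assms(3)[of m] by simp
  fix p assume p: "p < length xs"
  have "xs ! p \<le> r \<longleftrightarrow> ys ! p \<le> r" for r
    using sorted_nth_le[OF assms(1) p, of r] sorted_nth_le[OF assms(2), of p r] p l assms(3)[of r] by simp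
  from this[of "xs ! p"] this[of "ys ! p"] show "xs ! p = ys ! p" by simp
qed

lemma finite_seg: "mat X \<Longrightarrow> 1 \<le> j \<Longrightarrow> finite {x. 1 \<le> x \<and> j \<le> kap X r x}"
proof -
  assume "mat X" "1 \<le> j"
  then obtain L n where b: "box L n X" by (auto simp: mat_def)
  have "{x. 1 \<le> x \<and> j \<le> kap X r x} \<subseteq> {..n}" using box_kap[OF b, of r] \<open>1 \<le> j\<close> by fastforce
  then show ?thesis by (rule finite_subset) simp
qed

lemma seg_0: assumes "r < j" shows "seg X r j = 0"
proof -
  have "\<not> j \<le> kap X r x" for x using kap_le[of X r x] assms by simp
  then show ?thesis by (simp add: seg_def)
qed

lemma seg_mono: assumes "mat X" "1 \<le> j" "r \<le> s" shows "seg X r j \<le> seg X s j"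
  unfolding seg_def
proof (rule card_mono[OF finite_seg[OF assms(1,2)]], rule Collect_mono, intro impI)
  fix x assume "1 \<le> x \<and> j \<le> kap X r x"
  then show "1 \<le> x \<and> j \<le> kap X s x" using kap_mono[OF assms(3), of X x] by simp
qed

lemma recording_chigh:
  assumes b: "box L n X" and c: "chigh X" and j: "1 \<le> j"
  shows "sorted (recording n X k j)" "\<And>x. x \<in> set (recording n X k j) \<Longrightarrow> 1 \<le> x \<and> x \<le> k"
    "\<And>r. length (filter (\<lambda>x. x \<le> r) (recording n X k j)) = seg X (min r k) j"
proof -
  have m: "mat X" using b by (auto simp: mat_def)
  have "sorted (recording n X k j) \<and> (\<forall>x \<in> set (recording n X k j). 1 \<le> x \<and> x \<le> k) \<and>
    (\<forall>r. length (filter (\<lambda>x. x \<le> r) (recording n X k j)) = seg X (min r k) j)"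
    by (rule recording_generic[OF _ seg_0 _ j])
      (use seg_mono[OF m] in \<open>auto simp: collapse_chigh[OF b c] Cn_def seg_def\<close>)
  then show "sorted (recording n X k j)" "\<And>x. x \<in> set (recording n X k j) \<Longrightarrow> 1 \<le> x \<and> x \<le> k"
    "\<And>r. length (filter (\<lambda>x. x \<le> r) (recording n X k j)) = seg X (min r k) j" by auto
qed

lemma length_recording_chigh:
  assumes b: "box L n X" and c: "chigh X" and j: "1 \<le> j"
  shows "length (recording n X k j) = seg X k j"
proof -
  have "filter (\<lambda>x. x \<le> k) (recording n X k j) = recording n X k j"
    using recording_chigh(2)[OF assms] by (auto simp: filter_id_conv)
  then show ?thesis using recording_chigh(3)[OF assms, of k k] by simp
qed

definition qrow :: "tableau \<Rightarrow> nat \<Rightarrow> nat list" where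
  "qrow Q j = (if 1 \<le> j \<and> j \<le> length Q then Q ! (j - 1) else [])"

lemma takeWhile_rows:
  assumes "\<And>j. 1 \<le> j \<Longrightarrow> f j = [] \<Longrightarrow> f (Suc j) = []" and "\<And>j. H < j \<Longrightarrow> f j = []" and j: "1 \<le> j"
  shows "qrow (takeWhile (\<lambda>R. R \<noteq> []) (map f [1..<Suc H])) j = f j"
proof -
  let ?Q = "takeWhile (\<lambda>R. R \<noteq> []) (map f [1..<Suc H])"
  have mono: "f j' = []" if "1 \<le> i" "f i = []" "i \<le> j'" for i j'
    using that(3,2,1) by (induction rule: dec_induct) (use assms(1) in auto)
  have len: "length ?Q \<le> H" using length_takeWhile_le[of _ "map f [1..<Suc H]"] by (metis diff_Suc_1 length_map length_upt)
  have nth: "?Q ! p = f (Suc p)" if "p < length ?Q" for p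
    using takeWhile_nth[OF that] that len by (simp add: nth_upt del: upt_Suc)
  show ?thesis
  proof (cases "j \<le> length ?Q")
    case True
    then show ?thesis using nth[of "j - 1"] j unfolding qrow_def by simp
  next
    case False
    have "f (Suc (length ?Q)) = []"
    proof (cases "length ?Q < H")
      case True
      then have "length ?Q < length (map f [1..<Suc H])" by (simp del: upt_Suc)
      then have "\<not> (map f [1..<Suc H] ! length ?Q \<noteq> [])" by (rule nth_length_takeWhile)
      then show ?thesis using True by (simp add: nth_upt del: upt_Suc)
    next
      case False
      then show ?thesis using assms(2) by simp
    qed
    then have "f j = []" using mono[of "Suc (length ?Q)" j] False by simp
    then show ?thesis using False by (simp add: qrow_def)
  qed
qed

lemma seg_antimono: "mat X \<Longrightarrow> 1 \<le> j \<Longrightarrow> seg X r (Suc j) \<le> seg X r j"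
  unfolding seg_def by (rule card_mono[OF finite_seg]) auto

lemma qrow_chigh:
  assumes b: "box L n X" and c: "chigh X" and j: "1 \<le> j"
  shows "qrow (rho_Q n X) j = recording n X (height X) j"
  unfolding rho_Q_def
proof (rule takeWhile_rows[OF _ _ j])
  have m: "mat X" using b by (auto simp: mat_def)
  fix i assume i: "1 \<le> i" "recording n X (height X) i = []"
  then have "seg X (height X) i = 0" using length_recording_chigh[OF b c i(1), of "height X"] by simp
  then have "seg X (height X) (Suc i) = 0" using seg_antimono[OF m i(1), of "height X"] by simp
  then show "recording n X (height X) (Suc i) = []"
    using length_recording_chigh[OF b c, of "Suc i" "height X"] by simp
next
  fix i assume i: "height X < i"
  then show "recording n X (height X) i = []"
    using length_recording_chigh[OF b c, of i "height X"] seg_0[OF i] by simp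
qed

lemma kap_height: "mat X \<Longrightarrow> height X \<le> r \<Longrightarrow> kap X r x = kap X (height X) x"
proof -
  assume m: "mat X" and r: "height X \<le> r"
  obtain L n where b: "box L n X" using m by (auto simp: mat_def)
  have "s \<le> height X" if "x \<in> X s" for s
    using box_height(1)[OF b, of s] that by (cases "height X < s") auto
  then have "s \<le> height X \<and> s \<le> r" if "x \<in> X s" for s using that r by (meson order_trans)
  then have "tr X x \<inter> {1..r} = tr X x \<inter> {1..height X}" by auto
  then show ?thesis by (simp add: kap_def)
qed

lemma seg_rho_Q:
  assumes b: "box L n X" and c: "chigh X" and j: "1 \<le> j"
  shows "seg X r j = length (filter (\<lambda>x. x \<le> r) (qrow (rho_Q n X) j))"
proof -
  have m: "mat X" using b by (auto simp: mat_def)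
  have "seg X r j = seg X (min r (height X)) j"
    using kap_height[OF m, of r] by (auto simp: min_def seg_def)
  then show ?thesis unfolding qrow_chigh[OF assms] recording_chigh(3)[OF assms] .
qed

text \<open>Since column counts decrease to the right, the set is closed under going left, so its
  size determines it.\<close>

lemma seg_set:
  assumes "mat X" "chigh X" "1 \<le> j" shows "{x. 1 \<le> x \<and> j \<le> kap X r x} = {1..seg X r j}"
proof -
  let ?S = "{x. 1 \<le> x \<and> j \<le> kap X r x}"
  have f: "finite ?S" using finite_seg assms by blast
  have down: "y \<in> ?S" if "x \<in> ?S" "1 \<le> y" "y \<le> x" for x y
    using chigh_antimono[OF assms(1,2) that(2,3), of r] that by auto
  have "?S = {1..card ?S}"
  proof (cases "?S = {}")
    case False
    have "?S = {1..Max ?S}" using down[OF Max_in[OF f False]] Max_ge[OF f] by auto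
    then show ?thesis by (metis card_atLeastAtMost diff_Suc_1)
  next
    case True
    then have c0: "card ?S = 0" by (metis card.empty)
    show ?thesis unfolding c0 using True by simp
  qed
  then show ?thesis unfolding seg_def .
qed

text \<open>Counting entries at most \<open>r\<close> in the rows of the tableau gives
  \<open>seg\<close>; being sizes of initial segments these give all prefix counts of columns, and
  the differences of prefix counts are the balls.\<close>

lemma chigh_rho_Q_inj:
  assumes X: "box L n X" "chigh X" and Y: "box L' n' Y" "chigh Y" and Q: "rho_Q n X = rho_Q n' Y"
  shows "X = Y"
proof -
  have m: "mat X" "mat Y" using X Y by (auto simp: mat_def)
  have s: "seg X r j = seg Y r j" if "1 \<le> j" for r j
    using seg_rho_Q[OF X that] seg_rho_Q[OF Y that] Q by simp
  have k: "kap X r x = kap Y r x" if "1 \<le> x" for r x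
  proof -
    have "j \<le> kap X r x \<longleftrightarrow> j \<le> kap Y r x" if "1 \<le> j" for j
      using seg_set[OF m(1) X(2) that, of r] seg_set[OF m(2) Y(2) that, of r] s[OF that, of r] \<open>1 \<le> x\<close> by auto
    note e = this
    have "kap X r x \<le> kap Y r x" using e[of "kap X r x"] by (cases "kap X r x") auto
    moreover have "kap Y r x \<le> kap X r x" using e[of "kap Y r x"] by (cases "kap Y r x") auto
    ultimately show ?thesis by simp
  qed
  have "x \<in> X r \<longleftrightarrow> x \<in> Y r" for x r
  proof (cases "1 \<le> x \<and> 1 \<le> r")
    case True
    then obtain r' where r': "r = Suc r'" by (cases r) auto
    have "kap X (Suc r') x = kap Y (Suc r') x" "kap X r' x = kap Y r' x" using k True by auto
    then show ?thesis unfolding r' by (cases "x \<in> X (Suc r')"; cases "x \<in> Y (Suc r')"; simp add: kap_Suc)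
  next
    case False
    have "x \<notin> X r" using False mat_row0[OF m(1)] mat_col0[OF m(1), of x r] by (cases "r = 0") auto
    moreover have "x \<notin> Y r" using False mat_row0[OF m(2)] mat_col0[OF m(2), of x r] by (cases "r = 0") auto
    ultimately show ?thesis by simp
  qed
  then have "X r = Y r" for r by blast
  then show ?thesis by (rule ext)
qed

lemma rho_Q_eq_conn:
  assumes X: "box L n X" and Y: "box L' n' Y" and Q: "rho_Q n X = rho_Q n' Y"
  shows "conn X Y"
proof -
  have m: "mat X" "mat Y" using X Y by (auto simp: mat_def)
  obtain X0 where X0: "conn X X0" "chigh X0" "box L n X0" using ex_chigh[OF m(1)] X by blast
  obtain Y0 where Y0: "conn Y Y0" "chigh Y0" "box L' n' Y0" using ex_chigh[OF m(2)] Y by blast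
  have "rho_Q n X0 = rho_Q n' Y0"
    using rho_Q_conn[OF X0(1) X X0(3)] rho_Q_conn[OF Y0(1) Y Y0(3)] Q by simp
  then have "X0 = Y0" using chigh_rho_Q_inj[OF X0(3,2) Y0(3,2)] by blast
  then show ?thesis using X0(1) conn_sym[OF Y0(1) m(2)] conn_trans by blast
qed

section \<open>Row highest arrays and types\<close>

text \<open>Both words commute with the column moves, and acting moves can be cancelled; so
  agreement at one member spreads along the component.\<close>

lemma conn_rops_inj:
  assumes "mat X" "rword u" "rword v" "conn X X0" "rops u X0 = rops v X0"
  shows "rops u X = rops v X"
  using assms(4,5)
proof (induction rule: conn.induct)
  case (cup Y i)
  have mY: "mat Y" by (rule conn_mat[OF cup.hyps(1) assms(1)])
  note c = rops_cup[OF mY assms(2) cup.hyps(2)] rops_cup[OF mY assms(3) cup.hyps(2)]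
  have "cup i (rops u Y) = cup i (rops v Y)" using cup.prems unfolding c(1,5) .
  then have e: "cdn i (cup i (rops u Y)) = cdn i (cup i (rops v Y))" by simp
  have "0 < cphi i (rops u Y)" "0 < cphi i (rops v Y)" using cup.hyps(3) c by simp_all
  then have "rops u Y = rops v Y"
    using e cup_counts(3)[OF mat_rops[OF assms(2) mY] cup.hyps(2)] cup_counts(3)[OF mat_rops[OF assms(3) mY] cup.hyps(2)]
    by simp
  then show ?case by (rule cup.IH)
next
  case (cdn Y i)
  have mY: "mat Y" by (rule conn_mat[OF cdn.hyps(1) assms(1)])
  note c = rops_cup[OF mY assms(2) cdn.hyps(2)] rops_cup[OF mY assms(3) cdn.hyps(2)]
  have "cdn i (rops u Y) = cdn i (rops v Y)" using cdn.prems unfolding c(4,8) .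
  then have e: "cup i (cdn i (rops u Y)) = cup i (cdn i (rops v Y))" by simp
  have "0 < ceps i (rops u Y)" "0 < ceps i (rops v Y)" using cdn.hyps(3) c by simp_all
  then have "rops u Y = rops v Y"
    using e cdn_counts(3)[OF mat_rops[OF assms(2) mY]] cdn_counts(3)[OF mat_rops[OF assms(3) mY]]
    by simp
  then show ?case by (rule cdn.IH)
qed

text \<open>Row highest forces nested rows: take \<open>u\<close> in row \<open>r + 1\<close> but
  not in row \<open>r\<close>, with the rows below nested. Every ball of row \<open>r\<close> stands
  on a full column, so it lies left of \<open>u\<close> by the decrease of column counts, and
  \<open>u\<close> is unmatched. Nested rows are determined by the column sizes.\<close>

lemma chigh_rhigh:
  assumes X: "mat X" "chigh X" "rhigh X" and r: "1 \<le> r"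
  shows "X r = {x. 1 \<le> x \<and> r \<le> card (tr X x)}"
proof -
  have sub: "X (Suc r) \<subseteq> X r" if "1 \<le> r" for r
    using that
  proof (induction r rule: less_induct)
    case (less r)
    have full: "kap X r x = r" if "x \<in> X r" for x
    proof -
      have "x \<in> X s" if "1 \<le> s" "s \<le> r" for s
        using that(2,1) \<open>x \<in> X r\<close>
      proof (induction rule: inc_induct)
        case (step s) then show ?case using less(1)[of s] by auto
      qed simp
      then have "tr X x \<inter> {1..r} = {1..r}" by auto
      then show ?thesis by (simp add: kap_def)
    qed
    show ?case
    proof
      fix u assume u: "u \<in> X (Suc r)"
      show "u \<in> X r"
      proof (rule ccontr)
        assume nu: "u \<notin> X r"
        have lt: "b < u" if "b \<in> X r" for b
        proof (rule ccontr)
          assume "\<not> b < u"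
          then have "kap X r b \<le> kap X r u"
            using chigh_antimono[OF X(1,2), of u b r] mat_col0[OF X(1) u] by simp
          then have "kap X r u = r" using full[OF that] kap_le[of X r u] by simp
          moreover have "kap X r u < r"
          proof -
            obtain r' where r': "r = Suc r'" using less(2) by (cases r) auto
            then have "kap X r u = kap X r' u" using nu by (simp add: kap_Suc)
            then show ?thesis using kap_le[of X r' u] r' by simp
          qed
          ultimately show False by simp
        qed
        have u1: "1 \<le> u" using mat_col0[OF X(1) u] .
        have "hgt (X (Suc r)) (X r) (u - 1) < hgt (X (Suc r)) (X r) q" if "u \<le> q" for q
        proof -
          have "X r \<inter> {u..q} = {}" using lt by fastforce
          moreover have "u \<in> X (Suc r) \<inter> {u..q}" using u that by simp
          then have "0 < card (X (Suc r) \<inter> {u..q})" by (metis card_gt_0_iff empty_iff finite_Int finite_atLeastAtMost)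
          ultimately show ?thesis using hgt_diff[of u q "X (Suc r)" "X r"] u1 that by simp
        qed
        then have "u \<in> uo (X (Suc r)) (X r)" using u1 by (simp add: uo_def)
        then have "0 < eps r X" unfolding eps_def geps_def
          using finite_uo[OF mat_fin1[OF X(1)], of "Suc r" "X r"] by (auto simp: card_gt_0_iff)
        then show False using X(3) less(2) by (simp add: rhigh_def)
      qed
    qed
  qed
  have down: "x \<in> X s" if "x \<in> X r" "1 \<le> s" "s \<le> r" for x r s
    using that(3,2,1) by (induction rule: inc_induct) (use sub in auto)
  have "x \<in> X r \<longleftrightarrow> r \<le> card (tr X x)" for x
  proof
    have f: "finite (tr X x)" using mat_finite[of "tr X"] X by simp
    assume "x \<in> X r"
    then have "{1..r} \<subseteq> tr X x" using down by auto
    then show "r \<le> card (tr X x)" using card_mono[OF f, of "{1..r}"] by simp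
  next
    assume c: "r \<le> card (tr X x)"
    have pos: "1 \<le> s" if "s \<in> tr X x" for s using that mat_row0[OF X(1)] by (cases s) auto
    show "x \<in> X r"
    proof (rule ccontr)
      assume n: "x \<notin> X r"
      have "tr X x \<subseteq> {1..r - 1}"
      proof
        fix s assume s: "s \<in> tr X x"
        have "\<not> r \<le> s" using down[of x s r] s n r by auto
        then show "s \<in> {1..r - 1}" using pos[OF s] by auto
      qed
      then have "card (tr X x) \<le> r - 1" using card_mono[of "{1..r - 1}" "tr X x"] by simp
      then show False using c r by simp
    qed
  qed
  then show ?thesis using mat_col0[OF X(1)] by auto
qed

text \<open>Row operators preserve column sizes, and these determine the result on the column
  highest member; \<open>conn_rops_inj\<close> carries the equality back.\<close>

lemma rhigh_unique:
  assumes "mat X" "rword u" "rword v" "rhigh (rops u X)" "rhigh (rops v X)"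
  shows "rops u X = rops v X"
proof -
  obtain X0 where X0: "conn X X0" "chigh X0" using ex_chigh[OF assms(1)] by blast
  have m0: "mat X0" using conn_mat[OF X0(1) assms(1)] .
  have "rops w X0 r = {x. 1 \<le> x \<and> r \<le> card (tr X0 x)}" if "rword w" "rhigh (rops w X)" "1 \<le> r" for w r
  proof -
    have "rhigh (rops w X0)" using that rhigh_conn[OF conn_rops[OF X0(1) assms(1) that(1)] mat_rops[OF that(1) assms(1)]] by simp
    moreover have "chigh (rops w X0)" using chigh_rops[OF m0 that(1)] X0 by simp
    ultimately show ?thesis using chigh_rhigh[OF mat_rops[OF that(1) m0] _ _ that(3)] card_col_rops[OF m0 that(1)] by simp
  qed
  then have "rops u X0 r = rops v X0 r" for r
    using assms mat_row0[OF mat_rops[OF assms(2) m0]] mat_row0[OF mat_rops[OF assms(3) m0]]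
    by (cases "r = 0") auto
  then have "rops u X0 = rops v X0" by blast
  then show ?thesis using conn_rops_inj[OF assms(1-3) X0(1)] by blast
qed

section \<open>The sum of squares of the row sizes\<close>

definition supp :: "mlq \<Rightarrow> nat set" where "supp X = {r. X r \<noteq> {}}"

definition norm2 :: "mlq \<Rightarrow> nat" where "norm2 X = (\<Sum>r \<in> supp X. card (X r) ^ 2)"
definition total :: "mlq \<Rightarrow> nat" where "total X = (\<Sum>r \<in> supp X. card (X r))"

lemma finite_supp: assumes "mat X" shows "finite (supp X)"
proof -
  obtain L n where b: "box L n X" using assms by (auto simp: mat_def)
  have "supp X \<subseteq> {..L}" using b unfolding supp_def box_def by auto
  then show ?thesis by (rule finite_subset) simp
qed

lemma sum_supp: "finite S \<Longrightarrow> supp X \<subseteq> S \<Longrightarrow> g 0 = 0 \<Longrightarrow> (\<Sum>r \<in> supp X. g (card (X r))) = (\<Sum>r \<in> S. g (card (X r)))"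
  by (rule sum.mono_neutral_left) (auto simp: supp_def)

lemma sum_two_rows:
  fixes g :: "nat \<Rightarrow> nat"
  assumes "mat X" "mat Y" "\<And>r. r \<noteq> j \<Longrightarrow> r \<noteq> Suc j \<Longrightarrow> Y r = X r" "g 0 = 0"
  shows "(\<Sum>r \<in> supp Y. g (card (Y r))) + g (card (X j)) + g (card (X (Suc j))) =
    (\<Sum>r \<in> supp X. g (card (X r))) + g (card (Y j)) + g (card (Y (Suc j)))"
proof -
  define S where "S = supp X \<union> supp Y \<union> {j, Suc j}"
  have f: "finite S" unfolding S_def using finite_supp assms(1,2) by simp
  have 1: "(\<Sum>r \<in> supp Z. g (card (Z r))) = g (card (Z j)) + g (card (Z (Suc j))) + (\<Sum>r \<in> S - {j} - {Suc j}. g (card (Z r)))"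
    if "supp Z \<subseteq> S" for Z
  proof -
    have "(\<Sum>r \<in> supp Z. g (card (Z r))) = (\<Sum>r \<in> S. g (card (Z r)))" by (rule sum_supp[where g = g, OF f that assms(4)])
    also have "\<dots> = g (card (Z j)) + (\<Sum>r \<in> S - {j}. g (card (Z r)))" by (rule sum.remove[OF f]) (simp add: S_def)
    also have "(\<Sum>r \<in> S - {j}. g (card (Z r))) = g (card (Z (Suc j))) + (\<Sum>r \<in> S - {j} - {Suc j}. g (card (Z r)))"
      by (rule sum.remove) (use f in \<open>auto simp: S_def\<close>)
    finally show ?thesis by simp
  qed
  have "(\<Sum>r \<in> S - {j} - {Suc j}. g (card (Y r))) = (\<Sum>r \<in> S - {j} - {Suc j}. g (card (X r)))"
    by (rule sum.cong) (use assms(3) in auto)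
  moreover have "supp X \<subseteq> S" "supp Y \<subseteq> S" unfolding S_def by auto
  ultimately show ?thesis using 1[of X] 1[of Y] by simp
qed

lemma total_step:
  assumes "mat X" "mat Y" "\<And>r. r \<noteq> j \<Longrightarrow> r \<noteq> Suc j \<Longrightarrow> Y r = X r"
    "card (Y j) + card (Y (Suc j)) = card (X j) + card (X (Suc j))"
  shows "total Y = total X"
  using sum_two_rows[where g = "\<lambda>x. x" and j = j, OF assms(1-3)] assms(4) unfolding total_def by simp

lemma norm2_step:
  assumes "mat X" "mat Y" "\<And>r. r \<noteq> j \<Longrightarrow> r \<noteq> Suc j \<Longrightarrow> Y r = X r"
  shows "norm2 Y + card (X j) ^ 2 + card (X (Suc j)) ^ 2 = norm2 X + card (Y j) ^ 2 + card (Y (Suc j)) ^ 2"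
  using sum_two_rows[where g = "\<lambda>x. x ^ 2" and j = j, OF assms(1-3)] unfolding norm2_def by simp

lemma norm2_le: assumes "mat X" shows "norm2 X \<le> total X ^ 2"
proof -
  have "card (X r) \<le> total X" if "r \<in> supp X" for r
    unfolding total_def using that finite_supp[OF assms] by (intro member_le_sum) auto
  then have "norm2 X \<le> (\<Sum>r \<in> supp X. card (X r) * total X)"
    unfolding norm2_def power2_eq_square by (intro sum_mono mult_left_mono) auto
  also have "\<dots> = total X ^ 2" unfolding total_def power2_eq_square sum_distrib_right ..
  finally show ?thesis .
qed

lemma total_rops: "mat X \<Longrightarrow> rword w \<Longrightarrow> total (rops w X) = total X"
proof (induction w X rule: rops.induct)
  case (2 b j w X)
  have m: "mat (rup j X)" "mat (rdn j X)" using 2 by (auto simp: mat_rup mat_rdn)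
  have u: "total (rup j X) = total X"
  proof (cases "0 < phi j X")
    case True
    then show ?thesis using rup_counts[OF 2(2) True] by (intro total_step[OF 2(2) m(1), of j] rup_other) auto
  next
    case False then show ?thesis using rup_id[OF 2(2)] by simp
  qed
  have d: "total (rdn j X) = total X"
  proof (cases "0 < eps j X")
    case True
    then show ?thesis using rdn_counts[OF 2(2) True] by (intro total_step[OF 2(2) m(2), of j] rdn_other) auto
  next
    case False then show ?thesis using rdn_id[OF 2(2)] by simp
  qed
  show ?case using 2(1) 2(3) m u d by (cases b) auto
qed simp

text \<open>Row sizes \<open>b + phi\<close> and \<open>b + eps\<close> become
  \<open>b + phi + eps\<close> and \<open>b\<close>. The gain is positive exactly when the array is
  strictly inside its string, and it is the same towards the other end.\<close>

lemma norm2_rmax: assumes "mat X" "1 \<le> j" shows "norm2 (rmax j X) = norm2 X + 2 * eps j X * phi j X"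
proof -
  note it = rdn_iter[OF assms, of "eps j X", folded rmax_def]
  have n: "norm2 (rmax j X) + card (X j) ^ 2 + card (X (Suc j)) ^ 2 = norm2 X + card (rmax j X j) ^ 2 + card (rmax j X (Suc j)) ^ 2"
    by (rule norm2_step[OF assms(1) mat_rmax[OF assms] rmax_other])
  obtain b where b: "card (X (Suc j)) = b + eps j X" using it(6) by (metis le_add_diff_inverse2 le_refl)
  have "int (eps j X) - int (phi j X) = int (b + eps j X) - int (card (X j))" using eps_phi[OF assms(1), of j] b by simp
  then have p: "card (X j) = b + phi j X" by simp
  have "card (rmax j X j) = b + phi j X + eps j X" "card (rmax j X (Suc j)) = b" using it(4,5) b p by auto
  then show ?thesis using n unfolding b p by (simp add: power2_eq_square algebra_simps)
qed

definition rumax :: "nat \<Rightarrow> mlq \<Rightarrow> mlq" where "rumax j X = (rup j ^^ phi j X) X"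

lemma norm2_rumax: assumes "mat X" "1 \<le> j" shows "norm2 (rumax j X) = norm2 X + 2 * eps j X * phi j X"
proof -
  note it = rup_iter[OF assms(1), of "phi j X" j, folded rumax_def]
  have m: "mat (rumax j X)" using it by simp
  have n: "norm2 (rumax j X) + card (X j) ^ 2 + card (X (Suc j)) ^ 2 = norm2 X + card (rumax j X j) ^ 2 + card (rumax j X (Suc j)) ^ 2"
    by (rule norm2_step[OF assms(1) m]) (simp add: rumax_def rup_iter_other)
  obtain b where b: "card (X j) = b + phi j X" using it(6) by (metis le_add_diff_inverse2 le_refl)
  have "int (eps j X) - int (phi j X) = int (card (X (Suc j))) - int (b + phi j X)" using eps_phi[OF assms(1), of j] b by simp
  then have p: "card (X (Suc j)) = b + eps j X" by simp
  have "card (rumax j X (Suc j)) = b + eps j X + phi j X" "card (rumax j X j) = b" using it(4,5) b p by auto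
  then show ?thesis using n unfolding b p by (simp add: power2_eq_square algebra_simps)
qed

lemma norm2_sw: "mat X \<Longrightarrow> 1 \<le> j \<Longrightarrow> norm2 (sw j X) = norm2 X"
  using norm2_step[of X "sw j X" j] mat_sw card_sw sw_other[of _ j X] by simp

lemma norm2_Tf: assumes "mat X" "1 \<le> r" shows "norm2 (Tf k r X) = norm2 X"
proof (cases "r \<le> k")
  case True
  then show ?thesis using assms(2)
  proof (induction "k - r" arbitrary: r)
    case (Suc d)
    then have "norm2 (Tf k (Suc r) X) = norm2 X" "r < k" by auto
    then show ?case using norm2_sw[OF Tf_rows(1)[OF assms(1)], of "Suc r" k r] Suc.prems by (simp add: Tf_Suc)
  qed simp
qed (simp add: Tf_def)

lemma csum_tr_rdn: assumes "mat X" "1 \<le> j" "0 < eps j X" shows "csum (tr (rdn j X)) < csum (tr X)"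
proof -
  obtain c where c: "dn (X (Suc j)) (X j) c" using assms geps_pos[of X] unfolding eps_def by auto
  have m: "c \<in> X (Suc j)" "c \<notin> X j" using dn_mem[OF c] by auto
  let ?S = "{(x, r). r \<in> tr X x}"
  have f: "finite ?S" using finite_sites[of "tr X"] assms(1) by simp
  have e: "{(x, r). r \<in> tr (rdn j X) x} = insert (c, j) (?S - {(c, Suc j)})"
    unfolding rdn_def gdn_eq[OF c] using assms(2) by (auto simp: mem_mv)
  have "csum (tr X) = Suc j + (\<Sum>(x, r) \<in> ?S - {(c, Suc j)}. r)"
    unfolding csum_def using f m by (subst sum.remove[of _ "(c, Suc j)"]) auto
  moreover have "csum (tr (rdn j X)) = j + (\<Sum>(x, r) \<in> ?S - {(c, Suc j)}. r)"
    unfolding csum_def e using f m by (subst sum.insert) auto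
  ultimately show ?thesis by simp
qed

lemma csum_tr_rmax: assumes "mat X" "1 \<le> j" "0 < eps j X" shows "csum (tr (rmax j X)) < csum (tr X)"
proof -
  have "csum (tr ((rdn j ^^ Suc k) X)) < csum (tr X)" if "Suc k \<le> eps j X" for k
    using that
  proof (induction k)
    case 0 then show ?case using csum_tr_rdn[OF assms] by simp
  next
    case (Suc k)
    have "0 < eps j ((rdn j ^^ Suc k) X)" "mat ((rdn j ^^ Suc k) X)"
      using rdn_iter[OF assms(1,2), of "Suc k"] Suc by auto
    then have "csum (tr (rdn j ((rdn j ^^ Suc k) X))) < csum (tr ((rdn j ^^ Suc k) X))"
      using csum_tr_rdn assms(2) by blast
    then show ?case using Suc by simp
  qed
  from this[of "eps j X - 1"] show ?thesis unfolding rmax_def using assms(3) by simp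
qed

lemma rops_row1: "(\<forall>(b, j) \<in> set u. 2 \<le> j) \<Longrightarrow> rops u X 1 = X 1"
  by (induction u X rule: rops.induct) (auto simp: rup_other rdn_other)

text \<open>Operators of index at least 2 leave row 1 alone. Pushing down with them ends because the
  sum of the row indices falls, and \<open>norm2\<close> never decreases on the way.\<close>

lemma collapse_upper:
  "mat X \<Longrightarrow> \<exists>u. rword u \<and> (\<forall>(b, j) \<in> set u. 2 \<le> j) \<and> (\<forall>j\<ge>2. eps j (rops u X) = 0) \<and> norm2 X \<le> norm2 (rops u X)"
proof (induction "csum (tr X)" arbitrary: X rule: less_induct)
  case less
  show ?case
  proof (cases "\<forall>j\<ge>2. eps j X = 0")
    case True
    then show ?thesis by (intro exI[of _ "[]"]) simp
  next
    case False
    then obtain j where j: "2 \<le> j" "0 < eps j X" by auto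
    then have j1: "1 \<le> j" by simp
    obtain u where u: "rword u" "\<forall>(b, j) \<in> set u. 2 \<le> j" "\<forall>i\<ge>2. eps i (rops u (rmax j X)) = 0"
      "norm2 (rmax j X) \<le> norm2 (rops u (rmax j X))"
      using less(1)[OF csum_tr_rmax[OF less(2) j1 j(2)] mat_rmax[OF less(2) j1]] by blast
    have e: "rops u (rmax j X) = rops (replicate (eps j X) (False, j) @ u) X"
      unfolding rops_append rmax_def rdn_iter_rops ..
    have "norm2 X \<le> norm2 (rmax j X)" using norm2_rmax[OF less(2) j1] by simp
    then show ?thesis using u j1 j unfolding e
      by (intro exI[of _ "replicate (eps j X) (False, j) @ u"]) auto
  qed
qed

section \<open>First rows are determined by the row highest array\<close>

lemma initial_unique:
  fixes U V C :: "nat set"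
  assumes "finite U" "finite V" "card U = card V"
    and "\<And>x y. x \<in> U \<Longrightarrow> y \<in> C - U \<Longrightarrow> x < y" "\<And>x y. x \<in> V \<Longrightarrow> y \<in> C - V \<Longrightarrow> x < y" "U \<subseteq> C" "V \<subseteq> C"
  shows "U = V"
proof (rule ccontr)
  assume ne: "U \<noteq> V"
  have "\<not> U \<subseteq> V" using card_subset_eq[OF assms(2) _ assms(3)] ne by blast
  moreover have "\<not> V \<subseteq> U" using card_subset_eq[OF assms(1) _ assms(3)[symmetric]] ne by blast
  ultimately obtain x y where "x \<in> U" "x \<notin> V" "y \<in> V" "y \<notin> U" by blast
  then have "x < y" "y < x" using assms(4)[of x y] assms(5)[of y x] assms(6,7) by auto
  then show False by simp
qed

text \<open>The lower row at any place of a string of row moves can be read off from its two ends.\<close>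

lemma string_determined:
  assumes m: "mat Y" "mat Z" and j: "1 \<le> j"
    and e: "rmax j Y j = rmax j Z j" "rumax j Y j = rumax j Z j" "card (Y j) = card (Z j)"
  shows "Y j = Z j"
proof -
  have up: "rumax j W j = W j - uc (W (Suc j)) (W j)" if "mat W" for W
  proof -
    have "{b \<in> uc (W (Suc j)) (W j). hgt (W (Suc j)) (W j) b < int (phi j W) - int (phi j W)} = uc (W (Suc j)) (W j)"
      by (force simp: uc_def)
    then show ?thesis unfolding rumax_def using rup_iter_low(1)[OF that, of "phi j W" j] by simp
  qed
  note dn = rmax_rows(2)[OF m(1) j] rmax_rows(2)[OF m(2) j]
  let ?uY = "uc (Y (Suc j)) (Y j)" and ?uZ = "uc (Z (Suc j)) (Z j)"
  let ?oY = "uo (Y (Suc j)) (Y j)" and ?oZ = "uo (Z (Suc j)) (Z j)"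
  \<comment> \<open>\<open>C\<close> collects the columns whose ball moves somewhere along the
    string. The unmatched closings are its leftmost columns, as many as the size of row
    \<open>j\<close> requires.\<close>
  define C where "C = rmax j Y j - rumax j Y j"
  have CY: "C = ?uY \<union> ?oY" unfolding C_def dn up[OF m(1)] using uc_subset[of "Y (Suc j)" "Y j"] uo_subset[of "Y (Suc j)" "Y j"] by auto
  have CZ: "C = ?uZ \<union> ?oZ" unfolding C_def e dn up[OF m(2)] using uc_subset[of "Z (Suc j)" "Z j"] uo_subset[of "Z (Suc j)" "Z j"] by auto
  have f: "finite ?uY" "finite ?uZ" "finite (Y j)" "finite (Z j)"
    using finite_uc[OF mat_fin1[OF m(1)]] finite_uc[OF mat_fin1[OF m(2)]] mat_finite m by auto
  have sY: "?uY \<subseteq> Y j" and sZ: "?uZ \<subseteq> Z j" using uc_subset by blast+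
  have "card (Y j - ?uY) = card (Z j - ?uZ)" using e(2) unfolding up[OF m(1)] up[OF m(2)] by simp
  then have "card (Y j) - card ?uY = card (Z j) - card ?uZ" using sY sZ f by (simp add: card_Diff_subset)
  moreover have "card ?uY \<le> card (Y j)" "card ?uZ \<le> card (Z j)" using sY sZ f by (auto intro: card_mono)
  ultimately have "card ?uY = card ?uZ" using e(3) by simp
  moreover have "x < y" if "x \<in> ?uY" "y \<in> C - ?uY" for x y
    using uc_less_uo[of x "Y (Suc j)" "Y j" y] that unfolding CY by blast
  moreover have "x < y" if "x \<in> ?uZ" "y \<in> C - ?uZ" for x y
    using uc_less_uo[of x "Z (Suc j)" "Z j" y] that unfolding CZ by blast
  moreover have "?uY \<subseteq> C" using CY by blast
  moreover have "?uZ \<subseteq> C" using CZ by blast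
  ultimately have "?uY = ?uZ" by (rule initial_unique[OF f(1,2)])
  moreover have "Y j = (rumax j Y j) \<union> ?uY" "Z j = rumax j Z j \<union> ?uZ" unfolding up[OF m(1)] up[OF m(2)] using sY sZ by auto
  ultimately show ?thesis using e(2) by simp
qed

lemma uo_nested: "U \<subseteq> D \<Longrightarrow> uo U D = {}"
  using uo_subset[of U D] by blast

lemma vset_nested:
  assumes "fin1 U" "fin1 D" "U \<subseteq> D" shows "vset U D = D - U"
proof -
  have f: "finite D" "finite U" using assms by (auto simp: fin1_def)
  have "card (uc U D) = card (D - U)"
    using card_uo_uc[OF assms(1,2)] uo_nested[OF assms(3)] f assms(3) card_mono[OF f(1) assms(3)]
    by (simp add: card_Diff_subset)
  then have "uc U D = D - U" using uc_subset[of U D] f by (intro card_subset_eq) auto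
  moreover have "hgt U D b < 0" if "b \<in> uc U D" for b using that by (auto simp: uc_def)
  ultimately show ?thesis unfolding vset_def uo_nested[OF assms(3)] by auto
qed

lemma sw_nested:
  assumes m: "mat X" "1 \<le> j" and n: "X (Suc j) \<subseteq> X j"
  shows "sw j X j = X (Suc j)" "sw j X (Suc j) = X j"
proof -
  have c: "card (X (Suc j)) \<le> card (X j)" using n mat_finite[OF m(1)] card_mono by blast
  show "sw j X j = X (Suc j)" "sw j X (Suc j) = X j"
    unfolding sw_rows[OF m(1) c] vset_nested[OF mat_fin1[OF m(1)] mat_fin1[OF m(1)] n] using n by auto
qed

lemma mat_swap: "mat X \<Longrightarrow> 1 \<le> j \<Longrightarrow> mat (X(j := X (Suc j), Suc j := X j))"
proof -
  assume "mat X" "1 \<le> j"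
  then obtain L n where "box L n X" by (auto simp: mat_def)
  then have "box (max L (Suc j)) n (X(j := X (Suc j), Suc j := X j))"
    unfolding box_def using \<open>1 \<le> j\<close> by (auto simp: le_max_iff_disj)
  then show ?thesis by (auto simp: mat_def)
qed

text \<open>The array with the two rows exchanged is covered by \<open>sw_nested\<close>; the
  involution then gives the case of the opposite inclusion.\<close>

lemma sw_nested':
  assumes m: "mat X" "1 \<le> j" and n: "X j \<subseteq> X (Suc j)"
  shows "sw j X j = X (Suc j)" "sw j X (Suc j) = X j"
proof -
  define Z where "Z = X(j := X (Suc j), Suc j := X j)"
  have mZ: "mat Z" unfolding Z_def by (rule mat_swap[OF m])
  have "Z (Suc j) \<subseteq> Z j" unfolding Z_def using n by simp
  note s = sw_nested[OF mZ m(2) this]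
  have "sw j Z = X"
  proof
    have z: "Z j = X (Suc j)" "Z (Suc j) = X j" "\<And>r. r \<noteq> j \<Longrightarrow> r \<noteq> Suc j \<Longrightarrow> Z r = X r"
      unfolding Z_def by auto
    fix r show "sw j Z r = X r"
      using s sw_other[of r j Z] z by (cases "r = j"; cases "r = Suc j") auto
  qed
  then have "sw j X = Z" using sw_sw[OF mZ m(2)] by simp
  then show "sw j X j = X (Suc j)" "sw j X (Suc j) = X j" unfolding Z_def by auto
qed

lemma uo_initial: assumes "fin1 U" shows "uo U {1..c} = U - {1..c}"
proof -
  have U: "U = (U \<inter> {1..c}) \<union> (U - {1..c})" by blast
  have "uo ((U \<inter> {1..c}) \<union> (U - {1..c})) {1..c} = U - {1..c}"
  proof (rule uo_split)
    show "fin1 (U \<inter> {1..c})" "fin1 (U - {1..c})" "fin1 {1..c}" using assms by (auto simp: fin1_def)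
    show "b < u" if "u \<in> U - {1..c}" "b \<in> {1..c} \<union> (U \<inter> {1..c})" for u b
      using that assms by (cases u) (auto simp: fin1_def)
    show "card (U \<inter> {1..c} \<inter> {p..}) \<le> card ({1..c} \<inter> {p..})" for p by (intro card_mono) auto
  qed
  then show ?thesis using U by simp
qed

lemma down_closed:
  fixes S :: "nat set"
  assumes "finite S" "0 \<notin> S" "\<And>x. Suc x \<in> S \<Longrightarrow> 1 \<le> x \<Longrightarrow> x \<in> S"
  shows "S = {1..card S}"
proof (cases "S = {}")
  case False
  have M: "Max S \<in> S" using assms False by simp
  have "y \<in> S" if "1 \<le> y" "y \<le> Max S" for y
    using that(2,1) by (induction rule: inc_induct) (use M assms(3) in auto)
  then have "S = {1..Max S}" using assms(1,2) by (auto simp: Suc_le_eq intro: gr0I)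
  then show ?thesis by (metis card_atLeastAtMost diff_Suc_1)
qed simp

text \<open>Carries the size of row 1 up to row \<open>q + 1\<close>; the word
  \<open>Tf (Suc q) 1\<close> undoes it.\<close>

fun Uw :: "nat \<Rightarrow> mlq \<Rightarrow> mlq" where
  "Uw 0 X = X" | "Uw (Suc q) X = sw (Suc q) (Uw q X)"

lemma mat_Uw: "mat X \<Longrightarrow> mat (Uw q X)"
  by (induction q) (auto simp: mat_sw)

lemma Tf_Uw: "mat X \<Longrightarrow> Tf (Suc q) 1 (Uw q X) = X"
proof (induction q)
  case (Suc q)
  have "Tf (Suc (Suc q)) 1 Z = Tf (Suc q) 1 (sw (Suc q) Z)" for Z
    unfolding Tf_def by simp
  then show ?case using Suc sw_sw[OF mat_Uw[OF Suc(2)], of "Suc q" q] by simp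
qed simp

lemma Uw_conn:
  assumes "conn X Y" "mat X"
  shows "\<exists>w. rword w \<and> Uw q X = rops w X \<and> Uw q Y = rops w Y"
proof (induction q)
  case 0 then show ?case by (intro exI[of _ "[]"]) simp
next
  case (Suc q)
  then obtain w where w: "rword w" "Uw q X = rops w X" "Uw q Y = rops w Y" by blast
  obtain v where "rword v" "sw (Suc q) (rops w X) = rops v (rops w X)" "sw (Suc q) (rops w Y) = rops v (rops w Y)"
    using sw_conn[OF conn_rops[OF assms w(1)] mat_rops[OF w(1) assms(2)], of "Suc q"] by auto
  then show ?case using w by (intro exI[of _ "w @ v"]) (simp add: rops_append)
qed

text \<open>The case where the induction of \<open>row1_determined\<close> cannot ascend. Rows from
  2 on are nested, so \<open>Tf k 2\<close> brings row \<open>k\<close> unchanged to row 2, above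
  the initial segment in row 1. Being at an end of the string makes the two rows comparable, and the
  decrease of column counts leaves no gap.\<close>

lemma rows_initial:
  assumes X: "mat X" "chigh X" and high: "\<And>j. 2 \<le> j \<Longrightarrow> eps j X = 0"
    and ends: "\<And>k. 2 \<le> k \<Longrightarrow> eps 1 (Tf k 2 X) = 0 \<or> phi 1 (Tf k 2 X) = 0"
    and r: "1 \<le> r"
  shows "X r = {1..card (X r)}"
proof -
  have k1: "kap Z 1 x = of_bool (x \<in> Z 1)" for Z x using kap_Suc[of Z 0 x] by simp
  have row1: "Z 1 = {1..card (Z 1)}" if "mat Z" "chigh Z" for Z
  proof (rule down_closed)
    show "finite (Z 1)" "0 \<notin> Z 1" using mat_fin1[OF that(1), of 1] by (auto simp: fin1_def)
    fix x assume "Suc x \<in> Z 1" "1 \<le> x"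
    then show "x \<in> Z 1" using that chigh_kap[OF that(1)] k1[of Z] by (auto simp: of_bool_def split: if_splits) (metis k1 le_zero_eq of_bool_eq(2) of_bool_eq_0_iff zero_neq_one)
  qed
  have "X k = {1..card (X k)}" if "2 \<le> k" for k
    using that
  proof (induction k rule: less_induct)
    case (less k)
    have nest: "X k \<subseteq> X i" if "2 \<le> i" "i < k" for i
    proof -
      have "X k \<subseteq> X (k - 1)"
      proof -
        have "eps (k - 1) X = 0" using high[of "k - 1"] that by simp
        then have "uo (X k) (X (k - 1)) = {}"
          using that finite_uo[OF mat_fin1[OF X(1)], of k "X (k - 1)"] unfolding eps_def geps_def by simp
        moreover have "uo (X k) (X (k - 1)) = X k - X (k - 1)"
          using uo_initial[OF mat_fin1[OF X(1)], of k "card (X (k - 1))"] less(1)[of "k - 1"] that by simp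
        ultimately show ?thesis by blast
      qed
      also have "\<dots> \<subseteq> X i"
      proof -
        have "i \<le> k - 1" using that by simp
        then show ?thesis
        proof (induction rule: inc_induct)
          case (step i')
          have i2: "2 \<le> i'" using step that by simp
          have "card (X (Suc i')) \<le> card (X i')" using eps_phi[OF X(1), of i'] high[OF i2] by simp
          moreover have "X (Suc i') = {1..card (X (Suc i'))}" "X i' = {1..card (X i')}"
            using less(1)[of i'] less(1)[of "Suc i'"] step i2 that by auto
          ultimately have "X (Suc i') \<subseteq> X i'" by (metis atLeastatMost_subset_iff order_refl)
          then show ?case using step by blast
        qed simp
      qed
      finally show ?thesis .
    qed
    have tf: "Tf k i X i = X k" if "2 \<le> i" "i \<le> k" for i
      using that
    proof (induction "k - i" arbitrary: i)
      case 0 then show ?case by simp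
    next
      case (Suc d)
      then have "Tf k (Suc i) X (Suc i) = X k" "i < k" by auto
      moreover have "mat (Tf k (Suc i) X)" "Tf k (Suc i) X i = X i" using Tf_rows[OF X(1), of "Suc i" k] \<open>i < k\<close> by auto
      ultimately show ?case using sw_nested(1)[of "Tf k (Suc i) X" i] nest[of i] Suc by (simp add: Tf_Suc)
    qed
    define Y where "Y = Tf k 2 X"
    have Y: "mat Y" "chigh Y" "Y 2 = X k" "Y 1 = X 1"
    proof -
      obtain w where w: "rword w" "Tf k 2 X = rops w X" using Tf_conn[OF conn.self X(1), of 2 k] by auto
      show "mat Y" "chigh Y" unfolding Y_def w using mat_rops[OF w(1) X(1)] chigh_rops[OF X(1) w(1)] X by auto
      show "Y 2 = X k" "Y 1 = X 1" unfolding Y_def using tf[of 2] less Tf_rows(2)[OF X(1), of 2 k 1] by auto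
    qed
    define m where "m = card (Y 1)"
    have R: "Y 1 = {1..m}" unfolding m_def by (rule row1[OF Y(1,2)])
    have k2: "kap Y 2 x = of_bool (x \<in> Y 1) + of_bool (x \<in> Y 2)" for x
      using kap_Suc[of Y 1 x] k1[of Y x] by (simp add: numeral_2_eq_2)
    have dec: "kap Y 2 (Suc x) \<le> kap Y 2 x" if "1 \<le> x" for x using Y(2) chigh_kap[OF Y(1)] that by blast
    \<comment> \<open>One end of the string puts row 2 inside row 1, the other end the
      reverse.\<close>
    have cases: "Y 2 \<subseteq> {1..m} \<or> {1..m} \<subseteq> Y 2"
    proof (cases "eps 1 Y = 0")
      case True
      then have "uo (Y 2) {1..m} = {}" using finite_uo[OF mat_fin1[OF Y(1)], of 2 "{1..m}"] R
        unfolding eps_def geps_def by (simp add: numeral_2_eq_2)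
      then show ?thesis using uo_initial[OF mat_fin1[OF Y(1)], of 2 m] by blast
    next
      case False
      then have "phi 1 Y = 0" using ends[of k] less unfolding Y_def by auto
      then have "\<forall>q. 0 \<le> hgt (Y 2) {1..m} q"
        using card_uc_min[of "{1..m}" 0 "Y 2"] R unfolding phi_def gphi_def by (simp add: numeral_2_eq_2 fin1_def)
      then have "m \<le> card (Y 2 \<inter> {1..m})" by (auto simp: hgt_def dest: spec[of _ m])
      then have "Y 2 \<inter> {1..m} = {1..m}" by (intro card_seteq) auto
      then show ?thesis by blast
    qed
    have "Y 2 = {1..card (Y 2)}"
    proof (rule down_closed)
      show "finite (Y 2)" "0 \<notin> Y 2" using mat_fin1[OF Y(1), of 2] by (auto simp: fin1_def)
      fix x assume x: "Suc x \<in> Y 2" "1 \<le> x"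
      show "x \<in> Y 2"
      proof (rule ccontr)
        assume n: "x \<notin> Y 2"
        then have "kap Y 2 x = of_bool (x \<le> m)" using x unfolding k2 R by simp
        moreover have "kap Y 2 (Suc x) = of_bool (Suc x \<le> m) + 1" using x unfolding k2 R by simp
        ultimately have "x \<le> m" "\<not> Suc x \<le> m" using dec[OF x(2)] by (auto simp: of_bool_def split: if_splits)
        then show False using cases n x by auto
      qed
    qed
    then show ?case using Y by simp
  qed
  then show ?thesis using row1[OF X] r by (cases "r = 1") auto
qed

text \<open>Among pairs with different first rows, take one of maximal \<open>norm2\<close>.\<close>

lemma row1_determined:
  assumes M: "mat M" "conn M M'"
    and H: "\<And>w k. rword w \<Longrightarrow> rhigh (rops w M) \<Longrightarrow> 1 \<le> k \<Longrightarrow> Tf k 1 (rops w M) 1 = Tf k 1 (rops w M') 1"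
    and w: "rword w"
  shows "rops w M 1 = rops w M' 1"
  using w
\<comment> \<open>Row operators keep \<open>total\<close>, whose square bounds \<open>norm2\<close>;
  so this measure falls as \<open>norm2\<close> grows.\<close>
proof (induction "total M ^ 2 - norm2 (rops w M)" arbitrary: w rule: less_induct)
  case less
  define X X' where "X = rops w M" and "X' = rops w M'"
  have mX: "mat X" unfolding X_def by (rule mat_rops[OF less(2) M(1)])
  have cX: "conn X X'" unfolding X_def X'_def by (rule conn_rops[OF M(2,1) less(2)])
  have IH: "rops v X 1 = rops v X' 1" if "rword v" "norm2 X < norm2 (rops v X)" for v
  proof -
    have r: "rword (w @ v)" using less(2) that by simp
    have "norm2 (rops (w @ v) M) \<le> total M ^ 2"
      using norm2_le[OF mat_rops[OF r M(1)]] total_rops[OF M(1) r] by simp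
    then have "total M ^ 2 - norm2 (rops (w @ v) M) < total M ^ 2 - norm2 (rops w M)"
      using that unfolding X_def rops_append by simp
    from less(1)[OF this r] show ?thesis unfolding X_def X'_def rops_append .
  qed
  obtain u where u: "rword u" "\<forall>(b, j) \<in> set u. 2 \<le> j" "\<forall>j\<ge>2. eps j (rops u X) = 0" "norm2 X \<le> norm2 (rops u X)"
    using collapse_upper[OF mX] by blast
  define X1 X1' where "X1 = rops u X" and "X1' = rops u X'"
  have r1: "X1 1 = X 1" "X1' 1 = X' 1" unfolding X1_def X1'_def using rops_row1[OF u(2)] by auto
  have m1: "mat X1" unfolding X1_def by (rule mat_rops[OF u(1) mX])
  have c1: "conn X1 X1'" unfolding X1_def X1'_def by (rule conn_rops[OF cX mX u(1)])
  have m1': "mat X1'" by (rule conn_mat[OF c1 m1])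
  have "X1 1 = X1' 1"
  \<comment> \<open>Either some row \<open>k\<close>, brought to row 2, is strictly inside its
    string with row 1, or every such array is at an end.\<close>
  proof (cases "\<exists>k\<ge>2. 0 < eps 1 (Tf k 2 X1) \<and> 0 < phi 1 (Tf k 2 X1)")
    case True
    then obtain k where k: "2 \<le> k" "0 < eps 1 (Tf k 2 X1)" "0 < phi 1 (Tf k 2 X1)" by blast
    obtain v where v: "rword v" "Tf k 2 X1 = rops v X1" "Tf k 2 X1' = rops v X1'"
      using Tf_conn[OF c1 m1, of 2 k] by auto
    define Y Y' where "Y = Tf k 2 X1" and "Y' = Tf k 2 X1'"
    have mY: "mat Y" "mat Y'" unfolding Y_def Y'_def v using mat_rops[OF v(1)] m1 m1' by auto
    have cY: "conn Y Y'" unfolding Y_def Y'_def v by (rule conn_rops[OF c1 m1 v(1)])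
    have e: "eps 1 Y' = eps 1 Y" "phi 1 Y' = phi 1 Y" "card (Y' 1) = card (Y 1)"
      using conn_inv[OF cY mY(1)] by auto
    have nY: "norm2 X \<le> norm2 Y" unfolding Y_def using norm2_Tf[OF m1, of 2 k] u(4) unfolding X1_def by simp
    have pos: "0 < 2 * eps 1 Y * phi 1 Y" using k unfolding Y_def by simp
    have YX: "Y = rops v (rops u X)" "Y' = rops v (rops u X')"
      using v unfolding Y_def Y'_def X1_def X1'_def by auto
    \<comment> \<open>Both ends of the string have a larger \<open>norm2\<close>, so the induction
      hypothesis applies to them; \<open>string_determined\<close> recovers row 1 in
      between.\<close>
    have "rmax 1 Y 1 = rmax 1 Y' 1"
    proof -
      have "rmax 1 Y = rops (u @ v @ replicate (eps 1 Y) (False, 1)) X"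
        "rmax 1 Y' = rops (u @ v @ replicate (eps 1 Y) (False, 1)) X'"
        unfolding rmax_def rdn_iter_rops rops_append YX[symmetric] e by (rule refl)+
      moreover have "norm2 X < norm2 (rmax 1 Y)" using norm2_rmax[OF mY(1), of 1] nY pos by linarith
      ultimately show ?thesis using IH[of "u @ v @ replicate (eps 1 Y) (False, 1)"] u(1) v(1) by simp
    qed
    moreover have "rumax 1 Y 1 = rumax 1 Y' 1"
    proof -
      have "rumax 1 Y = rops (u @ v @ replicate (phi 1 Y) (True, 1)) X"
        "rumax 1 Y' = rops (u @ v @ replicate (phi 1 Y) (True, 1)) X'"
        unfolding rumax_def rup_iter_rops rops_append YX[symmetric] e by (rule refl)+
      moreover have "norm2 X < norm2 (rumax 1 Y)" using norm2_rumax[OF mY(1), of 1] nY pos by linarith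
      ultimately show ?thesis using IH[of "u @ v @ replicate (phi 1 Y) (True, 1)"] u(1) v(1) by simp
    qed
    ultimately have "Y 1 = Y' 1" using string_determined[OF mY, of 1] e by simp
    then show ?thesis unfolding Y_def Y'_def using Tf_rows(2)[OF m1, of 2 k 1] Tf_rows(2)[OF m1', of 2 k 1] k by simp
  next
    case False
    obtain X0 where X0: "conn X1 X0" "chigh X0" using ex_chigh[OF m1] by blast
    have m0: "mat X0" by (rule conn_mat[OF X0(1) m1])
    have ini: "X0 r = {1..card (X0 r)}" if "1 \<le> r" for r
    proof (rule rows_initial[OF m0 X0(2) _ _ that])
      show "eps j X0 = 0" if "2 \<le> j" for j
        using conn_inv(2)[OF X0(1) m1, of j] u(3) that unfolding X1_def by simp
      show "eps 1 (Tf k 2 X0) = 0 \<or> phi 1 (Tf k 2 X0) = 0" if k: "2 \<le> k" for k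
      proof -
        obtain v where v: "rword v" "Tf k 2 X1 = rops v X1" "Tf k 2 X0 = rops v X0"
          using Tf_conn[OF X0(1) m1, of 2 k] by auto
        have "conn (Tf k 2 X1) (Tf k 2 X0)" unfolding v by (rule conn_rops[OF X0(1) m1 v(1)])
        moreover have "mat (Tf k 2 X1)" unfolding v by (rule mat_rops[OF v(1) m1])
        ultimately have "eps 1 (Tf k 2 X0) = eps 1 (Tf k 2 X1)" "phi 1 (Tf k 2 X0) = phi 1 (Tf k 2 X1)"
          using conn_inv[of "Tf k 2 X1" "Tf k 2 X0"] by auto
        then show ?thesis using False k by auto
      qed
    qed
    define m where "m = card (X0 1)"
    have sz: "card (X0 (Suc j)) \<le> card (X0 j)" if "2 \<le> j" for j
      using eps_phi[OF m0, of j] conn_inv(2)[OF X0(1) m1, of j] u(3) that unfolding X1_def by simp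
    have "\<exists>q. card (X0 (Suc (Suc q))) \<le> m"
    proof -
      obtain L n where b: "box L n X0" using m0 by (auto simp: mat_def)
      have "X0 (Suc (Suc L)) = {}" using b unfolding box_def by fastforce
      then show ?thesis by (intro exI[of _ L]) simp
    qed
    \<comment> \<open>Rows from 2 on decrease in size, so \<open>q\<close> is the number of rows
      larger than row 1. All rows being initial segments, the swaps in \<open>Uw q\<close> just
      carry row 1 past these rows, and the result is nested.\<close>
    define q where "q = (LEAST q. card (X0 (Suc (Suc q))) \<le> m)"
    have q1: "card (X0 (Suc (Suc q))) \<le> m" unfolding q_def by (rule LeastI_ex) fact
    have q2: "m < card (X0 (Suc (Suc i)))" if "i < q" for i
      using not_less_Least[of i "\<lambda>q. card (X0 (Suc (Suc q))) \<le> m"] that unfolding q_def by simp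
    have rows: "\<forall>r\<ge>1. Uw i X0 r = (if r \<le> i then X0 (Suc r) else if r = Suc i then X0 1 else X0 r)" if "i \<le> q" for i
      using that
    proof (induction i)
      case 0 then show ?case by auto
    next
      case (Suc i)
      let ?Z = "Uw i X0"
      have Z: "?Z (Suc i) = X0 1" "?Z (Suc (Suc i)) = X0 (Suc (Suc i))" using Suc by auto
      have "X0 1 \<subseteq> X0 (Suc (Suc i))"
        using ini[of 1] ini[of "Suc (Suc i)"] q2[of i] Suc(2) unfolding m_def
        by (metis Suc_le_lessD atLeastatMost_subset_iff le_refl less_imp_le_nat One_nat_def Suc_le_mono le0)
      then have s: "sw (Suc i) ?Z (Suc i) = X0 (Suc (Suc i))" "sw (Suc i) ?Z (Suc (Suc i)) = X0 1"
        using sw_nested'[OF mat_Uw[OF m0], of "Suc i" i] Z by auto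
      show ?case
      proof (intro allI impI)
        fix r :: nat assume r: "1 \<le> r"
        consider "r = Suc i" | "r = Suc (Suc i)" | "r \<noteq> Suc i" "r \<noteq> Suc (Suc i)" by blast
        then show "Uw (Suc i) X0 r = (if r \<le> Suc i then X0 (Suc r) else if r = Suc (Suc i) then X0 1 else X0 r)"
        proof cases
          case 3
          then have "Uw (Suc i) X0 r = ?Z r" using sw_other[of r "Suc i" ?Z] by simp
          then show ?thesis using Suc r 3 by auto
        qed (use s in auto)
      qed
    qed
    have "rhigh (Uw q X0)" unfolding rhigh_def
    proof (intro allI impI)
      fix j :: nat assume j: "1 \<le> j"
      have iniU: "Uw q X0 r = {1..card (Uw q X0 r)}" if "1 \<le> r" for r
        using rows[of q] ini[of r] ini[of "Suc r"] ini[of 1] that by (auto split: if_splits)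
      have "card (Uw q X0 (Suc j)) \<le> card (Uw q X0 j)"
      proof -
        consider "Suc j \<le> q" | "j = q" | "j = Suc q" | "j > Suc q" by linarith
        then show ?thesis
        proof cases
          case 1 then show ?thesis using rows[of q] j sz[of "Suc j"] by simp
        next
          case 2
          then obtain q' where "q = Suc q'" using j by (cases q) auto
          then show ?thesis using rows[of q] j 2 q2[of q'] unfolding m_def by simp
        next
          case 3 then show ?thesis using rows[of q] j q1 unfolding m_def by simp
        next
          case 4 then show ?thesis using rows[of q] j sz[of j] by simp
        qed
      qed
      then have "Uw q X0 (Suc j) \<subseteq> Uw q X0 j" using iniU[of j] iniU[of "Suc j"] j
        by (metis atLeastatMost_subset_iff le_refl le_SucI)
      then show "eps j (Uw q X0) = 0" unfolding eps_def geps_def by (simp add: uo_nested)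
    qed
    moreover obtain v where v: "rword v" "Uw q X1 = rops v X1" "Uw q X0 = rops v X0"
      using Uw_conn[OF X0(1) m1] by blast
    ultimately have rh: "rhigh (rops v X1)" using rhigh_conn[OF conn_rops[OF X0(1) m1 v(1)] mat_rops[OF v(1) m1]] by simp
    obtain v' where v': "rword v'" "Uw q X1 = rops v' X1" "Uw q X1' = rops v' X1'" using Uw_conn[OF c1 m1] by blast
    have e: "Uw q X1 = rops (w @ u @ v') M" "Uw q X1' = rops (w @ u @ v') M'"
      using v'(2,3) unfolding rops_append X1_def X1'_def X_def X'_def by auto
    \<comment> \<open>The array after \<open>Uw q\<close> is row highest, so the hypothesis
      \<open>H\<close> compares its first rows after \<open>Tf\<close>; at \<open>k = q + 1\<close>
      the word undoes \<open>Uw q\<close>.\<close>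
    have "Tf (Suc q) 1 (Uw q X1) 1 = Tf (Suc q) 1 (Uw q X1') 1"
      unfolding e
    proof (rule H)
      show "rword (w @ u @ v')" using less(2) u(1) v'(1) by simp
      show "rhigh (rops (w @ u @ v') M)" unfolding e(1)[symmetric] v using rh .
    qed simp
    then show ?thesis unfolding Tf_Uw[OF m1] Tf_Uw[OF m1'] .
  qed
  then show ?case using r1 unfolding X_def X'_def by simp
qed

text \<open>By \<open>rhigh_unique\<close> all row highest arrays reachable from \<open>M\<close>
  coincide, and likewise for \<open>M'\<close>; hence a single word \<open>w0\<close> supplies the
  hypothesis of \<open>row1_determined\<close>.\<close>

lemma type_determined:
  assumes M: "mat M" "conn M M'" and w0: "rword w0" "rhigh (rops w0 M)"
    and T: "\<And>k. 1 \<le> k \<Longrightarrow> Tf k 1 (rops w0 M) 1 = Tf k 1 (rops w0 M') 1" and k: "1 \<le> k"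
  shows "Tf k 1 M 1 = Tf k 1 M' 1"
proof -
  have m': "mat M'" by (rule conn_mat[OF M(2,1)])
  have h': "rhigh (rops w M')" if "rword w" "rhigh (rops w M)" for w
    using rhigh_conn[OF conn_rops[OF M(2,1) that(1)] mat_rops[OF that(1) M(1)]] that by simp
  obtain v where v: "rword v" "Tf k 1 M = rops v M" "Tf k 1 M' = rops v M'"
    using Tf_conn[OF M(2,1), of 1 k] by auto
  show ?thesis unfolding v
  proof (rule row1_determined[OF M _ v(1)])
    fix w k assume w: "rword w" "rhigh (rops w M)" "1 \<le> (k :: nat)"
    have "rops w M = rops w0 M" by (rule rhigh_unique[OF M(1) w(1) w0(1) w(2) w0(2)])
    moreover have "rops w M' = rops w0 M'" by (rule rhigh_unique[OF m' w(1) w0(1) h'[OF w(1,2)] h'[OF w0]])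
    ultimately show "Tf k 1 (rops w M) 1 = Tf k 1 (rops w M') 1" using T[OF w(3)] by simp
  qed
qed

section \<open>Arrays of reading words\<close>

text \<open>Models the reading word of a tableau: \<open>a i j\<close> counts the entries at most
  \<open>i\<close> in row \<open>j\<close>, and \<open>off j\<close> the letters read before that
  row, higher rows being read first. The assumption \<open>strict\<close> is column strictness,
  \<open>sep\<close> says that the segment of row \<open>j + 1\<close> ends before that of row
  \<open>j\<close>.\<close>

locale blocks =
  fixes off :: "nat \<Rightarrow> nat" and a :: "nat \<Rightarrow> nat \<Rightarrow> nat" and M :: mlq and L n :: nat
  assumes mono: "\<And>i j. a i j \<le> a (Suc i) j"
    and zero: "\<And>j. a 0 j = 0"
    and strict: "\<And>i j. 1 \<le> j \<Longrightarrow> a (Suc i) (Suc j) \<le> a i j"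
    and sep: "\<And>i j. 1 \<le> j \<Longrightarrow> off (Suc j) + a i (Suc j) \<le> off j"
    and M: "\<And>r. M (Suc r) = (\<Union>j\<in>{1..}. {off j + a r j<..off j + a (Suc r) j})"
    and box: "box L n M"
begin

lemma a_zero: "i < j \<Longrightarrow> a i j = 0"
proof (induction i arbitrary: j)
  case 0 then show ?case by (simp add: zero)
next
  case (Suc i)
  then obtain j' where j': "j = Suc j'" "i < j'" by (cases j) auto
  then show ?case using strict[of j' i] Suc(1)[of j'] by simp
qed

lemma sep': "1 \<le> s \<Longrightarrow> s < j \<Longrightarrow> off j + a i j \<le> off s"
proof (induction j)
  case (Suc j)
  show ?case
  proof (cases "s = j")
    case True then show ?thesis using sep[of j i] Suc by simp
  next
    case False
    then have "off j \<le> off s" "1 \<le> j" using Suc by auto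
    then show ?thesis using sep[of j i] by simp
  qed
qed simp

text \<open>The counterpart of \<open>Dn\<close>: newcomers of block \<open>r\<close> are to settle
  in row \<open>r\<close>, and row \<open>j\<close> still carries those of all blocks up to
  \<open>j\<close>.\<close>

definition F :: "nat \<Rightarrow> nat \<Rightarrow> mlq" where
  "F k j = (\<lambda>r. if r = 0 then {}
     else if r < j then {off r<..off r + a k r}
     else if r = j then {off j<..off j + a k j} \<union> (\<Union>s\<in>{1..j}. {off s + a k s<..off s + a (Suc k) s})
     else if r \<le> Suc k then {off r<..off r + a (Suc k) r} else M r)"

definition E :: "nat \<Rightarrow> mlq" where
  "E k = (\<lambda>r. if r = 0 then {} else if r \<le> k then {off r<..off r + a k r} else M r)"

lemma mat_M: "mat M"
  unfolding mat_def using box by blast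

lemma F_start: "F k (Suc k) = E k"
proof
  fix r
  show "F k (Suc k) r = E k r"
  proof (cases "r = Suc k")
    case True
    have "(\<Union>j\<in>{1..}. {off j + a k j<..off j + a (Suc k) j}) = (\<Union>s\<in>{1..Suc k}. {off s + a k s<..off s + a (Suc k) s})"
    proof (intro equalityI UN_least)
      fix j assume "j \<in> {1::nat..}"
      then show "{off j + a k j<..off j + a (Suc k) j} \<subseteq> (\<Union>s\<in>{1..Suc k}. {off s + a k s<..off s + a (Suc k) s})"
        using a_zero[of "Suc k" j] by (cases "j \<le> Suc k") (auto simp: a_zero)
    qed auto
    then show ?thesis using True M[of k] a_zero[of k "Suc k"] by (simp add: F_def E_def)
  next
    case False
    then show ?thesis by (auto simp: F_def E_def)
  qed
qed

lemma F_end: "F k 1 = E (Suc k)"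
proof
  fix r
  have "{off 1<..off 1 + a k 1} \<union> {off 1 + a k 1<..off 1 + a (Suc k) 1} = {off 1<..off 1 + a (Suc k) 1}"
    using mono[of k 1] by auto
  then show "F k 1 r = E (Suc k) r" by (auto simp: F_def E_def)
qed

text \<open>Blocks run from right to left, so newcomers of blocks up to \<open>j\<close> lie right
  of row \<open>j\<close> and fall. What stays in row \<open>j + 1\<close> lies left of row
  \<open>j\<close> and is no longer than it, by \<open>strict\<close>, so it is matched.\<close>

lemma F_step:
  assumes j: "1 \<le> j" "j \<le> k" and m: "mat (F k (Suc j))"
  shows "rmax j (F k (Suc j)) = F k j"
proof -
  let ?D = "F k (Suc j)"
  define U1 where "U1 = {off (Suc j)<..off (Suc j) + a (Suc k) (Suc j)}"
  define U2 where "U2 = (\<Union>s\<in>{1..j}. {off s + a k s<..off s + a (Suc k) s})"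
  have low: "?D j = {off j<..off j + a k j}" using j by (simp add: F_def)
  have "{1..Suc j} = insert (Suc j) {1..j}" by auto
  moreover have "{off (Suc j)<..off (Suc j) + a k (Suc j)} \<union> {off (Suc j) + a k (Suc j)<..off (Suc j) + a (Suc k) (Suc j)} = U1"
    unfolding U1_def using mono[of k "Suc j"] by auto
  ultimately have upp: "?D (Suc j) = U1 \<union> U2" unfolding U2_def F_def by auto
  have u1: "off (Suc j) + a (Suc k) (Suc j) \<le> off j" using sep[OF j(1)] .
  have b: "b < u" if uU: "u \<in> U2" and bU: "b \<in> ?D j \<union> U1" for u b
  proof -
    obtain s where s: "1 \<le> s" "s \<le> j" "off s + a k s < u" using uU unfolding U2_def by auto
    have "b \<le> off j + a k j" using bU u1 unfolding low U1_def by auto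
    also have "\<dots> \<le> off s + a k s" using sep'[of s j k] s by (cases "s = j") auto
    finally show ?thesis using s by simp
  qed
  have c: "card (U1 \<inter> {p..}) \<le> card (?D j \<inter> {p..})" for p
  proof (cases "U1 \<inter> {p..} = {}")
    case False
    then have "p \<le> off j" using u1 unfolding U1_def by auto
    then have e: "?D j \<inter> {p..} = ?D j" unfolding low by auto
    have "card (U1 \<inter> {p..}) \<le> card U1" unfolding U1_def by (intro card_mono) auto
    also have "\<dots> \<le> card (?D j)" using strict[OF j(1), of k] unfolding U1_def low by simp
    finally show ?thesis unfolding e .
  qed simp
  note r = rmax_split[OF m j(1) upp b c]
  show ?thesis
  proof
    fix r'
    consider "r' = j" | "r' = Suc j" | "r' \<noteq> j" "r' \<noteq> Suc j" by blast
    then show "rmax j ?D r' = F k j r'"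
    proof cases
      case 1
      then show ?thesis using r(2) j unfolding low U2_def by (simp add: F_def)
    next
      case 2
      then show ?thesis using r(1) j unfolding U1_def by (simp add: F_def)
    next
      case 3
      then show ?thesis using rmax_other[of r' j ?D] by (auto simp: F_def)
    qed
  qed
qed

lemma collapse_blocks: "collapse n M k = E k"
proof (induction k)
  case 0
  show ?case using mat_row0[OF mat_M] by (intro ext) (auto simp: E_def)
next
  case (Suc k)
  have mE: "mat (E k)" using box_collapse[OF box, of k] Suc by (auto simp: mat_def)
  have "foldr rmax [j..<Suc k] (E k) = F k j \<and> mat (F k j)" if "1 \<le> j" "j \<le> Suc k" for j
    using that
  proof (induction "Suc k - j" arbitrary: j)
    case 0
    then have "j = Suc k" by simp
    then show ?case using F_start[of k] mE by simp
  next
    case (Suc d)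
    then have "foldr rmax [Suc j..<Suc k] (E k) = F k (Suc j)" "mat (F k (Suc j))" by auto
    then show ?case using F_step[of j k] mat_rmax[of "F k (Suc j)" j] Suc by (simp add: upt_conv_Cons del: upt_Suc)
  qed
  from this[of 1] show ?case using collapse_Suc[OF box, of k] Suc F_end[of k] by simp
qed

lemma recording_blocks:
  assumes j: "1 \<le> j"
  shows "sorted (recording n M k j)" "\<And>r. length (filter (\<lambda>x. x \<le> r) (recording n M k j)) = a (min r k) j"
proof -
  have "sorted (recording n M k j) \<and> (\<forall>x \<in> set (recording n M k j). 1 \<le> x \<and> x \<le> k) \<and>
    (\<forall>r. length (filter (\<lambda>x. x \<le> r) (recording n M k j)) = a (min r k) j)"
    by (rule recording_generic[where s = a, OF _ a_zero mono j]) (auto simp: collapse_blocks E_def)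
  then show "sorted (recording n M k j)" "\<And>r. length (filter (\<lambda>x. x \<le> r) (recording n M k j)) = a (min r k) j"
    by auto
qed

end

section \<open>The array of the reading word of a tableau\<close>

definition good_tab :: "tableau \<Rightarrow> bool" where
  "good_tab T \<longleftrightarrow> (\<forall>R \<in> set T. sorted R \<and> R \<noteq> [] \<and> 0 \<notin> set R) \<and>
     (\<forall>i j. Suc i < length T \<longrightarrow> j < length (T ! Suc i) \<longrightarrow> j < length (T ! i) \<and> T ! i ! j < T ! Suc i ! j)"

text \<open>The permutation-like array of a word: column \<open>p\<close> holds one ball, in the row
  given by the \<open>p\<close>-th letter. Letter 0 gives no ball.\<close>

definition wmat :: "nat list \<Rightarrow> mlq" where
  "wmat w r = {p. 1 \<le> r \<and> 1 \<le> p \<and> p \<le> length w \<and> w ! (p - 1) = r}"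

definition tcnt :: "tableau \<Rightarrow> nat \<Rightarrow> nat \<Rightarrow> nat" where
  "tcnt T i j = length (filter (\<lambda>x. x \<le> i) (qrow T j))"

definition toff :: "tableau \<Rightarrow> nat \<Rightarrow> nat" where
  "toff T j = length (concat (drop j T))"

lemma sorted_positions:
  fixes R :: "nat list"
  assumes "sorted R"
  shows "{p. p < length R \<and> R ! p = Suc r} =
    {length (filter (\<lambda>x. x \<le> r) R)..<length (filter (\<lambda>x. x \<le> Suc r) R)}"
proof -
  have "p < length R \<and> R ! p = Suc r \<longleftrightarrow> length (filter (\<lambda>x. x \<le> r) R) \<le> p \<and> p < length (filter (\<lambda>x. x \<le> Suc r) R)" for p
  proof (cases "p < length R")
    case True
    have "R ! p = Suc r \<longleftrightarrow> \<not> R ! p \<le> r \<and> R ! p \<le> Suc r" by auto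
    then show ?thesis using sorted_nth_le[OF assms True, of r] sorted_nth_le[OF assms True, of "Suc r"] True by auto
  next
    case False
    then have "length (filter (\<lambda>x. x \<le> Suc r) R) \<le> p"
      using length_filter_le[of "\<lambda>x. x \<le> Suc r" R] by (meson not_less order_trans)
    then show ?thesis using False by auto
  qed
  then show ?thesis by (simp add: set_eq_iff)
qed

lemma wmat_append:
  "wmat (u @ R) r = wmat u r \<union> (\<lambda>p. length u + p + 1) ` {p. p < length R \<and> R ! p = r \<and> 1 \<le> r}"
proof (rule set_eqI)
  fix p
  show "p \<in> wmat (u @ R) r \<longleftrightarrow> p \<in> wmat u r \<union> (\<lambda>p. length u + p + 1) ` {p. p < length R \<and> R ! p = r \<and> 1 \<le> r}"
  proof (cases "p \<le> length u")
    case True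
    then show ?thesis by (auto simp: wmat_def nth_append)
  next
    case False
    define q where "q = p - length u - 1"
    have q: "p = length u + q + 1" using False unfolding q_def by simp
    then show ?thesis by (auto simp: wmat_def nth_append)
  qed
qed

lemma qrow_Cons: "qrow (R # T) (Suc j) = (if j = 0 then R else qrow T j)"
  unfolding qrow_def by (cases j) simp_all

lemma image_shift: "(\<lambda>p::nat. k + p + 1) ` {x..<y} = {k + x<..k + y}"
proof (rule set_eqI)
  fix q show "q \<in> (\<lambda>p. k + p + 1) ` {x..<y} \<longleftrightarrow> q \<in> {k + x<..k + y}"
  proof
    assume "q \<in> {k + x<..k + y}"
    then show "q \<in> (\<lambda>p. k + p + 1) ` {x..<y}" by (intro image_eqI[of _ _ "q - k - 1"]) auto
  qed auto
qed

lemma length_concat_rev: "length (concat (rev T)) = length (concat T)"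
  by (induction T) auto

lemma wmat_reading_word:
  assumes "\<forall>R \<in> set T. sorted R"
  shows "wmat (reading_word T) (Suc r) = (\<Union>j\<in>{1..}. {toff T j + tcnt T r j<..toff T j + tcnt T (Suc r) j})"
  using assms
proof (induction T)
  case Nil
  have "wmat (reading_word []) (Suc r) = {}" by (simp add: wmat_def reading_word_def)
  moreover have "tcnt [] i j = 0" for i j by (cases "1 \<le> j") (simp_all add: tcnt_def qrow_def)
  ultimately show ?case by simp
next
  case (Cons R T)
  have rw: "reading_word (R # T) = reading_word T @ R" by (simp add: reading_word_def)
  have len: "length (reading_word T) = toff (R # T) 1"
    by (simp add: reading_word_def toff_def length_concat_rev)
  have off: "toff (R # T) (Suc j) = toff T j" for j by (simp add: toff_def)
  have cnt: "tcnt (R # T) i (Suc j) = (if j = 0 then length (filter (\<lambda>x. x \<le> i) R) else tcnt T i j)" for i j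
    by (simp add: tcnt_def qrow_Cons)
  have I: "{1::nat..} = insert 1 (Suc ` {1..})"
  proof (rule set_eqI)
    fix j :: nat show "j \<in> {1..} \<longleftrightarrow> j \<in> insert 1 (Suc ` {1..})"
    proof (cases j)
      case (Suc i)
      show ?thesis unfolding Suc by (cases "i = 0") auto
    qed auto
  qed
  have "wmat (reading_word (R # T)) (Suc r) = wmat (reading_word T) (Suc r) \<union>
    (\<lambda>p. toff (R # T) 1 + p + 1) ` {length (filter (\<lambda>x. x \<le> r) R)..<length (filter (\<lambda>x. x \<le> Suc r) R)}"
    unfolding rw wmat_append len using sorted_positions[of R r] Cons(2) by simp
  also have "\<dots> = {toff (R # T) 1 + tcnt (R # T) r 1<..toff (R # T) 1 + tcnt (R # T) (Suc r) 1} \<union>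
     (\<Union>j\<in>{1..}. {toff (R # T) (Suc j) + tcnt (R # T) r (Suc j)<..toff (R # T) (Suc j) + tcnt (R # T) (Suc r) (Suc j)})"
  proof -
    have eq: "(\<Union>j\<in>{1..}. {toff T j + tcnt T r j<..toff T j + tcnt T (Suc r) j}) =
      (\<Union>j\<in>{1..}. {toff (R # T) (Suc j) + tcnt (R # T) r (Suc j)<..toff (R # T) (Suc j) + tcnt (R # T) (Suc r) (Suc j)})"
    proof (rule SUP_cong[OF HOL.refl])
      fix j :: nat assume "j \<in> {1..}"
      then have "tcnt (R # T) i (Suc j) = tcnt T i j" for i using cnt[of i j] by simp
      then show "{toff T j + tcnt T r j<..toff T j + tcnt T (Suc r) j} =
        {toff (R # T) (Suc j) + tcnt (R # T) r (Suc j)<..toff (R # T) (Suc j) + tcnt (R # T) (Suc r) (Suc j)}"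
        by (simp only: off)
    qed
    have ih: "wmat (reading_word T) (Suc r) = (\<Union>j\<in>{1..}. {toff T j + tcnt T r j<..toff T j + tcnt T (Suc r) j})"
      using Cons by simp
    have c1: "tcnt (R # T) i 1 = length (filter (\<lambda>x. x \<le> i) R)" for i using cnt[of i 0] by simp
    show ?thesis by (subst ih, subst eq, subst c1, subst c1, subst image_shift, rule Un_commute)
  qed
  also have "\<dots> = (\<Union>j\<in>insert 1 (Suc ` {1..}). {toff (R # T) j + tcnt (R # T) r j<..toff (R # T) j + tcnt (R # T) (Suc r) j})"
    by simp
  finally show ?case by (subst I)
qed

lemma box_wmat: assumes "\<And>x. x \<in> set w \<Longrightarrow> x \<le> L" shows "box L (length w) (wmat w)"
  unfolding box_def wmat_def
proof (intro allI impI)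
  fix r c assume "c \<in> {p. 1 \<le> r \<and> 1 \<le> p \<and> p \<le> length w \<and> w ! (p - 1) = r}"
  then have c: "1 \<le> r" "1 \<le> c" "c \<le> length w" "w ! (c - 1) = r" by auto
  then have "r \<in> set w" using nth_mem[of "c - 1" w] by auto
  then show "1 \<le> r \<and> r \<le> L \<and> 1 \<le> c \<and> c \<le> length w" using assms c by auto
qed

lemma qrow_mem: "1 \<le> j \<Longrightarrow> j \<le> length T \<Longrightarrow> qrow T j \<in> set T"
  by (auto simp: qrow_def)

lemma good_rows: "good_tab T \<Longrightarrow> R \<in> set T \<Longrightarrow> sorted R \<and> R \<noteq> [] \<and> 0 \<notin> set R"
  unfolding good_tab_def by blast

lemma good_qrow:
  assumes "good_tab T" shows "sorted (qrow T j)" "0 \<notin> set (qrow T j)"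
    "1 \<le> j \<Longrightarrow> qrow T j = [] \<longleftrightarrow> length T < j"
proof -
  have "sorted (qrow T j) \<and> 0 \<notin> set (qrow T j) \<and> (1 \<le> j \<longrightarrow> (qrow T j = [] \<longleftrightarrow> length T < j))"
  proof (cases "1 \<le> j \<and> j \<le> length T")
    case True
    then have "qrow T j \<in> set T" by (simp add: qrow_mem)
    from good_rows[OF assms this] True show ?thesis by auto
  next
    case False
    then show ?thesis by (auto simp: qrow_def)
  qed
  then show "sorted (qrow T j)" "0 \<notin> set (qrow T j)"
    "1 \<le> j \<Longrightarrow> qrow T j = [] \<longleftrightarrow> length T < j" by auto
qed

lemma blocks_wmat:
  assumes T: "good_tab T" and L: "\<And>x. x \<in> set (reading_word T) \<Longrightarrow> x \<le> L"
  shows "blocks (toff T) (tcnt T) (wmat (reading_word T)) L (length (reading_word T))"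
proof
  have srt: "sorted (qrow T j)" for j
    by (rule good_qrow(1)[OF T])
  show "tcnt T i j \<le> tcnt T (Suc i) j" for i j
  proof -
    have e: "filter (\<lambda>x. x \<le> i) (qrow T j) = filter (\<lambda>x. x \<le> i) (filter (\<lambda>x. x \<le> Suc i) (qrow T j))"
      unfolding filter_filter by (rule filter_cong) auto
    show ?thesis unfolding tcnt_def by (subst e) (rule length_filter_le)
  qed
  show "tcnt T 0 j = 0" for j
  proof -
    have "\<not> x \<le> 0" if "x \<in> set (qrow T j)" for x using good_qrow(2)[OF T, of j] that by (cases x) auto
    then have "filter (\<lambda>x. x \<le> 0) (qrow T j) = []" by (simp only: filter_empty_conv) blast
    then show ?thesis by (simp add: tcnt_def)
  qed
  show "tcnt T (Suc i) (Suc j) \<le> tcnt T i j" if j: "1 \<le> j" for i j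
  proof (cases "tcnt T (Suc i) (Suc j)")
    case (Suc p)
    have "tcnt T (Suc i) (Suc j) \<le> length (qrow T (Suc j))" unfolding tcnt_def by (rule length_filter_le)
    then have pl: "p < length (qrow T (Suc j))" using Suc by simp
    then have jl: "Suc j \<le> length T" by (auto simp: qrow_def split: if_splits)
    have rows: "qrow T (Suc j) = T ! j" "qrow T j = T ! (j - 1)" using jl j by (auto simp: qrow_def)
    have "T ! j ! p \<le> Suc i" using sorted_nth_le[OF srt pl, of "Suc i"] Suc unfolding tcnt_def rows by simp
    moreover have "p < length (T ! (j - 1)) \<and> T ! (j - 1) ! p < T ! j ! p"
    proof -
      have e: "Suc (j - 1) = j" using j by simp
      show ?thesis using T[unfolded good_tab_def, THEN conjunct2, rule_format, of "j - 1" p] jl pl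
        unfolding e rows by simp
    qed
    ultimately have "p < length (qrow T j)" "qrow T j ! p \<le> i" unfolding rows by auto
    then have "p < tcnt T i j" using sorted_nth_le[OF srt, of p j i] unfolding tcnt_def by simp
    then show ?thesis using Suc by simp
  qed simp
  show "toff T (Suc j) + tcnt T i (Suc j) \<le> toff T j" if "1 \<le> j" for i j
  proof (cases "j < length T")
    case True
    then have "drop j T = T ! j # drop (Suc j) T" by (simp add: Cons_nth_drop_Suc)
    then have "toff T j = length (T ! j) + toff T (Suc j)" by (simp add: toff_def)
    moreover have "tcnt T i (Suc j) \<le> length (T ! j)" using True by (simp add: tcnt_def qrow_def)
    ultimately show ?thesis by simp
  next
    case False
    then show ?thesis by (simp add: tcnt_def qrow_def toff_def)
  qed
  show "wmat (reading_word T) (Suc r) = (\<Union>j\<in>{1..}. {toff T j + tcnt T r j<..toff T j + tcnt T (Suc r) j})" for r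
    by (rule wmat_reading_word) (use good_rows[OF T] in blast)
  show "box L (length (reading_word T)) (wmat (reading_word T))" by (rule box_wmat[OF L])
qed

lemma qrow_inject:
  assumes "\<And>R. R \<in> set T \<Longrightarrow> R \<noteq> []" "\<And>R. R \<in> set T' \<Longrightarrow> R \<noteq> []" "\<And>j. 1 \<le> j \<Longrightarrow> qrow T j = qrow T' j"
  shows "T = T'"
proof -
  have le: "length U \<le> length V" if "\<And>R. R \<in> set U \<Longrightarrow> R \<noteq> []" "\<And>j. 1 \<le> j \<Longrightarrow> qrow U j = qrow V j" for U V :: tableau
  proof (rule ccontr)
    assume "\<not> length U \<le> length V"
    then have "qrow V (Suc (length V)) = []" "qrow U (Suc (length V)) \<in> set U" by (auto simp: qrow_def)
    then show False using that(1)[of "qrow U (Suc (length V))"] that(2)[of "Suc (length V)"] by simp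
  qed
  have l: "length T = length T'" using le[of T T'] le[of T' T] assms by simp
  show ?thesis
  proof (rule nth_equalityI[OF l])
    fix i assume "i < length T"
    then show "T ! i = T' ! i" using assms(3)[of "Suc i"] l by (simp add: qrow_def)
  qed
qed

lemma rho_Q_wmat:
  assumes T: "good_tab T"
  shows "rho_Q (length (reading_word T)) (wmat (reading_word T)) = T"
proof -
  define w where "w = reading_word T"
  define L where "L = Max (insert 0 (set w))"
  have L: "x \<le> L" if "x \<in> set w" for x unfolding L_def using that by simp
  interpret blocks "toff T" "tcnt T" "wmat w" L "length w"
    unfolding w_def
  proof (rule blocks_wmat[OF T])
    show "x \<le> L" if "x \<in> set (reading_word T)" for x using L[of x] that unfolding w_def .
  qed
  let ?H = "height (wmat w)"
  have srt: "sorted (qrow T j)" for j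
    by (rule good_qrow(1)[OF T])
  \<comment> \<open>Above the height no letter occurs, so the counts no longer change; stopping the
    recording at the height loses nothing.\<close>
  have stable: "tcnt T (?H + d) j = tcnt T ?H j" if "1 \<le> j" for d j
  proof (induction d)
    case (Suc d)
    have "wmat w (Suc (?H + d)) = {}" using box_height(1)[OF box] by simp
    then have "{toff T j + tcnt T (?H + d) j<..toff T j + tcnt T (Suc (?H + d)) j} = {}" using M[of "?H + d"] that by blast
    then show ?case using Suc mono[of "?H + d" j] by simp
  qed simp
  have rec: "recording (length w) (wmat w) ?H j = qrow T j" if j: "1 \<le> j" for j
  proof (rule sorted_filter_unique[OF recording_blocks(1)[OF j] srt])
    fix r
    have "tcnt T (min r ?H) j = tcnt T r j" using stable[OF j, of "r - ?H"] by (cases "?H \<le> r") (auto simp: min_def)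
    then show "length (filter (\<lambda>x. x \<le> r) (recording (length w) (wmat w) ?H j)) = length (filter (\<lambda>x. x \<le> r) (qrow T j))"
      unfolding recording_blocks(2)[OF j] by (simp add: tcnt_def)
  qed
  have ne: "qrow T j = [] \<longleftrightarrow> length T < j" if "1 \<le> j" for j
    by (rule good_qrow(3)[OF T that])
  have big: "qrow T j = []" if "?H < j" for j
  proof (rule sorted_filter_unique)
    fix r
    have "1 \<le> j" using that by simp
    have "length (filter (\<lambda>x. x \<le> r) (qrow T j)) = tcnt T (min r ?H) j"
      using stable[OF \<open>1 \<le> j\<close>, of "r - ?H"] by (cases "?H \<le> r") (auto simp: min_def tcnt_def)
    also have "\<dots> = 0" using a_zero[of "min r ?H" j] that by simp
    finally show "length (filter (\<lambda>x. x \<le> r) (qrow T j)) = length (filter (\<lambda>x. x \<le> r) [])" by simp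
  qed (use srt in auto)
  have "rho_Q (length w) (wmat w) = T"
  proof (rule qrow_inject)
    show "R \<noteq> []" if "R \<in> set (rho_Q (length w) (wmat w))" for R
      using set_takeWhileD[OF that[unfolded rho_Q_def]] by simp
    show "R \<noteq> []" if "R \<in> set T" for R using good_rows[OF T that] by blast
    fix j :: nat assume j: "1 \<le> j"
    have "qrow (rho_Q (length w) (wmat w)) j = recording (length w) (wmat w) ?H j"
      unfolding rho_Q_def
    proof (rule takeWhile_rows[OF _ _ j])
      fix i assume "1 \<le> i" "recording (length w) (wmat w) ?H i = []"
      then show "recording (length w) (wmat w) ?H (Suc i) = []" using rec[of i] rec[of "Suc i"] ne[of i] ne[of "Suc i"] by simp
    next
      fix i assume "?H < i" then show "recording (length w) (wmat w) ?H i = []" using rec[of i] big[of i] by simp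
    qed
    then show "qrow (rho_Q (length w) (wmat w)) j = qrow T j" using rec[OF j] by simp
  qed
  then show ?thesis unfolding w_def .
qed

section \<open>Greedy pairings\<close>

definition pcnt :: "nat set \<Rightarrow> nat \<Rightarrow> int" where
  "pcnt A p = int (card (A \<inter> {1..p}))"

text \<open>For sets of equal size: \<open>A\<close> can be moved onto \<open>B\<close> by going
  cyclically to the right with at most \<open>h\<close> wraps.\<close>

definition leh :: "int \<Rightarrow> nat set \<Rightarrow> nat set \<Rightarrow> bool" where
  "leh h A B \<longleftrightarrow> (\<forall>p. pcnt B p \<le> pcnt A p + h)"

lemma pcnt_0 [simp]: "pcnt A 0 = 0" by (simp add: pcnt_def)

lemma hgt_pcnt: "hgt A B p = pcnt A p - pcnt B p" by (simp add: hgt_def pcnt_def)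

lemma leh_nonneg: "leh h A B \<Longrightarrow> 0 \<le> h"
  unfolding leh_def using pcnt_0 by (metis add_0)

lemma leh_trans: "leh h A B \<Longrightarrow> leh g B C \<Longrightarrow> leh (h + g) A C"
  unfolding leh_def by (smt (verit))

lemma leh_refl: "leh 0 A A" by (simp add: leh_def)

lemma pcnt_mono: "B \<subseteq> S \<Longrightarrow> p \<le> q \<Longrightarrow> pcnt B q - pcnt B p \<le> pcnt S q - pcnt S p"
proof -
  assume "B \<subseteq> S" "p \<le> q"
  have e: "pcnt A q - pcnt A p = int (card (A \<inter> {Suc p..q}))" for A
  proof -
    have "A \<inter> {1..q} = (A \<inter> {1..p}) \<union> (A \<inter> {Suc p..q})" using \<open>p \<le> q\<close> by auto
    moreover have "(A \<inter> {1..p}) \<inter> (A \<inter> {Suc p..q}) = {}" by auto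
    ultimately have "card (A \<inter> {1..q}) = card (A \<inter> {1..p}) + card (A \<inter> {Suc p..q})"
      by (metis card_Un_disjoint finite_Int finite_atLeastAtMost)
    then show ?thesis by (simp add: pcnt_def)
  qed
  show ?thesis unfolding e using \<open>B \<subseteq> S\<close> by (auto intro: card_mono)
qed

lemma pcnt_all: "fin1 A \<Longrightarrow> \<exists>P. \<forall>q\<ge>P. pcnt A q = int (card A)"
proof -
  assume "fin1 A"
  then obtain P where P: "A \<subseteq> {1..P}" using fin1_bound by blast
  have "A \<inter> {1..q} = A" if "P \<le> q" for q using P that by auto
  then have "\<forall>q\<ge>P. pcnt A q = int (card A)" unfolding pcnt_def by simp
  then show ?thesis by blast
qed

text \<open>The wrapped balls occupy the leftmost \<open>card (uo A S)\<close> unmatched closings,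
  so up to \<open>p\<close> only the excess over this number is free; the subtraction is meant to be
  truncated.\<close>

lemma vset_count:
  assumes "fin1 A" "fin1 S"
  shows "card (vset A S \<inter> {1..p}) = card (uc A S \<inter> {1..p}) - card (uo A S)"
proof (induction p)
  case 0 then show ?case by simp
next
  case (Suc p)
  have *: "{1..Suc p} = insert (Suc p) {1..p}" by auto
  show ?case
  proof (cases "Suc p \<in> uc A S")
    case False
    then have "uc A S \<inter> {1..Suc p} = uc A S \<inter> {1..p}" "vset A S \<inter> {1..Suc p} = vset A S \<inter> {1..p}"
      unfolding * vset_def by auto
    then show ?thesis using Suc by simp
  next
    case True
    then have "uc A S \<inter> {1..Suc p} = insert (Suc p) (uc A S \<inter> {1..p})" unfolding * by auto
    then have cu: "card (uc A S \<inter> {1..Suc p}) = Suc (card (uc A S \<inter> {1..p}))" by simp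
    have h: "hgt A S (Suc p) = - int (card (uc A S \<inter> {1..Suc p}))" by (rule hgt_uc[OF True])
    show ?thesis
    proof (cases "card (uo A S) < card (uc A S \<inter> {1..Suc p})")
      case T: True
      then have "Suc p \<in> vset A S" using True h unfolding vset_def by simp
      then have "vset A S \<inter> {1..Suc p} = insert (Suc p) (vset A S \<inter> {1..p})" unfolding * by auto
      then have "card (vset A S \<inter> {1..Suc p}) = Suc (card (vset A S \<inter> {1..p}))" by simp
      then show ?thesis using Suc cu T by simp
    next
      case F: False
      then have "Suc p \<notin> vset A S" using h unfolding vset_def by simp
      then have "vset A S \<inter> {1..Suc p} = vset A S \<inter> {1..p}" unfolding * by auto
      then show ?thesis using Suc cu F by simp
    qed
  qed
qed

definition phiset :: "nat set \<Rightarrow> nat set \<Rightarrow> nat set" where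
  "phiset A S = S - vset A S"

lemma phiset_props:
  assumes f: "fin1 A" "fin1 S"
  shows "pcnt (phiset A S) p = pcnt S p - int (card (uc A S \<inter> {1..p}) - card (uo A S))"
    "phiset A S \<subseteq> S"
proof -
  have s: "vset A S \<subseteq> S" unfolding vset_def using uc_subset[of A S] by blast
  have "phiset A S \<inter> {1..p} = (S \<inter> {1..p}) - (vset A S \<inter> {1..p})" unfolding phiset_def by auto
  moreover have "card ((S \<inter> {1..p}) - (vset A S \<inter> {1..p})) = card (S \<inter> {1..p}) - card (vset A S \<inter> {1..p})"
    using s by (intro card_Diff_subset) auto
  moreover have "card (vset A S \<inter> {1..p}) \<le> card (S \<inter> {1..p})" using s by (intro card_mono) auto
  ultimately show "pcnt (phiset A S) p = pcnt S p - int (card (uc A S \<inter> {1..p}) - card (uo A S))"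
    unfolding pcnt_def vset_count[OF f, symmetric] by simp
  show "phiset A S \<subseteq> S" unfolding phiset_def by blast
qed

lemma card_phiset:
  assumes f: "fin1 A" "fin1 S" and le: "card A \<le> card S"
  shows "card (phiset A S) = card A"
proof -
  obtain P where P: "S \<subseteq> {1..P}" using fin1_bound f by blast
  have "phiset A S \<inter> {1..P} = phiset A S" "S \<inter> {1..P} = S" "uc A S \<inter> {1..P} = uc A S"
    using P phiset_props(2)[OF f] uc_subset[of A S] by auto
  then have "int (card (phiset A S)) = int (card S) - int (card (uc A S) - card (uo A S))"
    using phiset_props(1)[OF f, of P] unfolding pcnt_def by simp
  then show ?thesis using card_uo_uc[OF f] le by linarith
qed

lemma greedy_leh:
  assumes f: "fin1 A" "fin1 S"
  shows "leh (int (card (uo A S))) A (phiset A S)"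
  unfolding leh_def
proof
  fix p
  have "- int (card (uc A S \<inter> {1..p})) \<le> hgt A S p" using hgt_low[of p A S] by blast
  then show "pcnt (phiset A S) p \<le> pcnt A p + int (card (uo A S))"
    unfolding phiset_props(1)[OF f] hgt_pcnt by linarith
qed

text \<open>Greedy pairing is optimal: it arrives earliest and with the fewest wraps.\<close>

lemma greedy_optimal:
  assumes f: "fin1 A" "fin1 S" and B: "B \<subseteq> S" "card B = card A" and l: "leh h A B"
  shows "leh (h - int (card (uo A S))) (phiset A S) B"
  unfolding leh_def
proof
  fix p
  let ?q = "int (card (uo A S))" and ?N = "card (uc A S \<inter> {1..p})"
  have lp: "pcnt B x \<le> pcnt A x + h" for x using l by (simp add: leh_def)
  \<comment> \<open>Compared at a lowest place \<open>x\<close> of the path: beyond \<open>x\<close>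
    the subset \<open>B\<close> has no more balls than \<open>S\<close>, so the surplus before
    \<open>x\<close> must be paid for by wraps.\<close>
  have hq: "?q \<le> h"
  proof -
    obtain x where x: "hgt A S x = - int (card (uc A S))" using hgt_eq_card_uc[OF f(2)] by blast
    have fB: "fin1 B" using f(2) B(1) by (auto simp: fin1_def intro: finite_subset)
    obtain P1 P2 where P: "\<forall>q\<ge>P1. pcnt B q = int (card B)" "\<forall>q\<ge>P2. pcnt S q = int (card S)"
      using pcnt_all[OF fB] pcnt_all[OF f(2)] by blast
    define P where "P = max x (max P1 P2)"
    have "pcnt B P - pcnt B x \<le> pcnt S P - pcnt S x" using B(1) by (rule pcnt_mono) (simp add: P_def)
    moreover have "pcnt B P = int (card B)" "pcnt S P = int (card S)" using P unfolding P_def by auto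
    ultimately show ?thesis using x card_uo_uc[OF f] lp[of x] B(2) unfolding hgt_pcnt by linarith
  qed
  show "pcnt B p \<le> pcnt (phiset A S) p + (h - ?q)"
  proof (cases "?N \<le> card (uo A S)")
    case True
    have "pcnt B p \<le> pcnt S p" using pcnt_mono[OF B(1), of 0 p] by simp
    then show ?thesis unfolding phiset_props(1)[OF f] using True hq by simp
  next
    case False
    \<comment> \<open>Up to \<open>p\<close> the path is lowest at \<open>x\<close>; there the bound
      on \<open>B\<close> is tight, and afterwards \<open>B\<close> grows no faster than
      \<open>S\<close>.\<close>
    obtain x where x: "x \<le> p" "hgt A S x = - int ?N" using hgt_low[of p A S] by blast
    have "pcnt B p - pcnt B x \<le> pcnt S p - pcnt S x" by (rule pcnt_mono[OF B(1) x(1)])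
    then show ?thesis unfolding phiset_props(1)[OF f] using False x(2) lp[of x] unfolding hgt_pcnt by linarith
  qed
qed

section \<open>Reflection of columns, and chains chosen from opposite ends\<close>

definition rf :: "nat \<Rightarrow> nat set \<Rightarrow> nat set" where
  "rf n A = (\<lambda>p. n + 1 - p) ` A"

lemma rf_rf: "A \<subseteq> {1..n} \<Longrightarrow> rf n (rf n A) = A"
proof -
  assume "A \<subseteq> {1..n}"
  then have "n + 1 - (n + 1 - p) = p" if "p \<in> A" for p using that by fastforce
  then show ?thesis unfolding rf_def image_image by simp
qed

lemma rf_sub: "A \<subseteq> {1..n} \<Longrightarrow> rf n A \<subseteq> {1..n}"
  unfolding rf_def by fastforce

lemma rf_inj: "A \<subseteq> {1..n::nat} \<Longrightarrow> inj_on (\<lambda>p. n + 1 - p) A"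
proof (rule inj_onI)
  fix x y :: nat assume a: "A \<subseteq> {1..n}" "x \<in> A" "y \<in> A" "n + 1 - x = n + 1 - y"
  then have "x \<le> n" "y \<le> n" by auto
  then have "n + 1 - (n + 1 - x) = x" "n + 1 - (n + 1 - y) = y" by simp_all
  then show "x = y" using a(4) by metis
qed

lemma card_rf: "A \<subseteq> {1..n} \<Longrightarrow> card (rf n A) = card A"
  unfolding rf_def by (rule card_image[OF rf_inj])

lemma rf_mono: "A \<subseteq> B \<Longrightarrow> rf n A \<subseteq> rf n B"
  unfolding rf_def by blast

lemma sub_fin1: "A \<subseteq> {1..n} \<Longrightarrow> fin1 A"
  unfolding fin1_def using finite_subset[of A "{1..n}"] by auto

text \<open>Prefix counts of a reflected set are suffix counts of the set, and equal sizes turn the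
  inequality around. Thus a choice to the left becomes a choice to the right.\<close>

lemma leh_rf:
  assumes A: "A \<subseteq> {1..n}" and B: "B \<subseteq> {1..n}" and c: "card A = card B" and l: "leh h A B"
  shows "leh h (rf n B) (rf n A)"
  unfolding leh_def
proof
  have count: "pcnt (rf n S) p = int (card S) - pcnt S (n - p)" if S: "S \<subseteq> {1..n}" for S p
  proof -
    have "rf n S \<inter> {1..p} = rf n (S - {1..n - p})" unfolding rf_def using S by fastforce
    then have "card (rf n S \<inter> {1..p}) = card (S - {1..n - p})" using card_rf[of "S - {1..n - p}" n] S by auto
    also have "\<dots> = card S - card (S \<inter> {1..n - p})" using sub_fin1[OF S] by (simp add: card_Diff_subset_Int fin1_def)
    finally show ?thesis using sub_fin1[OF S] card_mono[of S "S \<inter> {1..n - p}"] by (simp add: pcnt_def fin1_def of_nat_diff)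
  qed
  fix p
  have "pcnt B (n - p) \<le> pcnt A (n - p) + h" using l unfolding leh_def by blast
  then show "pcnt (rf n A) p \<le> pcnt (rf n B) p + h" unfolding count[OF A] count[OF B] c by simp
qed

text \<open>The chain \<open>D\<close> is chosen greedily to the right from the top, the chain \<open>E\<close> greedily to the
  left from the bottom. Both have the least possible number of wraps.\<close>

lemma greedy_chains:
  fixes W D E :: "nat \<Rightarrow> nat set" and j n :: nat
  assumes W: "\<And>r. W r \<subseteq> {1..n}" and j: "1 \<le> j"
    and cW: "\<And>r. 1 \<le> r \<Longrightarrow> r \<le> j \<Longrightarrow> card (W j) \<le> card (W r)"
    and D0: "D j = W j" and D: "\<And>r. 1 \<le> r \<Longrightarrow> r < j \<Longrightarrow> D r = phiset (D (Suc r)) (W r)"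
    and E0: "E 1 \<subseteq> W 1" "card (E 1) = card (W j)" "\<And>x y. x \<in> E 1 \<Longrightarrow> y \<in> W 1 - E 1 \<Longrightarrow> y < x"
    and E: "\<And>r. 1 \<le> r \<Longrightarrow> r < j \<Longrightarrow> rf n (E (Suc r)) = phiset (rf n (E r)) (rf n (W (Suc r)))"
    and Esub: "\<And>r. 1 \<le> r \<Longrightarrow> r \<le> j \<Longrightarrow> E r \<subseteq> W r"
  shows "(\<Sum>r = 1..<j. card (uo (D (Suc r)) (W r))) = (\<Sum>r = 1..<j. card (uo (rf n (E r)) (rf n (W (Suc r)))))"
proof -
  define e where "e r = int (card (uo (D (Suc r)) (W r)))" for r
  define u where "u r = int (card (uo (rf n (E r)) (rf n (W (Suc r)))))" for r
  have fW: "fin1 (W r)" for r using sub_fin1[OF W] .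
  have Dp: "D r \<subseteq> W r \<and> card (D r) = card (W j)" if "1 \<le> r" "r \<le> j" for r
    using that(2,1)
  proof (induction rule: inc_induct)
    case base then show ?case using D0 by simp
  next
    case (step r)
    then have "D (Suc r) \<subseteq> W (Suc r)" "card (D (Suc r)) = card (W j)" by auto
    then have fD: "fin1 (D (Suc r))" using sub_fin1 W by (meson order_trans)
    show ?case using D[of r] step phiset_props(2)[OF fD fW] card_phiset[OF fD fW, of r] cW[of r] by auto
  qed
  have Ec: "card (E r) = card (W j)" if "1 \<le> r" "r \<le> j" for r
    using that
  proof (induction r rule: nat_induct_at_least)
    case base then show ?case using E0 by simp
  next
    case (Suc r)
    then have step: "1 \<le> r" "r < j" "card (E r) = card (W j)" by auto
    have "E r \<subseteq> W r" "E (Suc r) \<subseteq> W (Suc r)" using step(1,2) by (simp_all add: Esub)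
    then have E1: "E r \<subseteq> {1..n}" "E (Suc r) \<subseteq> {1..n}" using W by blast+
    have "card (E (Suc r)) = card (rf n (E (Suc r)))" using card_rf[OF E1(2)] by simp
    also have "\<dots> = card (rf n (E r))"
      unfolding E[OF step(1,2)]
      using card_phiset[OF sub_fin1[OF rf_sub[OF E1(1)]] sub_fin1[OF rf_sub[OF W]]] card_rf[OF E1(1)] card_rf[OF W] step cW[of "Suc r"] by simp
    finally show ?case using card_rf[OF E1(1)] step by simp
  qed
  have sub: "D r \<subseteq> {1..n}" "E r \<subseteq> {1..n}" if "1 \<le> r" "r \<le> j" for r
    using Dp[OF that] Esub[OF that] W by blast+
  have Ej: "E j = W j" using Esub[of j] Ec[of j] fW[of j] j by (simp add: card_subset_eq fin1_def)
  have lD: "leh (e r) (D (Suc r)) (D r)" if "1 \<le> r" "r < j" for r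
    unfolding e_def using D[OF that] greedy_leh[OF sub_fin1[OF sub(1)] fW, of "Suc r" r] that by simp
  have lE: "leh (u r) (E (Suc r)) (E r)" if "1 \<le> r" "r < j" for r
  proof -
    have s: "E r \<subseteq> {1..n}" "E (Suc r) \<subseteq> {1..n}" using sub[of r] sub[of "Suc r"] that by auto
    have "leh (u r) (rf n (E r)) (rf n (E (Suc r)))"
      unfolding u_def E[OF that] by (rule greedy_leh[OF sub_fin1[OF rf_sub[OF s(1)]] sub_fin1[OF rf_sub[OF W]]])
    then have "leh (u r) (rf n (rf n (E (Suc r)))) (rf n (rf n (E r)))"
      by (rule leh_rf[OF rf_sub[OF s(1)] rf_sub[OF s(2)], rotated]) (use card_rf s Ec[of r] Ec[of "Suc r"] that in auto)
    then show ?thesis unfolding rf_rf[OF s(1)] rf_rf[OF s(2)] .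
  qed
  \<comment> \<open>From the common start in row \<open>j\<close> the greedy chain \<open>D\<close>
    stays ahead of \<open>E\<close>; at row 1 the nonnegative slack says that \<open>D\<close> has
    no more wraps than \<open>E\<close>.\<close>
  have down: "leh ((\<Sum>s = r..<j. u s) - (\<Sum>s = r..<j. e s)) (D r) (E r)" if "1 \<le> r" "r \<le> j" for r
    using that(2,1)
  proof (induction rule: inc_induct)
    case base then show ?case using D0 Ej by (simp add: leh_refl)
  next
    case (step r)
    let ?g = "(\<Sum>s = Suc r..<j. u s) - (\<Sum>s = Suc r..<j. e s)"
    have l: "leh (?g + u r) (D (Suc r)) (E r)" by (rule leh_trans[OF _ lE]) (use step in auto)
    have "leh (?g + u r - e r) (D r) (E r)"
      unfolding e_def[of r] D[OF step(4,2)]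
      by (rule greedy_optimal[OF _ fW Esub _ l]) (use step sub_fin1[OF sub(1)] Dp[of "Suc r"] Ec[of r] in auto)
    then show ?case using step by (simp add: sum.atLeast_Suc_lessThan algebra_simps)
  qed
  \<comment> \<open>The same from row 1 upwards after reflection, with \<open>E\<close> as the
    greedy chain; it starts with the rightmost balls of row 1 and gives the opposite
    inequality.\<close>
  have up: "leh ((\<Sum>s = 1..<r. e s) - (\<Sum>s = 1..<r. u s)) (D r) (E r)" if "1 \<le> r" "r \<le> j" for r
    using that
  proof (induction r rule: nat_induct_at_least)
    case base
    have D1: "D 1 \<subseteq> W 1" "card (D 1) = card (E 1)" using Dp[of 1] E0 j by auto
    have "pcnt (E 1) p \<le> pcnt (D 1) p" for p
    proof (cases "E 1 \<inter> {1..p} = {}")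
      case True
      then show ?thesis by (simp add: pcnt_def)
    next
      case False
      then obtain x where x: "x \<in> E 1" "x \<le> p" by auto
      have "D 1 - {1..p} \<subseteq> E 1 - {1..p}"
      proof
        fix y assume y: "y \<in> D 1 - {1..p}"
        have "y \<in> E 1"
        proof (rule ccontr)
          assume "y \<notin> E 1"
          then have "y < x" using E0(3)[OF x(1)] y D1(1) by blast
          then show False using y x fW[of 1] D1(1) by (auto simp: fin1_def) (metis not_less_eq_eq One_nat_def Suc_leI le_zero_eq less_imp_le_nat neq0_conv order_trans subsetD)
        qed
        then show "y \<in> E 1 - {1..p}" using y by blast
      qed
      then have "card (D 1 - {1..p}) \<le> card (E 1 - {1..p})"
        using sub(2)[of 1] j by (intro card_mono) (auto intro: finite_subset)
      moreover have "card (S \<inter> {1..p}) + card (S - {1..p}) = card S" if "S \<subseteq> {1..n}" for S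
      proof -
        have "(S \<inter> {1..p}) \<inter> (S - {1..p}) = {}" by blast
        then show ?thesis
          using card_Un_disjoint[of "S \<inter> {1..p}" "S - {1..p}"] finite_subset[OF that] by (simp add: Int_Diff_Un)
      qed
      note this[of "D 1"] this[of "E 1"]
      ultimately have "card (E 1 \<inter> {1..p}) \<le> card (D 1 \<inter> {1..p})"
        using D1(2) sub(1)[of 1] sub(2)[of 1] j by simp
      then show ?thesis by (simp add: pcnt_def)
    qed
    then show ?case by (simp add: leh_def)
  next
    case (Suc r)
    then have step: "1 \<le> r" "r < j" by auto
    let ?g = "(\<Sum>s = 1..<r. e s) - (\<Sum>s = 1..<r. u s)"
    have r: "1 \<le> r" "r \<le> j" "Suc r \<le> j" "1 \<le> Suc r" using step by auto
    have "leh ?g (D r) (E r)" using Suc by simp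
    then have "leh (e r + ?g) (D (Suc r)) (E r)" by (rule leh_trans[OF lD[OF step(1,2)]])
    then have l: "leh (e r + ?g) (rf n (E r)) (rf n (D (Suc r)))"
      by (rule leh_rf[OF sub(1)[OF r(4,3)] sub(2)[OF r(1,2)], rotated]) (use Dp[OF r(4,3)] Ec[OF r(1,2)] in simp)
    have "leh (e r + ?g - u r) (rf n (E (Suc r))) (rf n (D (Suc r)))"
      unfolding u_def[of r] E[OF step(1,2)]
      by (rule greedy_optimal[OF sub_fin1[OF rf_sub[OF sub(2)[OF r(1,2)]]] sub_fin1[OF rf_sub[OF W]] _ _ l])
        (use Dp[OF r(4,3)] Ec[OF r(1,2)] card_rf[OF sub(1)[OF r(4,3)]] card_rf[OF sub(2)[OF r(1,2)]] rf_mono in auto)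
    then have "leh (e r + ?g - u r) (rf n (rf n (D (Suc r)))) (rf n (rf n (E (Suc r))))"
      by (rule leh_rf[OF rf_sub[OF sub(2)[OF r(4,3)]] rf_sub[OF sub(1)[OF r(4,3)]], rotated])
        (use Dp[OF r(4,3)] Ec[OF r(4,3)] card_rf[OF sub(1)[OF r(4,3)]] card_rf[OF sub(2)[OF r(4,3)]] in simp)
    then show ?case unfolding rf_rf[OF sub(1)[OF r(4,3)]] rf_rf[OF sub(2)[OF r(4,3)]]
      using step by (simp add: algebra_simps)
  qed
  have "0 \<le> (\<Sum>s = 1..<j. u s) - (\<Sum>s = 1..<j. e s)" using leh_nonneg[OF down[of 1]] j by simp
  moreover have "0 \<le> (\<Sum>s = 1..<j. e s) - (\<Sum>s = 1..<j. u s)" using leh_nonneg[OF up[of j]] j by simp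
  ultimately have "(\<Sum>s = 1..<j. e s) = (\<Sum>s = 1..<j. u s)" by simp
  then show ?thesis unfolding e_def u_def by (simp only: of_nat_sum[symmetric] of_nat_eq_iff)
qed

section \<open>Charge\<close>

definition letter_pos :: "nat list \<Rightarrow> nat \<Rightarrow> nat set" where
  "letter_pos w r = {s. s < length w \<and> w ! s = r}"

lemma finite_letter_pos: "finite (letter_pos w r)" by (simp add: letter_pos_def)

lemma card_letter_pos: "card (letter_pos w r) = count_list w r"
  unfolding letter_pos_def count_list_eq_length_filter length_filter_conv_card by (rule arg_cong[of _ _ card]) auto

lemma wmat_letter_pos: "1 \<le> r \<Longrightarrow> wmat w r = Suc ` letter_pos w r"
proof -
  assume "1 \<le> r"
  have "p \<in> Suc ` letter_pos w r" if "1 \<le> p" "p \<le> length w" "w ! (p - 1) = r" for p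
    using that by (intro image_eqI[of _ _ "p - 1"]) (auto simp: letter_pos_def)
  then show ?thesis using \<open>1 \<le> r\<close> unfolding wmat_def by (auto simp: letter_pos_def)
qed

lemma card_wmat: "1 \<le> r \<Longrightarrow> card (wmat w r) = count_list w r"
  using wmat_letter_pos card_letter_pos by (simp add: card_image)

lemma mat_wmat: "mat (wmat w)"
  unfolding mat_def using box_wmat[of w "Max (insert 0 (set w))"] by fastforce

lemma next_left_mem: "finite A \<Longrightarrow> A \<noteq> {} \<Longrightarrow> next_left A t \<in> A"
proof -
  assume A: "finite A" "A \<noteq> {}"
  have "Max {s \<in> A. s < t} \<in> {s \<in> A. s < t}" if "\<exists>s \<in> A. s < t" by (rule Max_in) (use A that in auto)
  then show ?thesis unfolding next_left_def using Max_in[OF A] by auto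
qed

text \<open>Reflection exchanges the cyclic search to the left in the charge and the cyclic search
  to the right in the labelling. The former is strict and the latter weak, hence the condition that
  \<open>t\<close> is not in \<open>A\<close>.\<close>

lemma first_right_reflect:
  assumes A: "A \<subseteq> {..<n::nat}" "A \<noteq> {}" and t: "t \<notin> A" "t \<le> n"
  shows "first_right ((\<lambda>a. n - a) ` A) (n - t) = n - next_left A t"
proof -
  have fin: "finite A" using A finite_subset by blast
  have anti: "Min ((\<lambda>a. n - a) ` B) = n - Max B" if "B \<subseteq> A" "B \<noteq> {}" for B
  proof (rule Min_eqI)
    have fB: "finite B" using that fin finite_subset by blast
    show "finite ((\<lambda>a. n - a) ` B)" using fB by blast
    show "n - Max B \<in> (\<lambda>a. n - a) ` B" using Max_in[OF fB that(2)] by blast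
    show "n - Max B \<le> y" if "y \<in> (\<lambda>a. n - a) ` B" for y using that Max_ge[OF fB] diff_le_mono2 by blast
  qed
  have ge: "n - t \<le> n - a \<longleftrightarrow> a < t" if "a \<in> A" for a
  proof -
    have "a < n" "a \<noteq> t" using A t that by auto
    then show ?thesis using t by linarith
  qed
  have e: "{b \<in> (\<lambda>a. n - a) ` A. n - t \<le> b} = (\<lambda>a. n - a) ` {s \<in> A. s < t}" using ge by auto
  have ex: "(\<exists>b \<in> (\<lambda>a. n - a) ` A. n - t \<le> b) \<longleftrightarrow> (\<exists>s \<in> A. s < t)" using ge by auto
  show ?thesis
  proof (cases "\<exists>s \<in> A. s < t")
    case True
    then have "Min ((\<lambda>a. n - a) ` {s \<in> A. s < t}) = n - Max {s \<in> A. s < t}" by (intro anti) auto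
    then show ?thesis unfolding first_right_def next_left_def ex e using True by simp
  next
    case False
    then show ?thesis unfolding first_right_def next_left_def ex using anti[OF subset_refl A(2)] by simp
  qed
qed

lemma pair_balls_unfold:
  assumes "\<And>k. k < m \<Longrightarrow> first_right (S - g ` {..<k}) (f k) = g k"
  shows "pair_balls (map f [0..<m]) S = map (\<lambda>k. (f k, g k)) [0..<m]"
  using assms
proof (induction m)
  case 0 then show ?case by simp
next
  case (Suc m)
  have IH: "pair_balls (map f [0..<m]) S = map (\<lambda>k. (f k, g k)) [0..<m]" by (rule Suc.IH) (use Suc.prems in simp)
  have "snd ` set (map (\<lambda>k. (f k, g k)) [0..<m]) = g ` {..<m}" by (simp add: image_image lessThan_atLeast0)
  then show ?case using Suc.prems[of m] by (simp add: pair_balls_append IH)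
qed

lemma rf_Suc: "rf n (Suc ` A) = (\<lambda>a. n - a) ` A" by (simp add: rf_def image_image)

lemma wmat_sub: "wmat w r \<subseteq> {1..length w}" by (auto simp: wmat_def)

section \<open>Standard subwords of a word with partition content\<close>

locale partition_word =
  fixes w :: "nat list"
  assumes pos: "0 \<notin> set w" and decr: "\<And>r. 1 \<le> r \<Longrightarrow> count_list w (Suc r) \<le> count_list w r"
begin

abbreviation P :: "nat \<Rightarrow> nat set" where "P r \<equiv> letter_pos w r"

definition x :: "nat \<Rightarrow> nat \<Rightarrow> nat" where "x k r = sub_pos w (remaining w k) r"

text \<open>The places of letter \<open>r\<close> used by the first \<open>k\<close> subwords;
  \<open>min\<close> because only as many subwords contain \<open>r\<close> as there are letters
  \<open>r\<close>.\<close>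

definition I :: "nat \<Rightarrow> nat \<Rightarrow> nat set" where "I k r = (\<lambda>i. x i r) ` {..<min k (count_list w r)}"

lemma count_antimono: "1 \<le> r \<Longrightarrow> r \<le> s \<Longrightarrow> count_list w s \<le> count_list w r"
proof -
  assume r: "1 \<le> r" and "r \<le> s"
  show ?thesis using \<open>r \<le> s\<close>
  proof (induction s rule: nat_induct_at_least)
    case base then show ?case by simp
  next
    case (Suc s)
    have "count_list w (Suc s) \<le> count_list w s" by (rule decr) (use r Suc in simp)
    then show ?case using Suc.IH by simp
  qed
qed

text \<open>What remains determines the letters and places of the next subword, which in turn
  determine what remains. The first two clauses are proved by induction, the other two follow from
  them at each \<open>k\<close>.\<close>

lemma chosen:
  "(\<forall>r\<ge>1. {s \<in> remaining w k. w ! s = r} = P r - I k r \<and> I k r \<subseteq> P r \<and> card (I k r) = min k (count_list w r)) \<and>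
   remaining w k \<subseteq> {..<length w} \<and>
   sub_letters w (remaining w k) = {r. 1 \<le> r \<and> k < count_list w r} \<and>
   (\<forall>r. k < count_list w (Suc r) \<longrightarrow> x k (Suc r) \<in> P (Suc r) - I k (Suc r) \<and>
      x k (Suc r) = next_left (P (Suc r) - I k (Suc r)) (x k r))" (is "?A k \<and> ?B k \<and> ?C k \<and> ?D k")
proof -
  have letters: "?C k \<and> ?D k" if A: "?A k" and B: "?B k" for k
  proof
    have fin: "finite (remaining w k)" using B finite_subset by blast
    have mem: "r \<in> (!) w ` remaining w k \<longleftrightarrow> k < count_list w r" if "1 \<le> r" for r
    proof -
      have a: "{s \<in> remaining w k. w ! s = r} = P r - I k r" "I k r \<subseteq> P r" "card (I k r) = min k (count_list w r)"
        using A that by blast+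
      have "r \<in> (!) w ` remaining w k \<longleftrightarrow> {s \<in> remaining w k. w ! s = r} \<noteq> {}" by auto
      also have "\<dots> \<longleftrightarrow> card (I k r) < card (P r)"
        unfolding a(1) using a(2) finite_letter_pos by (metis Diff_eq_empty_iff card_mono card_seteq leD not_le_imp_less finite_subset)
      finally show ?thesis unfolding a(3) card_letter_pos by auto
    qed
    define m where "m = Max (insert 0 ((!) w ` remaining w k))"
    have mx: "r \<le> m" if "r \<in> (!) w ` remaining w k" for r unfolding m_def using fin that by simp
    have mi: "m \<in> (!) w ` remaining w k" if "1 \<le> m"
      using Max_in[of "insert 0 ((!) w ` remaining w k)"] fin that unfolding m_def by auto
    show "?C k" unfolding sub_letters_def m_def[symmetric]
    proof (intro set_eqI iffI)
      fix r assume "r \<in> {1..m}"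
      then have r: "1 \<le> r" "r \<le> m" by auto
      then have "k < count_list w m" using mem[of m] mi by auto
      then show "r \<in> {r. 1 \<le> r \<and> k < count_list w r}" using count_antimono[OF r] r by simp
    next
      fix r assume "r \<in> {r. 1 \<le> r \<and> k < count_list w r}"
      then show "r \<in> {1..m}" using mem[of r] mx[of r] by auto
    qed
    show "?D k"
    proof (intro allI impI)
      fix r assume k: "k < count_list w (Suc r)"
      have e: "{s \<in> remaining w k. w ! s = Suc r} = P (Suc r) - I k (Suc r)" "card (I k (Suc r)) = min k (count_list w (Suc r))"
        "I k (Suc r) \<subseteq> P (Suc r)" using A by auto
      have "P (Suc r) - I k (Suc r) \<noteq> {}"
      proof
        assume "P (Suc r) - I k (Suc r) = {}"
        then have "P (Suc r) = I k (Suc r)" using e(3) by blast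
        then show False using e(2) card_letter_pos[of w "Suc r"] k by simp
      qed
      moreover have xx: "x k (Suc r) = next_left (P (Suc r) - I k (Suc r)) (x k r)"
        unfolding x_def sub_pos.simps e(1) ..
      moreover have "finite (P (Suc r) - I k (Suc r))" using finite_letter_pos by blast
      ultimately have "x k (Suc r) \<in> P (Suc r) - I k (Suc r)" using next_left_mem by presburger
      then show "x k (Suc r) \<in> P (Suc r) - I k (Suc r) \<and> x k (Suc r) = next_left (P (Suc r) - I k (Suc r)) (x k r)"
        using xx by blast
    qed
  qed
  have "?A k \<and> ?B k"
  proof (induction k)
    case 0
    show ?case by (auto simp: I_def letter_pos_def)
  next
    case (Suc k)
    then have A: "?A k" and B: "?B k" by auto
    note CD = letters[OF A B]
    let ?U = "{r. 1 \<le> r \<and> k < count_list w r}"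
    have rem: "remaining w (Suc k) = remaining w k - x k ` ?U" using CD by (simp add: x_def[abs_def])
    have xP: "x k r \<in> P r - I k r" if "r \<in> ?U" for r using CD that by (cases r) auto
    have "{s \<in> remaining w (Suc k). w ! s = r} = P r - I (Suc k) r \<and> I (Suc k) r \<subseteq> P r \<and>
      card (I (Suc k) r) = min (Suc k) (count_list w r)" if r: "1 \<le> r" for r
    proof -
      have a: "{s \<in> remaining w k. w ! s = r} = P r - I k r" "I k r \<subseteq> P r" "card (I k r) = min k (count_list w r)"
        using A r by blast+
      show ?thesis
      proof (cases "k < count_list w r")
        case True
        then have rU: "r \<in> ?U" using r by simp
        have I: "I (Suc k) r = insert (x k r) (I k r)"
          using True unfolding I_def by (simp add: min_def lessThan_Suc)
        have "{s \<in> remaining w (Suc k). w ! s = r} = {s \<in> remaining w k. w ! s = r} - {x k r}"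
          unfolding rem using xP rU by (auto simp: letter_pos_def)
        moreover have "card (insert (x k r) (I k r)) = Suc (card (I k r))"
          using xP[OF rU] finite_subset[OF a(2) finite_letter_pos] by simp
        ultimately show ?thesis unfolding I a(1) using a(2,3) xP[OF rU] True by auto
      next
        case False
        then have I: "I (Suc k) r = I k r" unfolding I_def by (simp add: min_def)
        have "{s \<in> remaining w (Suc k). w ! s = r} = {s \<in> remaining w k. w ! s = r}"
          unfolding rem using xP False by (auto simp: letter_pos_def)
        then show ?thesis unfolding I using a False by auto
      qed
    qed
    then show ?case using B rem by blast
  qed
  then show ?thesis using letters by blast
qed

lemma x_mem: "1 \<le> r \<Longrightarrow> k < count_list w r \<Longrightarrow> x k r \<in> P r - I k r"
  using chosen[of k] by (cases r) auto

lemma x_inj: "1 \<le> r \<Longrightarrow> inj_on (\<lambda>i. x i r) {..<count_list w r}"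
proof -
  assume r: "1 \<le> r"
  have "card (I (count_list w r) r) = count_list w r" using chosen[of "count_list w r"] r by simp
  then show ?thesis unfolding I_def by (intro eq_card_imp_inj_on) auto
qed

lemma I_eq: "k \<le> count_list w r \<Longrightarrow> I k r = (\<lambda>i. x i r) ` {..<k}"
  by (simp add: I_def min_absorb1)

lemma sub_index_eq: "sub_index w (remaining w k) r = (\<Sum>s<r. of_bool (x k s < x k (Suc s)))"
  by (induction r) (simp_all add: x_def)

definition H :: nat where "H = height (wmat w)"

lemma psz_wmat: "psz (wmat w)"
  unfolding psz_def using decr card_wmat by simp

lemma count_above: "H < r \<Longrightarrow> count_list w r = 0"
proof -
  assume r: "H < r"
  obtain L n where "box L n (wmat w)" using mat_wmat unfolding mat_def by blast
  then have "wmat w r = {}" using box_height(1) r unfolding H_def by blast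
  then show ?thesis using card_wmat[of r w] r by simp
qed

text \<open>The index of letter \<open>j\<close> in a subword is its number of ascents from
  \<open>s\<close> to \<open>s + 1\<close> below \<open>j\<close>. The step from 0 never counts,
  since the search starts to the right of the word. Exchanging sums groups the ascents by
  \<open>j\<close>.\<close>

lemma word_charge_eq:
  "word_charge w = (\<Sum>j = 1..H. \<Sum>s = 1..<j. card {k. k < count_list w j \<and> x k s < x k (Suc s)})"
proof -
  let ?b = "\<lambda>k s. (of_bool (x k s < x k (Suc s)) :: nat)"
  have z: "?b k 0 = 0" if "k < count_list w 1" for k
  proof -
    have "x k 1 < length w" using x_mem[of 1 k] that by (simp add: letter_pos_def)
    then show ?thesis by (simp add: x_def)
  qed
  have "(\<Sum>r \<in> sub_letters w (remaining w k). sub_index w (remaining w k) r) =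
    (\<Sum>j = 1..H. if k < count_list w j then \<Sum>s = 1..<j. ?b k s else 0)" if k: "k < count_list w 1" for k
  proof -
    have s: "sub_letters w (remaining w k) = {j \<in> {1..H}. k < count_list w j}"
    proof -
      have "j \<le> H" if "k < count_list w j" for j using count_above[of j] that by (cases "H < j") auto
      then show ?thesis using chosen[of k] by auto
    qed
    have "sub_index w (remaining w k) j = (\<Sum>s = 1..<j. ?b k s)" if "1 \<le> j" for j
    proof -
      have "(\<Sum>s<j. ?b k s) = ?b k 0 + (\<Sum>s = 1..<j. ?b k s)"
        unfolding lessThan_atLeast0 using that by (subst sum.atLeast_Suc_lessThan) (simp_all only: One_nat_def Suc_le_eq)
      then show ?thesis unfolding sub_index_eq using z[OF k] by linarith
    qed
    then show ?thesis unfolding s by (simp add: sum.inter_filter[symmetric])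
  qed
  then have "word_charge w = (\<Sum>k<count_list w 1. \<Sum>j = 1..H. if k < count_list w j then \<Sum>s = 1..<j. ?b k s else 0)"
    unfolding word_charge_def by simp
  also have "\<dots> = (\<Sum>j = 1..H. \<Sum>k<count_list w 1. if k < count_list w j then \<Sum>s = 1..<j. ?b k s else 0)"
    by (rule sum.swap)
  also have "\<dots> = (\<Sum>j = 1..H. \<Sum>s = 1..<j. card {k. k < count_list w j \<and> x k s < x k (Suc s)})"
  proof (rule sum.cong[OF refl])
    fix j assume "j \<in> {1..H}"
    then have le: "count_list w j \<le> count_list w 1" using count_antimono[of 1 j] by simp
    have "{k \<in> {..<count_list w 1}. k < count_list w j} = {..<count_list w j}" using le by auto
    then have "(\<Sum>k<count_list w 1. if k < count_list w j then \<Sum>s = 1..<j. ?b k s else 0) =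
      (\<Sum>k<count_list w j. \<Sum>s = 1..<j. ?b k s)"
      by (subst sum.inter_filter[symmetric]) simp_all
    also have "\<dots> = (\<Sum>s = 1..<j. \<Sum>k<count_list w j. ?b k s)" by (rule sum.swap)
    also have "\<dots> = (\<Sum>s = 1..<j. card {k. k < count_list w j \<and> x k s < x k (Suc s)})"
    proof (rule sum.cong[OF refl])
      fix s
      have "{k. k < count_list w j \<and> x k s < x k (Suc s)} = {..<count_list w j} \<inter> {k. x k s < x k (Suc s)}" by auto
      then show "(\<Sum>k<count_list w j. ?b k s) = card {k. k < count_list w j \<and> x k s < x k (Suc s)}"
        by (simp add: sum_of_bool_eq)
    qed
    finally show "(\<Sum>k<count_list w 1. if k < count_list w j then \<Sum>s = 1..<j. ?b k s else 0) =
      (\<Sum>s = 1..<j. card {k. k < count_list w j \<and> x k s < x k (Suc s)})" .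
  qed
  finally show ?thesis .
qed

text \<open>Letter \<open>j\<close> occurs just in the first \<open>count_list w j\<close> subwords,
  so these are the places of \<open>s\<close> in the subwords that reach \<open>j\<close>.
  \<open>Suc\<close> passes from list positions to columns.\<close>

definition E :: "nat \<Rightarrow> nat \<Rightarrow> nat set" where
  "E j s = (\<lambda>k. Suc (x k s)) ` {..<count_list w j}"

lemma E_eq: "E j s = Suc ` (\<lambda>k. x k s) ` {..<count_list w j}" by (simp add: E_def image_image)

lemma E_sub: assumes "1 \<le> s" "s \<le> j" shows "E j s \<subseteq> wmat w s"
proof -
  have "x k s \<in> P s" if "k < count_list w j" for k using x_mem[of s k] count_antimono[OF assms] assms that by auto
  then show ?thesis unfolding E_eq wmat_letter_pos[OF assms(1)] by blast
qed

text \<open>After reflection, extracting the subwords in turn is a run of \<open>pair_balls\<close>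
  from letter \<open>s\<close> to letter \<open>s + 1\<close>, and ascents are its wraps. The
  outcome of a run depends on its set of balls only.\<close>

lemma E_pairing:
  assumes s: "1 \<le> s" "s < j"
  shows "rf (length w) (E j (Suc s)) = phiset (rf (length w) (E j s)) (rf (length w) (wmat w (Suc s)))"
    "card (uo (rf (length w) (E j s)) (rf (length w) (wmat w (Suc s)))) =
      card {k. k < count_list w j \<and> x k s < x k (Suc s)}"
proof -
  let ?n = "length w"
  let ?S = "(\<lambda>a. ?n - a) ` P (Suc s)" and ?c = "count_list w j"
  let ?f = "\<lambda>k. ?n - x k s" and ?g = "\<lambda>k. ?n - x k (Suc s)"
  have c: "?c \<le> count_list w s" "?c \<le> count_list w (Suc s)" using count_antimono[of s j] count_antimono[of "Suc s" j] s by auto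
  have lt: "x k s < ?n" "x k (Suc s) < ?n" if "k < ?c" for k
    using x_mem[of s k] x_mem[of "Suc s" k] that c s by (auto simp: letter_pos_def)
  have S: "rf ?n (wmat w (Suc s)) = ?S" using wmat_letter_pos[of "Suc s" w] rf_Suc by simp
  have pb: "pair_balls (map ?f [0..<?c]) ?S = map (\<lambda>k. (?f k, ?g k)) [0..<?c]"
  proof (rule pair_balls_unfold)
    fix k assume k: "k < ?c"
    let ?A = "P (Suc s) - I k (Suc s)"
    have D: "x k (Suc s) \<in> ?A" "x k (Suc s) = next_left ?A (x k s)"
    proof -
      have "k < count_list w (Suc s)" using k c(2) by simp
      then show "x k (Suc s) \<in> ?A" "x k (Suc s) = next_left ?A (x k s)" using chosen[of k] by blast+
    qed
    have I: "I k (Suc s) = (\<lambda>i. x i (Suc s)) ` {..<k}" by (rule I_eq) (use k c in simp)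
    have inj: "inj_on (\<lambda>a. ?n - a) (P (Suc s))" by (rule inj_onI) (auto simp: letter_pos_def)
    have Isub: "I k (Suc s) \<subseteq> P (Suc s)" using chosen[of k] by auto
    have "?S - ?g ` {..<k} = (\<lambda>a. ?n - a) ` ?A"
      using inj_on_image_set_diff[OF inj Diff_subset Isub] I Isub by (auto simp: image_image inj_on_image_set_diff[OF inj])
    moreover have "x k s \<notin> ?A" using x_mem[of s k] s k c by (auto simp: letter_pos_def)
    moreover have "?A \<subseteq> {..<?n}" by (auto simp: letter_pos_def)
    ultimately show "first_right (?S - ?g ` {..<k}) (?f k) = ?g k"
      using first_right_reflect[of ?A ?n "x k s"] D lt[OF k] by auto
  qed
  have inj: "inj_on (\<lambda>k. x k r) {..<?c}" if "1 \<le> r" "r \<le> Suc s" for r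
    by (rule inj_on_subset[OF x_inj[OF that(1)]]) (use count_antimono[of r j] that s in auto)
  have "distinct (map ?f [0..<?c])"
  proof -
    have "inj_on ?f {..<?c}"
    proof (rule inj_onI)
      fix a b assume ab: "a \<in> {..<?c}" "b \<in> {..<?c}" "?f a = ?f b"
      then have "x a s = x b s" using lt(1)[of a] lt(1)[of b] by simp
      then show "a = b" using inj_onD[OF inj[of s]] ab s by auto
    qed
    then show ?thesis by (simp add: distinct_map lessThan_atLeast0)
  qed
  moreover have fS: "fin1 ?S" unfolding fin1_def using finite_letter_pos by (auto simp: letter_pos_def)
  moreover have "0 \<notin> set (map ?f [0..<?c])" using lt(1) by fastforce
  moreover have "card ?S = count_list w (Suc s)"
    using card_rf[OF wmat_sub, of w "Suc s"] card_wmat[of "Suc s" w] S by simp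
  then have "length (map ?f [0..<?c]) \<le> card ?S" using c by simp
  ultimately have V: "?S - snd ` set (pair_balls (map ?f [0..<?c]) ?S) = vset (set (map ?f [0..<?c])) ?S"
    "length (filter (\<lambda>(i, j). j < i) (pair_balls (map ?f [0..<?c]) ?S)) = card (uo (set (map ?f [0..<?c])) ?S)"
    "snd ` set (pair_balls (map ?f [0..<?c]) ?S) \<subseteq> ?S"
    using pair_balls_vset[OF fS, of "map ?f [0..<?c]"] by auto
  have fs: "set (map ?f [0..<?c]) = rf ?n (E j s)" unfolding E_eq rf_Suc by (auto simp: image_image)
  have gs: "snd ` set (pair_balls (map ?f [0..<?c]) ?S) = rf ?n (E j (Suc s))"
    unfolding pb E_eq rf_Suc by (auto simp: image_image)
  show "rf ?n (E j (Suc s)) = phiset (rf ?n (E j s)) (rf ?n (wmat w (Suc s)))"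
    unfolding S phiset_def fs[symmetric] V(1)[symmetric] using V(3) unfolding gs by blast
  have "length (filter (\<lambda>(i, j). j < i) (pair_balls (map ?f [0..<?c]) ?S)) = length (filter (\<lambda>k. ?g k < ?f k) [0..<?c])"
    unfolding pb by (simp add: filter_map o_def)
  also have "\<dots> = card {k. k < ?c \<and> ?g k < ?f k}"
    unfolding length_filter_conv_card by (rule arg_cong[of _ _ card]) auto
  also have "{k. k < ?c \<and> ?g k < ?f k} = {k. k < ?c \<and> x k s < x k (Suc s)}" using lt by fastforce
  finally show "card (uo (rf ?n (E j s)) (rf ?n (wmat w (Suc s)))) = card {k. k < ?c \<and> x k s < x k (Suc s)}"
    unfolding S fs[symmetric] V(2)[symmetric] .
qed

text \<open>The subwords that reach \<open>j\<close> are the earliest ones, and each takes the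
  rightmost 1 still present.\<close>

lemma E_first:
  assumes "1 \<le> j" "p \<in> E j 1" "q \<in> wmat w 1 - E j 1"
  shows "q < p"
proof -
  obtain k where k: "k < count_list w j" "p = Suc (x k 1)" using assms(2) unfolding E_def by auto
  obtain y where y: "y \<in> P 1" "q = Suc y" using assms(3) wmat_letter_pos[of 1 w] by auto
  have c: "k < count_list w 1" using count_antimono[of 1 j] assms(1) k by simp
  have ny: "y \<noteq> x i 1" if "i < count_list w j" for i using assms(3) that y unfolding E_def by auto
  have I: "I k 1 = (\<lambda>i. x i 1) ` {..<k}" using c by (intro I_eq) simp
  have yA: "y \<in> P 1 - I k 1" unfolding I
  proof (rule DiffI[OF y(1)], rule notI)
    assume "y \<in> (\<lambda>i. x i 1) ` {..<k}"
    then obtain i where "i < k" "y = x i 1" by blast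
    then show False using ny[of i] k by simp
  qed
  have "x k 1 = next_left (P 1 - I k 1) (length w)" using chosen[of k] c by (auto simp: x_def)
  also have "\<dots> = Max (P 1 - I k 1)"
  proof -
    have "{s \<in> P 1 - I k 1. s < length w} = P 1 - I k 1" by (auto simp: letter_pos_def)
    then show ?thesis unfolding next_left_def by simp
  qed
  finally have "y \<le> x k 1" using yA finite_letter_pos by simp
  then show ?thesis using ny[OF k(1)] k y by simp
qed

text \<open>For each \<open>j\<close> two chains through rows \<open>1..j\<close> of
  \<open>wmat w\<close> are compared: labels of at least \<open>j\<close>, built from the top, and
  subwords reaching \<open>j\<close>, built from the bottom. Only their total numbers of wraps are
  equated, by \<open>greedy_chains\<close>.\<close>

theorem word_charge_maj: "word_charge w = maj (wmat w)"
proof -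
  let ?M = "wmat w" and ?n = "length w"
  have main: "(\<Sum>s = 1..<j. card {k. k < count_list w j \<and> x k s < x k (Suc s)}) =
    (\<Sum>s = 1..<j. eps s (Tf j (Suc s) ?M))" if j: "1 \<le> j" for j
  proof -
    have "(\<Sum>s = 1..<j. card (uo (Tf j (Suc s) ?M (Suc s)) (?M s))) =
      (\<Sum>s = 1..<j. card (uo (rf ?n (E j s)) (rf ?n (?M (Suc s)))))"
    proof (rule greedy_chains[where D = "\<lambda>r. Tf j r ?M r" and E = "E j" and W = ?M and n = ?n, OF wmat_sub j])
      show "card (?M j) \<le> card (?M r)" if "1 \<le> r" "r \<le> j" for r using psz_mono[OF psz_wmat that] .
      show "Tf j j ?M j = ?M j" by simp
      show "Tf j r ?M r = phiset (Tf j (Suc r) ?M (Suc r)) (?M r)" if r: "1 \<le> r" "r < j" for r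
      proof -
        let ?X = "Tf j (Suc r) ?M"
        have X: "mat ?X" "?X r = ?M r" "card (?X (Suc r)) = card (?M j)"
          using Tf_rows[OF mat_wmat, of "Suc r" j] r by auto
        have "card (?X (Suc r)) \<le> card (?X r)" using X psz_mono[OF psz_wmat r(1)] r by simp
        then show ?thesis using sw_rows(1)[OF X(1)] X(2) r unfolding phiset_def Tf_Suc[OF r(2)] by simp
      qed
      show "E j 1 \<subseteq> ?M 1" using E_sub[of 1 j] j by simp
      have "inj_on (\<lambda>k. x k 1) {..<count_list w j}"
        by (rule inj_on_subset[OF x_inj[of 1]]) (use count_antimono[of 1 j] j in auto)
      then have "card ((\<lambda>k. x k 1) ` {..<count_list w j}) = count_list w j" by (simp add: card_image)
      then show "card (E j 1) = card (?M j)" unfolding E_eq using card_wmat[OF j] by (simp add: card_image)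
      show "q < p" if "p \<in> E j 1" "q \<in> ?M 1 - E j 1" for p q using E_first[OF j that] .
      show "rf ?n (E j (Suc r)) = phiset (rf ?n (E j r)) (rf ?n (?M (Suc r)))" if "1 \<le> r" "r < j" for r
        using E_pairing(1)[OF that] .
      show "E j r \<subseteq> ?M r" if "1 \<le> r" "r \<le> j" for r using E_sub[OF that] .
    qed
    moreover have "card (uo (Tf j (Suc s) ?M (Suc s)) (?M s)) = eps s (Tf j (Suc s) ?M)" if "s \<in> {1..<j}" for s
      using Tf_rows(2)[OF mat_wmat, of "Suc s" j s] that by (simp add: eps_def geps_def)
    moreover have "card (uo (rf ?n (E j s)) (rf ?n (?M (Suc s)))) = card {k. k < count_list w j \<and> x k s < x k (Suc s)}"
      if "s \<in> {1..<j}" for s using E_pairing(2)[of s j] that by simp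
    ultimately show ?thesis by simp
  qed
  have "maj ?M = (\<Sum>r = 2..H. \<Sum>k = r..H. eps (r - 1) (Tf k r ?M))"
    unfolding H_def by (rule maj_eq[OF mat_wmat psz_wmat])
  also have "\<dots> = (\<Sum>(r, k) \<in> Sigma {2..H} (\<lambda>r. {r..H}). eps (r - 1) (Tf k r ?M))"
    by (rule sum.Sigma) auto
  also have "\<dots> = (\<Sum>(j, s) \<in> Sigma {1..H} (\<lambda>j. {1..<j}). eps s (Tf j (Suc s) ?M))"
    by (rule sum.reindex_bij_witness[of _ "\<lambda>(j, s). (Suc s, j)" "\<lambda>(r, k). (k, r - 1)"]) auto
  also have "\<dots> = (\<Sum>j = 1..H. \<Sum>s = 1..<j. eps s (Tf j (Suc s) ?M))"
    by (rule sum.Sigma[symmetric]) auto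
  finally show ?thesis unfolding word_charge_eq using main by simp
qed

end

section \<open>Shapes and types of multiline queues\<close>

lemma part_conjugate:
  assumes s: "sorted (rev lam)"
  shows "part (conjugate lam) r = (if r = 0 then 0 else length (filter (\<lambda>a. r \<le> a) lam))"
proof -
  let ?f = "\<lambda>r. length (filter (\<lambda>a. r \<le> a) lam)"
  have p: "part (conjugate lam) r = (if 1 \<le> r \<and> r \<le> part lam 1 then ?f r else 0)"
  proof (cases "1 \<le> r \<and> r \<le> part lam 1")
    case True
    then have "map ?f [1..<Suc (part lam 1)] ! (r - 1) = ?f ([1..<Suc (part lam 1)] ! (r - 1))"
      by (intro nth_map) (auto simp del: upt_Suc)
    also have "[1..<Suc (part lam 1)] ! (r - 1) = 1 + (r - 1)" by (rule nth_upt) (use True in auto)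
    finally show ?thesis unfolding conjugate_def part_def[of "map ?f [1..<Suc (part lam 1)]"] using True
      by (simp del: upt_Suc)
  next
    case False
    then show ?thesis unfolding conjugate_def part_def[of "map ?f [1..<Suc (part lam 1)]"]
      by (auto simp del: upt_Suc)
  qed
  have "?f r = 0" if "1 \<le> r" "part lam 1 < r"
  proof -
    have "a \<le> part lam 1" if a: "a \<in> set lam" for a
    proof -
      obtain b l where "lam = b # l" using a by (cases lam) auto
      then show ?thesis using a s by (auto simp: part_def sorted_append)
    qed
    then have "filter (\<lambda>a. r \<le> a) lam = []" using that by (fastforce simp: filter_empty_conv)
    then show ?thesis by simp
  qed
  then show ?thesis unfolding p by auto
qed

lemma sorted_rev_comp_sort: "sorted (rev (comp_sort \<beta>))" by (simp add: comp_sort_def)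

lemma length_filter_mset: "mset xs = mset ys \<Longrightarrow> length (filter P xs) = length (filter P ys)"
  using mset_filter[of P xs] mset_filter[of P ys] size_mset[of "filter P xs"] size_mset[of "filter P ys"] by simp

lemma canonical_0 [simp]: "canonical_mlq \<beta> 0 = {}" by (simp add: canonical_mlq_def)

lemma mem_canonical: "c \<in> canonical_mlq \<beta> r \<longleftrightarrow> 1 \<le> r \<and> 1 \<le> c \<and> c \<le> length \<beta> \<and> r \<le> \<beta> ! (c - 1)"
  by (auto simp: canonical_mlq_def)

lemma length_filter_comp_sort:
  assumes "1 \<le> r" shows "length (filter (\<lambda>a. r \<le> a) (comp_sort \<beta>)) = card (canonical_mlq \<beta> r)"
proof -
  have "length (filter (\<lambda>a. r \<le> a) (comp_sort \<beta>)) = length (filter (\<lambda>a. r \<le> a) (filter (\<lambda>a. 0 < a) \<beta>))"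
    unfolding comp_sort_def by (rule length_filter_mset) simp
  also have "\<dots> = length (filter (\<lambda>a. r \<le> a) \<beta>)" 
  proof -
    have "(\<lambda>a::nat. 0 < a \<and> r \<le> a) = (\<lambda>a. r \<le> a)" using assms by auto
    then show ?thesis by simp
  qed
  also have "\<dots> = card {i. i < length \<beta> \<and> r \<le> \<beta> ! i}" by (simp add: length_filter_conv_card)
  also have "\<dots> = card (Suc ` {i. i < length \<beta> \<and> r \<le> \<beta> ! i})" by (simp add: card_image)
  also have "Suc ` {i. i < length \<beta> \<and> r \<le> \<beta> ! i} = canonical_mlq \<beta> r"
  proof (intro set_eqI iffI)
    fix c assume "c \<in> canonical_mlq \<beta> r"
    then show "c \<in> Suc ` {i. i < length \<beta> \<and> r \<le> \<beta> ! i}"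
      by (intro image_eqI[of _ _ "c - 1"]) (auto simp: mem_canonical)
  qed (use assms in \<open>auto simp: mem_canonical\<close>)
  finally show ?thesis .
qed

lemma part_conjugate_comp_sort: "part (conjugate (comp_sort \<beta>)) r = card (canonical_mlq \<beta> r)"
  using part_conjugate[OF sorted_rev_comp_sort, of \<beta> r] length_filter_comp_sort[of r \<beta>] by simp

text \<open>Expressing row sizes by the canonical queue of the composition removes conjugate
  partitions from the later arguments.\<close>

lemma MLQ_iff: "M \<in> MLQ n (comp_sort \<alpha>) \<longleftrightarrow> (\<forall>r. M r \<subseteq> {1..n} \<and> card (M r) = card (canonical_mlq \<alpha> r))"
  by (simp add: MLQ_def part_conjugate_comp_sort)

lemma canonical_above: "Max (insert 0 (set \<alpha>)) < r \<Longrightarrow> canonical_mlq \<alpha> r = {}"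
proof -
  assume r: "Max (insert 0 (set \<alpha>)) < r"
  have "a < r" if "a \<in> set \<alpha>" for a using Max_ge[of "insert 0 (set \<alpha>)" a] that r by simp
  then have "\<alpha> ! (c - 1) < r" if "1 \<le> c" "c \<le> length \<alpha>" for c using that by simp
  then show ?thesis by (fastforce simp: mem_canonical set_eq_iff)
qed

lemma canonical_nested: "1 \<le> r \<Longrightarrow> canonical_mlq \<alpha> (Suc r) \<subseteq> canonical_mlq \<alpha> r"
  by (auto simp: mem_canonical)

lemma canonical_sub: "canonical_mlq \<alpha> r \<subseteq> {1..length \<alpha>}"
  by (auto simp: mem_canonical)

lemma MLQ_box: assumes "M \<in> MLQ n (comp_sort \<alpha>)" shows "box (Max (insert 0 (set \<alpha>))) n M"
  unfolding box_def
proof (intro allI impI)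
  fix r c assume c: "c \<in> M r"
  have M: "M r \<subseteq> {1..n}" "card (M r) = card (canonical_mlq \<alpha> r)" using assms unfolding MLQ_iff by auto
  have "finite (M r)" using M(1) finite_subset by blast
  then have "card (M r) \<noteq> 0" using c by auto
  then have "canonical_mlq \<alpha> r \<noteq> {}" using M(2) card.empty by metis
  then have "r \<noteq> 0" "r \<le> Max (insert 0 (set \<alpha>))" using canonical_above[of \<alpha> r] by (auto simp: not_le)
  then show "1 \<le> r \<and> r \<le> Max (insert 0 (set \<alpha>)) \<and> 1 \<le> c \<and> c \<le> n" using c M(1) by auto
qed

lemma MLQ_mat: "M \<in> MLQ n (comp_sort \<alpha>) \<Longrightarrow> mat M" using MLQ_box unfolding mat_def by blast

lemma MLQ_psz: assumes "M \<in> MLQ n (comp_sort \<alpha>)" shows "psz M"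
  unfolding psz_def
proof (intro allI impI)
  fix r :: nat assume "1 \<le> r"
  then show "card (M (Suc r)) \<le> card (M r)"
    using assms card_mono[OF _ canonical_nested[of r \<alpha>]] finite_subset[OF canonical_sub[of \<alpha> r]] unfolding MLQ_iff by simp
qed

lemma canonical_MLQ: "canonical_mlq \<alpha> \<in> MLQ (length \<alpha>) (comp_sort \<alpha>)"
  using canonical_sub by (simp add: MLQ_iff)

lemma canonical_inject:
  assumes "length \<beta> = length \<gamma>" "\<And>k. 1 \<le> k \<Longrightarrow> canonical_mlq \<beta> k = canonical_mlq \<gamma> k"
  shows "\<beta> = \<gamma>"
proof (rule nth_equalityI[OF assms(1)])
  fix i assume i: "i < length \<beta>"
  have "k \<le> \<beta> ! i \<longleftrightarrow> k \<le> \<gamma> ! i" if "1 \<le> k" for k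
    using assms(2)[OF that] assms(1) mem_canonical[of "Suc i" \<beta> k] mem_canonical[of "Suc i" \<gamma> k] i that by simp
  then show "\<beta> ! i = \<gamma> ! i" by (metis le_antisym le_refl less_one not_less zero_le)
qed

text \<open>Row \<open>k\<close> of a canonical queue consists of the columns with entry at least
  \<open>k\<close>, here the labels at least \<open>k\<close> in row 1. This turns equality of types
  into equality of first rows.\<close>

lemma canonical_type:
  assumes N: "mat N" "psz N" "N 1 \<subseteq> {1..n}" and k: "1 \<le> k"
  shows "canonical_mlq (mlq_type n N) k = Tf k 1 N 1"
proof (rule set_eqI)
  fix c
  have ge: "k \<le> fm_label N 1 c \<longleftrightarrow> c \<in> Tf k 1 N 1" by (rule fm_label_ge[OF N(1,2)]) (use k in auto)
  have "c \<in> N 1" if "k \<le> fm_label N 1 c"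
  proof (rule ccontr)
    assume "c \<notin> N 1"
    then have "fm_label N 1 c = 0" using fm_main[OF N(1,2), of 1] by auto
    then show False using that k by simp
  qed
  moreover have "mlq_type n N ! (c - 1) = fm_label N 1 c" if "1 \<le> c" "c \<le> n"
    using that by (simp add: mlq_type_def del: upt_Suc)
  ultimately show "c \<in> canonical_mlq (mlq_type n N) k \<longleftrightarrow> c \<in> Tf k 1 N 1"
    unfolding ge[symmetric] mem_canonical using k N(3) by (auto simp: mlq_type_def)
qed

lemma length_mlq_type [simp]: "length (mlq_type n N) = n" by (simp add: mlq_type_def)

lemma MLQ_own_type:
  assumes N: "mat N" "psz N" "\<And>r. N r \<subseteq> {1..n}"
  shows "N \<in> MLQ n (comp_sort (mlq_type n N))"
  unfolding MLQ_iff
proof (intro allI conjI N(3))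
  fix r
  show "card (N r) = card (canonical_mlq (mlq_type n N) r)"
    using canonical_type[OF N, of r] Tf_rows(3)[OF N(1), of 1 r] mat_row0[OF N(1)] by (cases "r = 0") auto
qed

section \<open>Nonwrapping queues are the row highest ones\<close>

lemma Tf_nested:
  assumes C: "mat C" "\<And>r. 1 \<le> r \<Longrightarrow> C (Suc r) \<subseteq> C r" and r: "1 \<le> r" "r \<le> k"
  shows "Tf k r C r = C k"
  using r(2,1)
proof (induction rule: inc_induct)
  case base then show ?case by simp
next
  case (step r)
  let ?X = "Tf k (Suc r) C"
  have X: "mat ?X" "?X r = C r" "?X (Suc r) = C k" using Tf_rows(1,2)[OF C(1), of "Suc r" k] step by auto
  have "C k \<subseteq> C r"
  proof -
    have "r \<le> k" using step by simp
    then show ?thesis using \<open>1 \<le> r\<close>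
    proof (induction rule: inc_induct)
      case (step q) then show ?case using C(2)[of q] by auto
    qed simp
  qed
  then show ?case using sw_nested(1)[OF X(1) step(4)] X Tf_Suc[OF step(2)] by simp
qed

lemma nested_psz: "mat C \<Longrightarrow> (\<And>r. 1 \<le> r \<Longrightarrow> C (Suc r) \<subseteq> C r) \<Longrightarrow> psz C"
  unfolding psz_def by (intro allI impI card_mono mat_finite) auto

lemma nested_rhigh: "(\<And>r. 1 \<le> r \<Longrightarrow> C (Suc r) \<subseteq> C r) \<Longrightarrow> rhigh C"
  unfolding rhigh_def eps_def geps_def using uo_nested by simp

lemma maj_nested:
  assumes C: "mat C" "\<And>r. 1 \<le> r \<Longrightarrow> C (Suc r) \<subseteq> C r"
  shows "maj C = 0"
proof -
  have "eps (r - 1) (Tf k r C) = 0" if r: "2 \<le> r" "r \<le> k" for r k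
  proof -
    have "Tf k r C r = C k" by (rule Tf_nested[OF C]) (use r in auto)
    moreover have "Tf k r C (r - 1) = C (r - 1)" by (rule Tf_rows(2)[OF C(1)]) (use r in auto)
    moreover have "C k \<subseteq> C (r - 1)"
    proof -
      have "Tf k (r - 1) C (r - 1) = C k" by (rule Tf_nested[OF C]) (use r in auto)
      have "r - 1 \<le> k" using r by simp
      then show ?thesis using r(1)
      proof (induction rule: inc_induct)
        case (step q) then show ?case using C(2)[of q] by (cases "q = 0") auto
      qed simp
    qed
    ultimately show ?thesis using uo_nested[of "C k" "C (r - 1)"] r(1) by (simp add: eps_def geps_def)
  qed
  then have "(\<Sum>k = r..height C. eps (r - 1) (Tf k r C)) = 0" if "r \<in> {2..height C}" for r
    using that by (intro sum.neutral) auto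
  then have "(\<Sum>r = 2..height C. \<Sum>k = r..height C. eps (r - 1) (Tf k r C)) = 0"
    by (rule sum.neutral[rule_format])
  then show ?thesis using maj_eq[OF C(1) nested_psz[OF C]] by metis
qed

text \<open>The summand \<open>k = r\<close> of \<open>maj_eq\<close> is \<open>eps (r - 1)\<close>
  of \<open>N\<close> itself.\<close>

lemma maj_0_rhigh: assumes N: "mat N" "psz N" and m: "maj N = 0" shows "rhigh N"
  unfolding rhigh_def
proof (intro allI impI)
  fix j :: nat assume j: "1 \<le> j"
  show "eps j N = 0"
  proof (cases "Suc j \<le> height N")
    case True
    have "(\<Sum>r = 2..height N. \<Sum>k = r..height N. eps (r - 1) (Tf k r N)) = 0" using m maj_eq[OF N] by simp
    then have "\<forall>r \<in> {2..height N}. \<forall>k \<in> {r..height N}. eps (r - 1) (Tf k r N) = 0" by simp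
    moreover have "Suc j \<in> {2..height N}" "Suc j \<in> {Suc j..height N}" using j True by auto
    ultimately have "eps (Suc j - 1) (Tf (Suc j) (Suc j) N) = 0" by blast
    then show ?thesis by simp
  next
    case False
    obtain L n where "box L n N" using N unfolding mat_def by blast
    then have "N (Suc j) = {}" using box_height(1) False by (meson not_le)
    then have "uo (N (Suc j)) (N j) = {}" using uo_subset[of "N (Suc j)" "N j"] by blast
    then show ?thesis by (simp add: eps_def geps_def)
  qed
qed

lemma rhigh_psz: assumes "mat N" "rhigh N" shows "psz N"
  unfolding psz_def
proof (intro allI impI)
  fix r :: nat assume "1 \<le> r"
  then have "eps r N = 0" using assms(2) unfolding rhigh_def by blast
  then show "card (N (Suc r)) \<le> card (N r)" using eps_phi[OF assms(1), of r] by simp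
qed

text \<open>Both properties are constant on components, and the column highest member of a row
  highest array has nested rows.\<close>

lemma rhigh_maj_0: assumes N: "mat N" "rhigh N" shows "maj N = 0"
proof -
  obtain Y where Y: "conn N Y" "chigh Y" using ex_chigh[OF N(1)] by blast
  have mY: "mat Y" "rhigh Y" using conn_mat[OF Y(1) N(1)] rhigh_conn[OF Y(1) N(1)] N(2) by auto
  have "maj Y = 0"
    by (rule maj_nested[OF mY(1)]) (use chigh_rhigh[OF mY(1) Y(2) mY(2)] in auto)
  then show ?thesis using maj_conn[OF Y(1) N(1) rhigh_psz[OF N]] by simp
qed

lemma canonical_mat: "mat (canonical_mlq \<beta>)" by (rule MLQ_mat[OF canonical_MLQ])

lemma canonical_Tf: "1 \<le> k \<Longrightarrow> Tf k 1 (canonical_mlq \<beta>) 1 = canonical_mlq \<beta> k"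
  by (rule Tf_nested[OF canonical_mat canonical_nested]) auto

lemma canonical_NMLQ: "canonical_mlq \<beta> \<in> NMLQ_of_type \<beta>"
proof -
  have "mlq_type (length \<beta>) (canonical_mlq \<beta>) = \<beta>"
  proof (rule canonical_inject)
    fix k :: nat assume k: "1 \<le> k"
    show "canonical_mlq (mlq_type (length \<beta>) (canonical_mlq \<beta>)) k = canonical_mlq \<beta> k"
      using canonical_type[OF canonical_mat MLQ_psz[OF canonical_MLQ] canonical_sub k] canonical_Tf[OF k] by simp
  qed simp
  then show ?thesis using maj_nested[OF canonical_mat canonical_nested, of \<beta>] canonical_MLQ[of \<beta>]
    by (simp add: NMLQ_of_type_def MLQ_of_type_def)
qed

section \<open>The bijection\<close>

lemma rho_N_chigh:
  assumes b: "box L n X" and c: "chigh X" and r: "1 \<le> r"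
  shows "rho_N n X r = {1..seg X (height X) r}"
proof -
  have m: "mat X" using b unfolding mat_def by blast
  show ?thesis
  proof (cases "r \<le> height X")
    case True
    then have "rho_N n X r = {x. 1 \<le> x \<and> r \<le> kap X (height X) x}"
      using r unfolding rho_N_def collapse_chigh[OF b c] Cn_def by simp
    then show ?thesis using seg_set[OF m c r] by simp
  next
    case False
    then have "rho_N n X r = X r" using r unfolding rho_N_def collapse_chigh[OF b c] Cn_def by simp
    then show ?thesis using box_height(1)[OF b, of r] seg_0[of "height X" r X] False by simp
  qed
qed

lemma length_qrow_rho_Q:
  assumes b: "box L n X" and c: "chigh X" and j: "1 \<le> j"
  shows "length (qrow (rho_Q n X) j) = seg X (height X) j"
  unfolding qrow_chigh[OF assms] by (rule length_recording_chigh[OF assms])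

text \<open>Being row highest is checked on the column highest member, whose collapsed rows are
  initial segments of decreasing length.\<close>

lemma rho_N_word:
  assumes b: "box L n M"
  shows "\<exists>w. rword w \<and> rho_N n M = rops w M \<and> rhigh (rho_N n M)"
proof -
  have m: "mat M" using b unfolding mat_def by blast
  obtain Y where Y: "conn M Y" "chigh Y" "box L n Y" using ex_chigh[OF m] b by blast
  have mY: "mat Y" using Y(3) unfolding mat_def by blast
  obtain w where w: "rword w" "rho_N n M = rops w M" "rho_N n Y = rops w Y" using rho_N_conn[OF Y(1) b Y(3)] by blast
  have "rhigh (rho_N n Y)"
  proof (rule nested_rhigh)
    fix r :: nat assume r: "1 \<le> r"
    show "rho_N n Y (Suc r) \<subseteq> rho_N n Y r"
      using rho_N_chigh[OF Y(3,2), of r] rho_N_chigh[OF Y(3,2), of "Suc r"] seg_antimono[OF mY r, of "height Y"] r by auto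
  qed
  then have "rhigh (rops w M)"
    using rhigh_conn[OF conn_rops[OF Y(1) m w(1)] mat_rops[OF w(1) m]] w(3) by simp
  then show ?thesis using w by auto
qed

lemma card_rho_N:
  assumes b: "box L n M" and r: "1 \<le> r"
  shows "card (rho_N n M r) = length (qrow (rho_Q n M) r)"
proof -
  have m: "mat M" using b unfolding mat_def by blast
  obtain Y where Y: "conn M Y" "chigh Y" "box L n Y" using ex_chigh[OF m] b by blast
  obtain w where w: "rword w" "rho_N n M = rops w M" "rho_N n Y = rops w Y" using rho_N_conn[OF Y(1) b Y(3)] by blast
  have "card (rho_N n Y r) = card (rho_N n M r)"
    using conn_inv(1)[OF conn_rops[OF Y(1) m w(1)] mat_rops[OF w(1) m]] w by simp
  then show ?thesis
    using rho_N_chigh[OF Y(3,2) r] length_qrow_rho_Q[OF Y(3,2) r] rho_Q_conn[OF Y(1) b Y(3)] by simp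
qed

lemma rho_Q_good:
  assumes b: "box L n M"
  shows "good_tab (rho_Q n M)"
proof -
  have m: "mat M" using b unfolding mat_def by blast
  obtain X where X: "conn M X" "chigh X" "box L n X" using ex_chigh[OF m] b by blast
  have mX: "mat X" using X(3) unfolding mat_def by blast
  let ?T = "rho_Q n X"
  have q: "qrow ?T j = recording n X (height X) j" if "1 \<le> j" for j using qrow_chigh[OF X(3,2) that] .
  have sq: "sorted (qrow ?T j)" "0 \<notin> set (qrow ?T j)" if "1 \<le> j" for j
  proof -
    show "sorted (qrow ?T j)" unfolding q[OF that] by (rule recording_chigh(1)[OF X(3,2) that])
    have "\<not> 1 \<le> (0::nat)" by simp
    then show "0 \<notin> set (qrow ?T j)" unfolding q[OF that] using recording_chigh(2)[OF X(3,2) that, of 0 "height X"] by blast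
  qed
  have nth: "?T ! i = qrow ?T (Suc i)" if "i < length ?T" for i using that by (simp add: qrow_def)
  have rows: "sorted R \<and> R \<noteq> [] \<and> 0 \<notin> set R" if R: "R \<in> set ?T" for R
  proof -
    obtain i where i: "i < length ?T" "R = ?T ! i" using R by (auto simp: in_set_conv_nth)
    have "R \<noteq> []" using R unfolding rho_Q_def by (rule set_takeWhileD[THEN conjunct2])
    then show ?thesis using sq[of "Suc i"] nth[OF i(1)] i by simp
  qed
  have cols: "j < length (?T ! i) \<and> ?T ! i ! j < ?T ! Suc i ! j"
    if i: "Suc i < length ?T" and j: "j < length (?T ! Suc i)" for i j
  proof -
    define f where "f = ?T ! Suc i ! j"
    have e: "?T ! Suc i = qrow ?T (Suc (Suc i))" "?T ! i = qrow ?T (Suc i)" using nth[of i] nth[of "Suc i"] i by auto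
    have seg: "seg X r k = length (filter (\<lambda>x. x \<le> r) (qrow ?T k))" if "1 \<le> k" for r k
      using seg_rho_Q[OF X(3,2) that] .
    have "f \<in> set (?T ! Suc i)" using j unfolding f_def by simp
    then have f: "f \<noteq> 0" using sq(2)[of "Suc (Suc i)"] e by (metis One_nat_def Suc_le_mono zero_le)
    then obtain g where g: "f = Suc g" using not0_implies_Suc by blast
    have "j < length (filter (\<lambda>x. x \<le> f) (qrow ?T (Suc (Suc i))))"
      using sorted_nth_le[OF sq(1), of "Suc (Suc i)" j f] j e unfolding f_def by simp
    then have "Suc j \<in> {1..seg X f (Suc (Suc i))}" using seg[of "Suc (Suc i)" f] by simp
    then have "Suc j \<in> {x. 1 \<le> x \<and> Suc (Suc i) \<le> kap X f x}" using seg_set[OF mX X(2), of "Suc (Suc i)" f] by simp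
    then have "Suc (Suc i) \<le> kap X f (Suc j)" by blast
    \<comment> \<open>Column strictness: one row of the array adds at most one ball to a column, so
      with \<open>g = f - 1\<close> the row below has an entry at most \<open>g\<close> in the same
      place.\<close>
    then have "Suc i \<le> kap X g (Suc j)" unfolding g kap_Suc by (simp split: if_splits add: of_bool_def)
    then have "Suc j \<in> {1..seg X g (Suc i)}" using seg_set[OF mX X(2), of "Suc i" g, symmetric] by simp
    then have lt: "j < length (filter (\<lambda>x. x \<le> g) (qrow ?T (Suc i)))" using seg[of "Suc i" g] by simp
    then have l: "j < length (qrow ?T (Suc i))" using length_filter_le[of "\<lambda>x. x \<le> g" "qrow ?T (Suc i)"] by linarith
    then have "qrow ?T (Suc i) ! j \<le> g" using sorted_nth_le[OF sq(1), of "Suc i" j g] lt by simp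
    then show ?thesis using l e g unfolding f_def by simp
  qed
  have "good_tab ?T" unfolding good_tab_def using rows cols by blast
  then show ?thesis using rho_Q_conn[OF X(1) b X(3)] by simp
qed

lemma conn_reading_word:
  assumes b: "box L n M"
  shows "conn M (wmat (reading_word (rho_Q n M)))"
proof -
  let ?w = "reading_word (rho_Q n M)"
  obtain L' where "box L' (length ?w) (wmat ?w)"
    using box_wmat[of ?w "Max (insert 0 (set ?w))"] by fastforce
  then show ?thesis using rho_Q_eq_conn[OF b] rho_Q_wmat[OF rho_Q_good[OF b]] by metis
qed

lemma set_reading_word: "set (reading_word T) = (\<Union>R \<in> set T. set R)" by (auto simp: reading_word_def)

lemma count_reading_word: "count_list (reading_word T) k = count_list (concat T) k"
  by (induction T) (simp_all add: reading_word_def)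

lemma content_rho_Q:
  assumes b: "box L n M" shows "count_list (concat (rho_Q n M)) r = card (M r)"
proof -
  have m: "mat M" using b unfolding mat_def by blast
  let ?w = "reading_word (rho_Q n M)"
  have "count_list ?w r = card (M r)"
  proof (cases "1 \<le> r")
    case True
    then show ?thesis using conn_inv(1)[OF conn_reading_word[OF b] m, of r] card_wmat[of r ?w] by simp
  next
    case False
    then have "r = 0" by simp
    moreover have "0 \<notin> set ?w" using rho_Q_good[OF b] unfolding set_reading_word good_tab_def by blast
    ultimately show ?thesis using mat_row0[OF m] by (simp add: count_list_0_iff)
  qed
  then show ?thesis by (simp add: count_reading_word)
qed

lemma maj_charge:
  assumes b: "box L n M" and p: "psz M" shows "maj M = charge (rho_Q n M)"
proof -
  have m: "mat M" using b unfolding mat_def by blast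
  let ?w = "reading_word (rho_Q n M)"
  have "partition_word ?w"
  proof
    show "0 \<notin> set ?w" using rho_Q_good[OF b] unfolding set_reading_word good_tab_def by blast
    show "count_list ?w (Suc r) \<le> count_list ?w r" if "1 \<le> r" for r
      using p that unfolding count_reading_word content_rho_Q[OF b] psz_def by blast
  qed
  then have "word_charge ?w = maj (wmat ?w)" by (rule partition_word.word_charge_maj)
  then show ?thesis using maj_conn[OF conn_reading_word[OF b] m p] by (simp add: charge_def)
qed

text \<open>Column moves after \<open>w\<close> are images of column moves before it, with equal
  string lengths; so a path starting at \<open>rops w X\<close> lifts step by step.\<close>

lemma conn_lift:
  assumes "conn (rops w X) N" "mat X" "rword w"
  shows "\<exists>M. conn X M \<and> rops w M = N"
  using assms(1)
proof induction
  case self then show ?case using conn.self by blast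
next
  case (cup N i)
  then obtain M where M: "conn X M" "rops w M = N" by blast
  have m: "mat M" using conn_mat[OF M(1) assms(2)] .
  have "conn X (cup i M)"
    by (rule conn.cup[OF M(1)]) (use cup rops_cup(2)[OF m assms(3)] M in auto)
  then show ?case using rops_cup(1)[OF m assms(3)] cup M by metis
next
  case (cdn N i)
  then obtain M where M: "conn X M" "rops w M = N" by blast
  have m: "mat M" using conn_mat[OF M(1) assms(2)] .
  have "conn X (cdn i M)"
    by (rule conn.cdn[OF M(1)]) (use cdn rops_cup(3)[OF m assms(3)] M in auto)
  then show ?case using rops_cup(4)[OF m assms(3)] cdn M by metis
qed

lemma recording_change_n: "box L n X \<Longrightarrow> box L m X \<Longrightarrow> recording n X k = recording m X k"
proof (induction k)
  case (Suc k)
  then have "recording n X k = recording m X k" by blast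
  then show ?case by (rule_tac ext) (simp only: recording.simps collapse_change_n[OF Suc.prems])
qed simp

lemma rho_Q_change_n: "box L n X \<Longrightarrow> box L m X \<Longrightarrow> rho_Q n X = rho_Q m X"
  unfolding rho_Q_def using recording_change_n[of L n X m "height X"] by metis

text \<open>Equal tableaux place both arrays in one component, so one word collapses both. The word
  that undoes it on \<open>M\<close> also undoes it on \<open>M'\<close>.\<close>

lemma rho_inj:
  assumes b: "box L n M" "box L' n M'" and r: "rho n M = rho n M'"
  shows "M = M'"
proof -
  define K where "K = max L L'"
  have b': "box K n M" "box K n M'" using b box_mono[of _ n _ K n] unfolding K_def by auto
  have m: "mat M" "mat M'" using b unfolding mat_def by blast+
  have c: "conn M M'" using rho_Q_eq_conn[OF b] r unfolding rho_def by simp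
  obtain w where w: "rword w" "rho_N n M = rops w M" "rho_N n M' = rops w M'" using rho_N_conn[OF c b'] by blast
  obtain w' where w': "rword w'" "rops w' (rops w M) = M" using rops_inverse[OF m(1) w(1)] by blast
  have "rops (w @ w') M' = rops [] M'"
    by (rule conn_rops_inj[OF m(2) _ _ conn_sym[OF c m(1)]]) (use w w' in \<open>simp_all add: rops_append\<close>)
  then show ?thesis using w w' r by (simp add: rho_def rops_append)
qed

text \<open>Start in the component of the reading word of \<open>T\<close>. Its column highest
  member \<open>X\<close> collapses to initial segments with the row lengths of \<open>T\<close>,
  which is also the column highest member \<open>N0\<close> of the component of \<open>N\<close>.
  Lifting the path from \<open>N0\<close> to \<open>N\<close> gives \<open>M\<close>.\<close>

lemma rho_surj:
  assumes T: "good_tab T" and N: "box L n N" "rhigh N" and c: "\<And>r. 1 \<le> r \<Longrightarrow> card (N r) = length (qrow T r)"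
  shows "\<exists>M. (\<exists>L. box L n M) \<and> rho n M = (N, T)"
proof -
  let ?w = "reading_word T"
  have mN: "mat N" using N unfolding mat_def by blast
  obtain K where K: "box K (length ?w) (wmat ?w)"
    using box_wmat[of ?w "Max (insert 0 (set ?w))"] by fastforce
  obtain X where X: "conn (wmat ?w) X" "chigh X" "box K (length ?w) X" using ex_chigh[OF mat_wmat] K by blast
  have mX: "mat X" using X(3) unfolding mat_def by blast
  have QX: "rho_Q (length ?w) X = T" using rho_Q_conn[OF X(1) K X(3)] rho_Q_wmat[OF T] by simp
  \<comment> \<open>The reading word may occupy more than \<open>n\<close> columns; \<open>X\<close>
    does not, since it uses only as many columns as the first row of \<open>T\<close> has
    boxes.\<close>
  have colX: "x \<le> n" if x: "x \<in> X r" for x r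
  proof -
    have r: "r \<noteq> 0" "1 \<le> x" using mat_row0[OF mX] mat_col0[OF mX x] x by (metis empty_iff)+
    then obtain s where s: "r = Suc s" using not0_implies_Suc by blast
    have one: "1 \<le> kap X r x" using x unfolding s kap_Suc by simp
    then have "x \<le> seg X r 1" using seg_set[OF mX X(2), of 1 r] r one by auto
    also have "seg X r 1 \<le> length (qrow T 1)" using seg_rho_Q[OF X(3,2), of 1 r] QX by simp
    also have "\<dots> = card (N 1)" using c by simp
    also have "\<dots> \<le> card {1..n}" using N(1) unfolding box_def by (intro card_mono) auto
    finally show ?thesis by simp
  qed
  have bX: "box K n X" using X(3) colX unfolding box_def by blast
  have QX': "rho_Q n X = T"
    using rho_Q_change_n[of K n X "length ?w"] bX X(3) QX by simp
  obtain w where w: "rword w" "rho_N n X = rops w X" "rhigh (rho_N n X)" using rho_N_word[OF bX] by blast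
  obtain N0 where N0: "conn N N0" "chigh N0" "box L n N0" using ex_chigh[OF mN] N(1) by blast
  have mN0: "mat N0" "rhigh N0" using conn_mat[OF N0(1) mN] rhigh_conn[OF N0(1) mN] N(2) by auto
  have "N0 r = rho_N n X r" for r
  proof (cases "r = 0")
    case True
    then show ?thesis using mat_row0[OF mN0(1)] mat_row0[OF mat_rops[OF w(1) mX]] w(2) by simp
  next
    case False
    then have r: "1 \<le> r" by simp
    have "tr N0 x \<inter> {1..L} = tr N0 x" for x using N0(3) unfolding box_def by auto
    then have "N0 r = {x. 1 \<le> x \<and> r \<le> kap N0 L x}" using chigh_rhigh[OF mN0(1) N0(2) mN0(2) r] unfolding kap_def by simp
    then have e: "N0 r = {1..seg N0 L r}" using seg_set[OF mN0(1) N0(2) r] by simp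
    have "card (N0 r) = length (qrow T r)" using c[OF r] conn_inv(1)[OF N0(1) mN] by simp
    then have "seg N0 L r = seg X (height X) r" using e length_qrow_rho_Q[OF bX X(2) r] QX' by simp
    then show ?thesis using e rho_N_chigh[OF bX X(2) r] by simp
  qed
  then have "rops w X = N0" using w(2) by (intro ext) simp
  then have "conn (rops w X) N" using conn_sym[OF N0(1) mN] by simp
  then obtain M where M: "conn X M" "rops w M = N" using conn_lift[OF _ mX w(1)] by blast
  have mM: "mat M" using conn_mat[OF M(1) mX] .
  \<comment> \<open>Column sizes are preserved by \<open>w\<close>, so \<open>M\<close> uses no
    column that \<open>N\<close> leaves empty.\<close>
  have bM: "\<exists>L. box L n M"
  proof -
    obtain L1 n1 where b1: "box L1 n1 M" using mM unfolding mat_def by blast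
    have "x \<le> n" if x: "x \<in> M r" for x r
    proof (rule ccontr)
      assume nx: "\<not> x \<le> n"
      have "tr N x = {}" unfolding tr_def using N(1) nx unfolding box_def by blast
      then have "card (tr (rops w M) x) = 0" unfolding M(2) by simp
      then have "card (tr M x) = 0" unfolding card_col_rops[OF mM w(1)] .
      moreover have "tr M x \<subseteq> {1..L1}" using b1 unfolding box_def tr_def by auto
      then have "finite (tr M x)" using finite_subset by blast
      ultimately have "tr M x = {}" by simp
      then show False using x unfolding tr_def by blast
    qed
    then have "box L1 n M" using b1 unfolding box_def by blast
    then show ?thesis by blast
  qed
  then obtain L1 where L1: "box L1 n M" by blast
  define K1 where "K1 = max K L1"
  have b1: "box K1 n X" "box K1 n M" using box_mono[OF bX, of K1 n] box_mono[OF L1, of K1 n] unfolding K1_def by auto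
  have QM: "rho_Q n M = T" using rho_Q_conn[OF M(1) b1] QX' by simp
  obtain u where u: "rword u" "rho_N n X = rops u X" "rho_N n M = rops u M" using rho_N_conn[OF M(1) b1] by blast
  have "rops u M = rops w M"
    by (rule conn_rops_inj[OF mM u(1) w(1) conn_sym[OF M(1) mX]]) (use u w in simp)
  then have "rho n M = (N, T)" using u M QM by (simp add: rho_def)
  then show ?thesis using bM by blast
qed

text \<open>Only column sizes enter, and row operators preserve them; so collapsing keeps the
  weight.\<close>

lemma weight_columns:
  assumes b: "box L n M" shows "weight M = (\<Prod>c = 1..n. xvar c ^ card (tr M c))"
proof -
  have row: "(\<Prod>b \<in> M r. xvar b) = (\<Prod>c = 1..n. if c \<in> M r then xvar c else 1)" for r
  proof -
    have "M r \<subseteq> {1..n}" using b unfolding box_def by auto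
    then have "M r = {c \<in> {1..n}. c \<in> M r}" by blast
    then have "(\<Prod>b \<in> M r. xvar b) = (\<Prod>b \<in> {c \<in> {1..n}. c \<in> M r}. xvar b)" by simp
    also have "\<dots> = (\<Prod>c = 1..n. if c \<in> M r then xvar c else 1)" by (rule prod.inter_filter) simp
    finally show ?thesis .
  qed
  have col: "(\<Prod>r = 1..height M. if c \<in> M r then xvar c else 1) = xvar c ^ card (tr M c)" for c
  proof -
    have "r \<in> {1..height M}" if "c \<in> M r" for r
    proof -
      have "1 \<le> r" using b that unfolding box_def by blast
      moreover have "r \<le> height M" using box_height(1)[OF b, of r] that by (cases "height M < r") auto
      ultimately show ?thesis by simp
    qed
    then have "tr M c = {r \<in> {1..height M}. c \<in> M r}" unfolding tr_def by blast
    moreover have "(\<Prod>r = 1..height M. if c \<in> M r then xvar c else 1) = (\<Prod>r \<in> {r \<in> {1..height M}. c \<in> M r}. xvar c)"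
      by (rule prod.inter_filter[symmetric]) simp
    ultimately show ?thesis by simp
  qed
  show ?thesis unfolding weight_def row by (subst prod.swap) (simp only: col)
qed

lemma weight_rho_N:
  assumes b: "box L n M" shows "weight (rho_N n M) = weight M"
proof -
  have m: "mat M" using b unfolding mat_def by blast
  obtain w where w: "rword w" "rho_N n M = rops w M" using rho_N_word[OF b] by blast
  have "box L n (rho_N n M)" unfolding rho_N_def by (rule box_collapse[OF b])
  then show ?thesis using weight_columns[OF b] weight_columns[of L n "rho_N n M"] w(2) card_col_rops[OF m w(1)] by simp
qed

lemma length_filter_take:
  fixes lam :: "nat list"
  assumes "sorted (rev lam)"
  shows "length (filter (\<lambda>a. r \<le> a) (take k lam)) = min k (length (filter (\<lambda>a. r \<le> a) lam))"
  using assms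
proof (induction lam arbitrary: k)
  case Nil then show ?case by simp
next
  case (Cons a lam)
  have s: "sorted (rev lam)" "\<forall>b \<in> set lam. b \<le> a" using Cons.prems by (auto simp: sorted_append)
  show ?case
  proof (cases k)
    case (Suc j)
    show ?thesis
    proof (cases "r \<le> a")
      case True
      then show ?thesis using Cons.IH[OF s(1), of j] Suc by simp
    next
      case False
      then have "filter (\<lambda>b. r \<le> b) lam = []" "filter (\<lambda>b. r \<le> b) (take j lam) = []"
        using s(2) set_take_subset[of j lam] by (fastforce simp: filter_empty_conv)+
      then show ?thesis using Suc False by simp
    qed
  qed simp
qed

lemma sum_list_layers:
  fixes xs :: "nat list"
  shows "\<forall>a \<in> set xs. a \<le> R \<Longrightarrow> sum_list xs = (\<Sum>r = 1..R. length (filter (\<lambda>a. r \<le> a) xs))"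
proof (induction xs)
  case Nil then show ?case by simp
next
  case (Cons a xs)
  have "(\<Sum>r = 1..R. of_bool (r \<le> a)) = card ({1..R} \<inter> {r. r \<le> a})" by (simp add: sum_of_bool_eq)
  also have "{1..R} \<inter> {r. r \<le> a} = {1..a}" using Cons.prems by auto
  finally have "(\<Sum>r = 1..R. of_bool (r \<le> a)) = a" by simp
  moreover have "length (filter (\<lambda>a. r \<le> a) (a # xs)) = of_bool (r \<le> a) + length (filter (\<lambda>a. r \<le> a) xs)" for r by simp
  ultimately show ?case using Cons by (simp only: sum.distrib) simp
qed

lemma sum_take_comp_sort:
  assumes R: "\<forall>a \<in> set \<beta>. a \<le> R"
  shows "sum_list (take k (comp_sort \<beta>)) = (\<Sum>r = 1..R. min k (card (canonical_mlq \<beta> r)))"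
proof -
  have "\<forall>a \<in> set (take k (comp_sort \<beta>)). a \<le> R"
    using R set_take_subset[of k "comp_sort \<beta>"] by (auto simp: comp_sort_def)
  then have "sum_list (take k (comp_sort \<beta>)) = (\<Sum>r = 1..R. length (filter (\<lambda>a. r \<le> a) (take k (comp_sort \<beta>))))"
    by (rule sum_list_layers)
  then show ?thesis by (simp add: length_filter_take[OF sorted_rev_comp_sort] length_filter_comp_sort)
qed

lemma length_comp_sort: "length (comp_sort \<beta>) \<le> length \<beta>" by (simp add: comp_sort_def)

text \<open>In a column highest array, row \<open>r\<close> of the recording tableau has the length
  \<open>card {x. r \<le> kap Y R x}\<close>, so that both sides count the balls in the first \<open>k\<close> columns.\<close>

lemma min_seg_sum:
  assumes m: "mat Y" "chigh Y" and H: "height Y \<le> R"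
  shows "(\<Sum>r = 1..R. min k (seg Y R r)) = (\<Sum>r = 1..R. card (Y r \<inter> {1..k}))"
proof -
  have "min k (seg Y R r) = (\<Sum>x = 1..k. of_bool (r \<le> kap Y R x))" if r: "r \<in> {1..R}" for r
  proof -
    have "{1..k} \<inter> {x. r \<le> kap Y R x} = {1..k} \<inter> {x. 1 \<le> x \<and> r \<le> kap Y R x}" by auto
    also have "\<dots> = {1..min k (seg Y R r)}" using seg_set[OF m, of r R] r by auto
    finally show ?thesis by (simp add: sum_of_bool_eq)
  qed
  then have "(\<Sum>r = 1..R. min k (seg Y R r)) = (\<Sum>r = 1..R. \<Sum>x = 1..k. of_bool (r \<le> kap Y R x))" by simp
  also have "\<dots> = (\<Sum>x = 1..k. \<Sum>r = 1..R. of_bool (r \<le> kap Y R x))" by (rule sum.swap)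
  also have "\<dots> = (\<Sum>x = 1..k. \<Sum>r = 1..R. of_bool (x \<in> Y r))"
  proof (rule sum.cong[OF refl])
    fix x
    have "{1..R} \<inter> {r. r \<le> kap Y R x} = {1..kap Y R x}" using kap_le[of Y R x] by auto
    moreover have "{1..R} \<inter> {r. x \<in> Y r} = tr Y x \<inter> {1..R}" unfolding tr_def by blast
    ultimately show "(\<Sum>r = 1..R. of_bool (r \<le> kap Y R x)) = (\<Sum>r = 1..R. (of_bool (x \<in> Y r) :: nat))"
      by (simp add: sum_of_bool_eq kap_def)
  qed
  also have "\<dots> = (\<Sum>r = 1..R. \<Sum>x = 1..k. of_bool (x \<in> Y r))" by (rule sum.swap)
  also have "\<dots> = (\<Sum>r = 1..R. card (Y r \<inter> {1..k}))" by (simp add: sum_of_bool_eq Int_commute)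
  finally show ?thesis .
qed

lemma rho_N_MLQ:
  assumes b: "box L n M" shows "rho_N n M \<in> NMLQ_of_type (mlq_type n (rho_N n M))"
proof -
  have b': "box L n (rho_N n M)" unfolding rho_N_def by (rule box_collapse[OF b])
  obtain w where w: "rword w" "rho_N n M = rops w M" "rhigh (rho_N n M)" using rho_N_word[OF b] by blast
  have mN: "mat (rho_N n M)" using b' unfolding mat_def by blast
  have "rho_N n M r \<subseteq> {1..n}" for r using b' unfolding box_def by auto
  then have "rho_N n M \<in> MLQ n (comp_sort (mlq_type n (rho_N n M)))"
    by (rule MLQ_own_type[OF mN rhigh_psz[OF mN w(3)]])
  then show ?thesis using rhigh_maj_0[OF mN w(3)] by (simp add: NMLQ_of_type_def MLQ_of_type_def)
qed

lemma NMLQ_MLQ: "N \<in> NMLQ_of_type \<beta> \<Longrightarrow> N \<in> MLQ (length \<beta>) (comp_sort \<beta>)"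
  "N \<in> NMLQ_of_type \<beta> \<Longrightarrow> mlq_type (length \<beta>) N = \<beta>" "N \<in> NMLQ_of_type \<beta> \<Longrightarrow> maj N = 0"
  by (simp_all add: NMLQ_of_type_def MLQ_of_type_def)

text \<open>Partial sums for \<beta> count the balls in the first \<open>k\<close> columns of the
  column highest member; each row contributes at most \<open>k\<close> and at most its size, which
  are the partial sums for \<alpha>. At \<open>k = n\<close> nothing is cut off.\<close>

lemma rho_dominated:
  assumes M: "M \<in> MLQ n (comp_sort \<alpha>)" and \<alpha>: "length \<alpha> = n"
  defines "\<beta> \<equiv> mlq_type n (rho_N n M)"
  shows "dominated (comp_sort \<beta>) (comp_sort \<alpha>)"
proof -
  have m: "mat M" by (rule MLQ_mat[OF M])
  obtain L where b: "box L n M" using MLQ_box[OF M] by blast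
  obtain Y where Y: "conn M Y" "chigh Y" "box L n Y" using ex_chigh[OF m] b by blast
  have mY: "mat Y" using Y(3) unfolding mat_def by blast
  have len: "length \<beta> = n" by (simp add: \<beta>_def)
  define R where "R = height Y + Max (insert 0 (set \<alpha> \<union> set \<beta>))"
  have R: "\<forall>a \<in> set \<alpha>. a \<le> R" "\<forall>a \<in> set \<beta>. a \<le> R" "height Y \<le> R"
    using Max_ge[of "insert 0 (set \<alpha> \<union> set \<beta>)"] unfolding R_def by (auto intro: trans_le_add2)
  have ca: "card (canonical_mlq \<alpha> r) = card (Y r)" for r
    using M conn_inv(1)[OF Y(1) m, of r] unfolding MLQ_iff by simp
  have cb: "card (canonical_mlq \<beta> r) = seg Y R r" if r: "1 \<le> r" for r
  proof -
    have "rho_N n M \<in> MLQ n (comp_sort \<beta>)" using NMLQ_MLQ(1)[OF rho_N_MLQ[OF b]] len unfolding \<beta>_def by simp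
    then have "card (canonical_mlq \<beta> r) = length (qrow (rho_Q n Y) r)"
      using card_rho_N[OF b r] rho_Q_conn[OF Y(1) b Y(3)] unfolding MLQ_iff by simp
    then show ?thesis unfolding length_qrow_rho_Q[OF Y(3,2) r] seg_def kap_height[OF mY R(3)] .
  qed
  have tb: "sum_list (take k (comp_sort \<beta>)) = (\<Sum>r = 1..R. card (Y r \<inter> {1..k}))" for k
  proof -
    have "(\<Sum>r = 1..R. min k (card (canonical_mlq \<beta> r))) = (\<Sum>r = 1..R. min k (seg Y R r))" by (rule sum.cong) (simp_all add: cb)
    then show ?thesis unfolding sum_take_comp_sort[OF R(2)] using min_seg_sum[OF mY Y(2) R(3)] by simp
  qed
  have ta: "sum_list (take k (comp_sort \<alpha>)) = (\<Sum>r = 1..R. min k (card (Y r)))" for k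
    unfolding sum_take_comp_sort[OF R(1)] ca ..
  have sub: "Y r \<subseteq> {1..n}" for r using Y(3) unfolding box_def by auto
  have "sum_list (take k (comp_sort \<beta>)) \<le> sum_list (take k (comp_sort \<alpha>))" for k
    unfolding ta tb
  proof (rule sum_mono)
    fix r
    have "card (Y r \<inter> {1..k}) \<le> card {1..k}" by (rule card_mono) auto
    moreover have "card (Y r \<inter> {1..k}) \<le> card (Y r)" by (rule card_mono[OF mat_finite[OF mY]]) blast
    ultimately show "card (Y r \<inter> {1..k}) \<le> min k (card (Y r))" by simp
  qed
  moreover have "sum_list (take n (comp_sort \<beta>)) = sum_list (take n (comp_sort \<alpha>))"
    unfolding ta tb
  proof (rule sum.cong[OF refl])
    fix r
    have "card (Y r) \<le> card {1..n}" by (rule card_mono) (use sub in auto)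
    moreover have "Y r \<inter> {1..n} = Y r" using sub by blast
    ultimately show "card (Y r \<inter> {1..n}) = min n (card (Y r))" by simp
  qed
  moreover have "take n (comp_sort \<beta>) = comp_sort \<beta>" "take n (comp_sort \<alpha>) = comp_sort \<alpha>"
    using length_comp_sort[of \<beta>] length_comp_sort[of \<alpha>] len \<alpha> by simp_all
  ultimately show ?thesis unfolding dominated_def by simp
qed

section \<open>Tableaux, types and the final summation\<close>

lemma part_inject:
  assumes "0 \<notin> set a" "0 \<notin> set b" "\<And>r. 1 \<le> r \<Longrightarrow> part a r = part b r" shows "a = b"
proof -
  have pos: "part c r \<noteq> 0 \<longleftrightarrow> r \<le> length c" if "0 \<notin> set c" "1 \<le> r" for c :: "nat list" and r
  proof (cases "r \<le> length c")
    case True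
    then have "c ! (r - 1) \<in> set c" using that(2) by simp
    then have "c ! (r - 1) \<noteq> 0" using that(1) by metis
    then show ?thesis using that True by (simp add: part_def)
  qed (simp add: part_def)
  have "r \<le> length a \<longleftrightarrow> r \<le> length b" if "1 \<le> r" for r
    using pos[OF assms(1) that] pos[OF assms(2) that] assms(3)[OF that] by simp
  then have l: "length a = length b" by (metis le_antisym le_refl less_one not_less zero_le)
  show ?thesis
  proof (rule nth_equalityI[OF l])
    show "a ! i = b ! i" if "i < length a" for i using assms(3)[of "Suc i"] that l by (simp add: part_def)
  qed
qed

lemma conjugate_pos: assumes "sorted (rev lam)" shows "0 \<notin> set (conjugate lam)"
proof
  assume "0 \<in> set (conjugate lam)"
  then obtain r where r: "1 \<le> r" "r \<le> part lam 1" "length (filter (\<lambda>a. r \<le> a) lam) = 0"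
    unfolding conjugate_def by (auto simp del: upt_Suc)
  then obtain a l where lam: "lam = a # l" by (cases lam) (auto simp: part_def)
  then show False using r by (simp add: part_def)
qed

lemma SSYT_iff:
  "T \<in> SSYT (conjugate (comp_sort \<beta>)) (conjugate (comp_sort \<alpha>)) \<longleftrightarrow>
   good_tab T \<and> (\<forall>r\<ge>1. length (qrow T r) = card (canonical_mlq \<beta> r)) \<and>
   (\<forall>k. count_list (concat T) k = card (canonical_mlq \<alpha> k))" (is "?l \<longleftrightarrow> ?r")
proof -
  have part_T: "part (map length T) r = length (qrow T r)" if "1 \<le> r" for r
    using that by (auto simp: part_def qrow_def)
  show ?thesis
  proof
    assume ?l
    then have T: "map length T = conjugate (comp_sort \<beta>)" "\<forall>R \<in> set T. sorted R"
      "\<And>i j. Suc i < length T \<Longrightarrow> j < length (T ! Suc i) \<Longrightarrow> T ! i ! j < T ! Suc i ! j"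
      "\<And>k. count_list (concat T) k = card (canonical_mlq \<alpha> k)"
      unfolding SSYT_def part_conjugate_comp_sort by auto
    have q: "length (qrow T r) = card (canonical_mlq \<beta> r)" if "1 \<le> r" for r
      using part_T[OF that] unfolding T(1) part_conjugate_comp_sort by simp
    have ne: "R \<noteq> []" if "R \<in> set T" for R
    proof
      assume "R = []"
      then have "0 \<in> length ` set T" using that by force
      then have "0 \<in> set (map length T)" by simp
      then show False using conjugate_pos[OF sorted_rev_comp_sort] T(1) by metis
    qed
    have "0 \<notin> set (concat T)" using T(4)[of 0] count_list_0_iff[of "concat T" 0] by simp
    then have z: "0 \<notin> set R" if "R \<in> set T" for R using that by auto
    have "j < length (T ! i)" if "Suc i < length T" "j < length (T ! Suc i)" for i j
    proof -
      have "T ! i = qrow T (Suc i)" "T ! Suc i = qrow T (Suc (Suc i))" using that by (auto simp: qrow_def)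
      moreover have "card (canonical_mlq \<beta> (Suc (Suc i))) \<le> card (canonical_mlq \<beta> (Suc i))"
        by (rule card_mono[OF mat_finite[OF canonical_mat] canonical_nested]) simp
      ultimately show ?thesis using that q[of "Suc i"] q[of "Suc (Suc i)"] by simp
    qed
    then have "good_tab T" unfolding good_tab_def using T(2,3) ne z by blast
    then show ?r using q T(4) by blast
  next
    assume r: ?r
    then have g: "good_tab T" and q: "\<And>r. 1 \<le> r \<Longrightarrow> length (qrow T r) = card (canonical_mlq \<beta> r)"
      and c: "\<And>k. count_list (concat T) k = card (canonical_mlq \<alpha> k)" by blast+
    have "map length T = conjugate (comp_sort \<beta>)"
    proof (rule part_inject[OF _ conjugate_pos[OF sorted_rev_comp_sort]])
      show "0 \<notin> set (map length T)" using good_rows[OF g] by auto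
      show "part (map length T) r = part (conjugate (comp_sort \<beta>)) r" if "1 \<le> r" for r
        unfolding part_T[OF that] part_conjugate_comp_sort by (rule q[OF that])
    qed
    moreover have "\<forall>R \<in> set T. sorted R" using good_rows[OF g] by blast
    moreover have "\<forall>i j. Suc i < length T \<longrightarrow> j < length (T ! Suc i) \<longrightarrow> T ! i ! j < T ! Suc i ! j"
      using g unfolding good_tab_def by blast
    ultimately show ?l unfolding SSYT_def part_conjugate_comp_sort using c by blast
  qed
qed

lemma rho_Q_SSYT:
  assumes M: "M \<in> MLQ n (comp_sort \<alpha>)"
  shows "rho_Q n M \<in> SSYT (conjugate (comp_sort (mlq_type n (rho_N n M)))) (conjugate (comp_sort \<alpha>))"
proof -
  obtain L where b: "box L n M" using MLQ_box[OF M] by blast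
  have "rho_N n M \<in> MLQ n (comp_sort (mlq_type n (rho_N n M)))" using NMLQ_MLQ(1)[OF rho_N_MLQ[OF b]] by simp
  then have "length (qrow (rho_Q n M) r) = card (canonical_mlq (mlq_type n (rho_N n M)) r)" if "1 \<le> r" for r
    using card_rho_N[OF b that] unfolding MLQ_iff by simp
  moreover have "count_list (concat (rho_Q n M)) k = card (canonical_mlq \<alpha> k)" for k
    using content_rho_Q[OF b, of k] M unfolding MLQ_iff by simp
  ultimately show ?thesis unfolding SSYT_iff using rho_Q_good[OF b] by blast
qed

lemma rho_ex:
  assumes N: "N \<in> NMLQ_of_type \<beta>" and l: "length \<beta> = n"
    and Q: "Q \<in> SSYT (conjugate (comp_sort \<beta>)) (conjugate (comp_sort \<alpha>))"
  shows "\<exists>M \<in> MLQ n (comp_sort \<alpha>). rho n M = (N, Q)"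
proof -
  have N': "N \<in> MLQ n (comp_sort \<beta>)" "maj N = 0" using NMLQ_MLQ[OF N] l by auto
  have q: "good_tab Q" "\<And>r. 1 \<le> r \<Longrightarrow> length (qrow Q r) = card (canonical_mlq \<beta> r)"
    "\<And>k. count_list (concat Q) k = card (canonical_mlq \<alpha> k)" using Q unfolding SSYT_iff by blast+
  have "rhigh N" by (rule maj_0_rhigh[OF MLQ_mat[OF N'(1)] MLQ_psz[OF N'(1)] N'(2)])
  moreover have "card (N r) = length (qrow Q r)" if "1 \<le> r" for r using N'(1) q(2)[OF that] unfolding MLQ_iff by simp
  ultimately obtain M L where M: "box L n M" "rho n M = (N, Q)" using rho_surj[OF q(1) MLQ_box[OF N'(1)]] by blast
  have "M r \<subseteq> {1..n}" for r using M(1) unfolding box_def by auto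
  moreover have "card (M r) = card (canonical_mlq \<alpha> r)" for r
    using content_rho_Q[OF M(1), of r] q(3)[of r] M(2) by (simp add: rho_def)
  ultimately have "M \<in> MLQ n (comp_sort \<alpha>)" unfolding MLQ_iff by blast
  then show ?thesis using M(2) by blast
qed

text \<open>The common tableau provides a common collapsing word to row highest arrays, and
  \<open>canonical_type\<close> turns their equal types into the hypothesis of
  \<open>type_determined\<close>.\<close>

lemma rho_type:
  assumes M: "M \<in> MLQ n (comp_sort \<alpha>)" "M' \<in> MLQ n (comp_sort \<alpha>)"
    and Q: "rho_Q n M = rho_Q n M'" and t: "mlq_type n (rho_N n M) = mlq_type n (rho_N n M')"
  shows "mlq_type n M = mlq_type n M'"
proof -
  define L where "L = Max (insert 0 (set \<alpha>))"
  have b: "box L n M" "box L n M'" using MLQ_box M unfolding L_def by auto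
  have m: "mat M" "mat M'" using b unfolding mat_def by blast+
  have c: "conn M M'" by (rule rho_Q_eq_conn[OF b Q])
  obtain w where w: "rword w" "rho_N n M = rops w M" "rho_N n M' = rops w M'" using rho_N_conn[OF c b] by blast
  have can: "canonical_mlq (mlq_type n (rho_N n X)) k = Tf k 1 (rho_N n X) 1" if X: "box L n X" and k: "1 \<le> k" for X k
  proof -
    have b': "box L n (rho_N n X)" unfolding rho_N_def by (rule box_collapse[OF X])
    have mX: "mat (rho_N n X)" using b' unfolding mat_def by blast
    have r: "rhigh (rho_N n X)" using rho_N_word[OF X] by blast
    show ?thesis by (rule canonical_type[OF mX rhigh_psz[OF mX r] _ k]) (use b' in \<open>auto simp: box_def\<close>)
  qed
  have rh: "rhigh (rops w M)" using rho_N_word[OF b(1)] w(2) by auto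
  have e: "Tf k 1 (rops w M) 1 = Tf k 1 (rops w M') 1" if "1 \<le> k" for k
    using can[OF b(1) that] can[OF b(2) that] t w(2,3) by simp
  show ?thesis
  proof (rule canonical_inject)
    fix k :: nat assume k: "1 \<le> k"
    have "Tf k 1 M 1 = Tf k 1 M' 1" by (rule type_determined[OF m(1) c w(1) rh e k])
    moreover have "M 1 \<subseteq> {1..n}" "M' 1 \<subseteq> {1..n}" using M unfolding MLQ_iff by blast+
    ultimately show "canonical_mlq (mlq_type n M) k = canonical_mlq (mlq_type n M') k"
      using canonical_type[OF m(1) MLQ_psz[OF M(1)] _ k] canonical_type[OF m(2) MLQ_psz[OF M(2)] _ k] by simp
  qed simp
qed

lemma finite_MLQ: "finite (MLQ n (comp_sort \<alpha>))"
proof (rule finite_subset)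
  let ?L = "Max (insert 0 (set \<alpha>))"
  show "MLQ n (comp_sort \<alpha>) \<subseteq> {M. \<forall>r. (r \<in> {1..?L} \<longrightarrow> M r \<in> Pow {1..n}) \<and> (r \<notin> {1..?L} \<longrightarrow> M r = {})}"
  proof
    fix M assume M: "M \<in> MLQ n (comp_sort \<alpha>)"
    have "box ?L n M" by (rule MLQ_box[OF M])
    then have "M r = {}" if "r \<notin> {1..?L}" for r using that unfolding box_def by (metis atLeastAtMost_iff equals0I)
    then show "M \<in> {M. \<forall>r. (r \<in> {1..?L} \<longrightarrow> M r \<in> Pow {1..n}) \<and> (r \<notin> {1..?L} \<longrightarrow> M r = {})}"
      using M unfolding MLQ_iff by blast
  qed
  show "finite {M. \<forall>r. (r \<in> {1..?L} \<longrightarrow> M r \<in> Pow {1..n}) \<and> (r \<notin> {1..?L} \<longrightarrow> M r = ({} :: nat set))}"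
    by (rule finite_set_of_finite_funs) simp_all
qed

text \<open>By surjectivity each tableau comes from a queue that collapses to the canonical one, and
  there are finitely many queues.\<close>

lemma finite_SSYT:
  assumes "length \<beta> = n"
  shows "finite (SSYT (conjugate (comp_sort \<beta>)) (conjugate (comp_sort \<alpha>)))"
proof (rule finite_surj[OF finite_MLQ])
  show "SSYT (conjugate (comp_sort \<beta>)) (conjugate (comp_sort \<alpha>)) \<subseteq> rho_Q n ` MLQ n (comp_sort \<alpha>)"
  proof
    fix Q assume Q: "Q \<in> SSYT (conjugate (comp_sort \<beta>)) (conjugate (comp_sort \<alpha>))"
    obtain M where "M \<in> MLQ n (comp_sort \<alpha>)" "rho n M = (canonical_mlq \<beta>, Q)"
      using rho_ex[OF canonical_NMLQ assms Q] by blast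
    then show "Q \<in> rho_Q n ` MLQ n (comp_sort \<alpha>)" by (auto simp: rho_def)
  qed
qed

lemma finite_dominated: "finite {\<beta>. length \<beta> = n \<and> dominated (comp_sort \<beta>) lam}"
proof (rule finite_subset)
  show "{\<beta>. length \<beta> = n \<and> dominated (comp_sort \<beta>) lam} \<subseteq> {\<beta>. set \<beta> \<subseteq> {..sum_list lam} \<and> length \<beta> = n}"
  proof (intro subsetI CollectI conjI)
    fix \<beta> a assume b: "\<beta> \<in> {\<beta>. length \<beta> = n \<and> dominated (comp_sort \<beta>) lam}" and a: "a \<in> set \<beta>"
    have "a \<le> sum_list (comp_sort \<beta>)"
    proof (cases "a = 0")
      case False
      then have "a \<in> set (comp_sort \<beta>)" using a by (simp add: comp_sort_def)
      then show ?thesis by (rule member_le_sum_list) simp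
    qed simp
    then show "a \<in> {..sum_list lam}" using b by (simp add: dominated_def)
  qed simp
  show "finite {\<beta>. set \<beta> \<subseteq> {..sum_list lam} \<and> length \<beta> = n}" by (rule finite_lists_length_eq) simp
qed

lemma scalar_sum: "scalar (sum f A) = (\<Sum>x \<in> A. scalar (f x))"
  by (induction A rule: infinite_finite_induct) (simp_all add: scalar_def single_add)

theorem theorem4p4:
  fixes n :: nat and \<alpha> :: "nat list"
  assumes "0 < n"
    and "length \<alpha> = n"
    and "length (comp_sort \<alpha>) < n"
  shows "asep_poly \<alpha> =
    (\<Sum>\<beta> \<in> {\<beta>. length \<beta> = n \<and> dominated (comp_sort \<beta>) (comp_sort \<alpha>)}.
       scalar (K_coeff \<alpha> \<beta>) * atom \<beta>)"
proof -
  let ?lam = "comp_sort \<alpha>"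
  let ?B = "{\<beta>. length \<beta> = n \<and> dominated (comp_sort \<beta>) ?lam}"
  let ?Q = "\<lambda>\<beta>. {Q \<in> SSYT (conjugate (comp_sort \<beta>)) (conjugate ?lam).
    mlq_type n (rho_inv n ?lam (canonical_mlq \<beta>, Q)) = \<alpha>}"
  let ?N = NMLQ_of_type
  let ?F = "\<lambda>M. (mlq_type n (rho_N n M), rho_Q n M, rho_N n M)"
  let ?g = "\<lambda>(\<beta>, Q, N). scalar (qvar ^ charge Q) * weight N"
  have inj: "inj_on (rho n) (MLQ n ?lam)"
    by (rule inj_onI) (rule rho_inj[OF MLQ_box MLQ_box])
  \<comment> \<open>The coefficient looks at the preimage of
    \<open>(canonical_mlq \<beta>, Q)\<close>, not at \<open>M\<close>; both collapse to arrays of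
    type \<beta> with the same tableau, so \<open>rho_type\<close> gives them the same type.\<close>
  have inv_type: "mlq_type n (rho_inv n ?lam (canonical_mlq \<beta>, rho_Q n M)) = mlq_type n M"
    if M: "M \<in> MLQ n ?lam" and b: "length \<beta> = n" "mlq_type n (rho_N n M) = \<beta>" for M \<beta>
  proof -
    have "rho_Q n M \<in> SSYT (conjugate (comp_sort \<beta>)) (conjugate ?lam)" using rho_Q_SSYT[OF M] b(2) by simp
    then obtain M' where M': "M' \<in> MLQ n ?lam" "rho n M' = (canonical_mlq \<beta>, rho_Q n M)"
      using rho_ex[OF canonical_NMLQ b(1)] by blast
    have "rho_inv n ?lam (canonical_mlq \<beta>, rho_Q n M) = M'"
      unfolding rho_inv_def by (rule the_inv_into_f_eq[OF inj M'(2,1)])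
    moreover have "mlq_type n M' = mlq_type n M"
    proof (rule rho_type[OF M'(1) M])
      show "rho_Q n M' = rho_Q n M" using M'(2) by (simp add: rho_def)
      show "mlq_type n (rho_N n M') = mlq_type n (rho_N n M)"
        using M'(2) NMLQ_MLQ(2)[OF canonical_NMLQ, of \<beta>] b by (simp add: rho_def)
    qed
    ultimately show ?thesis by simp
  qed
  \<comment> \<open>The first component is redundant data of the third, recorded to split the sum
    over \<beta>; the condition on \<open>Q\<close> transfers to \<open>M\<close> by
    \<open>inv_type\<close>.\<close>
  have bij: "bij_betw ?F (MLQ_of_type \<alpha>) (SIGMA \<beta>:?B. ?Q \<beta> \<times> ?N \<beta>)"
  proof (rule bij_betw_imageI)
    show "inj_on ?F (MLQ_of_type \<alpha>)"
    proof (rule inj_onI)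
      fix M M' assume "M \<in> MLQ_of_type \<alpha>" "M' \<in> MLQ_of_type \<alpha>" "?F M = ?F M'"
      then show "M = M'" using inj_onD[OF inj, of M M'] assms(2) by (simp add: rho_def MLQ_of_type_def)
    qed
    show "?F ` MLQ_of_type \<alpha> = (SIGMA \<beta>:?B. ?Q \<beta> \<times> ?N \<beta>)"
    proof (intro set_eqI iffI)
      fix p assume "p \<in> ?F ` MLQ_of_type \<alpha>"
      then obtain M where M: "M \<in> MLQ n ?lam" "mlq_type n M = \<alpha>" and p: "p = ?F M"
        using assms(2) by (auto simp: MLQ_of_type_def)
      show "p \<in> (SIGMA \<beta>:?B. ?Q \<beta> \<times> ?N \<beta>)"
        using rho_dominated[OF M(1) assms(2)] rho_Q_SSYT[OF M(1)] inv_type[OF M(1)] rho_N_MLQ[OF MLQ_box[OF M(1)]] M(2)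
        unfolding p by simp
    next
      fix p assume "p \<in> (SIGMA \<beta>:?B. ?Q \<beta> \<times> ?N \<beta>)"
      then obtain \<beta> Q N where p: "p = (\<beta>, Q, N)" and b: "length \<beta> = n" and Q: "Q \<in> ?Q \<beta>" and N: "N \<in> ?N \<beta>" by blast
      obtain M where M: "M \<in> MLQ n ?lam" "rho n M = (N, Q)" using rho_ex[OF N b] Q by blast
      have e: "rho_N n M = N" "rho_Q n M = Q" using M(2) by (simp_all add: rho_def)
      have t: "mlq_type n (rho_N n M) = \<beta>" using NMLQ_MLQ(2)[OF N] b e by simp
      have "mlq_type n M = \<alpha>" using inv_type[OF M(1) b t] Q e by simp
      then show "p \<in> ?F ` MLQ_of_type \<alpha>"
        using M(1) e t assms(2) p by (intro image_eqI[of _ _ M]) (auto simp: MLQ_of_type_def)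
    qed
  qed
  have fin: "finite (?Q \<beta>)" "finite (?N \<beta>)" if "\<beta> \<in> ?B" for \<beta>
  proof -
    show "finite (?Q \<beta>)" using finite_SSYT[of \<beta> n \<alpha>] that by simp
    show "finite (?N \<beta>)" by (rule finite_subset[OF _ finite_MLQ]) (use NMLQ_MLQ(1) in blast)
  qed
  have "(\<Sum>\<beta> \<in> ?B. scalar (K_coeff \<alpha> \<beta>) * atom \<beta>) = (\<Sum>\<beta> \<in> ?B. \<Sum>(Q, N) \<in> ?Q \<beta> \<times> ?N \<beta>. scalar (qvar ^ charge Q) * weight N)"
    unfolding K_coeff_def atom_def scalar_sum assms(2) sum_product sum.cartesian_product ..
  also have "\<dots> = (\<Sum>p \<in> (SIGMA \<beta>:?B. ?Q \<beta> \<times> ?N \<beta>). ?g p)"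
    by (subst sum.Sigma) (use fin finite_dominated in \<open>auto intro: finite_cartesian_product simp: case_prod_beta\<close>)
  also have "\<dots> = (\<Sum>M \<in> MLQ_of_type \<alpha>. ?g (?F M))" by (rule sum.reindex_bij_betw[OF bij, symmetric])
  also have "\<dots> = (\<Sum>M \<in> MLQ_of_type \<alpha>. scalar (qvar ^ maj M) * weight M)"
  proof (rule sum.cong[OF refl])
    fix M assume "M \<in> MLQ_of_type \<alpha>"
    then have M: "M \<in> MLQ n ?lam" using assms(2) by (simp add: MLQ_of_type_def)
    show "?g (?F M) = scalar (qvar ^ maj M) * weight M"
      using maj_charge[OF MLQ_box[OF M] MLQ_psz[OF M]] weight_rho_N[OF MLQ_box[OF M]] by simp
  qed
  finally show ?thesis by (simp add: asep_poly_def)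
qed

end
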